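(* The 2-category $\mathsf{sRCat}$ of split restriction categories admits the construction of differential objects. In particular, the tangentad of differential objects of a Cartesian tangent split restriction category $(\mathbb X,\mathbb T)$ is the Cartesian tangent split restriction category $\mathsf{DO}(\mathbb X,\mathbb T)$.
   Context: Composition $\circ$ is in the usual order. A restriction category is a category with an assignment $f:A\to B\mapsto\bar f:A\to A$ such that $f\bar f=f$, $\bar f\bar g=\bar g\bar f$ (same source), $\overline{g\bar f}=\bar g\bar f$ (same source), $\bar g f=f\,\overline{gf}$. $f$ is total if $\bar f=\mathrm{id}$; $e$ is a restriction idempotent if $e=\bar e$. It is split if all restriction idempotents split. Restriction functors preserve $\overline{(-)}$; a natural transformation is total if its components are. $\mathsf{sRCat}$ is the 2-category of split restriction categories, restriction functors, total natural transformations. $\mathrm{Tot}(\mathbb X)$ is the subcategory of total maps. A restriction terminal object $*$ has for each $X$ a unique total map $!_X:X\to*$, with $!_Y\circ f={!_X}\circ\bar f$ for all $f:X\to Y$. A restriction product of $A,B$ is $A\times B$ with total projections such that for $f:X\to A$, $g:X\to B$ there is a unique $\langle f,g\rangle$ with $\pi_1\langle f,g\rangle=f\bar g$, $\pi_2\langle f,g\rangle=g\bar f$. A restriction pullback of total maps is a pullback whose projections are total. A tangent split restriction category $(\mathbb X,\mathbb T)$ (a tangentad in $\mathsf{sRCat}$) is a split restriction category with a restriction functor $T$ and total natural transformations $p:T\Rightarrow\mathrm{id}$, $z:\mathrm{id}\Rightarrow T$, $s:T_2\Rightarrow T$, $l:T\Rightarrow T^2$, $c:T^2\Rightarrow T^2$,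 where $T_nA$ is the $n$-fold restriction pullback of $p_A$ along itself (required to exist, preserved by all $T^m$), such that: $(p_A,z_A,s_A)$ is a commutative monoid over $A$; $Tp\circ l=z\circ p$, $l\circ z=Tz\circ z$, $l\circ s=Ts\circ\langle l\pi_1,l\pi_2\rangle$; $p_T\circ c=Tp$, $c\circ Tz=z_T$, $c\circ Ts=s_T\circ\langle c\,T\pi_1,c\,T\pi_2\rangle$; $Tl\circ l=l_T\circ l$, $c\circ l=l$, $c_T\circ Tc\circ l_T=Tl\circ c$; $c\circ c=\mathrm{id}$, $Tc\circ c_T\circ Tc=c_T\circ Tc\circ c_T$; and the square with top $Ts\circ\langle z_T\pi_1,l\pi_2\rangle:T_2A\to T^2A$, left $p\pi_1$, right $Tp$, bottom $z:A\to TA$ is a restriction pullback. It is Cartesian if it has a restriction terminal object and binary restriction products, preserved by $T$. Then $\mathrm{Tot}(\mathbb X,\mathbb T)$ is a Cartesian tangent category (same definition with all maps total). A lax tangent morphism $(F,\alpha):(\mathbb X',\mathbb T')\to(\mathbb X,\mathbb T)$ is a restriction functor $F$ with a total $\alpha:FT'\Rightarrow TF$ such that $p_F\circ\alpha=Fp'$, $\alpha\circ Fz'=z_F$, $\alpha\circ Fs'=s_F\circ\langle\alpha F\pi_1,\alpha F\pi_2\rangle$, $l_F\circ\alpha=T\alpha\circ\alpha_{T'}\circ Fl'$, $c_F\circ T\alpha\circ\alpha_{T'}=T\alpha\circ\alpha_{T'}\circ Fc'$ (strict if $\alpha=\mathrm{id}$). Tangent 2-morphisms $\varphi:(F,\alpha)\Rightarrow(G,\beta)$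 are total natural transformations with $T\varphi\circ\alpha=\beta\circ\varphi_{T'}$. The hom-category $[\mathbb X',\mathbb T'\mid\mathbb X,\mathbb T]$ is a tangent category with $\bar T(F,\alpha)=(TF,c_F\circ T\alpha)$, $\bar T\varphi=T\varphi$, $\bar p_{(F,\alpha)}=p_F$, etc., Cartesian (with objectwise products) if $(\mathbb X,\mathbb T)$ is. A differential object of a Cartesian tangent category is $(A,\zeta_A,\sigma_A,\hat p_A)$ with $(A,\zeta_A:*\to A,\sigma_A:A\times A\to A)$ a commutative monoid and $\hat p_A:TA\to A$ with $\hat p_A\circ T\zeta_A=\zeta_A$, $\hat p_A\circ T\sigma_A=\sigma_A\circ(\hat p_A\times\hat p_A)$, $\hat p_A\circ z_A=\zeta_A\circ{!}$, $\hat p_A\circ s_A=\sigma_A\circ\langle\hat p_A\pi_1,\hat p_A\pi_2\rangle$, $\hat p_A\circ T\hat p_A\circ l_A=\hat p_A$, and $A\xleftarrow{p_A}TA\xrightarrow{\hat p_A}A$ a product diagram. A map $f:A\to B$ is linear (a morphism of differential objects) if $f\circ\hat p_A=\hat p_B\circ Tf$. In a hom-tangent category a differential object is pointwise if its product diagram is computed objectwise. For a Cartesian tangent split restriction category $(\mathbb X,\mathbb T)$, $\mathsf{DO}(\mathbb X,\mathbb T)$ has as objects the differential objects of $\mathrm{Tot}(\mathbb X,\mathbb T)$ (so $\zeta_A,\sigma_A,\hat p_A$ are total), and as morphisms the maps $f:A\to B$ of $\mathbb X$ such that both $f$ and $\bar f$ are morphisms of differential objects. Its restriction structure is that of $\mathbb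 X$; its tangent bundle functor is $(A,\zeta_A,\sigma_A,\hat p_A)\mapsto(TA,T\zeta_A,T\sigma_A,T\hat p_A\circ c_A)$, with structural transformations those of $\mathbb T$. A Cartesian tangent split restriction category admits the construction of differential objects if there are a Cartesian tangent split restriction category $\mathbb D$ (the tangentad of differential objects), a strict tangent morphism $U:\mathbb D\to(\mathbb X,\mathbb T)$ and a pointwise differential object $(U;\mathcal Z,\mathcal S,\hat{\mathcal P})$ in $[\mathbb D\mid\mathbb X,\mathbb T]$ such that for every tangent split restriction category $(\mathbb X',\mathbb T')$ the assignment $H\mapsto(U\circ H;\mathcal Z_H,\mathcal S_H,\hat{\mathcal P}_H)$ is an isomorphism of tangent categories from $[\mathbb X',\mathbb T'\mid\mathbb D]$ to the tangent category of pointwise differential objects and linear morphisms of $[\mathbb X',\mathbb T'\mid\mathbb X,\mathbb T]$. $\mathsf{sRCat}$ admits the construction of differential objects if every Cartesian tangent split restriction category does.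
   Formalization: Morphisms f of DO(X,T) are required to preserve ζ and σ as well as be linear; for partial maps this does not follow, and with linearity alone the nowhere defined map on the terminal object (sets and partial functions, T = id) is an idempotent that does not split. *)

theory Defs
  imports Main "HOL-Library.FuncSet"
begin

text \<open>
  Categories are records of objects, arrows, domain, codomain, identities, composition (in the usual
  order: \<open>g \<cdot> f\<close> is "first f") and restriction; tangent and Cartesian data are record extensions.  The
  values of the fields outside the carriers \<open>Ob\<close>, \<open>Ar\<close> are irrelevant.  A category without
  restriction structure is a record with the trivial restriction (every arrow is total).
\<close>

section \<open>Restriction categories\<close>

record ('o, 'a) rcat =
  Ob :: "'o set"
  Ar :: "'a set"
  Dom :: "'a \<Rightarrow> 'o"
  Cod :: "'a \<Rightarrow> 'o"
  Ide :: "'o \<Rightarrow> 'a"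
  Cmp :: "'a \<Rightarrow> 'a \<Rightarrow> 'a"  (infixr "\<cdot>\<index>" 70)
  Rst :: "'a \<Rightarrow> 'a"

definition Hom :: "('o, 'a, 'm) rcat_scheme \<Rightarrow> 'o \<Rightarrow> 'o \<Rightarrow> 'a set" where
  "Hom X A B = {f \<in> Ar X. Dom X f = A \<and> Cod X f = B}"

definition total :: "('o, 'a, 'm) rcat_scheme \<Rightarrow> 'a \<Rightarrow> bool" where
  "total X f \<longleftrightarrow> Rst X f = Ide X (Dom X f)"

locale category =
  fixes X :: "('o, 'a, 'm) rcat_scheme" (structure)
  assumes dom_ob: "f \<in> Ar X \<Longrightarrow> Dom X f \<in> Ob X"
    and cod_ob: "f \<in> Ar X \<Longrightarrow> Cod X f \<in> Ob X"
    and ide_hom: "A \<in> Ob X \<Longrightarrow> Ide X A \<in> Hom X A A"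
    and cmp_hom: "f \<in> Hom X A B \<Longrightarrow> g \<in> Hom X B C \<Longrightarrow> g \<cdot> f \<in> Hom X A C"
    and cmp_ide: "f \<in> Hom X A B \<Longrightarrow> f \<cdot> Ide X A = f"
    and ide_cmp: "f \<in> Hom X A B \<Longrightarrow> Ide X B \<cdot> f = f"
    and cmp_assoc: "f \<in> Hom X A B \<Longrightarrow> g \<in> Hom X B C \<Longrightarrow> h \<in> Hom X C D \<Longrightarrow>
      (h \<cdot> g) \<cdot> f = h \<cdot> (g \<cdot> f)"

locale restriction_category = category +
  assumes rst_hom: "f \<in> Hom X A B \<Longrightarrow> Rst X f \<in> Hom X A A"
    and cmp_rst: "f \<in> Hom X A B \<Longrightarrow> f \<cdot> Rst X f = f"
    and rst_commute: "f \<in> Hom X A B \<Longrightarrow> g \<in> Hom X A C \<Longrightarrow> Rst X f \<cdot> Rst X g = Rst X g \<cdot> Rst X f"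
    and rst_cmp_rst: "f \<in> Hom X A B \<Longrightarrow> g \<in> Hom X A C \<Longrightarrow> Rst X (g \<cdot> Rst X f) = Rst X g \<cdot> Rst X f"
    and rst_slide: "f \<in> Hom X A B \<Longrightarrow> g \<in> Hom X B C \<Longrightarrow> Rst X g \<cdot> f = f \<cdot> Rst X (g \<cdot> f)"

locale split_restriction_category = restriction_category +
  assumes rst_idem_split: "e \<in> Hom X A A \<Longrightarrow> e = Rst X e \<Longrightarrow>
    \<exists>E r s. E \<in> Ob X \<and> r \<in> Hom X A E \<and> s \<in> Hom X E A \<and> s \<cdot> r = e \<and> r \<cdot> s = Ide X E"

definition restriction_functor ::
  "('o, 'a, 'm) rcat_scheme \<Rightarrow> ('p, 'b, 'n) rcat_scheme \<Rightarrow> ('o \<Rightarrow> 'p) \<Rightarrow> ('a \<Rightarrow> 'b) \<Rightarrow> bool" where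
  "restriction_functor X Y Fo Fa \<longleftrightarrow>
     (\<forall>A \<in> Ob X. Fo A \<in> Ob Y) \<and>
     (\<forall>A B. \<forall>f \<in> Hom X A B. Fa f \<in> Hom Y (Fo A) (Fo B)) \<and>
     (\<forall>A \<in> Ob X. Fa (Ide X A) = Ide Y (Fo A)) \<and>
     (\<forall>A B C. \<forall>f \<in> Hom X A B. \<forall>g \<in> Hom X B C. Fa (g \<cdot>\<^bsub>X\<^esub> f) = Fa g \<cdot>\<^bsub>Y\<^esub> Fa f) \<and>
     (\<forall>f \<in> Ar X. Fa (Rst X f) = Rst Y (Fa f))"

definition total_nat_trans ::
  "('o, 'a, 'm) rcat_scheme \<Rightarrow> ('p, 'b, 'n) rcat_scheme \<Rightarrow> ('o \<Rightarrow> 'p) \<Rightarrow> ('a \<Rightarrow> 'b) \<Rightarrow>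
   ('o \<Rightarrow> 'p) \<Rightarrow> ('a \<Rightarrow> 'b) \<Rightarrow> ('o \<Rightarrow> 'b) \<Rightarrow> bool" where
  "total_nat_trans X Y Fo Fa Go Ga \<eta> \<longleftrightarrow>
     (\<forall>A \<in> Ob X. \<eta> A \<in> Hom Y (Fo A) (Go A) \<and> total Y (\<eta> A)) \<and>
     (\<forall>A B. \<forall>f \<in> Hom X A B. Ga f \<cdot>\<^bsub>Y\<^esub> \<eta> A = \<eta> B \<cdot>\<^bsub>Y\<^esub> Fa f)"


section \<open>Restriction limits\<close>

definition restriction_terminal :: "('o, 'a, 'm) rcat_scheme \<Rightarrow> 'o \<Rightarrow> bool" where
  "restriction_terminal X U \<longleftrightarrow> U \<in> Ob X \<and>
     (\<forall>A \<in> Ob X. \<exists>!t. t \<in> Hom X A U \<and> total X t) \<and>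
     (\<forall>A B. \<forall>f \<in> Hom X A B. \<forall>t \<in> Hom X A U. \<forall>t' \<in> Hom X B U.
        total X t \<longrightarrow> total X t' \<longrightarrow> t' \<cdot>\<^bsub>X\<^esub> f = t \<cdot>\<^bsub>X\<^esub> Rst X f)"

definition bang :: "('o, 'a, 'm) rcat_scheme \<Rightarrow> 'o \<Rightarrow> 'o \<Rightarrow> 'a" where
  "bang X U A = (THE t. t \<in> Hom X A U \<and> total X t)"

definition restriction_product ::
  "('o, 'a, 'm) rcat_scheme \<Rightarrow> 'o \<Rightarrow> 'o \<Rightarrow> 'o \<Rightarrow> 'a \<Rightarrow> 'a \<Rightarrow> bool" where
  "restriction_product X A B P u v \<longleftrightarrow> P \<in> Ob X \<and>
     u \<in> Hom X P A \<and> total X u \<and> v \<in> Hom X P B \<and> total X v \<and>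
     (\<forall>Q. \<forall>f \<in> Hom X Q A. \<forall>g \<in> Hom X Q B.
        \<exists>!h. h \<in> Hom X Q P \<and> u \<cdot>\<^bsub>X\<^esub> h = f \<cdot>\<^bsub>X\<^esub> Rst X g \<and> v \<cdot>\<^bsub>X\<^esub> h = g \<cdot>\<^bsub>X\<^esub> Rst X f)"

definition restriction_pullback ::
  "('o, 'a, 'm) rcat_scheme \<Rightarrow> 'a \<Rightarrow> 'a \<Rightarrow> 'o \<Rightarrow> 'a \<Rightarrow> 'a \<Rightarrow> bool" where
  "restriction_pullback X f g P u v \<longleftrightarrow> P \<in> Ob X \<and>
     u \<in> Hom X P (Dom X f) \<and> total X u \<and> v \<in> Hom X P (Dom X g) \<and> total X v \<and>
     f \<cdot>\<^bsub>X\<^esub> u = g \<cdot>\<^bsub>X\<^esub> v \<and>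
     (\<forall>Q. \<forall>a \<in> Hom X Q (Dom X f). \<forall>b \<in> Hom X Q (Dom X g). f \<cdot>\<^bsub>X\<^esub> a = g \<cdot>\<^bsub>X\<^esub> b \<longrightarrow>
        (\<exists>!h. h \<in> Hom X Q P \<and> u \<cdot>\<^bsub>X\<^esub> h = a \<and> v \<cdot>\<^bsub>X\<^esub> h = b))"

text \<open>\<open>P\<close> with projections \<open>pr 0, \<dots>, pr (n - 1)\<close> is the n-fold restriction pullback of \<open>b\<close> along
  itself, for \<open>n \<ge> 1\<close>.\<close>

definition fibre_power ::
  "('o, 'a, 'm) rcat_scheme \<Rightarrow> nat \<Rightarrow> 'a \<Rightarrow> 'o \<Rightarrow> (nat \<Rightarrow> 'a) \<Rightarrow> bool" where
  "fibre_power X n b P pr \<longleftrightarrow> P \<in> Ob X \<and>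
     (\<forall>i<n. pr i \<in> Hom X P (Dom X b) \<and> total X (pr i)) \<and>
     (\<forall>i<n. \<forall>j<n. b \<cdot>\<^bsub>X\<^esub> pr i = b \<cdot>\<^bsub>X\<^esub> pr j) \<and>
     (\<forall>Q \<in> Ob X. \<forall>u. (\<forall>i<n. u i \<in> Hom X Q (Dom X b)) \<and> (\<forall>i<n. \<forall>j<n. b \<cdot>\<^bsub>X\<^esub> u i = b \<cdot>\<^bsub>X\<^esub> u j) \<longrightarrow>
        (\<exists>!h. h \<in> Hom X Q P \<and> (\<forall>i<n. pr i \<cdot>\<^bsub>X\<^esub> h = u i)))"

text \<open>\<open>pairing X P u v a b\<close> is the arrow \<open>\<langle>a, b\<rangle>\<close> into \<open>P\<close> with projections \<open>u\<close>, \<open>v\<close>.\<close>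

definition pairing :: "('o, 'a, 'm) rcat_scheme \<Rightarrow> 'o \<Rightarrow> 'a \<Rightarrow> 'a \<Rightarrow> 'a \<Rightarrow> 'a \<Rightarrow> 'a" where
  "pairing X P u v a b = (THE h. h \<in> Hom X (Dom X a) P \<and> u \<cdot>\<^bsub>X\<^esub> h = a \<and> v \<cdot>\<^bsub>X\<^esub> h = b)"


section \<open>Tangent split restriction categories\<close>

text \<open>\<open>T2 A\<close> with projections \<open>q1 A\<close>, \<open>q2 A\<close> is a chosen pullback of \<open>tp A\<close> along itself (the source
  of the sum \<open>ts A\<close>).\<close>

record ('o, 'a) tcat = "('o, 'a) rcat" +
  To :: "'o \<Rightarrow> 'o"
  Ta :: "'a \<Rightarrow> 'a"
  T2 :: "'o \<Rightarrow> 'o"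
  q1 :: "'o \<Rightarrow> 'a"
  q2 :: "'o \<Rightarrow> 'a"
  tp :: "'o \<Rightarrow> 'a"
  tz :: "'o \<Rightarrow> 'a"
  ts :: "'o \<Rightarrow> 'a"
  tl :: "'o \<Rightarrow> 'a"
  tc :: "'o \<Rightarrow> 'a"

definition pairT2 :: "('o, 'a, 'm) tcat_scheme \<Rightarrow> 'o \<Rightarrow> 'a \<Rightarrow> 'a \<Rightarrow> 'a" where
  "pairT2 X A a b = pairing X (T2 X A) (q1 X A) (q2 X A) a b"

definition pairTT2 :: "('o, 'a, 'm) tcat_scheme \<Rightarrow> 'o \<Rightarrow> 'a \<Rightarrow> 'a \<Rightarrow> 'a" where
  "pairTT2 X A a b = pairing X (To X (T2 X A)) (Ta X (q1 X A)) (Ta X (q2 X A)) a b"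

definition T2a :: "('o, 'a, 'm) tcat_scheme \<Rightarrow> 'a \<Rightarrow> 'a" where
  "T2a X f = pairT2 X (Cod X f) (Ta X f \<cdot>\<^bsub>X\<^esub> q1 X (Dom X f)) (Ta X f \<cdot>\<^bsub>X\<^esub> q2 X (Dom X f))"

locale tangent_split_restriction_category =
  split_restriction_category X for X :: "('o, 'a, 'm) tcat_scheme" (structure) +
  assumes T_functor: "restriction_functor X X (To X) (Ta X)"
    and p_nat: "total_nat_trans X X (To X) (Ta X) (\<lambda>A. A) (\<lambda>f. f) (tp X)"
    and z_nat: "total_nat_trans X X (\<lambda>A. A) (\<lambda>f. f) (To X) (Ta X) (tz X)"
    and s_nat: "total_nat_trans X X (T2 X) (T2a X) (To X) (Ta X) (ts X)"
    and l_nat: "total_nat_trans X X (To X) (Ta X) (\<lambda>A. To X (To X A)) (\<lambda>f. Ta X (Ta X f)) (tl X)"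
    and c_nat: "total_nat_trans X X (\<lambda>A. To X (To X A)) (\<lambda>f. Ta X (Ta X f))
                  (\<lambda>A. To X (To X A)) (\<lambda>f. Ta X (Ta X f)) (tc X)"
    and T2_pullback: "A \<in> Ob X \<Longrightarrow>
      restriction_pullback X ((Ta X ^^ m) (tp X A)) ((Ta X ^^ m) (tp X A))
        ((To X ^^ m) (T2 X A)) ((Ta X ^^ m) (q1 X A)) ((Ta X ^^ m) (q2 X A))"
    and Tn_exists: "A \<in> Ob X \<Longrightarrow> 1 \<le> n \<Longrightarrow>
      \<exists>P pr. \<forall>m. fibre_power X n ((Ta X ^^ m) (tp X A)) ((To X ^^ m) P) (\<lambda>i. (Ta X ^^ m) (pr i))"
    and p_z: "A \<in> Ob X \<Longrightarrow> tp X A \<cdot> tz X A = Ide X A"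
    and p_s: "A \<in> Ob X \<Longrightarrow> tp X A \<cdot> ts X A = tp X A \<cdot> q1 X A"
    and s_unit: "A \<in> Ob X \<Longrightarrow> ts X A \<cdot> pairT2 X A (tz X A \<cdot> tp X A) (Ide X (To X A)) = Ide X (To X A)"
    and s_comm: "A \<in> Ob X \<Longrightarrow> ts X A \<cdot> pairT2 X A (q2 X A) (q1 X A) = ts X A"
    and s_assoc: "A \<in> Ob X \<Longrightarrow> fibre_power X 3 (tp X A) P pr \<Longrightarrow>
      ts X A \<cdot> pairT2 X A (ts X A \<cdot> pairT2 X A (pr 0) (pr 1)) (pr 2) =
      ts X A \<cdot> pairT2 X A (pr 0) (ts X A \<cdot> pairT2 X A (pr 1) (pr 2))"
    and Tp_l: "A \<in> Ob X \<Longrightarrow> Ta X (tp X A) \<cdot> tl X A = tz X A \<cdot> tp X A"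
    and l_z: "A \<in> Ob X \<Longrightarrow> tl X A \<cdot> tz X A = Ta X (tz X A) \<cdot> tz X A"
    and l_s: "A \<in> Ob X \<Longrightarrow>
      tl X A \<cdot> ts X A = Ta X (ts X A) \<cdot> pairTT2 X A (tl X A \<cdot> q1 X A) (tl X A \<cdot> q2 X A)"
    and pT_c: "A \<in> Ob X \<Longrightarrow> tp X (To X A) \<cdot> tc X A = Ta X (tp X A)"
    and c_Tz: "A \<in> Ob X \<Longrightarrow> tc X A \<cdot> Ta X (tz X A) = tz X (To X A)"
    and c_Ts: "A \<in> Ob X \<Longrightarrow> tc X A \<cdot> Ta X (ts X A) =
      ts X (To X A) \<cdot> pairT2 X (To X A) (tc X A \<cdot> Ta X (q1 X A)) (tc X A \<cdot> Ta X (q2 X A))"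
    and Tl_l: "A \<in> Ob X \<Longrightarrow> Ta X (tl X A) \<cdot> tl X A = tl X (To X A) \<cdot> tl X A"
    and c_l: "A \<in> Ob X \<Longrightarrow> tc X A \<cdot> tl X A = tl X A"
    and c_Tc_l: "A \<in> Ob X \<Longrightarrow>
      tc X (To X A) \<cdot> Ta X (tc X A) \<cdot> tl X (To X A) = Ta X (tl X A) \<cdot> tc X A"
    and c_c: "A \<in> Ob X \<Longrightarrow> tc X A \<cdot> tc X A = Ide X (To X (To X A))"
    and yang_baxter: "A \<in> Ob X \<Longrightarrow>
      Ta X (tc X A) \<cdot> tc X (To X A) \<cdot> Ta X (tc X A) = tc X (To X A) \<cdot> Ta X (tc X A) \<cdot> tc X (To X A)"
    \<comment> \<open>universality of the vertical lift; the pairing lands in \<open>T (T2 A)\<close>\<close>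
    and vertical_lift: "A \<in> Ob X \<Longrightarrow>
      restriction_pullback X (tz X A) (Ta X (tp X A)) (T2 X A) (tp X A \<cdot> q1 X A)
        (Ta X (ts X A) \<cdot> pairTT2 X A (tz X (To X A) \<cdot> q1 X A) (tl X A \<cdot> q2 X A))"

record ('o, 'a) ctcat = "('o, 'a) tcat" +
  One :: "'o"
  Prd :: "'o \<Rightarrow> 'o \<Rightarrow> 'o"
  pi1 :: "'o \<Rightarrow> 'o \<Rightarrow> 'a"
  pi2 :: "'o \<Rightarrow> 'o \<Rightarrow> 'a"

locale cartesian_tangent_split_restriction_category =
  tangent_split_restriction_category X for X :: "('o, 'a, 'm) ctcat_scheme" (structure) +
  assumes one_terminal: "restriction_terminal X (One X)"
    and T_one_terminal: "restriction_terminal X (To X (One X))"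
    and product: "A \<in> Ob X \<Longrightarrow> B \<in> Ob X \<Longrightarrow>
      restriction_product X A B (Prd X A B) (pi1 X A B) (pi2 X A B)"
    and T_product: "A \<in> Ob X \<Longrightarrow> B \<in> Ob X \<Longrightarrow>
      restriction_product X (To X A) (To X B) (To X (Prd X A B)) (Ta X (pi1 X A B)) (Ta X (pi2 X A B))"

definition rpair :: "('o, 'a, 'm) ctcat_scheme \<Rightarrow> 'a \<Rightarrow> 'a \<Rightarrow> 'a" where
  "rpair X f g = (THE h. h \<in> Hom X (Dom X f) (Prd X (Cod X f) (Cod X g)) \<and>
     pi1 X (Cod X f) (Cod X g) \<cdot>\<^bsub>X\<^esub> h = f \<cdot>\<^bsub>X\<^esub> Rst X g \<and>
     pi2 X (Cod X f) (Cod X g) \<cdot>\<^bsub>X\<^esub> h = g \<cdot>\<^bsub>X\<^esub> Rst X f)"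

definition prod_arr :: "('o, 'a, 'm) ctcat_scheme \<Rightarrow> 'a \<Rightarrow> 'a \<Rightarrow> 'a" where
  "prod_arr X f g =
     rpair X (f \<cdot>\<^bsub>X\<^esub> pi1 X (Dom X f) (Dom X g)) (g \<cdot>\<^bsub>X\<^esub> pi2 X (Dom X f) (Dom X g))"

definition pairTprod :: "('o, 'a, 'm) ctcat_scheme \<Rightarrow> 'o \<Rightarrow> 'o \<Rightarrow> 'a \<Rightarrow> 'a \<Rightarrow> 'a" where
  "pairTprod X A B a b =
     pairing X (To X (Prd X A B)) (Ta X (pi1 X A B)) (Ta X (pi2 X A B)) a b"

definition Tot :: "('o, 'a, 'm) rcat_scheme \<Rightarrow> ('o, 'a, 'm) rcat_scheme" where
  "Tot X = X\<lparr>Ar := {f \<in> Ar X. total X f}\<rparr>"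


section \<open>Tangent morphisms and hom-tangent categories\<close>

text \<open>The functor and natural transformation components are kept extensional (undefined outside
  the carriers), so that equality of records is equality of tangent morphisms.\<close>

record ('o1, 'a1, 'o, 'a) tmor =
  mo :: "'o1 \<Rightarrow> 'o"
  ma :: "'a1 \<Rightarrow> 'a"
  mn :: "'o1 \<Rightarrow> 'a"

definition lax_tangent_morphism ::
  "('o1, 'a1, 'm) tcat_scheme \<Rightarrow> ('o, 'a, 'n) tcat_scheme \<Rightarrow> ('o1, 'a1, 'o, 'a) tmor \<Rightarrow> bool" where
  "lax_tangent_morphism X' X F \<longleftrightarrow>
     mo F \<in> extensional (Ob X') \<and> ma F \<in> extensional (Ar X') \<and> mn F \<in> extensional (Ob X') \<and>
     restriction_functor X' X (mo F) (ma F) \<and>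
     total_nat_trans X' X (\<lambda>A. mo F (To X' A)) (\<lambda>f. ma F (Ta X' f))
       (\<lambda>A. To X (mo F A)) (\<lambda>f. Ta X (ma F f)) (mn F) \<and>
     (\<forall>A \<in> Ob X'.
        tp X (mo F A) \<cdot>\<^bsub>X\<^esub> mn F A = ma F (tp X' A) \<and>
        mn F A \<cdot>\<^bsub>X\<^esub> ma F (tz X' A) = tz X (mo F A) \<and>
        mn F A \<cdot>\<^bsub>X\<^esub> ma F (ts X' A) = ts X (mo F A) \<cdot>\<^bsub>X\<^esub>
          pairT2 X (mo F A) (mn F A \<cdot>\<^bsub>X\<^esub> ma F (q1 X' A)) (mn F A \<cdot>\<^bsub>X\<^esub> ma F (q2 X' A)) \<and>
        tl X (mo F A) \<cdot>\<^bsub>X\<^esub> mn F A =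
          Ta X (mn F A) \<cdot>\<^bsub>X\<^esub> mn F (To X' A) \<cdot>\<^bsub>X\<^esub> ma F (tl X' A) \<and>
        tc X (mo F A) \<cdot>\<^bsub>X\<^esub> Ta X (mn F A) \<cdot>\<^bsub>X\<^esub> mn F (To X' A) =
          Ta X (mn F A) \<cdot>\<^bsub>X\<^esub> mn F (To X' A) \<cdot>\<^bsub>X\<^esub> ma F (tc X' A))"

definition strict_tangent_morphism ::
  "('o1, 'a1, 'm) tcat_scheme \<Rightarrow> ('o, 'a, 'n) tcat_scheme \<Rightarrow> ('o1, 'a1, 'o, 'a) tmor \<Rightarrow> bool" where
  "strict_tangent_morphism X' X F \<longleftrightarrow> lax_tangent_morphism X' X F \<and>
     (\<forall>A \<in> Ob X'. mo F (To X' A) = To X (mo F A)) \<and>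
     (\<forall>f \<in> Ar X'. ma F (Ta X' f) = Ta X (ma F f)) \<and>
     (\<forall>A \<in> Ob X'. mn F A = Ide X (To X (mo F A)))"

definition tmor_comp ::
  "('o1, 'a1, 'm) tcat_scheme \<Rightarrow> ('o, 'a, 'n) tcat_scheme \<Rightarrow> ('o2, 'a2, 'o, 'a) tmor \<Rightarrow>
   ('o1, 'a1, 'o2, 'a2) tmor \<Rightarrow> ('o1, 'a1, 'o, 'a) tmor" where
  "tmor_comp X' X G F =
     \<lparr>mo = \<lambda>A \<in> Ob X'. mo G (mo F A),
      ma = \<lambda>f \<in> Ar X'. ma G (ma F f),
      mn = \<lambda>A \<in> Ob X'. mn G (mo F A) \<cdot>\<^bsub>X\<^esub> ma G (mn F A)\<rparr>"

definition tangent_2_morphism ::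
  "('o1, 'a1, 'm) tcat_scheme \<Rightarrow> ('o, 'a, 'n) tcat_scheme \<Rightarrow> ('o1, 'a1, 'o, 'a) tmor \<Rightarrow>
   ('o1, 'a1, 'o, 'a) tmor \<Rightarrow> ('o1 \<Rightarrow> 'a) \<Rightarrow> bool" where
  "tangent_2_morphism X' X F G \<phi> \<longleftrightarrow> \<phi> \<in> extensional (Ob X') \<and>
     total_nat_trans X' X (mo F) (ma F) (mo G) (ma G) \<phi> \<and>
     (\<forall>A \<in> Ob X'. Ta X (\<phi> A) \<cdot>\<^bsub>X\<^esub> mn F A = mn G A \<cdot>\<^bsub>X\<^esub> \<phi> (To X' A))"

definition hom_T ::
  "('o1, 'a1, 'm) tcat_scheme \<Rightarrow> ('o, 'a, 'n) tcat_scheme \<Rightarrow> ('o1, 'a1, 'o, 'a) tmor \<Rightarrow>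
   ('o1, 'a1, 'o, 'a) tmor" where
  "hom_T X' X F =
     \<lparr>mo = \<lambda>A \<in> Ob X'. To X (mo F A),
      ma = \<lambda>f \<in> Ar X'. Ta X (ma F f),
      mn = \<lambda>A \<in> Ob X'. tc X (mo F A) \<cdot>\<^bsub>X\<^esub> Ta X (mn F A)\<rparr>"

definition hom_T2 ::
  "('o1, 'a1, 'm) tcat_scheme \<Rightarrow> ('o, 'a, 'n) tcat_scheme \<Rightarrow> ('o1, 'a1, 'o, 'a) tmor \<Rightarrow>
   ('o1, 'a1, 'o, 'a) tmor" where
  "hom_T2 X' X F =
     \<lparr>mo = \<lambda>A \<in> Ob X'. T2 X (mo F A),
      ma = \<lambda>f \<in> Ar X'. T2a X (ma F f),
      mn = \<lambda>A \<in> Ob X'. pairTT2 X (mo F A)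
             (mn (hom_T X' X F) A \<cdot>\<^bsub>X\<^esub> q1 X (mo F (To X' A)))
             (mn (hom_T X' X F) A \<cdot>\<^bsub>X\<^esub> q2 X (mo F (To X' A)))\<rparr>"

text \<open>The hom-tangent category; its arrows are triples of a source, a target and a tangent
  2-morphism.  All arrows are total, so the restriction is trivial.\<close>

definition hom_tcat ::
  "('o1, 'a1, 'm) tcat_scheme \<Rightarrow> ('o, 'a, 'n) tcat_scheme \<Rightarrow>
   (('o1, 'a1, 'o, 'a) tmor,
    ('o1, 'a1, 'o, 'a) tmor \<times> ('o1, 'a1, 'o, 'a) tmor \<times> ('o1 \<Rightarrow> 'a)) tcat" where
  "hom_tcat X' X =
     \<lparr>Ob = {F. lax_tangent_morphism X' X F},
      Ar = {(F, G, \<phi>). lax_tangent_morphism X' X F \<and> lax_tangent_morphism X' X G \<and>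
              tangent_2_morphism X' X F G \<phi>},
      Dom = \<lambda>(F, G, \<phi>). F,
      Cod = \<lambda>(F, G, \<phi>). G,
      Ide = \<lambda>F. (F, F, \<lambda>A \<in> Ob X'. Ide X (mo F A)),
      Cmp = \<lambda>(_, K, \<psi>) (F, _, \<phi>). (F, K, \<lambda>A \<in> Ob X'. \<psi> A \<cdot>\<^bsub>X\<^esub> \<phi> A),
      Rst = \<lambda>(F, _, _). (F, F, \<lambda>A \<in> Ob X'. Ide X (mo F A)),
      To = hom_T X' X,
      Ta = \<lambda>(F, G, \<phi>). (hom_T X' X F, hom_T X' X G, \<lambda>A \<in> Ob X'. Ta X (\<phi> A)),
      T2 = hom_T2 X' X,
      q1 = \<lambda>F. (hom_T2 X' X F, hom_T X' X F, \<lambda>A \<in> Ob X'. q1 X (mo F A)),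
      q2 = \<lambda>F. (hom_T2 X' X F, hom_T X' X F, \<lambda>A \<in> Ob X'. q2 X (mo F A)),
      tp = \<lambda>F. (hom_T X' X F, F, \<lambda>A \<in> Ob X'. tp X (mo F A)),
      tz = \<lambda>F. (F, hom_T X' X F, \<lambda>A \<in> Ob X'. tz X (mo F A)),
      ts = \<lambda>F. (hom_T2 X' X F, hom_T X' X F, \<lambda>A \<in> Ob X'. ts X (mo F A)),
      tl = \<lambda>F. (hom_T X' X F, hom_T X' X (hom_T X' X F), \<lambda>A \<in> Ob X'. tl X (mo F A)),
      tc = \<lambda>F. (hom_T X' X (hom_T X' X F), hom_T X' X (hom_T X' X F),
                \<lambda>A \<in> Ob X'. tc X (mo F A))\<rparr>"

text \<open>Isomorphism of tangent categories: a strict tangent morphism that is bijective on objects and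
  on arrows.\<close>

definition tangent_iso ::
  "('o1, 'a1, 'm) tcat_scheme \<Rightarrow> ('o, 'a, 'n) tcat_scheme \<Rightarrow> ('o1 \<Rightarrow> 'o) \<Rightarrow> ('a1 \<Rightarrow> 'a) \<Rightarrow> bool" where
  "tangent_iso C D \<Phi>o \<Phi>a \<longleftrightarrow>
     strict_tangent_morphism C D
       \<lparr>mo = restrict \<Phi>o (Ob C), ma = restrict \<Phi>a (Ar C), mn = \<lambda>A \<in> Ob C. Ide D (To D (\<Phi>o A))\<rparr> \<and>
     bij_betw \<Phi>o (Ob C) (Ob D) \<and> bij_betw \<Phi>a (Ar C) (Ar D)"


section \<open>Differential objects\<close>

record ('o, 'a) dobj =
  dob :: "'o"
  dzero :: "'a"
  dadd :: "'a"
  dproj :: "'a"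

definition is_product :: "('o, 'a, 'm) rcat_scheme \<Rightarrow> 'o \<Rightarrow> 'o \<Rightarrow> 'o \<Rightarrow> 'a \<Rightarrow> 'a \<Rightarrow> bool" where
  "is_product C A B P u v \<longleftrightarrow> P \<in> Ob C \<and> u \<in> Hom C P A \<and> v \<in> Hom C P B \<and>
     (\<forall>Q. \<forall>f \<in> Hom C Q A. \<forall>g \<in> Hom C Q B.
        \<exists>!h. h \<in> Hom C Q P \<and> u \<cdot>\<^bsub>C\<^esub> h = f \<and> v \<cdot>\<^bsub>C\<^esub> h = g)"

text \<open>Differential objects of a Cartesian tangent category \<open>C\<close>.  Since T preserves finite products
  only up to the canonical isomorphisms, the first two equations for \<open>dproj\<close> are stated on
  \<open>T 1\<close> and on \<open>T (A \<times> A)\<close>.\<close>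

definition differential_object :: "('o, 'a, 'm) ctcat_scheme \<Rightarrow> ('o, 'a) dobj \<Rightarrow> bool" where
  "differential_object C D \<longleftrightarrow>
    (let A = dob D; \<zeta> = dzero D; \<sigma> = dadd D; ph = dproj D;
         \<pi>1 = pi1 C A A; \<pi>2 = pi2 C A A; AA = Prd C A A
     in A \<in> Ob C \<and> \<zeta> \<in> Hom C (One C) A \<and> \<sigma> \<in> Hom C AA A \<and> ph \<in> Hom C (To C A) A \<and>
        \<sigma> \<cdot>\<^bsub>C\<^esub> rpair C (\<zeta> \<cdot>\<^bsub>C\<^esub> bang C (One C) A) (Ide C A) = Ide C A \<and>
        \<sigma> \<cdot>\<^bsub>C\<^esub> rpair C \<pi>2 \<pi>1 = \<sigma> \<and>
        \<sigma> \<cdot>\<^bsub>C\<^esub> rpair C (\<sigma> \<cdot>\<^bsub>C\<^esub> pi1 C AA A) (pi2 C AA A) =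
          \<sigma> \<cdot>\<^bsub>C\<^esub> rpair C (\<pi>1 \<cdot>\<^bsub>C\<^esub> pi1 C AA A) (\<sigma> \<cdot>\<^bsub>C\<^esub> rpair C (\<pi>2 \<cdot>\<^bsub>C\<^esub> pi1 C AA A) (pi2 C AA A)) \<and>
        ph \<cdot>\<^bsub>C\<^esub> Ta C \<zeta> = \<zeta> \<cdot>\<^bsub>C\<^esub> bang C (One C) (To C (One C)) \<and>
        ph \<cdot>\<^bsub>C\<^esub> Ta C \<sigma> = \<sigma> \<cdot>\<^bsub>C\<^esub> rpair C (ph \<cdot>\<^bsub>C\<^esub> Ta C \<pi>1) (ph \<cdot>\<^bsub>C\<^esub> Ta C \<pi>2) \<and>
        ph \<cdot>\<^bsub>C\<^esub> tz C A = \<zeta> \<cdot>\<^bsub>C\<^esub> bang C (One C) A \<and>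
        ph \<cdot>\<^bsub>C\<^esub> ts C A = \<sigma> \<cdot>\<^bsub>C\<^esub> rpair C (ph \<cdot>\<^bsub>C\<^esub> q1 C A) (ph \<cdot>\<^bsub>C\<^esub> q2 C A) \<and>
        ph \<cdot>\<^bsub>C\<^esub> Ta C ph \<cdot>\<^bsub>C\<^esub> tl C A = ph \<and>
        is_product C A A (To C A) (tp C A) ph)"

definition linear :: "('o, 'a, 'm) tcat_scheme \<Rightarrow> ('o, 'a) dobj \<Rightarrow> ('o, 'a) dobj \<Rightarrow> 'a \<Rightarrow> bool" where
  "linear X D E f \<longleftrightarrow> f \<in> Hom X (dob D) (dob E) \<and> f \<cdot>\<^bsub>X\<^esub> dproj D = dproj E \<cdot>\<^bsub>X\<^esub> Ta X f"

text \<open>Morphisms of differential objects are the structure-preserving maps.  If \<open>f\<close> is total,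
  compatibility with \<open>dzero\<close> and \<open>dadd\<close> follows from linearity.  For a partial map it does not (a
  nowhere defined map is linear); it has to be demanded because \<open>dzero\<close> and \<open>dadd\<close> are to be natural
  on the category of differential objects, and because the nowhere defined idempotent does not split
  there.\<close>

definition do_morphism ::
  "('o, 'a, 'm) ctcat_scheme \<Rightarrow> ('o, 'a) dobj \<Rightarrow> ('o, 'a) dobj \<Rightarrow> 'a \<Rightarrow> bool" where
  "do_morphism X D E f \<longleftrightarrow> linear X D E f \<and>
     f \<cdot>\<^bsub>X\<^esub> dzero D = dzero E \<and>
     f \<cdot>\<^bsub>X\<^esub> dadd D = dadd E \<cdot>\<^bsub>X\<^esub> prod_arr X f f"

text \<open>The differential object on \<open>T A\<close>.  \<open>T \<zeta>\<close> and \<open>T \<sigma>\<close> are composed with the canonical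
  isomorphisms \<open>1 \<rightarrow> T 1\<close> and \<open>T A \<times> T A \<rightarrow> T (A \<times> A)\<close>.\<close>

definition do_T :: "('o, 'a, 'm) ctcat_scheme \<Rightarrow> ('o, 'a) dobj \<Rightarrow> ('o, 'a) dobj" where
  "do_T X D = (let A = dob D; TA = To X A in
     \<lparr>dob = TA,
      dzero = Ta X (dzero D) \<cdot>\<^bsub>X\<^esub> bang X (To X (One X)) (One X),
      dadd = Ta X (dadd D) \<cdot>\<^bsub>X\<^esub> pairTprod X A A (pi1 X TA TA) (pi2 X TA TA),
      dproj = Ta X (dproj D) \<cdot>\<^bsub>X\<^esub> tc X A\<rparr>)"

text \<open>The differential objects on \<open>T2 A\<close>, on \<open>1\<close> and on \<open>A \<times> B\<close> are the unique ones for which the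
  projections are linear.\<close>

definition do_T2 :: "('o, 'a, 'm) ctcat_scheme \<Rightarrow> ('o, 'a) dobj \<Rightarrow> ('o, 'a) dobj" where
  "do_T2 X D = (let A = dob D; B = T2 X A; TD = do_T X D in
     \<lparr>dob = B,
      dzero = pairT2 X A (dzero TD) (dzero TD),
      dadd = pairT2 X A
        (dadd TD \<cdot>\<^bsub>X\<^esub> prod_arr X (q1 X A) (q1 X A))
        (dadd TD \<cdot>\<^bsub>X\<^esub> prod_arr X (q2 X A) (q2 X A)),
      dproj = pairT2 X A (dproj TD \<cdot>\<^bsub>X\<^esub> Ta X (q1 X A)) (dproj TD \<cdot>\<^bsub>X\<^esub> Ta X (q2 X A))\<rparr>)"

definition do_one :: "('o, 'a, 'm) ctcat_scheme \<Rightarrow> ('o, 'a) dobj" where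
  "do_one X =
     \<lparr>dob = One X,
      dzero = Ide X (One X),
      dadd = bang X (One X) (Prd X (One X) (One X)),
      dproj = bang X (One X) (To X (One X))\<rparr>"

definition do_prod :: "('o, 'a, 'm) ctcat_scheme \<Rightarrow> ('o, 'a) dobj \<Rightarrow> ('o, 'a) dobj \<Rightarrow> ('o, 'a) dobj" where
  "do_prod X D E = (let A = dob D; B = dob E in
     \<lparr>dob = Prd X A B,
      dzero = rpair X (dzero D) (dzero E),
      dadd = rpair X
        (dadd D \<cdot>\<^bsub>X\<^esub> prod_arr X (pi1 X A B) (pi1 X A B))
        (dadd E \<cdot>\<^bsub>X\<^esub> prod_arr X (pi2 X A B) (pi2 X A B)),
      dproj = rpair X (dproj D \<cdot>\<^bsub>X\<^esub> Ta X (pi1 X A B)) (dproj E \<cdot>\<^bsub>X\<^esub> Ta X (pi2 X A B))\<rparr>)"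

text \<open>\<open>DO X\<close>: an arrow is a triple of a source, a target and an arrow of \<open>X\<close>, since the same arrow
  of \<open>X\<close> may be a morphism between several differential objects.\<close>

type_synonym ('o, 'a) do_arr = "('o, 'a) dobj \<times> ('o, 'a) dobj \<times> 'a"

definition DO :: "('o, 'a) ctcat \<Rightarrow> (('o, 'a) dobj, ('o, 'a) do_arr) ctcat" where
  "DO X =
     \<lparr>Ob = {D. differential_object (Tot X) D},
      Ar = {(D, E, f). differential_object (Tot X) D \<and> differential_object (Tot X) E \<and>
              do_morphism X D E f \<and> do_morphism X D D (Rst X f)},
      Dom = \<lambda>(D, E, f). D,
      Cod = \<lambda>(D, E, f). E,
      Ide = \<lambda>D. (D, D, Ide X (dob D)),
      Cmp = \<lambda>(_, K, g) (D, _, f). (D, K, g \<cdot>\<^bsub>X\<^esub> f),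
      Rst = \<lambda>(D, _, f). (D, D, Rst X f),
      To = do_T X,
      Ta = \<lambda>(D, E, f). (do_T X D, do_T X E, Ta X f),
      T2 = do_T2 X,
      q1 = \<lambda>D. (do_T2 X D, do_T X D, q1 X (dob D)),
      q2 = \<lambda>D. (do_T2 X D, do_T X D, q2 X (dob D)),
      tp = \<lambda>D. (do_T X D, D, tp X (dob D)),
      tz = \<lambda>D. (D, do_T X D, tz X (dob D)),
      ts = \<lambda>D. (do_T2 X D, do_T X D, ts X (dob D)),
      tl = \<lambda>D. (do_T X D, do_T X (do_T X D), tl X (dob D)),
      tc = \<lambda>D. (do_T X (do_T X D), do_T X (do_T X D), tc X (dob D)),
      One = do_one X,
      Prd = do_prod X,
      pi1 = \<lambda>D E. (do_prod X D E, D, pi1 X (dob D) (dob E)),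
      pi2 = \<lambda>D E. (do_prod X D E, E, pi2 X (dob D) (dob E))\<rparr>"


section \<open>Pointwise differential objects of hom-tangent categories\<close>

definition hom_one ::
  "('o1, 'a1, 'm) tcat_scheme \<Rightarrow> ('o, 'a, 'n) ctcat_scheme \<Rightarrow> ('o1, 'a1, 'o, 'a) tmor" where
  "hom_one X' X =
     \<lparr>mo = \<lambda>A \<in> Ob X'. One X,
      ma = \<lambda>f \<in> Ar X'. Ide X (One X),
      mn = \<lambda>A \<in> Ob X'. bang X (To X (One X)) (One X)\<rparr>"

definition hom_prod ::
  "('o1, 'a1, 'm) tcat_scheme \<Rightarrow> ('o, 'a, 'n) ctcat_scheme \<Rightarrow> ('o1, 'a1, 'o, 'a) tmor \<Rightarrow>
   ('o1, 'a1, 'o, 'a) tmor \<Rightarrow> ('o1, 'a1, 'o, 'a) tmor" where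
  "hom_prod X' X F G =
     \<lparr>mo = \<lambda>A \<in> Ob X'. Prd X (mo F A) (mo G A),
      ma = \<lambda>f \<in> Ar X'. prod_arr X (ma F f) (ma G f),
      mn = \<lambda>A \<in> Ob X'. pairTprod X (mo F A) (mo G A)
             (mn F A \<cdot>\<^bsub>X\<^esub> pi1 X (mo F (To X' A)) (mo G (To X' A)))
             (mn G A \<cdot>\<^bsub>X\<^esub> pi2 X (mo F (To X' A)) (mo G (To X' A)))\<rparr>"

record ('o1, 'a1, 'o, 'a) pdobj =
  pmor :: "('o1, 'a1, 'o, 'a) tmor"
  pzero :: "'o1 \<Rightarrow> 'a"
  padd :: "'o1 \<Rightarrow> 'a"
  pproj :: "'o1 \<Rightarrow> 'a"

definition component :: "('o1, 'a1, 'o, 'a) pdobj \<Rightarrow> 'o1 \<Rightarrow> ('o, 'a) dobj" where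
  "component K A = \<lparr>dob = mo (pmor K) A, dzero = pzero K A, dadd = padd K A, dproj = pproj K A\<rparr>"

text \<open>The structure maps are 2-morphisms of the hom-tangent category.  Equations between
  2-morphisms hold componentwise and all products involved are objectwise, so the equations and the
  product diagram of a pointwise differential object say that each component is a differential
  object.\<close>

definition pointwise_differential_object ::
  "('o1, 'a1, 'm) tcat_scheme \<Rightarrow> ('o, 'a, 'n) ctcat_scheme \<Rightarrow> ('o1, 'a1, 'o, 'a) pdobj \<Rightarrow> bool" where
  "pointwise_differential_object X' X K \<longleftrightarrow>
     lax_tangent_morphism X' X (pmor K) \<and>
     tangent_2_morphism X' X (hom_one X' X) (pmor K) (pzero K) \<and>
     tangent_2_morphism X' X (hom_prod X' X (pmor K) (pmor K)) (pmor K) (padd K) \<and>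
     tangent_2_morphism X' X (hom_T X' X (pmor K)) (pmor K) (pproj K) \<and>
     (\<forall>A \<in> Ob X'. differential_object (Tot X) (component K A))"

definition pdo_T ::
  "('o1, 'a1, 'm) tcat_scheme \<Rightarrow> ('o, 'a, 'n) ctcat_scheme \<Rightarrow> ('o1, 'a1, 'o, 'a) pdobj \<Rightarrow>
   ('o1, 'a1, 'o, 'a) pdobj" where
  "pdo_T X' X K =
     \<lparr>pmor = hom_T X' X (pmor K),
      pzero = \<lambda>A \<in> Ob X'. dzero (do_T X (component K A)),
      padd = \<lambda>A \<in> Ob X'. dadd (do_T X (component K A)),
      pproj = \<lambda>A \<in> Ob X'. dproj (do_T X (component K A))\<rparr>"

definition pdo_T2 ::
  "('o1, 'a1, 'm) tcat_scheme \<Rightarrow> ('o, 'a, 'n) ctcat_scheme \<Rightarrow> ('o1, 'a1, 'o, 'a) pdobj \<Rightarrow>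
   ('o1, 'a1, 'o, 'a) pdobj" where
  "pdo_T2 X' X K =
     \<lparr>pmor = hom_T2 X' X (pmor K),
      pzero = \<lambda>A \<in> Ob X'. dzero (do_T2 X (component K A)),
      padd = \<lambda>A \<in> Ob X'. dadd (do_T2 X (component K A)),
      pproj = \<lambda>A \<in> Ob X'. dproj (do_T2 X (component K A))\<rparr>"

definition pdo_tcat ::
  "('o1, 'a1, 'm) tcat_scheme \<Rightarrow> ('o, 'a, 'n) ctcat_scheme \<Rightarrow>
   (('o1, 'a1, 'o, 'a) pdobj,
    ('o1, 'a1, 'o, 'a) pdobj \<times> ('o1, 'a1, 'o, 'a) pdobj \<times> ('o1 \<Rightarrow> 'a)) tcat" where
  "pdo_tcat X' X =
     \<lparr>Ob = {K. pointwise_differential_object X' X K},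
      Ar = {(K, L, \<phi>). pointwise_differential_object X' X K \<and> pointwise_differential_object X' X L \<and>
              tangent_2_morphism X' X (pmor K) (pmor L) \<phi> \<and>
              (\<forall>A \<in> Ob X'. linear X (component K A) (component L A) (\<phi> A))},
      Dom = \<lambda>(K, L, \<phi>). K,
      Cod = \<lambda>(K, L, \<phi>). L,
      Ide = \<lambda>K. (K, K, \<lambda>A \<in> Ob X'. Ide X (mo (pmor K) A)),
      Cmp = \<lambda>(_, M, \<psi>) (K, _, \<phi>). (K, M, \<lambda>A \<in> Ob X'. \<psi> A \<cdot>\<^bsub>X\<^esub> \<phi> A),
      Rst = \<lambda>(K, _, _). (K, K, \<lambda>A \<in> Ob X'. Ide X (mo (pmor K) A)),
      To = pdo_T X' X,
      Ta = \<lambda>(K, L, \<phi>). (pdo_T X' X K, pdo_T X' X L, \<lambda>A \<in> Ob X'. Ta X (\<phi> A)),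
      T2 = pdo_T2 X' X,
      q1 = \<lambda>K. (pdo_T2 X' X K, pdo_T X' X K, \<lambda>A \<in> Ob X'. q1 X (mo (pmor K) A)),
      q2 = \<lambda>K. (pdo_T2 X' X K, pdo_T X' X K, \<lambda>A \<in> Ob X'. q2 X (mo (pmor K) A)),
      tp = \<lambda>K. (pdo_T X' X K, K, \<lambda>A \<in> Ob X'. tp X (mo (pmor K) A)),
      tz = \<lambda>K. (K, pdo_T X' X K, \<lambda>A \<in> Ob X'. tz X (mo (pmor K) A)),
      ts = \<lambda>K. (pdo_T2 X' X K, pdo_T X' X K, \<lambda>A \<in> Ob X'. ts X (mo (pmor K) A)),
      tl = \<lambda>K. (pdo_T X' X K, pdo_T X' X (pdo_T X' X K), \<lambda>A \<in> Ob X'. tl X (mo (pmor K) A)),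
      tc = \<lambda>K. (pdo_T X' X (pdo_T X' X K), pdo_T X' X (pdo_T X' X K),
                \<lambda>A \<in> Ob X'. tc X (mo (pmor K) A))\<rparr>"


section \<open>The construction of differential objects\<close>

text \<open>The comparison induced by a pointwise differential object \<open>K = (U; Z, S, P)\<close>, on objects
  \<open>H \<mapsto> (U \<circ> H; Z_H, S_H, P_H)\<close> and on 2-morphisms \<open>\<phi> \<mapsto> U \<phi>\<close>.\<close>

definition comparison_ob ::
  "('o1, 'a1, 'm) tcat_scheme \<Rightarrow> ('o, 'a, 'n) ctcat_scheme \<Rightarrow> ('o2, 'a2, 'o, 'a) pdobj \<Rightarrow>
   ('o1, 'a1, 'o2, 'a2) tmor \<Rightarrow> ('o1, 'a1, 'o, 'a) pdobj" where
  "comparison_ob X' X K H =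
     \<lparr>pmor = tmor_comp X' X (pmor K) H,
      pzero = \<lambda>A \<in> Ob X'. pzero K (mo H A),
      padd = \<lambda>A \<in> Ob X'. padd K (mo H A),
      pproj = \<lambda>A \<in> Ob X'. pproj K (mo H A)\<rparr>"

definition comparison_ar ::
  "('o1, 'a1, 'm) tcat_scheme \<Rightarrow> ('o, 'a, 'n) ctcat_scheme \<Rightarrow> ('o2, 'a2, 'o, 'a) pdobj \<Rightarrow>
   ('o1, 'a1, 'o2, 'a2) tmor \<times> ('o1, 'a1, 'o2, 'a2) tmor \<times> ('o1 \<Rightarrow> 'a2) \<Rightarrow>
   ('o1, 'a1, 'o, 'a) pdobj \<times> ('o1, 'a1, 'o, 'a) pdobj \<times> ('o1 \<Rightarrow> 'a)" where
  "comparison_ar X' X K = (\<lambda>(H, H', \<phi>).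
     (comparison_ob X' X K H, comparison_ob X' X K H', \<lambda>A \<in> Ob X'. ma (pmor K) (\<phi> A)))"

text \<open>\<open>DD\<close> with the pointwise differential object \<open>K\<close> is the tangentad of differential objects of
  \<open>X\<close>.  HOL does not quantify over types, so the types of the objects and arrows of the test
  categories \<open>X'\<close> are an explicit parameter, meant to be left as type variables.\<close>

definition tangentad_of_differential_objects ::
  "('o1 \<times> 'a1) itself \<Rightarrow> ('o, 'a) ctcat \<Rightarrow> ('o2, 'a2) ctcat \<Rightarrow> ('o2, 'a2, 'o, 'a) pdobj \<Rightarrow> bool" where
  "tangentad_of_differential_objects (test :: ('o1 \<times> 'a1) itself) X DD K \<longleftrightarrow>
     cartesian_tangent_split_restriction_category DD \<and>
     strict_tangent_morphism DD X (pmor K) \<and>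
     pointwise_differential_object DD X K \<and>
     (\<forall>X' :: ('o1, 'a1) tcat. tangent_split_restriction_category X' \<longrightarrow>
        tangent_iso (hom_tcat X' DD) (pdo_tcat X' X) (comparison_ob X' X K) (comparison_ar X' X K))"

definition admits_differential_objects :: "('o1 \<times> 'a1) itself \<Rightarrow> ('o, 'a) ctcat \<Rightarrow> bool" where
  "admits_differential_objects (test :: ('o1 \<times> 'a1) itself) (X :: ('o, 'a) ctcat) \<longleftrightarrow>
     (\<exists>(DD :: (('o, 'a) dobj, ('o, 'a) do_arr) ctcat) K. tangentad_of_differential_objects test X DD K)"

text \<open>The forgetful strict tangent morphism from \<open>DO X\<close> to \<open>X\<close> with its tautological pointwise
  differential object.\<close>

definition DO_universal :: "('o, 'a) ctcat \<Rightarrow> (('o, 'a) dobj, ('o, 'a) do_arr, 'o, 'a) pdobj" where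
  "DO_universal X =
     \<lparr>pmor = \<lparr>mo = \<lambda>D \<in> Ob (DO X). dob D,
              ma = \<lambda>t \<in> Ar (DO X). snd (snd t),
              mn = \<lambda>D \<in> Ob (DO X). Ide X (To X (dob D))\<rparr>,
      pzero = \<lambda>D \<in> Ob (DO X). dzero D,
      padd = \<lambda>D \<in> Ob (DO X). dadd D,
      pproj = \<lambda>D \<in> Ob (DO X). dproj D\<rparr>"

end

theory Submission
  imports Defs
begin

text \<open>
  The objects of \<open>DO X\<close> are the differential objects \<open>(A, \<zeta>, \<sigma>, ph)\<close> of the total maps of \<open>X\<close>, and its
  arrows are the maps of \<open>X\<close> that commute with \<open>\<zeta>\<close>, \<open>\<sigma>\<close> and \<open>ph\<close>.  Two observations carry the proof.

  \<^bold>\<open>Limits are created by the forgetful functor.\<close>  A jointly monic family of morphisms reflects the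
  equations of a differential object (\<open>dob_equations_reflect\<close>) and the property of being a morphism
  (\<open>do_morphism_reflect\<close>).  So a limit of differential objects in \<open>X\<close> carries at most one differential
  structure for which the projections are morphisms, and with it it is a limit in \<open>DO X\<close>.  The only
  point that needs an argument is the product diagram \<open>A \<leftarrow> T A \<rightarrow> A\<close> of the limit.  It is settled once for
  wide pullbacks preserved by \<open>T\<close> (\<open>dobj_wide_pullback\<close>), which covers \<open>T\<^sub>2 A\<close>, all fibre powers of
  \<open>p\<close>, and binary products (wide pullbacks over the terminal object).  Splittings of restriction
  idempotents are retracts and are treated in the same spirit (\<open>dobj_split\<close>).  On \<open>T A\<close> the structure is
  the image of that of \<open>A\<close> under \<open>T\<close>, corrected by the flip (\<open>dobj_do_T\<close>), and the structure maps
  \<open>p, z, s, l, c\<close> are linear by the axioms of a tangent category.  The tangent axioms of \<open>DO X\<close> are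
  then equations between arrows of \<open>X\<close> that hold in \<open>X\<close>.

  \<^bold>\<open>A pointwise differential object is a lift along the forgetful functor.\<close>  Let \<open>(F, \<alpha>)\<close> be a lax tangent
  morphism from \<open>S\<close> to \<open>X\<close> and let every \<open>F A\<close> carry a differential structure.  Naturality of these
  structures in \<open>A\<close> says that every \<open>F f\<close> is a morphism of differential objects; compatibility with the
  tangent structures says the same of every \<open>\<alpha>\<^sub>A\<close> (\<open>pointwise_iff\<close>).  Hence pointwise differential
  objects are exactly the lax tangent morphisms from \<open>S\<close> to \<open>DO X\<close> (\<open>comparison_ob_bij\<close>).  On arrows, a
  2-morphism is componentwise total, and a total linear map automatically preserves \<open>\<zeta>\<close> and \<open>\<sigma>\<close>
  (\<open>do_morphism_total_linear\<close>), so linear 2-morphisms are exactly the 2-morphisms into \<open>DO X\<close>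
  (\<open>comparison_ar_bij\<close>).  Both hom-categories have their tangent structure componentwise, whence the
  comparison preserves it strictly (\<open>comparison_iso\<close>).
\<close>

section \<open>Composition and totality\<close>

text \<open>
  Arrows are typed by \<open>Ar\<close>, \<open>Dom\<close> and \<open>Cod\<close> instead of hom-sets, so that the side conditions of the
  rewrite rules below contain no unknown objects and are decided by rewriting.  Composites are
  normalised by bracketing to the right.
\<close>

context category
begin

lemma in_Hom: "f \<in> Hom X A B \<longleftrightarrow> f \<in> Ar X \<and> Dom X f = A \<and> Cod X f = B"
  by (auto simp: Hom_def)

lemma dom_in_Ob [simp]: "f \<in> Ar X \<Longrightarrow> Dom X f \<in> Ob X"
  and cod_in_Ob [simp]: "f \<in> Ar X \<Longrightarrow> Cod X f \<in> Ob X"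
  by (simp_all add: dom_ob cod_ob)

lemma ide_in_Ar [simp]: "A \<in> Ob X \<Longrightarrow> Ide X A \<in> Ar X"
  and dom_ide [simp]: "A \<in> Ob X \<Longrightarrow> Dom X (Ide X A) = A"
  and cod_ide [simp]: "A \<in> Ob X \<Longrightarrow> Cod X (Ide X A) = A"
  using ide_hom[of A] by (simp_all add: in_Hom)

lemma cmp_in_Ar [simp]: "f \<in> Ar X \<Longrightarrow> g \<in> Ar X \<Longrightarrow> Cod X f = Dom X g \<Longrightarrow> g \<cdot> f \<in> Ar X"
  and dom_cmp [simp]: "f \<in> Ar X \<Longrightarrow> g \<in> Ar X \<Longrightarrow> Cod X f = Dom X g \<Longrightarrow> Dom X (g \<cdot> f) = Dom X f"
  and cod_cmp [simp]: "f \<in> Ar X \<Longrightarrow> g \<in> Ar X \<Longrightarrow> Cod X f = Dom X g \<Longrightarrow> Cod X (g \<cdot> f) = Cod X g"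
  using cmp_hom[of f "Dom X f" "Cod X f" g "Cod X g"] by (simp_all add: in_Hom)

lemma cmp_ide_right [simp]: "f \<in> Ar X \<Longrightarrow> Dom X f = A \<Longrightarrow> f \<cdot> Ide X A = f"
  and cmp_ide_left [simp]: "f \<in> Ar X \<Longrightarrow> Cod X f = A \<Longrightarrow> Ide X A \<cdot> f = f"
  by (auto intro: cmp_ide ide_cmp simp: in_Hom)

lemma assoc [simp]:
  "f \<in> Ar X \<Longrightarrow> g \<in> Ar X \<Longrightarrow> h \<in> Ar X \<Longrightarrow> Cod X f = Dom X g \<Longrightarrow> Cod X g = Dom X h \<Longrightarrow>
   (h \<cdot> g) \<cdot> f = h \<cdot> (g \<cdot> f)"
  by (rule cmp_assoc) (auto simp: in_Hom)

text \<open>With composites bracketed to the right, an equation \<open>a \<cdot> b = c \<cdot> d\<close> is applied inside a longer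
  composite in the form given here.\<close>

lemma assoc_eq:
  assumes "a \<cdot> b = c \<cdot> d"
    and "a \<in> Ar X" "b \<in> Ar X" "Cod X b = Dom X a" "c \<in> Ar X" "d \<in> Ar X" "Cod X d = Dom X c"
    and "x \<in> Ar X" "Cod X x = Dom X b"
  shows "a \<cdot> (b \<cdot> x) = c \<cdot> (d \<cdot> x)"
proof -
  have "Dom X b = Dom X d"
    using arg_cong[OF assms(1), of "Dom X"] assms(2-) by simp
  then have "(a \<cdot> b) \<cdot> x = a \<cdot> (b \<cdot> x)" "(c \<cdot> d) \<cdot> x = c \<cdot> (d \<cdot> x)"
    using assms(2-) by simp_all
  then show ?thesis
    using assms(1) by simp
qed

lemma assoc_reduce:
  assumes "a \<cdot> b = c"
    and "a \<in> Ar X" "b \<in> Ar X" "Cod X b = Dom X a" "x \<in> Ar X" "Cod X x = Dom X b"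
  shows "a \<cdot> (b \<cdot> x) = c \<cdot> x"
  using assms assoc[of x b a] by simp

end

context restriction_category
begin

lemma rst_in_Ar [simp]: "f \<in> Ar X \<Longrightarrow> Rst X f \<in> Ar X"
  and dom_rst [simp]: "f \<in> Ar X \<Longrightarrow> Dom X (Rst X f) = Dom X f"
  and cod_rst [simp]: "f \<in> Ar X \<Longrightarrow> Cod X (Rst X f) = Dom X f"
  using rst_hom[of f "Dom X f" "Cod X f"] by (simp_all add: in_Hom)

lemma cmp_own_rst [simp]: "f \<in> Ar X \<Longrightarrow> f \<cdot> Rst X f = f"
  using cmp_rst[of f "Dom X f" "Cod X f"] by (simp add: in_Hom)

lemma rst_comm:
  "f \<in> Ar X \<Longrightarrow> g \<in> Ar X \<Longrightarrow> Dom X f = Dom X g \<Longrightarrow> Rst X f \<cdot> Rst X g = Rst X g \<cdot> Rst X f"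
  using rst_commute[of f "Dom X f" "Cod X f" g "Cod X g"] by (simp add: in_Hom)

lemma rst_cmp_own_rst [simp]:
  "f \<in> Ar X \<Longrightarrow> g \<in> Ar X \<Longrightarrow> Dom X g = Dom X f \<Longrightarrow> Rst X (g \<cdot> Rst X f) = Rst X g \<cdot> Rst X f"
  using rst_cmp_rst[of f "Dom X f" "Cod X f" g "Cod X g"] by (simp add: in_Hom)

lemma rst_slide':
  "f \<in> Ar X \<Longrightarrow> g \<in> Ar X \<Longrightarrow> Cod X f = Dom X g \<Longrightarrow> Rst X g \<cdot> f = f \<cdot> Rst X (g \<cdot> f)"
  using rst_slide[of f "Dom X f" "Cod X f" g "Cod X g"] by (simp add: in_Hom)

lemma rst_ide [simp]: "A \<in> Ob X \<Longrightarrow> Rst X (Ide X A) = Ide X A"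
  using cmp_own_rst[of "Ide X A"] cmp_ide_left[of "Rst X (Ide X A)" A] by simp

lemma rst_rst [simp]: "f \<in> Ar X \<Longrightarrow> Rst X (Rst X f) = Rst X f"
  using rst_cmp_own_rst[of f "Ide X (Dom X f)"] by simp

lemma rst_idem [simp]: "f \<in> Ar X \<Longrightarrow> Rst X f \<cdot> Rst X f = Rst X f"
  using cmp_own_rst[of "Rst X f"] by simp

lemma rst_absorb [simp]:
  assumes "f \<in> Ar X" "g \<in> Ar X" "Cod X f = Dom X g"
  shows "Rst X f \<cdot> Rst X (g \<cdot> f) = Rst X (g \<cdot> f)"
proof -
  have "Rst X f \<cdot> Rst X (g \<cdot> f) = Rst X (g \<cdot> f) \<cdot> Rst X f"
    by (rule rst_comm) (use assms in simp_all)
  also have "\<dots> = Rst X ((g \<cdot> f) \<cdot> Rst X f)"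
    by (rule rst_cmp_own_rst[symmetric]) (use assms in simp_all)
  also have "\<dots> = Rst X (g \<cdot> f)"
    using assms by simp
  finally show ?thesis .
qed

lemma rst_cmp: "f \<in> Ar X \<Longrightarrow> g \<in> Ar X \<Longrightarrow> Cod X f = Dom X g \<Longrightarrow> Rst X (Rst X g \<cdot> f) = Rst X (g \<cdot> f)"
  by (subst rst_slide') simp_all

lemma rst_total [simp]: "total X f \<Longrightarrow> Rst X f = Ide X (Dom X f)"
  by (simp add: total_def)

lemma total_ide [simp]: "A \<in> Ob X \<Longrightarrow> total X (Ide X A)"
  by (simp add: total_def)

text \<open>A total map composed on the left does not change the domain of definition.\<close>

lemma rst_total_cmp [simp]:
  assumes "f \<in> Ar X" "g \<in> Ar X" "Cod X f = Dom X g" "total X g"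
  shows "Rst X (g \<cdot> f) = Rst X f"
  using rst_cmp[of f g] assms by simp

lemma total_cmp [simp]:
  "f \<in> Ar X \<Longrightarrow> g \<in> Ar X \<Longrightarrow> Cod X f = Dom X g \<Longrightarrow> total X g \<Longrightarrow> total X f \<Longrightarrow> total X (g \<cdot> f)"
  unfolding total_def[of X "g \<cdot> f"] by simp

lemma total_cancel:
  assumes "f \<in> Ar X" "g \<in> Ar X" "Cod X f = Dom X g" "total X (g \<cdot> f)"
  shows "total X f"
proof -
  have "Rst X (g \<cdot> f) = Ide X (Dom X f)"
    using assms rst_total[of "g \<cdot> f"] by simp
  then have "Rst X f \<cdot> Ide X (Dom X f) = Ide X (Dom X f)"
    using rst_absorb[of f g] assms(1-3) by metis
  then show ?thesis
    unfolding total_def using assms(1) by simp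
qed

end

section \<open>Functors and limits\<close>

lemma (in category) restriction_functorD:
  assumes "restriction_functor X Y Fo Fa"
  shows "A \<in> Ob X \<Longrightarrow> Fo A \<in> Ob Y"
    and "f \<in> Ar X \<Longrightarrow> Fa f \<in> Ar Y"
    and "f \<in> Ar X \<Longrightarrow> Dom Y (Fa f) = Fo (Dom X f)"
    and "f \<in> Ar X \<Longrightarrow> Cod Y (Fa f) = Fo (Cod X f)"
    and "A \<in> Ob X \<Longrightarrow> Fa (Ide X A) = Ide Y (Fo A)"
    and "f \<in> Ar X \<Longrightarrow> g \<in> Ar X \<Longrightarrow> Cod X f = Dom X g \<Longrightarrow> Fa (g \<cdot> f) = Fa g \<cdot>\<^bsub>Y\<^esub> Fa f"
    and "f \<in> Ar X \<Longrightarrow> Fa (Rst X f) = Rst Y (Fa f)"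
  using assms by (auto simp: restriction_functor_def Hom_def)

lemma (in category) restriction_functor_total:
  assumes "restriction_functor X Y Fo Fa" "f \<in> Ar X" "total X f"
  shows "total Y (Fa f)"
  using restriction_functorD[OF assms(1)] assms(2,3) unfolding total_def
  by (metis dom_in_Ob)

lemma (in category) restriction_functorI:
  assumes "\<And>A. A \<in> Ob X \<Longrightarrow> Fo A \<in> Ob Y"
    and "\<And>f. f \<in> Ar X \<Longrightarrow> Fa f \<in> Ar Y"
    and "\<And>f. f \<in> Ar X \<Longrightarrow> Dom Y (Fa f) = Fo (Dom X f)"
    and "\<And>f. f \<in> Ar X \<Longrightarrow> Cod Y (Fa f) = Fo (Cod X f)"
    and "\<And>A. A \<in> Ob X \<Longrightarrow> Fa (Ide X A) = Ide Y (Fo A)"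
    and "\<And>f g. f \<in> Ar X \<Longrightarrow> g \<in> Ar X \<Longrightarrow> Cod X f = Dom X g \<Longrightarrow> Fa (g \<cdot> f) = Fa g \<cdot>\<^bsub>Y\<^esub> Fa f"
    and "\<And>f. f \<in> Ar X \<Longrightarrow> Fa (Rst X f) = Rst Y (Fa f)"
  shows "restriction_functor X Y Fo Fa"
  using assms by (auto simp: restriction_functor_def Hom_def)

lemma total_nat_transD:
  assumes "total_nat_trans X Y Fo Fa Go Ga \<eta>"
  shows "A \<in> Ob X \<Longrightarrow> \<eta> A \<in> Ar Y"
    and "A \<in> Ob X \<Longrightarrow> Dom Y (\<eta> A) = Fo A"
    and "A \<in> Ob X \<Longrightarrow> Cod Y (\<eta> A) = Go A"
    and "A \<in> Ob X \<Longrightarrow> total Y (\<eta> A)"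
    and "f \<in> Ar X \<Longrightarrow> Ga f \<cdot>\<^bsub>Y\<^esub> \<eta> (Dom X f) = \<eta> (Cod X f) \<cdot>\<^bsub>Y\<^esub> Fa f"
  using assms unfolding total_nat_trans_def Hom_def by blast+

lemma total_nat_transI:
  assumes "\<And>A. A \<in> Ob X \<Longrightarrow> \<eta> A \<in> Ar Y"
    and "\<And>A. A \<in> Ob X \<Longrightarrow> Dom Y (\<eta> A) = Fo A"
    and "\<And>A. A \<in> Ob X \<Longrightarrow> Cod Y (\<eta> A) = Go A"
    and "\<And>A. A \<in> Ob X \<Longrightarrow> total Y (\<eta> A)"
    and "\<And>f. f \<in> Ar X \<Longrightarrow> Ga f \<cdot>\<^bsub>Y\<^esub> \<eta> (Dom X f) = \<eta> (Cod X f) \<cdot>\<^bsub>Y\<^esub> Fa f"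
  shows "total_nat_trans X Y Fo Fa Go Ga \<eta>"
  using assms by (auto simp: total_nat_trans_def Hom_def)

context restriction_category
begin

lemma pullbackD:
  assumes "restriction_pullback X f g P u v"
  shows "P \<in> Ob X" "u \<in> Ar X" "Dom X u = P" "Cod X u = Dom X f" "total X u"
    "v \<in> Ar X" "Dom X v = P" "Cod X v = Dom X g" "total X v" "f \<cdot> u = g \<cdot> v"
  using assms unfolding restriction_pullback_def in_Hom by blast+

lemma pullback_ex1:
  assumes "restriction_pullback X f g P u v"
    "a \<in> Ar X" "b \<in> Ar X" "Dom X b = Dom X a" "Cod X a = Dom X f" "Cod X b = Dom X g" "f \<cdot> a = g \<cdot> b"
  shows "\<exists>!h. h \<in> Hom X (Dom X a) P \<and> u \<cdot> h = a \<and> v \<cdot> h = b"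
proof -
  have "\<forall>Q. \<forall>a \<in> Hom X Q (Dom X f). \<forall>b \<in> Hom X Q (Dom X g). f \<cdot> a = g \<cdot> b \<longrightarrow>
      (\<exists>!h. h \<in> Hom X Q P \<and> u \<cdot> h = a \<and> v \<cdot> h = b)"
    using assms(1) unfolding restriction_pullback_def by (elim conjE)
  from this[rule_format, of a "Dom X a" b] show ?thesis
    using assms(2-) unfolding in_Hom by argo
qed

lemma pullback_ext:
  assumes P: "restriction_pullback X f g P u v" and fg: "f \<in> Ar X" "g \<in> Ar X"
    and h: "h \<in> Ar X" "h' \<in> Ar X" "Dom X h' = Dom X h" "Cod X h = P" "Cod X h' = P"
    and eq: "u \<cdot> h = u \<cdot> h'" "v \<cdot> h = v \<cdot> h'"
  shows "h = h'"
proof -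
  note [simp] = pullbackD(1-9)[OF P]
  have "f \<cdot> (u \<cdot> h') = g \<cdot> (v \<cdot> h')"
    by (rule assoc_eq) (use pullbackD(10)[OF P] fg h in simp_all)
  then have "\<exists>!k. k \<in> Hom X (Dom X (u \<cdot> h')) P \<and> u \<cdot> k = u \<cdot> h' \<and> v \<cdot> k = v \<cdot> h'"
    using fg h by (intro pullback_ex1[OF P]) simp_all
  then show ?thesis
    using h eq by (auto simp: in_Hom)
qed

lemma pairing:
  assumes "restriction_pullback X f g P u v"
    "a \<in> Ar X" "b \<in> Ar X" "Dom X b = Dom X a" "Cod X a = Dom X f" "Cod X b = Dom X g" "f \<cdot> a = g \<cdot> b"
  shows "pairing X P u v a b \<in> Ar X" "Dom X (pairing X P u v a b) = Dom X a"
    "Cod X (pairing X P u v a b) = P"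
    "u \<cdot> pairing X P u v a b = a" "v \<cdot> pairing X P u v a b = b"
  using theI'[OF pullback_ex1[OF assms]] by (auto simp: pairing_def in_Hom)

lemma pairing_total:
  assumes P: "restriction_pullback X f g P u v"
    and ab: "a \<in> Ar X" "b \<in> Ar X" "Dom X b = Dom X a" "Cod X a = Dom X f" "Cod X b = Dom X g" "f \<cdot> a = g \<cdot> b"
    and "total X a"
  shows "total X (pairing X P u v a b)"
  by (rule total_cancel[where g = u]) (use pairing[OF P ab] pullbackD[OF P] assms in simp_all)

lemma productD:
  assumes "restriction_product X A B P u v"
  shows "P \<in> Ob X" "u \<in> Ar X" "Dom X u = P" "Cod X u = A" "total X u"
    "v \<in> Ar X" "Dom X v = P" "Cod X v = B" "total X v"
  using assms unfolding restriction_product_def in_Hom by blast+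

lemma product_ex1:
  assumes "restriction_product X A B P u v"
    "a \<in> Ar X" "b \<in> Ar X" "Dom X b = Dom X a" "Cod X a = A" "Cod X b = B"
  shows "\<exists>!h. h \<in> Hom X (Dom X a) P \<and> u \<cdot> h = a \<cdot> Rst X b \<and> v \<cdot> h = b \<cdot> Rst X a"
proof -
  have "\<forall>Q. \<forall>a \<in> Hom X Q A. \<forall>b \<in> Hom X Q B.
      \<exists>!h. h \<in> Hom X Q P \<and> u \<cdot> h = a \<cdot> Rst X b \<and> v \<cdot> h = b \<cdot> Rst X a"
    using assms(1) unfolding restriction_product_def by (elim conjE)
  from this[rule_format, of a "Dom X a" b] show ?thesis
    using assms(2-) unfolding in_Hom by argo
qed

text \<open>The projections of a restriction product are jointly monic on all maps, also on partial ones: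
  \<open>u \<cdot> h\<close> and \<open>v \<cdot> h\<close> have the same restriction, namely that of \<open>h\<close>, so \<open>h\<close> is the map that the
  universal property assigns to them.\<close>

lemma product_ext:
  assumes P: "restriction_product X A B P u v"
    and h: "h \<in> Ar X" "h' \<in> Ar X" "Dom X h' = Dom X h" "Cod X h = P" "Cod X h' = P"
    and eq: "u \<cdot> h = u \<cdot> h'" "v \<cdot> h = v \<cdot> h'"
  shows "h = h'"
proof -
  note [simp] = productD[OF P]
  have "\<exists>!k. k \<in> Hom X (Dom X (u \<cdot> h')) P \<and> u \<cdot> k = (u \<cdot> h') \<cdot> Rst X (v \<cdot> h') \<and> v \<cdot> k = (v \<cdot> h') \<cdot> Rst X (u \<cdot> h')"
    using h by (intro product_ex1[OF P]) simp_all
  then show ?thesis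
    using h eq by (auto simp: in_Hom)
qed

lemma product_pairing:
  assumes P: "restriction_product X A B P u v"
    and ab: "a \<in> Ar X" "b \<in> Ar X" "Dom X b = Dom X a" "Cod X a = A" "Cod X b = B"
    and rst: "Rst X a = Rst X b"
  shows "pairing X P u v a b \<in> Ar X" "Dom X (pairing X P u v a b) = Dom X a"
    "Cod X (pairing X P u v a b) = P"
    "u \<cdot> pairing X P u v a b = a" "v \<cdot> pairing X P u v a b = b"
proof -
  have "a \<cdot> Rst X b = a" "b \<cdot> Rst X a = b"
    using ab rst cmp_own_rst[of a] cmp_own_rst[of b] by simp_all
  then show "pairing X P u v a b \<in> Ar X" "Dom X (pairing X P u v a b) = Dom X a"
    "Cod X (pairing X P u v a b) = P"
    "u \<cdot> pairing X P u v a b = a" "v \<cdot> pairing X P u v a b = b"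
    using theI'[OF product_ex1[OF P ab]] by (auto simp: pairing_def in_Hom)
qed

lemma product_pairing_total:
  assumes P: "restriction_product X A B P u v"
    and ab: "a \<in> Ar X" "b \<in> Ar X" "Dom X b = Dom X a" "Cod X a = A" "Cod X b = B"
    and "total X a" "total X b"
  shows "total X (pairing X P u v a b)"
  by (rule total_cancel[where g = u]) (use product_pairing[OF P ab] productD[OF P] assms in simp_all)

lemma product_transport:
  assumes P: "restriction_product X A B P u v"
    and k: "k \<in> Ar X" "Dom X k = Q" "Cod X k = P" and j: "j \<in> Ar X" "Dom X j = P" "Cod X j = Q"
    and kj: "k \<cdot> j = Ide X P" and jk: "j \<cdot> k = Ide X Q"
  shows "restriction_product X A B Q (u \<cdot> k) (v \<cdot> k)"
proof -
  note [simp] = productD[OF P] k j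
  have Q [simp]: "Q \<in> Ob X"
    using dom_in_Ob[OF k(1)] by simp
  have [simp]: "total X k"
    by (rule total_cancel[where g = j]) (simp_all add: jk)
  have kjx [simp]: "k \<cdot> (j \<cdot> x) = x" if "x \<in> Ar X" "Cod X x = P" for x
    using assoc_reduce[OF kj, of x] that by simp
  have jkx [simp]: "j \<cdot> (k \<cdot> x) = x" if "x \<in> Ar X" "Cod X x = Q" for x
    using assoc_reduce[OF jk, of x] that by simp
  have *: "\<exists>!h. h \<in> Hom X R Q \<and> (u \<cdot> k) \<cdot> h = a \<cdot> Rst X b \<and> (v \<cdot> k) \<cdot> h = b \<cdot> Rst X a"
    if "a \<in> Hom X R A" "b \<in> Hom X R B" for R a b
  proof -
    have ab: "a \<in> Ar X" "b \<in> Ar X" "Dom X b = Dom X a" "Cod X a = A" "Cod X b = B" "Dom X a = R"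
      using that by (auto simp: in_Hom)
    obtain h where h: "h \<in> Ar X" "Dom X h = R" "Cod X h = P"
        "u \<cdot> h = a \<cdot> Rst X b" "v \<cdot> h = b \<cdot> Rst X a"
      using product_ex1[OF P ab(1-5)] ab by (auto simp: in_Hom)
    show ?thesis
    proof (rule ex1I[where a = "j \<cdot> h"])
      show "j \<cdot> h \<in> Hom X R Q \<and> (u \<cdot> k) \<cdot> j \<cdot> h = a \<cdot> Rst X b \<and> (v \<cdot> k) \<cdot> j \<cdot> h = b \<cdot> Rst X a"
        using h by (simp add: in_Hom)
    next
      fix h' assume h': "h' \<in> Hom X R Q \<and> (u \<cdot> k) \<cdot> h' = a \<cdot> Rst X b \<and> (v \<cdot> k) \<cdot> h' = b \<cdot> Rst X a"
      then have h'': "h' \<in> Ar X" "Dom X h' = R" "Cod X h' = Q"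
        by (simp_all add: in_Hom)
      then have "u \<cdot> k \<cdot> h' = u \<cdot> h" "v \<cdot> k \<cdot> h' = v \<cdot> h"
        using h h' by simp_all
      then have "k \<cdot> h' = h"
        using h h'' by - (rule product_ext[OF P], simp_all)
      then show "h' = j \<cdot> h"
        using h'' jkx[of h'] by simp
    qed
  qed
  show ?thesis
    unfolding restriction_product_def
  proof (intro conjI allI ballI)
    show "u \<cdot> k \<in> Hom X Q A"
      by (simp add: in_Hom)
    show "v \<cdot> k \<in> Hom X Q B"
      by (simp add: in_Hom)
    show "total X (u \<cdot> k)"
      by simp
    show "total X (v \<cdot> k)"
      by simp
  qed (fact Q, fact *)
qed

end

section \<open>Tangent split restriction categories\<close>

context tangent_split_restriction_category
begin

lemmas T_functorD [simp] = restriction_functorD[OF T_functor]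
lemmas Ta_total [simp] = restriction_functor_total[OF T_functor]

lemmas tp_typing [simp] = total_nat_transD(1-4)[OF p_nat]
lemmas tz_typing [simp] = total_nat_transD(1-4)[OF z_nat]
lemmas ts_typing [simp] = total_nat_transD(1-4)[OF s_nat]
lemmas tl_typing [simp] = total_nat_transD(1-4)[OF l_nat]
lemmas tc_typing [simp] = total_nat_transD(1-4)[OF c_nat]

lemmas T2_pullback0 = T2_pullback[where m = 0, simplified]
lemmas T2_pullback1 = T2_pullback[where m = 1, simplified]

lemma T2_typing [simp]:
  assumes "A \<in> Ob X"
  shows "T2 X A \<in> Ob X"
    "q1 X A \<in> Ar X" "Dom X (q1 X A) = T2 X A" "Cod X (q1 X A) = To X A" "total X (q1 X A)"
    "q2 X A \<in> Ar X" "Dom X (q2 X A) = T2 X A" "Cod X (q2 X A) = To X A" "total X (q2 X A)"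
  using pullbackD(1-9)[OF T2_pullback0[OF assms]] assms by simp_all

lemma p_q2 [simp]: "A \<in> Ob X \<Longrightarrow> tp X A \<cdot> q2 X A = tp X A \<cdot> q1 X A"
  using pullbackD(10)[OF T2_pullback0] by simp

lemma p_q2_x [simp]:
  "A \<in> Ob X \<Longrightarrow> x \<in> Ar X \<Longrightarrow> Cod X x = T2 X A \<Longrightarrow> tp X A \<cdot> q2 X A \<cdot> x = tp X A \<cdot> q1 X A \<cdot> x"
  by (rule assoc_eq[OF p_q2]) simp_all

lemma T2_ext:
  assumes "q1 X A \<cdot> h = q1 X A \<cdot> h'" "q2 X A \<cdot> h = q2 X A \<cdot> h'"
    and "A \<in> Ob X" "h \<in> Ar X" "h' \<in> Ar X" "Dom X h' = Dom X h" "Cod X h = T2 X A" "Cod X h' = T2 X A"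
  shows "h = h'"
  by (rule pullback_ext[OF T2_pullback0[OF assms(3)]]) (use assms in simp_all)

lemma TT2_ext:
  assumes "Ta X (q1 X A) \<cdot> h = Ta X (q1 X A) \<cdot> h'" "Ta X (q2 X A) \<cdot> h = Ta X (q2 X A) \<cdot> h'"
    and "A \<in> Ob X" "h \<in> Ar X" "h' \<in> Ar X" "Dom X h' = Dom X h"
    "Cod X h = To X (T2 X A)" "Cod X h' = To X (T2 X A)"
  shows "h = h'"
  by (rule pullback_ext[OF T2_pullback1[OF assms(3)]]) (use assms in simp_all)

lemma pairT2 [simp]:
  assumes "A \<in> Ob X" "a \<in> Ar X" "b \<in> Ar X" "Dom X b = Dom X a" "Cod X a = To X A" "Cod X b = To X A"
    "tp X A \<cdot> a = tp X A \<cdot> b"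
  shows "pairT2 X A a b \<in> Ar X" "Dom X (pairT2 X A a b) = Dom X a" "Cod X (pairT2 X A a b) = T2 X A"
    "q1 X A \<cdot> pairT2 X A a b = a" "q2 X A \<cdot> pairT2 X A a b = b"
    "total X a \<Longrightarrow> total X (pairT2 X A a b)"
  unfolding pairT2_def
  using pairing[OF T2_pullback0] pairing_total[OF T2_pullback0] assms by simp_all

lemma pairTT2 [simp]:
  assumes "A \<in> Ob X" "a \<in> Ar X" "b \<in> Ar X" "Dom X b = Dom X a"
    "Cod X a = To X (To X A)" "Cod X b = To X (To X A)" "Ta X (tp X A) \<cdot> a = Ta X (tp X A) \<cdot> b"
  shows "pairTT2 X A a b \<in> Ar X" "Dom X (pairTT2 X A a b) = Dom X a"
    "Cod X (pairTT2 X A a b) = To X (T2 X A)"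
    "Ta X (q1 X A) \<cdot> pairTT2 X A a b = a" "Ta X (q2 X A) \<cdot> pairTT2 X A a b = b"
    "total X a \<Longrightarrow> total X (pairTT2 X A a b)"
  unfolding pairTT2_def
  using pairing[OF T2_pullback1] pairing_total[OF T2_pullback1] assms by simp_all

lemma q_pairT2_x [simp]:
  assumes "A \<in> Ob X" "a \<in> Ar X" "b \<in> Ar X" "Dom X b = Dom X a" "Cod X a = To X A" "Cod X b = To X A"
    "tp X A \<cdot> a = tp X A \<cdot> b" "x \<in> Ar X" "Cod X x = Dom X a"
  shows "q1 X A \<cdot> pairT2 X A a b \<cdot> x = a \<cdot> x" "q2 X A \<cdot> pairT2 X A a b \<cdot> x = b \<cdot> x"
  by (rule assoc_reduce; use assms in simp)+

lemma Tq_pairTT2_x [simp]: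
  assumes "A \<in> Ob X" "a \<in> Ar X" "b \<in> Ar X" "Dom X b = Dom X a"
    "Cod X a = To X (To X A)" "Cod X b = To X (To X A)" "Ta X (tp X A) \<cdot> a = Ta X (tp X A) \<cdot> b"
    "x \<in> Ar X" "Cod X x = Dom X a"
  shows "Ta X (q1 X A) \<cdot> pairTT2 X A a b \<cdot> x = a \<cdot> x" "Ta X (q2 X A) \<cdot> pairTT2 X A a b \<cdot> x = b \<cdot> x"
  by (rule assoc_reduce; use assms in simp)+

lemma Tq_T_pairT2 [simp]:
  assumes "A \<in> Ob X" "a \<in> Ar X" "b \<in> Ar X" "Dom X b = Dom X a" "Cod X a = To X A" "Cod X b = To X A"
    "tp X A \<cdot> a = tp X A \<cdot> b"
  shows "Ta X (q1 X A) \<cdot> Ta X (pairT2 X A a b) = Ta X a" "Ta X (q2 X A) \<cdot> Ta X (pairT2 X A a b) = Ta X b"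
    "x \<in> Ar X \<Longrightarrow> Cod X x = To X (Dom X a) \<Longrightarrow> Ta X (q1 X A) \<cdot> Ta X (pairT2 X A a b) \<cdot> x = Ta X a \<cdot> x"
    "x \<in> Ar X \<Longrightarrow> Cod X x = To X (Dom X a) \<Longrightarrow> Ta X (q2 X A) \<cdot> Ta X (pairT2 X A a b) \<cdot> x = Ta X b \<cdot> x"
proof -
  show *: "Ta X (q1 X A) \<cdot> Ta X (pairT2 X A a b) = Ta X a" "Ta X (q2 X A) \<cdot> Ta X (pairT2 X A a b) = Ta X b"
    using T_functorD(6)[of "pairT2 X A a b" "q1 X A"] T_functorD(6)[of "pairT2 X A a b" "q2 X A"] assms
    by simp_all
  show "Ta X (q1 X A) \<cdot> Ta X (pairT2 X A a b) \<cdot> x = Ta X a \<cdot> x"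
    "Ta X (q2 X A) \<cdot> Ta X (pairT2 X A a b) \<cdot> x = Ta X b \<cdot> x"
    if "x \<in> Ar X" "Cod X x = To X (Dom X a)"
    using assoc_reduce[OF *(1), of x] assoc_reduce[OF *(2), of x] assms that by simp_all
qed

text \<open>Naturality of \<open>p\<close>, \<open>z\<close>, \<open>l\<close> and \<open>c\<close> is oriented so that rewriting moves these maps to the right,
  past an arbitrary arrow.\<close>

lemma tp_natural:
  assumes "f \<in> Ar X" "Cod X f = B"
  shows "tp X B \<cdot> Ta X f = f \<cdot> tp X (Dom X f)"
    "x \<in> Ar X \<Longrightarrow> Cod X x = To X (Dom X f) \<Longrightarrow> tp X B \<cdot> Ta X f \<cdot> x = f \<cdot> tp X (Dom X f) \<cdot> x"
proof -
  show *: "tp X B \<cdot> Ta X f = f \<cdot> tp X (Dom X f)"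
    using total_nat_transD(5)[OF p_nat assms(1)] assms by simp
  show "tp X B \<cdot> Ta X f \<cdot> x = f \<cdot> tp X (Dom X f) \<cdot> x" if "x \<in> Ar X" "Cod X x = To X (Dom X f)"
    by (rule assoc_eq[OF *]) (use assms that in auto)
qed

lemma tz_natural:
  assumes "f \<in> Ar X" "Cod X f = B"
  shows "tz X B \<cdot> f = Ta X f \<cdot> tz X (Dom X f)"
    "x \<in> Ar X \<Longrightarrow> Cod X x = Dom X f \<Longrightarrow> tz X B \<cdot> f \<cdot> x = Ta X f \<cdot> tz X (Dom X f) \<cdot> x"
proof -
  show *: "tz X B \<cdot> f = Ta X f \<cdot> tz X (Dom X f)"
    using total_nat_transD(5)[OF z_nat assms(1)] assms by simp
  show "tz X B \<cdot> f \<cdot> x = Ta X f \<cdot> tz X (Dom X f) \<cdot> x" if "x \<in> Ar X" "Cod X x = Dom X f"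
    by (rule assoc_eq[OF *]) (use assms that in auto)
qed

lemma tl_natural:
  assumes "f \<in> Ar X" "Cod X f = B"
  shows "tl X B \<cdot> Ta X f = Ta X (Ta X f) \<cdot> tl X (Dom X f)"
    "x \<in> Ar X \<Longrightarrow> Cod X x = To X (Dom X f) \<Longrightarrow> tl X B \<cdot> Ta X f \<cdot> x = Ta X (Ta X f) \<cdot> tl X (Dom X f) \<cdot> x"
proof -
  show *: "tl X B \<cdot> Ta X f = Ta X (Ta X f) \<cdot> tl X (Dom X f)"
    using total_nat_transD(5)[OF l_nat assms(1)] assms by simp
  show "tl X B \<cdot> Ta X f \<cdot> x = Ta X (Ta X f) \<cdot> tl X (Dom X f) \<cdot> x"
    if "x \<in> Ar X" "Cod X x = To X (Dom X f)"
    by (rule assoc_eq[OF *]) (use assms that in auto)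
qed

lemma tc_natural:
  assumes "f \<in> Ar X" "Cod X f = B"
  shows "tc X B \<cdot> Ta X (Ta X f) = Ta X (Ta X f) \<cdot> tc X (Dom X f)"
    "x \<in> Ar X \<Longrightarrow> Cod X x = To X (To X (Dom X f)) \<Longrightarrow>
      tc X B \<cdot> Ta X (Ta X f) \<cdot> x = Ta X (Ta X f) \<cdot> tc X (Dom X f) \<cdot> x"
proof -
  show *: "tc X B \<cdot> Ta X (Ta X f) = Ta X (Ta X f) \<cdot> tc X (Dom X f)"
    using total_nat_transD(5)[OF c_nat assms(1)] assms by simp
  show "tc X B \<cdot> Ta X (Ta X f) \<cdot> x = Ta X (Ta X f) \<cdot> tc X (Dom X f) \<cdot> x"
    if "x \<in> Ar X" "Cod X x = To X (To X (Dom X f))"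
    by (rule assoc_eq[OF *]) (use assms that in auto)
qed

lemma T2a [simp]:
  assumes "f \<in> Ar X"
  shows "T2a X f \<in> Ar X" "Dom X (T2a X f) = T2 X (Dom X f)" "Cod X (T2a X f) = T2 X (Cod X f)"
    and "Cod X f = B \<Longrightarrow> q1 X B \<cdot> T2a X f = Ta X f \<cdot> q1 X (Dom X f)"
    and "Cod X f = B \<Longrightarrow> q2 X B \<cdot> T2a X f = Ta X f \<cdot> q2 X (Dom X f)"
    and "total X f \<Longrightarrow> total X (T2a X f)"
  unfolding T2a_def using assms by (auto simp: tp_natural)

lemma q_T2a_x [simp]:
  assumes "f \<in> Ar X" "Cod X f = B" "x \<in> Ar X" "Cod X x = T2 X (Dom X f)"
  shows "q1 X B \<cdot> T2a X f \<cdot> x = Ta X f \<cdot> q1 X (Dom X f) \<cdot> x"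
    "q2 X B \<cdot> T2a X f \<cdot> x = Ta X f \<cdot> q2 X (Dom X f) \<cdot> x"
  by (rule assoc_eq; use assms in auto)+

lemma Tq_T_T2a [simp]:
  assumes "f \<in> Ar X" "Cod X f = B"
  shows "Ta X (q1 X B) \<cdot> Ta X (T2a X f) = Ta X (Ta X f) \<cdot> Ta X (q1 X (Dom X f))"
    "Ta X (q2 X B) \<cdot> Ta X (T2a X f) = Ta X (Ta X f) \<cdot> Ta X (q2 X (Dom X f))"
    "x \<in> Ar X \<Longrightarrow> Cod X x = To X (T2 X (Dom X f)) \<Longrightarrow>
      Ta X (q1 X B) \<cdot> Ta X (T2a X f) \<cdot> x = Ta X (Ta X f) \<cdot> Ta X (q1 X (Dom X f)) \<cdot> x"
    "x \<in> Ar X \<Longrightarrow> Cod X x = To X (T2 X (Dom X f)) \<Longrightarrow>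
      Ta X (q2 X B) \<cdot> Ta X (T2a X f) \<cdot> x = Ta X (Ta X f) \<cdot> Ta X (q2 X (Dom X f)) \<cdot> x"
proof -
  show *: "Ta X (q1 X B) \<cdot> Ta X (T2a X f) = Ta X (Ta X f) \<cdot> Ta X (q1 X (Dom X f))"
    "Ta X (q2 X B) \<cdot> Ta X (T2a X f) = Ta X (Ta X f) \<cdot> Ta X (q2 X (Dom X f))"
    using T_functorD(6)[of "T2a X f" "q1 X B"] T_functorD(6)[of "T2a X f" "q2 X B"] assms by auto
  show "Ta X (q1 X B) \<cdot> Ta X (T2a X f) \<cdot> x = Ta X (Ta X f) \<cdot> Ta X (q1 X (Dom X f)) \<cdot> x"
    "Ta X (q2 X B) \<cdot> Ta X (T2a X f) \<cdot> x = Ta X (Ta X f) \<cdot> Ta X (q2 X (Dom X f)) \<cdot> x"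
    if "x \<in> Ar X" "Cod X x = To X (T2 X (Dom X f))"
    by (rule assoc_eq[OF *(1)] assoc_eq[OF *(2)]; use assms that in auto)+
qed

lemma ts_natural:
  assumes "f \<in> Ar X" "Cod X f = B"
  shows "Ta X f \<cdot> ts X (Dom X f) = ts X B \<cdot> T2a X f"
    "x \<in> Ar X \<Longrightarrow> Cod X x = T2 X (Dom X f) \<Longrightarrow> Ta X f \<cdot> ts X (Dom X f) \<cdot> x = ts X B \<cdot> T2a X f \<cdot> x"
proof -
  show *: "Ta X f \<cdot> ts X (Dom X f) = ts X B \<cdot> T2a X f"
    using total_nat_transD(5)[OF s_nat assms(1)] assms by simp
  show "Ta X f \<cdot> ts X (Dom X f) \<cdot> x = ts X B \<cdot> T2a X f \<cdot> x" if "x \<in> Ar X" "Cod X x = T2 X (Dom X f)"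
    by (rule assoc_eq[OF *]) (use assms that in auto)
qed

lemma c_c_x [simp]:
  "A \<in> Ob X \<Longrightarrow> x \<in> Ar X \<Longrightarrow> Cod X x = To X (To X A) \<Longrightarrow> tc X A \<cdot> tc X A \<cdot> x = x"
  using assoc_reduce[OF c_c, of A x] by simp

lemma Tp_c: "A \<in> Ob X \<Longrightarrow> Ta X (tp X A) \<cdot> tc X A = tp X (To X A)"
  using assoc_reduce[OF pT_c, of A "tc X A"] by (simp add: c_c)

lemma Tp_c_x [simp]:
  "A \<in> Ob X \<Longrightarrow> x \<in> Ar X \<Longrightarrow> Cod X x = To X (To X A) \<Longrightarrow> Ta X (tp X A) \<cdot> tc X A \<cdot> x = tp X (To X A) \<cdot> x"
  using assoc_reduce[OF Tp_c, of A x] by simp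

lemma pT_c_x [simp]:
  "A \<in> Ob X \<Longrightarrow> x \<in> Ar X \<Longrightarrow> Cod X x = To X (To X A) \<Longrightarrow> tp X (To X A) \<cdot> tc X A \<cdot> x = Ta X (tp X A) \<cdot> x"
  using assoc_reduce[OF pT_c, of A x] by simp

lemma Tp_Tq2 [simp]: "A \<in> Ob X \<Longrightarrow> Ta X (tp X A) \<cdot> Ta X (q2 X A) = Ta X (tp X A) \<cdot> Ta X (q1 X A)"
  using T_functorD(6)[of "q1 X A" "tp X A"] T_functorD(6)[of "q2 X A" "tp X A"] by simp

lemma T_cmp_cong:
  "f \<cdot> g = h \<Longrightarrow> f \<in> Ar X \<Longrightarrow> g \<in> Ar X \<Longrightarrow> Cod X g = Dom X f \<Longrightarrow> Ta X f \<cdot> Ta X g = Ta X h"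
  using T_functorD(6)[of g f] by simp

lemma c_z: "A \<in> Ob X \<Longrightarrow> tc X A \<cdot> tz X (To X A) = Ta X (tz X A)"
  using assoc_reduce[OF c_Tz, of A "Ide X (To X A)"] c_c_x[of A "Ta X (tz X A)"] by (simp add: c_Tz)

text \<open>The axioms for \<open>c\<close> with \<open>s\<close> and with \<open>l\<close>, solved for the other composite by means of \<open>c \<cdot> c = 1\<close>.\<close>

lemma l_c: "A \<in> Ob X \<Longrightarrow> tl X (To X A) \<cdot> tc X A = Ta X (tc X A) \<cdot> tc X (To X A) \<cdot> Ta X (tl X A)"
proof -
  assume A [simp]: "A \<in> Ob X"
  have cc: "Ta X (tc X A) \<cdot> Ta X (tc X A) \<cdot> x = x" if "x \<in> Ar X" "Cod X x = To X (To X (To X A))" for x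
    using assoc_reduce[of "Ta X (tc X A)" "Ta X (tc X A)" "Ide X (To X (To X (To X A)))" x] that
      T_functorD(6)[of "tc X A" "tc X A"] by (simp add: c_c del: T_functorD(6))
  have *: "tc X (To X A) \<cdot> Ta X (tc X A) \<cdot> tl X (To X A) \<cdot> x = Ta X (tl X A) \<cdot> tc X A \<cdot> x"
    if "x \<in> Ar X" "Cod X x = To X (To X A)" for x
    using assoc_eq[of "tc X (To X A)" "Ta X (tc X A) \<cdot> tl X (To X A)" "Ta X (tl X A)" "tc X A" x] that
    by (simp add: c_Tc_l)
  have "tl X (To X A) \<cdot> tc X A =
      Ta X (tc X A) \<cdot> tc X (To X A) \<cdot> tc X (To X A) \<cdot> Ta X (tc X A) \<cdot> tl X (To X A) \<cdot> tc X A"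
    by (simp add: cc)
  also have "\<dots> = Ta X (tc X A) \<cdot> tc X (To X A) \<cdot> Ta X (tl X A)"
    by (simp only: *[of "tc X A"] tc_typing A) (simp add: c_c)
  finally show ?thesis .
qed

lemma c_s:
  assumes [simp]: "A \<in> Ob X"
  shows "tc X A \<cdot> ts X (To X A) =
    Ta X (ts X A) \<cdot> pairTT2 X A (tc X A \<cdot> q1 X (To X A)) (tc X A \<cdot> q2 X (To X A))"
proof -
  let ?w = "pairTT2 X A (tc X A \<cdot> q1 X (To X A)) (tc X A \<cdot> q2 X (To X A))"
  let ?v = "pairT2 X (To X A) (tc X A \<cdot> Ta X (q1 X A)) (tc X A \<cdot> Ta X (q2 X A))"
  have "?v \<cdot> ?w = Ide X (T2 X (To X A))"
    by (rule T2_ext[where A = "To X A"]) simp_all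
  then have vw: "ts X (To X A) \<cdot> ?v \<cdot> ?w = ts X (To X A)"
    by simp
  have "tc X A \<cdot> ts X (To X A) = tc X A \<cdot> (tc X A \<cdot> Ta X (ts X A)) \<cdot> ?w"
    using vw by (simp add: c_Ts)
  also have "\<dots> = Ta X (ts X A) \<cdot> ?w"
    by simp
  finally show ?thesis .
qed

text \<open>Associativity of the addition holds for arbitrary triples of arrows in one fibre, since they
  factor through the threefold fibre power.\<close>

lemma s_assoc_triple:
  assumes A [simp]: "A \<in> Ob X"
    and u [simp]: "u \<in> Ar X" "Dom X u = Q" "Cod X u = To X A"
    and v [simp]: "v \<in> Ar X" "Dom X v = Q" "Cod X v = To X A"
    and w [simp]: "w \<in> Ar X" "Dom X w = Q" "Cod X w = To X A"
    and p [simp]: "tp X A \<cdot> u = tp X A \<cdot> w" "tp X A \<cdot> v = tp X A \<cdot> w"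
  shows "ts X A \<cdot> pairT2 X A (ts X A \<cdot> pairT2 X A u v) w =
    ts X A \<cdot> pairT2 X A u (ts X A \<cdot> pairT2 X A v w)"
proof -
  obtain P pr where "\<forall>m. fibre_power X 3 ((Ta X ^^ m) (tp X A)) ((To X ^^ m) P) (\<lambda>i. (Ta X ^^ m) (pr i))"
    using Tn_exists[of A 3] by auto
  from spec[OF this, of 0] have P: "fibre_power X 3 (tp X A) P pr"
    by simp
  obtain a b c where abc: "a = pr 0" "b = pr 1" "c = pr 2"
    by blast
  have [simp]: "Q \<in> Ob X"
    using dom_in_Ob[OF u(1)] by simp
  have "pr i \<in> Ar X \<and> Dom X (pr i) = P \<and> Cod X (pr i) = To X A" if "i < 3" for i
    using P that by (simp add: fibre_power_def in_Hom)
  then have [simp]: "a \<in> Ar X" "Dom X a = P" "Cod X a = To X A" "b \<in> Ar X" "Dom X b = P"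
    "Cod X b = To X A" "c \<in> Ar X" "Dom X c = P" "Cod X c = To X A"
    by (simp_all add: abc)
  have "\<forall>i<3. \<forall>j<3. tp X A \<cdot> pr i = tp X A \<cdot> pr j"
    using P unfolding fibre_power_def by (elim conjE)
  from this[rule_format, of 0 2] this[rule_format, of 1 2]
  have [simp]: "tp X A \<cdot> a = tp X A \<cdot> c" "tp X A \<cdot> b = tp X A \<cdot> c"
    by (simp_all add: abc)
  have "\<exists>h. h \<in> Hom X Q P \<and> a \<cdot> h = u \<and> b \<cdot> h = v \<and> c \<cdot> h = w"
  proof -
    let ?u = "\<lambda>i :: nat. if i = 0 then u else if i = 1 then v else w"
    have *: "\<forall>Q \<in> Ob X. \<forall>u. (\<forall>i<3. u i \<in> Hom X Q (Dom X (tp X A))) \<and>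
        (\<forall>i<3. \<forall>j<3. tp X A \<cdot> u i = tp X A \<cdot> u j) \<longrightarrow>
        (\<exists>!h. h \<in> Hom X Q P \<and> (\<forall>i<3. pr i \<cdot> h = u i))"
      using P unfolding fibre_power_def by (elim conjE)
    have "\<exists>!h. h \<in> Hom X Q P \<and> (\<forall>i<3. pr i \<cdot> h = ?u i)"
      by (rule *[rule_format]) (simp_all add: in_Hom)
    then obtain h where h: "h \<in> Hom X Q P" "\<forall>i<3. pr i \<cdot> h = ?u i"
      by blast
    show ?thesis
      using h(1) h(2)[rule_format, of 0] h(2)[rule_format, of 1] h(2)[rule_format, of 2]
      by (intro exI[of _ h]) (simp add: abc)
  qed
  then obtain h where h [simp]: "h \<in> Ar X" "Dom X h = Q" "Cod X h = P"
    and [simp]: "a \<cdot> h = u" "b \<cdot> h = v" "c \<cdot> h = w"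
    by (auto simp: in_Hom)
  have ps [simp]: "tp X A \<cdot> ts X A \<cdot> x = tp X A \<cdot> q1 X A \<cdot> x" if "x \<in> Ar X" "Cod X x = T2 X A" for x
    using assoc_eq[OF p_s, of A x] that by simp
  have [simp]: "pairT2 X A u v = pairT2 X A a b \<cdot> h" "pairT2 X A v w = pairT2 X A b c \<cdot> h"
    by (rule T2_ext[where A = A]; simp)+
  have "pairT2 X A (ts X A \<cdot> pairT2 X A a b \<cdot> h) w = pairT2 X A (ts X A \<cdot> pairT2 X A a b) c \<cdot> h"
    by (rule T2_ext[where A = A]) simp_all
  moreover have "pairT2 X A u (ts X A \<cdot> pairT2 X A b c \<cdot> h) = pairT2 X A a (ts X A \<cdot> pairT2 X A b c) \<cdot> h"
    by (rule T2_ext[where A = A]) simp_all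
  ultimately show ?thesis
    using s_assoc[OF A P, folded abc] assoc_eq[of "ts X A" "pairT2 X A (ts X A \<cdot> pairT2 X A a b) c"
        "ts X A" "pairT2 X A a (ts X A \<cdot> pairT2 X A b c)" h]
    by simp
qed

end

section \<open>Restriction terminal object and restriction products\<close>

context cartesian_tangent_split_restriction_category
begin

lemma one_in_Ob [simp]: "One X \<in> Ob X"
  using one_terminal by (simp add: restriction_terminal_def)

lemma terminal_bang:
  assumes U: "restriction_terminal X U" and "A \<in> Ob X"
  shows "bang X U A \<in> Ar X" "Dom X (bang X U A) = A" "Cod X (bang X U A) = U" "total X (bang X U A)"
proof -
  have "\<exists>!t. t \<in> Hom X A U \<and> total X t"
    using assms by (simp add: restriction_terminal_def)
  from theI'[OF this]
  show "bang X U A \<in> Ar X" "Dom X (bang X U A) = A" "Cod X (bang X U A) = U" "total X (bang X U A)"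
    by (simp_all add: bang_def in_Hom)
qed

lemma terminal_eq:
  assumes U: "restriction_terminal X U"
    and "f \<in> Ar X" "g \<in> Ar X" "total X f" "total X g" "Dom X f = Dom X g" "Cod X f = U" "Cod X g = U"
  shows "f = g"
proof -
  have "\<exists>!t. t \<in> Hom X (Dom X g) U \<and> total X t"
    using assms by (simp add: restriction_terminal_def)
  then show ?thesis
    using assms unfolding in_Hom by blast
qed

lemmas bang_one [simp] = terminal_bang[OF one_terminal]
lemmas bang_T_one [simp] = terminal_bang[OF T_one_terminal]
lemmas one_eq = terminal_eq[OF one_terminal]
lemmas T_one_eq = terminal_eq[OF T_one_terminal]

lemma bang_cmp [simp]:
  "f \<in> Ar X \<Longrightarrow> total X f \<Longrightarrow> Cod X f = A \<Longrightarrow> bang X (One X) A \<cdot> f = bang X (One X) (Dom X f)"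
  by (rule one_eq) auto

lemma one_ide [simp]: "bang X (One X) (One X) = Ide X (One X)"
  by (rule one_eq) auto

lemma prod_typing [simp]:
  assumes "A \<in> Ob X" "B \<in> Ob X"
  shows "Prd X A B \<in> Ob X"
    "pi1 X A B \<in> Ar X" "Dom X (pi1 X A B) = Prd X A B" "Cod X (pi1 X A B) = A" "total X (pi1 X A B)"
    "pi2 X A B \<in> Ar X" "Dom X (pi2 X A B) = Prd X A B" "Cod X (pi2 X A B) = B" "total X (pi2 X A B)"
  using productD[OF product[OF assms]] by simp_all

lemma prod_ext:
  assumes "pi1 X A B \<cdot> h = pi1 X A B \<cdot> h'" "pi2 X A B \<cdot> h = pi2 X A B \<cdot> h'" "A \<in> Ob X" "B \<in> Ob X"
    and "h \<in> Ar X" "h' \<in> Ar X" "Dom X h' = Dom X h" "Cod X h = Prd X A B" "Cod X h' = Prd X A B"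
  shows "h = h'"
  using assms by - (rule product_ext[OF product], simp_all)

lemma T_prod_ext:
  assumes "Ta X (pi1 X A B) \<cdot> h = Ta X (pi1 X A B) \<cdot> h'" "Ta X (pi2 X A B) \<cdot> h = Ta X (pi2 X A B) \<cdot> h'"
    and "A \<in> Ob X" "B \<in> Ob X"
    and "h \<in> Ar X" "h' \<in> Ar X" "Dom X h' = Dom X h"
    "Cod X h = To X (Prd X A B)" "Cod X h' = To X (Prd X A B)"
  shows "h = h'"
  using assms by - (rule product_ext[OF T_product], simp_all)

lemma rpair [simp]:
  assumes f: "f \<in> Ar X" and g: "g \<in> Ar X" and "Dom X g = Dom X f"
  shows "rpair X f g \<in> Ar X" "Dom X (rpair X f g) = Dom X f"
    "Cod X (rpair X f g) = Prd X (Cod X f) (Cod X g)"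
    and "Cod X f = A \<Longrightarrow> Cod X g = B \<Longrightarrow> pi1 X A B \<cdot> rpair X f g = f \<cdot> Rst X g"
    and "Cod X f = A \<Longrightarrow> Cod X g = B \<Longrightarrow> pi2 X A B \<cdot> rpair X f g = g \<cdot> Rst X f"
proof -
  let ?A = "Cod X f" and ?B = "Cod X g"
  have "rpair X f g \<in> Hom X (Dom X f) (Prd X ?A ?B) \<and>
      pi1 X ?A ?B \<cdot> rpair X f g = f \<cdot> Rst X g \<and> pi2 X ?A ?B \<cdot> rpair X f g = g \<cdot> Rst X f"
    unfolding rpair_def by (rule theI', rule product_ex1[OF product]) (simp_all add: assms)
  then show "rpair X f g \<in> Ar X" "Dom X (rpair X f g) = Dom X f"
    "Cod X (rpair X f g) = Prd X (Cod X f) (Cod X g)"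
    "Cod X f = A \<Longrightarrow> Cod X g = B \<Longrightarrow> pi1 X A B \<cdot> rpair X f g = f \<cdot> Rst X g"
    "Cod X f = A \<Longrightarrow> Cod X g = B \<Longrightarrow> pi2 X A B \<cdot> rpair X f g = g \<cdot> Rst X f"
    unfolding in_Hom by blast+
qed

lemma pi_rpair_x [simp]:
  assumes "f \<in> Ar X" "g \<in> Ar X" "Dom X g = Dom X f" "Cod X f = A" "Cod X g = B"
    and "x \<in> Ar X" "Cod X x = Dom X f"
  shows "pi1 X A B \<cdot> rpair X f g \<cdot> x = f \<cdot> Rst X g \<cdot> x" "pi2 X A B \<cdot> rpair X f g \<cdot> x = g \<cdot> Rst X f \<cdot> x"
  by (rule assoc_eq; use assms in auto)+

lemma T_pi_T_rpair [simp]: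
  assumes "f \<in> Ar X" "g \<in> Ar X" "Dom X g = Dom X f" "Cod X f = A" "Cod X g = B"
  shows "Ta X (pi1 X A B) \<cdot> Ta X (rpair X f g) = Ta X f \<cdot> Rst X (Ta X g)"
    "Ta X (pi2 X A B) \<cdot> Ta X (rpair X f g) = Ta X g \<cdot> Rst X (Ta X f)"
    and "x \<in> Ar X \<Longrightarrow> Cod X x = To X (Dom X f) \<Longrightarrow>
      Ta X (pi1 X A B) \<cdot> Ta X (rpair X f g) \<cdot> x = Ta X f \<cdot> Rst X (Ta X g) \<cdot> x"
    and "x \<in> Ar X \<Longrightarrow> Cod X x = To X (Dom X f) \<Longrightarrow>
      Ta X (pi2 X A B) \<cdot> Ta X (rpair X f g) \<cdot> x = Ta X g \<cdot> Rst X (Ta X f) \<cdot> x"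
proof -
  show *: "Ta X (pi1 X A B) \<cdot> Ta X (rpair X f g) = Ta X f \<cdot> Rst X (Ta X g)"
    "Ta X (pi2 X A B) \<cdot> Ta X (rpair X f g) = Ta X g \<cdot> Rst X (Ta X f)"
    using T_functorD(6)[of "rpair X f g" "pi1 X A B"] T_functorD(6)[of "rpair X f g" "pi2 X A B"] assms
    by auto
  show "Ta X (pi1 X A B) \<cdot> Ta X (rpair X f g) \<cdot> x = Ta X f \<cdot> Rst X (Ta X g) \<cdot> x"
    "Ta X (pi2 X A B) \<cdot> Ta X (rpair X f g) \<cdot> x = Ta X g \<cdot> Rst X (Ta X f) \<cdot> x"
    if "x \<in> Ar X" "Cod X x = To X (Dom X f)"
    by (rule assoc_eq[OF *(1)] assoc_eq[OF *(2)]; use assms that in auto)+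
qed

lemma rst_rpair [simp]:
  assumes "f \<in> Ar X" "g \<in> Ar X" "Dom X g = Dom X f"
  shows "Rst X (rpair X f g) = Rst X f \<cdot> Rst X g"
proof -
  have "Rst X (rpair X f g) = Rst X (pi1 X (Cod X f) (Cod X g) \<cdot> rpair X f g)"
    using assms by (subst rst_total_cmp) simp_all
  also have "\<dots> = Rst X (f \<cdot> Rst X g)"
    using assms by simp
  finally show ?thesis
    using assms by simp
qed

lemma total_rpair [simp]:
  "f \<in> Ar X \<Longrightarrow> g \<in> Ar X \<Longrightarrow> Dom X g = Dom X f \<Longrightarrow> total X f \<Longrightarrow> total X g \<Longrightarrow> total X (rpair X f g)"
  unfolding total_def[of X "rpair X f g"] by simp

text \<open>Since \<open>\<langle>f, g\<rangle>\<close> is defined where both components are, precomposition with a partial map \<open>x\<close> is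
  compatible with pairing by the slide axiom for restrictions.\<close>

lemma rpair_cmp:
  assumes "f \<in> Ar X" "g \<in> Ar X" "Dom X g = Dom X f" "x \<in> Ar X" "Cod X x = Dom X f"
  shows "rpair X f g \<cdot> x = rpair X (f \<cdot> x) (g \<cdot> x)"
proof -
  have "Rst X g \<cdot> x = x \<cdot> Rst X (g \<cdot> x)" "Rst X f \<cdot> x = x \<cdot> Rst X (f \<cdot> x)"
    using assms by (auto intro!: rst_slide')
  then show ?thesis
    using assms by - (rule prod_ext[where A = "Cod X f" and B = "Cod X g"], simp_all)
qed

lemma prod_arr [simp]:
  assumes "f \<in> Ar X" "g \<in> Ar X"
  shows "prod_arr X f g \<in> Ar X" "Dom X (prod_arr X f g) = Prd X (Dom X f) (Dom X g)"
    "Cod X (prod_arr X f g) = Prd X (Cod X f) (Cod X g)"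
    and "Cod X f = A \<Longrightarrow> Cod X g = B \<Longrightarrow> pi1 X A B \<cdot> prod_arr X f g =
      f \<cdot> pi1 X (Dom X f) (Dom X g) \<cdot> Rst X (g \<cdot> pi2 X (Dom X f) (Dom X g))"
    and "Cod X f = A \<Longrightarrow> Cod X g = B \<Longrightarrow> pi2 X A B \<cdot> prod_arr X f g =
      g \<cdot> pi2 X (Dom X f) (Dom X g) \<cdot> Rst X (f \<cdot> pi1 X (Dom X f) (Dom X g))"
    and "Rst X (prod_arr X f g) =
      Rst X (f \<cdot> pi1 X (Dom X f) (Dom X g)) \<cdot> Rst X (g \<cdot> pi2 X (Dom X f) (Dom X g))"
    and "total X f \<Longrightarrow> total X g \<Longrightarrow> total X (prod_arr X f g)"
  unfolding prod_arr_def using assms by auto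

lemma pi_prod_arr_x [simp]:
  assumes "f \<in> Ar X" "g \<in> Ar X" "Cod X f = A" "Cod X g = B"
    and "x \<in> Ar X" "Cod X x = Prd X (Dom X f) (Dom X g)"
  shows "pi1 X A B \<cdot> prod_arr X f g \<cdot> x =
      f \<cdot> pi1 X (Dom X f) (Dom X g) \<cdot> Rst X (g \<cdot> pi2 X (Dom X f) (Dom X g)) \<cdot> x"
    "pi2 X A B \<cdot> prod_arr X f g \<cdot> x =
      g \<cdot> pi2 X (Dom X f) (Dom X g) \<cdot> Rst X (f \<cdot> pi1 X (Dom X f) (Dom X g)) \<cdot> x"
  using assoc_reduce[of "pi1 X A B" "prod_arr X f g" _ x] assoc_reduce[of "pi2 X A B" "prod_arr X f g" _ x] assms
  by auto

text \<open>The product of arrows is functorial on partial maps as well.  The two sides of the equation are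
  pairs whose components differ only by restrictions, which are absorbed by the domain of
  definition of the other component.\<close>

lemma prod_arr_cmp:
  assumes fg: "f \<in> Ar X" "g \<in> Ar X" "f' \<in> Ar X" "g' \<in> Ar X" "Dom X f' = Cod X f" "Dom X g' = Cod X g"
  shows "prod_arr X f' g' \<cdot> prod_arr X f g = prod_arr X (f' \<cdot> f) (g' \<cdot> g)"
proof -
  let ?A = "Dom X f" and ?B = "Dom X g"
  let ?a = "f \<cdot> pi1 X ?A ?B" and ?b = "g \<cdot> pi2 X ?A ?B"
  let ?p = "rpair X ?a ?b"
  have ab: "?a \<in> Ar X" "?b \<in> Ar X" "Dom X ?a = Prd X ?A ?B" "Dom X ?b = Prd X ?A ?B"
      "Cod X ?a = Cod X f" "Cod X ?b = Cod X g"
    using fg by simp_all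
  \<comment> \<open>the two pairs differ only by restricting each component to the domain of the other\<close>
  have restr: "rpair X (f' \<cdot> a \<cdot> Rst X b) (g' \<cdot> b \<cdot> Rst X a) = rpair X (f' \<cdot> a) (g' \<cdot> b)"
    if [simp]: "a \<in> Ar X" "b \<in> Ar X" "Dom X b = Dom X a" "Cod X a = Dom X f'" "Cod X b = Dom X g'" for a b
  proof -
    have 1: "Rst X (f' \<cdot> a \<cdot> Rst X b) = Rst X (f' \<cdot> a) \<cdot> Rst X b"
      using rst_cmp_own_rst[of b "f' \<cdot> a"] fg by simp
    have 2: "Rst X (g' \<cdot> b \<cdot> Rst X a) = Rst X (g' \<cdot> b) \<cdot> Rst X a"
      using rst_cmp_own_rst[of a "g' \<cdot> b"] fg by simp
    have A: "Rst X a \<cdot> Rst X (f' \<cdot> a) = Rst X (f' \<cdot> a)" "Rst X (f' \<cdot> a) \<cdot> Rst X a = Rst X (f' \<cdot> a)"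
      using rst_absorb[of a f'] rst_comm[of a "f' \<cdot> a"] fg by simp_all
    have B: "Rst X b \<cdot> Rst X (g' \<cdot> b) = Rst X (g' \<cdot> b)" "Rst X (g' \<cdot> b) \<cdot> Rst X b = Rst X (g' \<cdot> b)"
      using rst_absorb[of b g'] rst_comm[of b "g' \<cdot> b"] fg by simp_all
    have "(f' \<cdot> a \<cdot> Rst X b) \<cdot> Rst X (g' \<cdot> b) \<cdot> Rst X a = f' \<cdot> a \<cdot> Rst X (g' \<cdot> b) \<cdot> Rst X a"
      using fg assoc_reduce[OF B(1), of "Rst X a"] by simp
    also have "\<dots> = f' \<cdot> a \<cdot> Rst X a \<cdot> Rst X (g' \<cdot> b)"
      using fg rst_comm[of "g' \<cdot> b" a] by simp
    also have "\<dots> = (f' \<cdot> a) \<cdot> Rst X (g' \<cdot> b)"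
      using fg assoc_reduce[OF cmp_own_rst, of a "Rst X (g' \<cdot> b)"] by simp
    finally have L: "(f' \<cdot> a \<cdot> Rst X b) \<cdot> Rst X (g' \<cdot> b) \<cdot> Rst X a = (f' \<cdot> a) \<cdot> Rst X (g' \<cdot> b)" .
    have "(g' \<cdot> b \<cdot> Rst X a) \<cdot> Rst X (f' \<cdot> a) \<cdot> Rst X b = g' \<cdot> b \<cdot> Rst X (f' \<cdot> a) \<cdot> Rst X b"
      using fg assoc_reduce[OF A(1), of "Rst X b"] by simp
    also have "\<dots> = g' \<cdot> b \<cdot> Rst X b \<cdot> Rst X (f' \<cdot> a)"
      using fg rst_comm[of "f' \<cdot> a" b] by simp
    also have "\<dots> = (g' \<cdot> b) \<cdot> Rst X (f' \<cdot> a)"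
      using fg assoc_reduce[OF cmp_own_rst, of b "Rst X (f' \<cdot> a)"] by simp
    finally have R: "(g' \<cdot> b \<cdot> Rst X a) \<cdot> Rst X (f' \<cdot> a) \<cdot> Rst X b = (g' \<cdot> b) \<cdot> Rst X (f' \<cdot> a)" .
    show ?thesis
    proof (rule prod_ext[where A = "Cod X f'" and B = "Cod X g'"])
      let ?P = "rpair X (f' \<cdot> a \<cdot> Rst X b) (g' \<cdot> b \<cdot> Rst X a)"
      have "pi1 X (Cod X f') (Cod X g') \<cdot> ?P = (f' \<cdot> a \<cdot> Rst X b) \<cdot> Rst X (g' \<cdot> b \<cdot> Rst X a)"
        by (rule rpair(4)) (use fg in simp_all)
      also have "\<dots> = (f' \<cdot> a) \<cdot> Rst X (g' \<cdot> b)"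
        unfolding 2 by (fact L)
      also have "\<dots> = pi1 X (Cod X f') (Cod X g') \<cdot> rpair X (f' \<cdot> a) (g' \<cdot> b)"
        by (rule rpair(4)[symmetric]) (use fg in simp_all)
      finally show "pi1 X (Cod X f') (Cod X g') \<cdot> ?P = pi1 X (Cod X f') (Cod X g') \<cdot> rpair X (f' \<cdot> a) (g' \<cdot> b)" .
      have "pi2 X (Cod X f') (Cod X g') \<cdot> ?P = (g' \<cdot> b \<cdot> Rst X a) \<cdot> Rst X (f' \<cdot> a \<cdot> Rst X b)"
        by (rule rpair(5)) (use fg in simp_all)
      also have "\<dots> = (g' \<cdot> b) \<cdot> Rst X (f' \<cdot> a)"
        unfolding 1 by (fact R)
      also have "\<dots> = pi2 X (Cod X f') (Cod X g') \<cdot> rpair X (f' \<cdot> a) (g' \<cdot> b)"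
        by (rule rpair(5)[symmetric]) (use fg in simp_all)
      finally show "pi2 X (Cod X f') (Cod X g') \<cdot> ?P = pi2 X (Cod X f') (Cod X g') \<cdot> rpair X (f' \<cdot> a) (g' \<cdot> b)" .
    qed (use fg in simp_all)
  qed
  have "prod_arr X f' g' \<cdot> ?p = rpair X (f' \<cdot> ?a \<cdot> Rst X ?b) (g' \<cdot> ?b \<cdot> Rst X ?a)"
    unfolding prod_arr_def using fg ab by (subst rpair_cmp) (simp_all add: rpair_cmp del: rst_total_cmp)
  also have "\<dots> = rpair X (f' \<cdot> ?a) (g' \<cdot> ?b)"
    using ab fg by (intro restr) simp_all
  finally show ?thesis
    using fg by (simp add: prod_arr_def)
qed

lemma pairTprod [simp]:
  assumes "a \<in> Ar X" "b \<in> Ar X" "Dom X b = Dom X a" "A \<in> Ob X" "B \<in> Ob X" "Cod X a = To X A"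
    "Cod X b = To X B" "Rst X a = Rst X b"
  shows "pairTprod X A B a b \<in> Ar X" "Dom X (pairTprod X A B a b) = Dom X a"
    "Cod X (pairTprod X A B a b) = To X (Prd X A B)"
    "Ta X (pi1 X A B) \<cdot> pairTprod X A B a b = a" "Ta X (pi2 X A B) \<cdot> pairTprod X A B a b = b"
    and "x \<in> Ar X \<Longrightarrow> Cod X x = Dom X a \<Longrightarrow> Ta X (pi1 X A B) \<cdot> pairTprod X A B a b \<cdot> x = a \<cdot> x"
    and "x \<in> Ar X \<Longrightarrow> Cod X x = Dom X a \<Longrightarrow> Ta X (pi2 X A B) \<cdot> pairTprod X A B a b \<cdot> x = b \<cdot> x"
    and "total X a \<Longrightarrow> total X (pairTprod X A B a b)"
proof -
  note * = product_pairing[OF T_product[OF assms(4,5)] assms(1-3,6-8), folded pairTprod_def]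
  show "pairTprod X A B a b \<in> Ar X" "Dom X (pairTprod X A B a b) = Dom X a"
    "Cod X (pairTprod X A B a b) = To X (Prd X A B)"
    "Ta X (pi1 X A B) \<cdot> pairTprod X A B a b = a" "Ta X (pi2 X A B) \<cdot> pairTprod X A B a b = b"
    by (fact *)+
  show "Ta X (pi1 X A B) \<cdot> pairTprod X A B a b \<cdot> x = a \<cdot> x"
    "Ta X (pi2 X A B) \<cdot> pairTprod X A B a b \<cdot> x = b \<cdot> x" if "x \<in> Ar X" "Cod X x = Dom X a"
    by (rule assoc_reduce; use * assms(1-7) that in simp)+
  show "total X (pairTprod X A B a b)" if "total X a"
    by (rule total_cancel[where g = "Ta X (pi1 X A B)"]) (use * that assms in simp_all)
qed

lemma total_of_pi1:
  "h \<in> Ar X \<Longrightarrow> Cod X h = Dom X u \<Longrightarrow> u \<in> Ar X \<Longrightarrow> u \<cdot> h = f \<Longrightarrow> total X f \<Longrightarrow> total X h"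
  using total_cancel[of h u] by simp

lemma in_Hom_Tot: "f \<in> Hom (Tot X) A B \<longleftrightarrow> f \<in> Ar X \<and> Dom X f = A \<and> Cod X f = B \<and> total X f"
  by (auto simp: Hom_def Tot_def)

lemma Tot_simps:
  "Ob (Tot X) = Ob X" "Dom (Tot X) = Dom X" "Cod (Tot X) = Cod X" "Ide (Tot X) = Ide X"
  "Cmp (Tot X) = Cmp X" "Rst (Tot X) = Rst X" "To (Tot X) = To X" "Ta (Tot X) = Ta X"
  "q1 (Tot X) = q1 X" "q2 (Tot X) = q2 X" "tp (Tot X) = tp X" "tz (Tot X) = tz X" "ts (Tot X) = ts X"
  "tl (Tot X) = tl X" "One (Tot X) = One X" "Prd (Tot X) = Prd X" "pi1 (Tot X) = pi1 X" "pi2 (Tot X) = pi2 X"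
  by (simp_all add: Tot_def)

text \<open>Objects with the same universal property are isomorphic, and restriction products can be transported
  along isomorphisms.  Invertibility of the comparison map is preserved by every functor and does not
  mention partial maps.\<close>

lemma product_transport_iff:
  assumes AB: "A \<in> Ob X" "B \<in> Ob X"
  shows "restriction_product X A B P u v \<longleftrightarrow> P \<in> Ob X \<and>
    u \<in> Ar X \<and> Dom X u = P \<and> Cod X u = A \<and> total X u \<and> v \<in> Ar X \<and> Dom X v = P \<and> Cod X v = B \<and> total X v \<and>
    (\<exists>j. j \<in> Ar X \<and> Dom X j = Prd X A B \<and> Cod X j = P \<and> rpair X u v \<cdot> j = Ide X (Prd X A B) \<and>
      j \<cdot> rpair X u v = Ide X P)" (is "?L \<longleftrightarrow> ?R")
proof
  assume P: ?L
  note [simp] = productD[OF P] AB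
  let ?j = "pairing X P u v (pi1 X A B) (pi2 X A B)"
  note [simp] = product_pairing[OF P, of "pi1 X A B" "pi2 X A B", simplified]
  have [simp]: "u \<cdot> ?j \<cdot> x = pi1 X A B \<cdot> x" "v \<cdot> ?j \<cdot> x = pi2 X A B \<cdot> x" if "x \<in> Ar X" "Cod X x = Prd X A B" for x
    by (rule assoc_reduce; use that in simp)+
  have "total X ?j"
    by (rule total_of_pi1[where u = u and f = "pi1 X A B"]) simp_all
  then have "rpair X u v \<cdot> ?j = Ide X (Prd X A B)"
    by - (rule prod_ext[where A = A and B = B], simp_all)
  moreover have "?j \<cdot> rpair X u v = Ide X P"
    by (rule product_ext[OF P]) simp_all
  ultimately show ?R
    by (intro conjI exI[of _ ?j]) simp_all
next
  assume R: ?R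
  then obtain j where [simp]: "P \<in> Ob X" "u \<in> Ar X" "Dom X u = P" "Cod X u = A" "total X u"
      "v \<in> Ar X" "Dom X v = P" "Cod X v = B" "total X v"
    and j: "j \<in> Ar X" "Dom X j = Prd X A B" "Cod X j = P" "rpair X u v \<cdot> j = Ide X (Prd X A B)"
      "j \<cdot> rpair X u v = Ide X P"
    by auto
  have "restriction_product X A B P (pi1 X A B \<cdot> rpair X u v) (pi2 X A B \<cdot> rpair X u v)"
    by (rule product_transport[OF product[OF AB] _ _ _ j(1-3)]) (simp_all add: AB j)
  then show ?L
    by (simp add: AB)
qed

text \<open>The universal property for total maps already implies the one for partial maps: it makes the
  comparison with the chosen restriction product invertible.\<close>

lemma is_product_Tot_iff:
  assumes AB [simp]: "A \<in> Ob X" "B \<in> Ob X"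
  shows "is_product (Tot X) A B P u v \<longleftrightarrow> restriction_product X A B P u v"
proof
  assume P: "is_product (Tot X) A B P u v"
  have [simp]: "P \<in> Ob X" "u \<in> Ar X" "Dom X u = P" "Cod X u = A" "total X u"
      "v \<in> Ar X" "Dom X v = P" "Cod X v = B" "total X v"
    using P unfolding is_product_def in_Hom_Tot Tot_simps by blast+
  have "\<forall>Q. \<forall>f \<in> Hom (Tot X) Q A. \<forall>g \<in> Hom (Tot X) Q B.
      \<exists>!h. h \<in> Hom (Tot X) Q P \<and> u \<cdot> h = f \<and> v \<cdot> h = g"
    using P unfolding is_product_def Tot_simps by (elim conjE)
  note univ = this[rule_format]
  obtain j where j [simp]: "j \<in> Ar X" "Dom X j = Prd X A B" "Cod X j = P" "total X j"
      "u \<cdot> j = pi1 X A B" "v \<cdot> j = pi2 X A B"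
    using univ[of "pi1 X A B" "Prd X A B" "pi2 X A B"] unfolding in_Hom_Tot by auto
  have "\<exists>!h. h \<in> Hom (Tot X) P P \<and> u \<cdot> h = u \<and> v \<cdot> h = v"
    by (rule univ) (simp_all add: in_Hom_Tot)
  then have uniq: "h = h'" if "h \<in> Hom (Tot X) P P" "u \<cdot> h = u" "v \<cdot> h = v"
      "h' \<in> Hom (Tot X) P P" "u \<cdot> h' = u" "v \<cdot> h' = v" for h h'
    using that by blast
  have [simp]: "u \<cdot> j \<cdot> x = pi1 X A B \<cdot> x" "v \<cdot> j \<cdot> x = pi2 X A B \<cdot> x"
    if "x \<in> Ar X" "Cod X x = Prd X A B" for x
    by (rule assoc_reduce; use that in simp)+
  have "j \<cdot> rpair X u v = Ide X P"
    by (rule uniq) (simp_all add: in_Hom_Tot)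
  moreover have "rpair X u v \<cdot> j = Ide X (Prd X A B)"
    by (rule prod_ext[where A = A and B = B]) simp_all
  ultimately show "restriction_product X A B P u v"
    by (subst product_transport_iff) (auto intro!: exI[of _ j])
next
  assume P: "restriction_product X A B P u v"
  note [simp] = productD[OF P]
  have "\<exists>!h. h \<in> Hom (Tot X) Q P \<and> u \<cdot> h = f \<and> v \<cdot> h = g"
    if "f \<in> Hom (Tot X) Q A" "g \<in> Hom (Tot X) Q B" for Q f g
  proof -
    have [simp]: "f \<in> Ar X" "Dom X f = Q" "Cod X f = A" "total X f"
        "g \<in> Ar X" "Dom X g = Q" "Cod X g = B" "total X g"
      using that by (simp_all add: in_Hom_Tot)
    have "\<exists>!h. h \<in> Hom X (Dom X f) P \<and> u \<cdot> h = f \<cdot> Rst X g \<and> v \<cdot> h = g \<cdot> Rst X f"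
      by (rule product_ex1[OF P]) simp_all
    moreover have "h \<in> Hom (Tot X) Q P \<and> u \<cdot> h = f \<and> v \<cdot> h = g \<longleftrightarrow>
        h \<in> Hom X (Dom X f) P \<and> u \<cdot> h = f \<cdot> Rst X g \<and> v \<cdot> h = g \<cdot> Rst X f" for h
      using total_of_pi1[of h u f] by (auto simp: in_Hom_Tot in_Hom)
    ultimately show ?thesis
      by simp
  qed
  then have "\<forall>Q. \<forall>f \<in> Hom (Tot X) Q A. \<forall>g \<in> Hom (Tot X) Q B.
      \<exists>!h. h \<in> Hom (Tot X) Q P \<and> u \<cdot> h = f \<and> v \<cdot> h = g"
    by blast
  then show "is_product (Tot X) A B P u v"
    unfolding is_product_def Tot_simps by (intro conjI) (simp_all add: in_Hom_Tot)
qed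

text \<open>\<open>T\<close> preserves the chosen restriction products, and it preserves the isomorphism of any other one
  with the chosen one.\<close>

lemma T_preserves_product:
  assumes P: "restriction_product X A B P u v" and AB [simp]: "A \<in> Ob X" "B \<in> Ob X"
  shows "restriction_product X (To X A) (To X B) (To X P) (Ta X u) (Ta X v)"
proof -
  note [simp] = productD[OF P]
  obtain j where [simp]: "j \<in> Ar X" "Dom X j = Prd X A B" "Cod X j = P"
    and j: "rpair X u v \<cdot> j = Ide X (Prd X A B)" "j \<cdot> rpair X u v = Ide X P"
    using P by (subst (asm) product_transport_iff) auto
  have "restriction_product X (To X A) (To X B) (To X P)
      (Ta X (pi1 X A B) \<cdot> Ta X (rpair X u v)) (Ta X (pi2 X A B) \<cdot> Ta X (rpair X u v))"
    by (rule product_transport[OF T_product, where j = "Ta X j"])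
      (use T_functorD(6)[of j "rpair X u v"] T_functorD(6)[of "rpair X u v" j] in \<open>simp_all add: j\<close>)
  then show ?thesis
    by simp
qed

lemma bang_Tot: "bang (Tot X) U A = bang X U A"
proof -
  have "t \<in> Hom (Tot X) A U \<and> total (Tot X) t \<longleftrightarrow> t \<in> Hom X A U \<and> total X t" for t
    unfolding in_Hom_Tot in_Hom total_def[of "Tot X"] total_def[of X] Tot_simps by blast
  then show ?thesis
    unfolding bang_def by simp
qed

lemma rpair_Tot:
  assumes fg: "f \<in> Ar X" "g \<in> Ar X" "Dom X g = Dom X f" "total X f" "total X g"
  shows "rpair (Tot X) f g = rpair X f g"
proof -
  let ?A = "Cod X f" and ?B = "Cod X g"
  have "h \<in> Hom X (Dom X f) (Prd X ?A ?B) \<and> pi1 X ?A ?B \<cdot> h = f \<and> pi2 X ?A ?B \<cdot> h = g \<longleftrightarrow>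
      h \<in> Hom (Tot X) (Dom X f) (Prd X ?A ?B) \<and> pi1 X ?A ?B \<cdot> h = f \<and> pi2 X ?A ?B \<cdot> h = g" for h
    using fg total_of_pi1[of h "pi1 X ?A ?B" f] by (auto simp: in_Hom_Tot in_Hom)
  then show ?thesis
    unfolding rpair_def Tot_simps using fg by simp
qed

end

section \<open>Differential objects in terms of the ambient category\<close>

context cartesian_tangent_split_restriction_category
begin

text \<open>The typing conditions and the equations of a differential object of the category of total maps,
  with pairings and terminal maps taken in \<open>X\<close>.  They are separated from the product diagram because
  they are reflected by jointly monic families, and the product diagram is not.\<close>

definition dob_typed :: "('o, 'a) dobj \<Rightarrow> bool" where
  "dob_typed D \<longleftrightarrow> dob D \<in> Ob X \<and>
    dzero D \<in> Ar X \<and> Dom X (dzero D) = One X \<and> Cod X (dzero D) = dob D \<and> total X (dzero D) \<and>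
    dadd D \<in> Ar X \<and> Dom X (dadd D) = Prd X (dob D) (dob D) \<and> Cod X (dadd D) = dob D \<and> total X (dadd D) \<and>
    dproj D \<in> Ar X \<and> Dom X (dproj D) = To X (dob D) \<and> Cod X (dproj D) = dob D \<and> total X (dproj D)"

definition dob_equations :: "('o, 'a) dobj \<Rightarrow> bool" where
  "dob_equations D \<longleftrightarrow>
    (let A = dob D; \<zeta> = dzero D; \<sigma> = dadd D; ph = dproj D;
         \<pi>1 = pi1 X A A; \<pi>2 = pi2 X A A; AA = Prd X A A
     in \<sigma> \<cdot> rpair X (\<zeta> \<cdot> bang X (One X) A) (Ide X A) = Ide X A \<and>
        \<sigma> \<cdot> rpair X \<pi>2 \<pi>1 = \<sigma> \<and>
        \<sigma> \<cdot> rpair X (\<sigma> \<cdot> pi1 X AA A) (pi2 X AA A) =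
          \<sigma> \<cdot> rpair X (\<pi>1 \<cdot> pi1 X AA A) (\<sigma> \<cdot> rpair X (\<pi>2 \<cdot> pi1 X AA A) (pi2 X AA A)) \<and>
        ph \<cdot> Ta X \<zeta> = \<zeta> \<cdot> bang X (One X) (To X (One X)) \<and>
        ph \<cdot> Ta X \<sigma> = \<sigma> \<cdot> rpair X (ph \<cdot> Ta X \<pi>1) (ph \<cdot> Ta X \<pi>2) \<and>
        ph \<cdot> tz X A = \<zeta> \<cdot> bang X (One X) A \<and>
        ph \<cdot> ts X A = \<sigma> \<cdot> rpair X (ph \<cdot> q1 X A) (ph \<cdot> q2 X A) \<and>
        ph \<cdot> Ta X ph \<cdot> tl X A = ph)"

abbreviation "dobj D \<equiv> differential_object (Tot X) D"

lemma dob_typed [simp]: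
  assumes "dob_typed D"
  shows "dob D \<in> Ob X"
    "dzero D \<in> Ar X" "Dom X (dzero D) = One X" "Cod X (dzero D) = dob D" "total X (dzero D)"
    "dadd D \<in> Ar X" "Dom X (dadd D) = Prd X (dob D) (dob D)" "Cod X (dadd D) = dob D" "total X (dadd D)"
    "dproj D \<in> Ar X" "Dom X (dproj D) = To X (dob D)" "Cod X (dproj D) = dob D" "total X (dproj D)"
  using assms by (simp_all add: dob_typed_def)

lemma dobj_iff_Tot:
  "dobj D \<longleftrightarrow> dob_typed D \<and> dob_equations D \<and>
    is_product (Tot X) (dob D) (dob D) (To X (dob D)) (tp X (dob D)) (dproj D)"
proof (cases "dob_typed D")
  case [simp]: True
  show ?thesis
    unfolding differential_object_def dob_equations_def Let_def Tot_simps in_Hom_Tot bang_Tot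
    by (simp add: rpair_Tot)
next
  case False
  then show ?thesis
    unfolding dob_typed_def differential_object_def Let_def Tot_simps in_Hom_Tot by blast
qed

lemma dobj_iff:
  "dobj D \<longleftrightarrow> dob_typed D \<and> dob_equations D \<and>
    restriction_product X (dob D) (dob D) (To X (dob D)) (tp X (dob D)) (dproj D)"
  using is_product_Tot_iff[of "dob D" "dob D"] dob_typed(1)[of D] by (auto simp: dobj_iff_Tot)

lemma dobj_typed [simp]: "dobj D \<Longrightarrow> dob_typed D"
  by (simp add: dobj_iff)

lemma dobj_product: "dobj D \<Longrightarrow> restriction_product X (dob D) (dob D) (To X (dob D)) (tp X (dob D)) (dproj D)"
  by (simp add: dobj_iff)

lemma dobj_equations:
  assumes "dobj D"
  shows "dadd D \<cdot> rpair X (dzero D \<cdot> bang X (One X) (dob D)) (Ide X (dob D)) = Ide X (dob D)"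
    and "dadd D \<cdot> rpair X (pi2 X (dob D) (dob D)) (pi1 X (dob D) (dob D)) = dadd D"
    and "dadd D \<cdot> rpair X (dadd D \<cdot> pi1 X (Prd X (dob D) (dob D)) (dob D)) (pi2 X (Prd X (dob D) (dob D)) (dob D)) =
      dadd D \<cdot> rpair X (pi1 X (dob D) (dob D) \<cdot> pi1 X (Prd X (dob D) (dob D)) (dob D))
        (dadd D \<cdot> rpair X (pi2 X (dob D) (dob D) \<cdot> pi1 X (Prd X (dob D) (dob D)) (dob D))
          (pi2 X (Prd X (dob D) (dob D)) (dob D)))"
    and "dproj D \<cdot> Ta X (dzero D) = dzero D \<cdot> bang X (One X) (To X (One X))"
    and "dproj D \<cdot> Ta X (dadd D) =
      dadd D \<cdot> rpair X (dproj D \<cdot> Ta X (pi1 X (dob D) (dob D))) (dproj D \<cdot> Ta X (pi2 X (dob D) (dob D)))"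
    and "dproj D \<cdot> tz X (dob D) = dzero D \<cdot> bang X (One X) (dob D)"
    and "dproj D \<cdot> ts X (dob D) = dadd D \<cdot> rpair X (dproj D \<cdot> q1 X (dob D)) (dproj D \<cdot> q2 X (dob D))"
    and "dproj D \<cdot> Ta X (dproj D) \<cdot> tl X (dob D) = dproj D"
  using assms unfolding dobj_iff dob_equations_def Let_def by blast+

text \<open>The same equations on generalised elements, that is, precomposed with total maps.\<close>

lemma zero_add:
  "dobj D \<Longrightarrow> a \<in> Ar X \<Longrightarrow> Cod X a = dob D \<Longrightarrow> total X a \<Longrightarrow> Q = Dom X a \<Longrightarrow>
    dadd D \<cdot> rpair X (dzero D \<cdot> bang X (One X) Q) a = a"
  using assoc_reduce[OF dobj_equations(1), of D a] by (simp add: rpair_cmp)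

lemma add_commute:
  "dobj D \<Longrightarrow> a \<in> Ar X \<Longrightarrow> b \<in> Ar X \<Longrightarrow> Dom X b = Dom X a \<Longrightarrow> Cod X a = dob D \<Longrightarrow> Cod X b = dob D \<Longrightarrow>
    total X a \<Longrightarrow> total X b \<Longrightarrow> dadd D \<cdot> rpair X a b = dadd D \<cdot> rpair X b a"
  using assoc_reduce[OF dobj_equations(2), of D "rpair X b a"] by (simp add: rpair_cmp)

lemma add_assoc:
  "dobj D \<Longrightarrow> a \<in> Ar X \<Longrightarrow> b \<in> Ar X \<Longrightarrow> c \<in> Ar X \<Longrightarrow> Dom X b = Dom X a \<Longrightarrow> Dom X c = Dom X a \<Longrightarrow>
    Cod X a = dob D \<Longrightarrow> Cod X b = dob D \<Longrightarrow> Cod X c = dob D \<Longrightarrow> total X a \<Longrightarrow> total X b \<Longrightarrow> total X c \<Longrightarrow>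
    dadd D \<cdot> rpair X (dadd D \<cdot> rpair X a b) c = dadd D \<cdot> rpair X a (dadd D \<cdot> rpair X b c)"
  using assoc_eq[OF dobj_equations(3), of D "rpair X (rpair X a b) c"] by (simp add: rpair_cmp)

lemma proj_T_zero:
  "dobj D \<Longrightarrow> x \<in> Ar X \<Longrightarrow> Cod X x = To X (One X) \<Longrightarrow> total X x \<Longrightarrow>
    dproj D \<cdot> Ta X (dzero D) \<cdot> x = dzero D \<cdot> bang X (One X) (Dom X x)"
  using assoc_eq[OF dobj_equations(4), of D x] by simp

lemma proj_T_add:
  "dobj D \<Longrightarrow> x \<in> Ar X \<Longrightarrow> Cod X x = To X (Prd X (dob D) (dob D)) \<Longrightarrow> total X x \<Longrightarrow>
    dproj D \<cdot> Ta X (dadd D) \<cdot> x = dadd D \<cdot>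
      rpair X (dproj D \<cdot> Ta X (pi1 X (dob D) (dob D)) \<cdot> x) (dproj D \<cdot> Ta X (pi2 X (dob D) (dob D)) \<cdot> x)"
  using assoc_eq[OF dobj_equations(5), of D x] by (simp add: rpair_cmp)

lemma proj_z:
  "dobj D \<Longrightarrow> x \<in> Ar X \<Longrightarrow> Cod X x = dob D \<Longrightarrow> total X x \<Longrightarrow> A = dob D \<Longrightarrow>
    dproj D \<cdot> tz X A \<cdot> x = dzero D \<cdot> bang X (One X) (Dom X x)"
  using assoc_eq[OF dobj_equations(6), of D x] by simp

lemma proj_s:
  "dobj D \<Longrightarrow> x \<in> Ar X \<Longrightarrow> Cod X x = T2 X (dob D) \<Longrightarrow> total X x \<Longrightarrow> A = dob D \<Longrightarrow>
    dproj D \<cdot> ts X A \<cdot> x = dadd D \<cdot> rpair X (dproj D \<cdot> q1 X (dob D) \<cdot> x) (dproj D \<cdot> q2 X (dob D) \<cdot> x)"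
  using assoc_eq[OF dobj_equations(7), of D x] by (simp add: rpair_cmp)

lemma proj_l:
  "dobj D \<Longrightarrow> x \<in> Ar X \<Longrightarrow> Cod X x = To X (dob D) \<Longrightarrow> A = dob D \<Longrightarrow>
    dproj D \<cdot> Ta X (dproj D) \<cdot> tl X A \<cdot> x = dproj D \<cdot> x"
  using assoc_reduce[of "dproj D" "Ta X (dproj D) \<cdot> tl X (dob D)" _ x, OF dobj_equations(8)] by simp

lemma dob_proj_ext:
  assumes D: "dobj D" and "tp X (dob D) \<cdot> h = tp X (dob D) \<cdot> h'" "dproj D \<cdot> h = dproj D \<cdot> h'"
    and "h \<in> Ar X" "h' \<in> Ar X" "Dom X h' = Dom X h" "Cod X h = To X (dob D)" "Cod X h' = To X (dob D)"
  shows "h = h'"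
  using assms by - (rule product_ext[OF dobj_product[OF D]], simp_all)

lemma dob_proj_pair:
  assumes D: "dobj D" and ab: "a \<in> Ar X" "b \<in> Ar X" "Dom X b = Dom X a" "Cod X a = dob D" "Cod X b = dob D"
    and "total X a" "total X b"
  obtains h where "h \<in> Ar X" "Dom X h = Dom X a" "Cod X h = To X (dob D)" "total X h"
    "tp X (dob D) \<cdot> h = a" "dproj D \<cdot> h = b"
  using product_pairing[OF dobj_product[OF D] ab] product_pairing_total[OF dobj_product[OF D] ab] assms
  by (auto intro: that)

section \<open>Morphisms of differential objects\<close>

lemma do_morphism_iff:
  "do_morphism X D E f \<longleftrightarrow> f \<in> Ar X \<and> Dom X f = dob D \<and> Cod X f = dob E \<and>
    f \<cdot> dproj D = dproj E \<cdot> Ta X f \<and> f \<cdot> dzero D = dzero E \<and> f \<cdot> dadd D = dadd E \<cdot> prod_arr X f f"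
  by (auto simp: do_morphism_def linear_def in_Hom)

lemma do_morphismD:
  assumes "do_morphism X D E f"
  shows "f \<in> Ar X" "Dom X f = dob D" "Cod X f = dob E"
    "f \<cdot> dproj D = dproj E \<cdot> Ta X f" "f \<cdot> dzero D = dzero E" "f \<cdot> dadd D = dadd E \<cdot> prod_arr X f f"
  using assms by (simp_all add: do_morphism_iff)

lemma do_morphism_x:
  assumes f: "do_morphism X D E f" and [simp]: "dob_typed D" "dob_typed E"
  shows "x \<in> Ar X \<Longrightarrow> Cod X x = To X (dob D) \<Longrightarrow> f \<cdot> dproj D \<cdot> x = dproj E \<cdot> Ta X f \<cdot> x"
    and "x \<in> Ar X \<Longrightarrow> Cod X x = One X \<Longrightarrow> f \<cdot> dzero D \<cdot> x = dzero E \<cdot> x"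
    and "x \<in> Ar X \<Longrightarrow> Cod X x = Prd X (dob D) (dob D) \<Longrightarrow> f \<cdot> dadd D \<cdot> x = dadd E \<cdot> prod_arr X f f \<cdot> x"
proof -
  note [simp] = do_morphismD(1-3)[OF f]
  show "f \<cdot> dproj D \<cdot> x = dproj E \<cdot> Ta X f \<cdot> x" if "x \<in> Ar X" "Cod X x = To X (dob D)"
    by (rule assoc_eq[OF do_morphismD(4)[OF f]]) (use that in simp_all)
  show "f \<cdot> dzero D \<cdot> x = dzero E \<cdot> x" if "x \<in> Ar X" "Cod X x = One X"
    by (rule assoc_reduce[OF do_morphismD(5)[OF f]]) (use that in simp_all)
  show "f \<cdot> dadd D \<cdot> x = dadd E \<cdot> prod_arr X f f \<cdot> x" if "x \<in> Ar X" "Cod X x = Prd X (dob D) (dob D)"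
    by (rule assoc_eq[OF do_morphismD(6)[OF f]]) (use that in simp_all)
qed

lemma do_morphism_cmp:
  assumes f: "do_morphism X D E f" and g: "do_morphism X E K g"
    and [simp]: "dob_typed D" "dob_typed E" "dob_typed K"
  shows "do_morphism X D K (g \<cdot> f)"
proof -
  note [simp] = do_morphismD[OF f] do_morphismD[OF g] do_morphism_x[OF g]
  show ?thesis
    by (simp add: do_morphism_iff prod_arr_cmp)
qed

lemma prod_arr_ide: "A \<in> Ob X \<Longrightarrow> B \<in> Ob X \<Longrightarrow> prod_arr X (Ide X A) (Ide X B) = Ide X (Prd X A B)"
  by (rule prod_ext[where A = A and B = B]) simp_all

lemma do_morphism_ide: "dob_typed D \<Longrightarrow> do_morphism X D D (Ide X (dob D))"
  by (simp add: do_morphism_iff prod_arr_ide)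

text \<open>By the slide axiom, \<open>Rst f \<cdot> ph = ph \<cdot> Rst (f \<cdot> ph) = ph \<cdot> Rst (ph \<cdot> T f) = ph \<cdot> T (Rst f)\<close>, as \<open>ph\<close>
  is total and \<open>T\<close> preserves restrictions; the same computation applies to \<open>\<zeta>\<close> and \<open>\<sigma>\<close>.\<close>

lemma do_morphism_rst:
  assumes f: "do_morphism X D E f" and [simp]: "dob_typed D" "dob_typed E"
  shows "do_morphism X D D (Rst X f)"
proof -
  note [simp] = do_morphismD(1-3)[OF f]
  let ?A = "dob D" and ?B = "dob E"
  have "Rst X f \<cdot> dproj D = dproj D \<cdot> Rst X (f \<cdot> dproj D)"
    by (rule rst_slide') simp_all
  moreover have "Rst X f \<cdot> dzero D = dzero D \<cdot> Rst X (f \<cdot> dzero D)"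
    by (rule rst_slide') simp_all
  moreover have "Rst X f \<cdot> dadd D = dadd D \<cdot> Rst X (f \<cdot> dadd D)"
    by (rule rst_slide') simp_all
  moreover have "Rst X (prod_arr X f f) = prod_arr X (Rst X f) (Rst X f)"
  proof -
    have 1: "Rst X f \<cdot> pi1 X ?A ?A = pi1 X ?A ?A \<cdot> Rst X (f \<cdot> pi1 X ?A ?A)"
      "Rst X f \<cdot> pi2 X ?A ?A = pi2 X ?A ?A \<cdot> Rst X (f \<cdot> pi2 X ?A ?A)"
      by (rule rst_slide'; simp)+
    have "Rst X (f \<cdot> pi2 X ?A ?A) \<cdot> Rst X (f \<cdot> pi1 X ?A ?A) = Rst X (f \<cdot> pi1 X ?A ?A) \<cdot> Rst X (f \<cdot> pi2 X ?A ?A)"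
      by (rule rst_comm) simp_all
    moreover have "Rst X (Rst X f \<cdot> pi1 X ?A ?A) = Rst X (f \<cdot> pi1 X ?A ?A)"
      "Rst X (Rst X f \<cdot> pi2 X ?A ?A) = Rst X (f \<cdot> pi2 X ?A ?A)"
      by (rule rst_cmp; simp)+
    moreover have "Rst X f \<cdot> pi1 X ?A ?A \<cdot> x = pi1 X ?A ?A \<cdot> Rst X (f \<cdot> pi1 X ?A ?A) \<cdot> x"
      "Rst X f \<cdot> pi2 X ?A ?A \<cdot> x = pi2 X ?A ?A \<cdot> Rst X (f \<cdot> pi2 X ?A ?A) \<cdot> x"
      if "x \<in> Ar X" "Cod X x = Prd X ?A ?A" for x
      by (rule assoc_eq[OF 1(1)] assoc_eq[OF 1(2)]; use that in simp)+
    ultimately show ?thesis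
      by - (rule prod_ext[where A = ?A and B = ?A], simp_all)
  qed
  ultimately show ?thesis
    by (simp add: do_morphism_iff do_morphismD[OF f])
qed

text \<open>A total linear map preserves zero and addition: both are determined by \<open>dproj\<close>, as
  \<open>\<zeta> \<circ> ! = ph \<circ> z\<close> and \<open>\<sigma> \<circ> \<langle>ph v, ph w\<rangle> = ph \<circ> s \<circ> \<langle>v, w\<rangle>\<close> for tangent vectors \<open>v\<close>, \<open>w\<close> at a
  common point.\<close>

lemma do_morphism_total_linear:
  assumes D: "dobj D" and E: "dobj E"
    and f: "f \<in> Ar X" "Dom X f = dob D" "Cod X f = dob E" "total X f"
    and lin: "f \<cdot> dproj D = dproj E \<cdot> Ta X f"
  shows "do_morphism X D E f"
proof -
  note [simp] = D E f
  let ?A = "dob D" and ?B = "dob E"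
  have linx: "f \<cdot> dproj D \<cdot> x = dproj E \<cdot> Ta X f \<cdot> x" if "x \<in> Ar X" "Cod X x = To X ?A" for x
    by (rule assoc_eq[OF lin]) (use that in simp_all)
  have "f \<cdot> dproj D \<cdot> tz X ?A \<cdot> dzero D = f \<cdot> dzero D"
    using proj_z[OF D, of "dzero D"] by simp
  moreover have "f \<cdot> dproj D \<cdot> tz X ?A \<cdot> dzero D = dproj E \<cdot> tz X ?B \<cdot> f \<cdot> dzero D"
    by (simp add: linx tz_natural(2)[OF f(1,3)])
  moreover have "dproj E \<cdot> tz X ?B \<cdot> f \<cdot> dzero D = dzero E"
    using proj_z[OF E, of "f \<cdot> dzero D"] by simp
  ultimately have zero: "f \<cdot> dzero D = dzero E"
    by simp
  obtain v where v [simp]: "v \<in> Ar X" "Dom X v = Prd X ?A ?A" "Cod X v = To X ?A" "total X v"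
      "tp X ?A \<cdot> v = pi1 X ?A ?A" "dproj D \<cdot> v = pi1 X ?A ?A"
    by (rule dob_proj_pair[OF D, of "pi1 X ?A ?A" "pi1 X ?A ?A"]) simp_all
  obtain w where w [simp]: "w \<in> Ar X" "Dom X w = Prd X ?A ?A" "Cod X w = To X ?A" "total X w"
      "tp X ?A \<cdot> w = pi1 X ?A ?A" "dproj D \<cdot> w = pi2 X ?A ?A"
    by (rule dob_proj_pair[OF D, of "pi1 X ?A ?A" "pi2 X ?A ?A"]) simp_all
  let ?k = "pairT2 X ?A v w"
  have id: "rpair X (pi1 X ?A ?A) (pi2 X ?A ?A) = Ide X (Prd X ?A ?A)"
    by (rule prod_ext[where A = ?A and B = ?A]) simp_all
  have "dproj D \<cdot> ts X ?A \<cdot> ?k = dadd D"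
    by (simp add: proj_s id)
  then have "f \<cdot> dadd D = f \<cdot> dproj D \<cdot> ts X ?A \<cdot> ?k"
    by simp
  also have "\<dots> = dproj E \<cdot> ts X ?B \<cdot> T2a X f \<cdot> ?k"
    using ts_natural(2)[OF f(1,3), of ?k] by (simp add: linx)
  also have "\<dots> = dadd E \<cdot> prod_arr X f f"
    by (simp add: proj_s linx[symmetric] prod_arr_def)
  finally show ?thesis
    by (simp add: do_morphism_iff lin zero)
qed

text \<open>After composition with \<open>pr i\<close>, each condition on \<open>h\<close> becomes the same condition on \<open>pr i \<cdot> h\<close>.\<close>

lemma do_morphism_reflect:
  assumes D: "dobj D" and Q: "dobj Q" and Di: "\<And>i. i \<in> I \<Longrightarrow> dobj (Di i)"
    and pr: "\<And>i. i \<in> I \<Longrightarrow> do_morphism X D (Di i) (pr i)"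
    and mono: "\<And>h h'. h \<in> Ar X \<Longrightarrow> h' \<in> Ar X \<Longrightarrow> Dom X h' = Dom X h \<Longrightarrow> Cod X h = dob D \<Longrightarrow>
      Cod X h' = dob D \<Longrightarrow> (\<And>i. i \<in> I \<Longrightarrow> pr i \<cdot> h = pr i \<cdot> h') \<Longrightarrow> h = h'"
    and h: "h \<in> Ar X" "Dom X h = dob Q" "Cod X h = dob D"
    and prh: "\<And>i. i \<in> I \<Longrightarrow> do_morphism X Q (Di i) (pr i \<cdot> h)"
  shows "do_morphism X Q D h"
  unfolding do_morphism_iff
proof (intro conjI)
  note [simp] = D Q Di do_morphismD(1-3)[OF pr] h
  have x: "pr i \<cdot> h \<cdot> x = (pr i \<cdot> h) \<cdot> x" if "i \<in> I" "x \<in> Ar X" "Cod X x = dob Q" for i x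
    using that by simp
  show "h \<cdot> dproj Q = dproj D \<cdot> Ta X h"
  proof (rule mono)
    show "pr i \<cdot> h \<cdot> dproj Q = pr i \<cdot> dproj D \<cdot> Ta X h" if "i \<in> I" for i
      using that by (simp add: x do_morphismD(4)[OF prh] do_morphism_x[OF pr] del: assoc)
  qed simp_all
  show "h \<cdot> dzero Q = dzero D"
  proof (rule mono)
    show "pr i \<cdot> h \<cdot> dzero Q = pr i \<cdot> dzero D" if "i \<in> I" for i
      using that by (simp add: x do_morphismD(5)[OF prh] do_morphismD(5)[OF pr] del: assoc)
  qed simp_all
  show "h \<cdot> dadd Q = dadd D \<cdot> prod_arr X h h"
  proof (rule mono)
    show "pr i \<cdot> h \<cdot> dadd Q = pr i \<cdot> dadd D \<cdot> prod_arr X h h" if "i \<in> I" for i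
      using that
      by (simp add: x do_morphismD(6)[OF prh] do_morphism_x(3)[OF pr] prod_arr_cmp del: assoc)
  qed simp_all
qed (use h in simp_all)

end

section \<open>Constructions on differential objects\<close>

context cartesian_tangent_split_restriction_category
begin

lemma pairTprod_cmp:
  assumes "a \<in> Ar X" "b \<in> Ar X" "Dom X b = Dom X a" "A \<in> Ob X" "B \<in> Ob X" "Cod X a = To X A"
    "Cod X b = To X B" "total X a" "total X b" "x \<in> Ar X" "Cod X x = Dom X a" "total X x"
  shows "pairTprod X A B a b \<cdot> x = pairTprod X A B (a \<cdot> x) (b \<cdot> x)"
  using assms by - (rule T_prod_ext[where A = A and B = B], simp_all)

lemma T_rpair:
  assumes "a \<in> Ar X" "b \<in> Ar X" "Dom X b = Dom X a" "total X a" "total X b"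
  shows "Ta X (rpair X a b) = pairTprod X (Cod X a) (Cod X b) (Ta X a) (Ta X b)"
  using assms by - (rule T_prod_ext[where A = "Cod X a" and B = "Cod X b"], simp_all)

lemma do_T_simps [simp]:
  "dob (do_T X D) = To X (dob D)"
  "dzero (do_T X D) = Ta X (dzero D) \<cdot> bang X (To X (One X)) (One X)"
  "dadd (do_T X D) = Ta X (dadd D) \<cdot> pairTprod X (dob D) (dob D)
    (pi1 X (To X (dob D)) (To X (dob D))) (pi2 X (To X (dob D)) (To X (dob D)))"
  "dproj (do_T X D) = Ta X (dproj D) \<cdot> tc X (dob D)"
  by (simp_all add: do_T_def Let_def)

text \<open>The differential object on \<open>T A\<close> is the image of \<open>A\<close> under the product preserving functor \<open>T\<close>,
  up to the flip \<open>c\<close>, which exchanges the projections \<open>p\<^sub>T\<close> and \<open>T p\<close> of \<open>T T A\<close>.\<close>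

lemma dobj_do_T:
  assumes D [simp]: "dobj D"
  shows "dobj (do_T X D)"
proof -
  let ?A = "dob D" and ?ph = "dproj D" and ?\<sigma> = "dadd D" and ?\<zeta> = "dzero D"
  let ?k = "bang X (To X (One X)) (One X)"
  let ?\<kappa> = "pairTprod X ?A ?A (pi1 X (To X ?A) (To X ?A)) (pi2 X (To X ?A) (To X ?A))"
  \<comment> \<open>each equation for \<open>T A\<close> is the image under \<open>T\<close> of an equation for \<open>A\<close>, rewritten with pairs
    into \<open>T (A \<times> A)\<close> as normal forms\<close>
  note N = pairTprod_cmp T_rpair rpair_cmp
  have k: "?k \<cdot> x = Ta X (bang X (One X) Q) \<cdot> y"
    if "x \<in> Ar X" "Cod X x = One X" "total X x" "y \<in> Ar X" "Cod X y = To X Q" "total X y"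
      "Dom X x = Dom X y" "Q \<in> Ob X" for x y Q
    by (rule T_one_eq) (use that in simp_all)
  have typed: "dob_typed (do_T X D)"
    unfolding dob_typed_def by simp
  have \<kappa>: "?\<kappa> \<cdot> rpair X a b = pairTprod X ?A ?A a b"
    if "a \<in> Ar X" "b \<in> Ar X" "Dom X b = Dom X a" "Cod X a = To X ?A" "Cod X b = To X ?A" "total X a" "total X b"
    for a b
    using that by (simp add: pairTprod_cmp)
  have T_zero_add: "Ta X ?\<sigma> \<cdot> pairTprod X ?A ?A (Ta X ?\<zeta> \<cdot> ?k \<cdot> bang X (One X) (Dom X a)) a = a"
    if a: "a \<in> Ar X" "Cod X a = To X ?A" "total X a" for a
  proof -
    have "Ta X ?\<sigma> \<cdot> Ta X (rpair X (?\<zeta> \<cdot> bang X (One X) ?A) (Ide X ?A)) = Ide X (To X ?A)"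
      by (subst T_cmp_cong[OF zero_add]) simp_all
    from assoc_reduce[OF this, of a] show ?thesis
      using a k[of "bang X (One X) (Dom X a)" a ?A] by (simp add: N)
  qed
  have T_add_commute: "Ta X ?\<sigma> \<cdot> pairTprod X ?A ?A b a = Ta X ?\<sigma> \<cdot> pairTprod X ?A ?A a b"
    if ab: "a \<in> Ar X" "b \<in> Ar X" "Dom X b = Dom X a" "Cod X a = To X ?A" "Cod X b = To X ?A" "total X a" "total X b"
    for a b
  proof -
    have id: "rpair X (pi1 X ?A ?A) (pi2 X ?A ?A) = Ide X (Prd X ?A ?A)"
      by (rule prod_ext[where A = ?A and B = ?A]) simp_all
    have "?\<sigma> \<cdot> rpair X (pi2 X ?A ?A) (pi1 X ?A ?A) = ?\<sigma>"
      using add_commute[OF D, of "pi2 X ?A ?A" "pi1 X ?A ?A"] by (simp add: id)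
    then have "Ta X ?\<sigma> \<cdot> Ta X (rpair X (pi2 X ?A ?A) (pi1 X ?A ?A)) = Ta X ?\<sigma>"
      by (rule T_cmp_cong) simp_all
    from assoc_reduce[OF this, of "pairTprod X ?A ?A a b"] show ?thesis
      using ab by (simp add: N)
  qed
  have T_add_assoc: "Ta X ?\<sigma> \<cdot> pairTprod X ?A ?A (Ta X ?\<sigma> \<cdot> pairTprod X ?A ?A a b) c =
      Ta X ?\<sigma> \<cdot> pairTprod X ?A ?A a (Ta X ?\<sigma> \<cdot> pairTprod X ?A ?A b c)"
    if abc: "a \<in> Ar X" "b \<in> Ar X" "c \<in> Ar X" "Dom X b = Dom X a" "Dom X c = Dom X a"
      "Cod X a = To X ?A" "Cod X b = To X ?A" "Cod X c = To X ?A" "total X a" "total X b" "total X c" for a b c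
  proof -
    let ?P = "Prd X (Prd X ?A ?A) ?A"
    let ?p = "pi1 X (Prd X ?A ?A) ?A" and ?r = "pi2 X (Prd X ?A ?A) ?A"
    let ?L = "rpair X (?\<sigma> \<cdot> rpair X (pi1 X ?A ?A \<cdot> ?p) (pi2 X ?A ?A \<cdot> ?p)) ?r"
    let ?R = "rpair X (pi1 X ?A ?A \<cdot> ?p) (?\<sigma> \<cdot> rpair X (pi2 X ?A ?A \<cdot> ?p) ?r)"
    have "?\<sigma> \<cdot> ?L = ?\<sigma> \<cdot> ?R"
      by (rule add_assoc) simp_all
    then have "Ta X (?\<sigma> \<cdot> ?L) = Ta X (?\<sigma> \<cdot> ?R)"
      by simp
    then have "Ta X ?\<sigma> \<cdot> Ta X ?L = Ta X ?\<sigma> \<cdot> Ta X ?R"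
      by simp
    from assoc_eq[OF this, of "pairTprod X (Prd X ?A ?A) ?A (pairTprod X ?A ?A a b) c"] show ?thesis
      using abc by (simp add: N)
  qed
  have phc: "?ph \<cdot> x = ?ph \<cdot> y \<Longrightarrow> Ta X ?ph \<cdot> Ta X x = Ta X ?ph \<cdot> Ta X y"
    if "x \<in> Ar X" "y \<in> Ar X" "Cod X x = To X ?A" "Cod X y = To X ?A" for x y
    using T_functorD(6)[of x ?ph] T_functorD(6)[of y ?ph] that by simp
  have eqs: "dob_equations (do_T X D)"
    unfolding dob_equations_def Let_def do_T_simps
  proof (intro conjI)
    show "(Ta X ?\<sigma> \<cdot> ?\<kappa>) \<cdot> rpair X ((Ta X ?\<zeta> \<cdot> ?k) \<cdot> bang X (One X) (To X ?A)) (Ide X (To X ?A)) = Ide X (To X ?A)"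
      using T_zero_add[of "Ide X (To X ?A)"] by (simp add: \<kappa>)
    show "(Ta X ?\<sigma> \<cdot> ?\<kappa>) \<cdot> rpair X (pi2 X (To X ?A) (To X ?A)) (pi1 X (To X ?A) (To X ?A)) = Ta X ?\<sigma> \<cdot> ?\<kappa>"
      by (simp add: \<kappa> T_add_commute)
    show "(Ta X ?\<sigma> \<cdot> ?\<kappa>) \<cdot> rpair X ((Ta X ?\<sigma> \<cdot> ?\<kappa>) \<cdot> pi1 X (Prd X (To X ?A) (To X ?A)) (To X ?A))
          (pi2 X (Prd X (To X ?A) (To X ?A)) (To X ?A)) =
        (Ta X ?\<sigma> \<cdot> ?\<kappa>) \<cdot> rpair X (pi1 X (To X ?A) (To X ?A) \<cdot> pi1 X (Prd X (To X ?A) (To X ?A)) (To X ?A))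
          ((Ta X ?\<sigma> \<cdot> ?\<kappa>) \<cdot> rpair X (pi2 X (To X ?A) (To X ?A) \<cdot> pi1 X (Prd X (To X ?A) (To X ?A)) (To X ?A))
            (pi2 X (Prd X (To X ?A) (To X ?A)) (To X ?A)))"
      by (simp add: \<kappa> T_add_assoc pairTprod_cmp)
    have "Ta X ?ph \<cdot> Ta X (Ta X ?\<zeta>) \<cdot> x = Ta X ?\<zeta> \<cdot> Ta X (bang X (One X) (To X (One X))) \<cdot> x"
      if "x \<in> Ar X" "Cod X x = To X (To X (One X))" for x
    proof (rule assoc_eq)
      have "?ph \<cdot> Ta X ?\<zeta> = ?\<zeta> \<cdot> bang X (One X) (To X (One X))"
        using proj_T_zero[OF D, of "Ide X (To X (One X))"] by simp
      then have "Ta X (?ph \<cdot> Ta X ?\<zeta>) = Ta X (?\<zeta> \<cdot> bang X (One X) (To X (One X)))"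
        by simp
      then show "Ta X ?ph \<cdot> Ta X (Ta X ?\<zeta>) = Ta X ?\<zeta> \<cdot> Ta X (bang X (One X) (To X (One X)))"
        by (simp del: bang_cmp)
    qed (use that in simp_all)
    moreover have "Ta X (bang X (One X) (To X (One X))) \<cdot> tc X (One X) \<cdot> Ta X ?k =
        ?k \<cdot> bang X (One X) (To X (One X))"
      by (rule T_one_eq) simp_all
    ultimately show "(Ta X ?ph \<cdot> tc X ?A) \<cdot> Ta X (Ta X ?\<zeta> \<cdot> ?k) = (Ta X ?\<zeta> \<cdot> ?k) \<cdot> bang X (One X) (To X (One X))"
      by (simp add: tc_natural)
    have "Ta X (?ph \<cdot> Ta X ?\<sigma>) =
        Ta X (?\<sigma> \<cdot> rpair X (?ph \<cdot> Ta X (pi1 X ?A ?A)) (?ph \<cdot> Ta X (pi2 X ?A ?A)))"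
      using proj_T_add[OF D, of "Ide X (To X (Prd X ?A ?A))"] by simp
    then have "Ta X ?ph \<cdot> Ta X (Ta X ?\<sigma>) =
        Ta X ?\<sigma> \<cdot> Ta X (rpair X (?ph \<cdot> Ta X (pi1 X ?A ?A)) (?ph \<cdot> Ta X (pi2 X ?A ?A)))"
      by simp
    from assoc_eq[OF this, of "tc X (Prd X ?A ?A) \<cdot> Ta X ?\<kappa>"]
    have "Ta X ?ph \<cdot> Ta X (Ta X ?\<sigma>) \<cdot> tc X (Prd X ?A ?A) \<cdot> Ta X ?\<kappa> =
        Ta X ?\<sigma> \<cdot> pairTprod X ?A ?A (Ta X ?ph \<cdot> Ta X (Ta X (pi1 X ?A ?A)) \<cdot> tc X (Prd X ?A ?A) \<cdot> Ta X ?\<kappa>)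
          (Ta X ?ph \<cdot> Ta X (Ta X (pi2 X ?A ?A)) \<cdot> tc X (Prd X ?A ?A) \<cdot> Ta X ?\<kappa>)"
      by (simp add: N)
    moreover have "Ta X (Ta X (pi1 X ?A ?A)) \<cdot> tc X (Prd X ?A ?A) \<cdot> Ta X ?\<kappa> = tc X ?A \<cdot> Ta X (pi1 X (To X ?A) (To X ?A))"
      "Ta X (Ta X (pi2 X ?A ?A)) \<cdot> tc X (Prd X ?A ?A) \<cdot> Ta X ?\<kappa> = tc X ?A \<cdot> Ta X (pi2 X (To X ?A) (To X ?A))"
      using tc_natural(2)[of "pi1 X ?A ?A" ?A "Ta X ?\<kappa>"] tc_natural(2)[of "pi2 X ?A ?A" ?A "Ta X ?\<kappa>"]
        T_functorD(6)[of ?\<kappa> "Ta X (pi1 X ?A ?A)"] T_functorD(6)[of ?\<kappa> "Ta X (pi2 X ?A ?A)"]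
      by simp_all
    ultimately show "(Ta X ?ph \<cdot> tc X ?A) \<cdot> Ta X (Ta X ?\<sigma> \<cdot> ?\<kappa>) = (Ta X ?\<sigma> \<cdot> ?\<kappa>) \<cdot>
        rpair X ((Ta X ?ph \<cdot> tc X ?A) \<cdot> Ta X (pi1 X (To X ?A) (To X ?A)))
          ((Ta X ?ph \<cdot> tc X ?A) \<cdot> Ta X (pi2 X (To X ?A) (To X ?A)))"
      by (simp add: tc_natural \<kappa>)
    have "Ta X (?ph \<cdot> tz X ?A) = Ta X (?\<zeta> \<cdot> bang X (One X) ?A)"
      using proj_z[OF D, of "Ide X ?A"] by simp
    then have "Ta X ?ph \<cdot> Ta X (tz X ?A) = Ta X ?\<zeta> \<cdot> Ta X (bang X (One X) ?A)"
      by simp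
    then show "(Ta X ?ph \<cdot> tc X ?A) \<cdot> tz X (To X ?A) = (Ta X ?\<zeta> \<cdot> ?k) \<cdot> bang X (One X) (To X ?A)"
      using k[of "bang X (One X) (To X ?A)" "Ide X (To X ?A)" ?A] by (simp add: c_z)
    have "Ta X (?ph \<cdot> ts X ?A) = Ta X (?\<sigma> \<cdot> rpair X (?ph \<cdot> q1 X ?A) (?ph \<cdot> q2 X ?A))"
      using proj_s[OF D, of "Ide X (T2 X ?A)"] by simp
    then have "Ta X ?ph \<cdot> Ta X (ts X ?A) = Ta X ?\<sigma> \<cdot> Ta X (rpair X (?ph \<cdot> q1 X ?A) (?ph \<cdot> q2 X ?A))"
      by simp
    from assoc_eq[OF this, of "pairTT2 X ?A (tc X ?A \<cdot> q1 X (To X ?A)) (tc X ?A \<cdot> q2 X (To X ?A))"]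
    show "(Ta X ?ph \<cdot> tc X ?A) \<cdot> ts X (To X ?A) = (Ta X ?\<sigma> \<cdot> ?\<kappa>) \<cdot>
        rpair X ((Ta X ?ph \<cdot> tc X ?A) \<cdot> q1 X (To X ?A)) ((Ta X ?ph \<cdot> tc X ?A) \<cdot> q2 X (To X ?A))"
      by (simp add: c_s N)
    have "Ta X (?ph \<cdot> Ta X ?ph \<cdot> tl X ?A) = Ta X ?ph"
      using proj_l[OF D, of "Ide X (To X ?A)"] by simp
    then have l: "Ta X ?ph \<cdot> Ta X (Ta X ?ph) \<cdot> Ta X (tl X ?A) = Ta X ?ph"
      by simp
    have "(Ta X ?ph \<cdot> tc X ?A) \<cdot> Ta X (Ta X ?ph \<cdot> tc X ?A) \<cdot> tl X (To X ?A) =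
        Ta X ?ph \<cdot> Ta X (Ta X ?ph) \<cdot> tc X (To X ?A) \<cdot> Ta X (tc X ?A) \<cdot> tl X (To X ?A)"
      by (simp add: tc_natural)
    also have "\<dots> = Ta X ?ph \<cdot> Ta X (Ta X ?ph) \<cdot> Ta X (tl X ?A) \<cdot> tc X ?A"
      by (simp add: c_Tc_l)
    also have "\<dots> = Ta X ?ph \<cdot> tc X ?A"
      using assoc_reduce[of "Ta X ?ph" "Ta X (Ta X ?ph) \<cdot> Ta X (tl X ?A)" "Ta X ?ph" "tc X ?A"] l by simp
    finally show "(Ta X ?ph \<cdot> tc X ?A) \<cdot> Ta X (Ta X ?ph \<cdot> tc X ?A) \<cdot> tl X (To X ?A) = Ta X ?ph \<cdot> tc X ?A" .
  qed
  have "restriction_product X (To X ?A) (To X ?A) (To X (To X ?A))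
      (Ta X (tp X ?A) \<cdot> tc X ?A) (Ta X ?ph \<cdot> tc X ?A)"
    by (rule product_transport[where j = "tc X ?A", OF T_preserves_product[OF dobj_product[OF D]]])
      (simp_all add: c_c)
  then show ?thesis
    using typed eqs by (simp add: dobj_iff[of "do_T X D"] Tp_c)
qed

text \<open>As \<open>pr i\<close> is a morphism, composition with it turns each equation for \<open>D\<close> into the same equation for
  \<open>Di i\<close>, evaluated at the image under \<open>pr i\<close> of the generic element.\<close>

lemma dob_equations_reflect:
  assumes D: "dob_typed D" and Di: "\<And>i. i \<in> I \<Longrightarrow> dobj (Di i)"
    and pr: "\<And>i. i \<in> I \<Longrightarrow> do_morphism X D (Di i) (pr i)" "\<And>i. i \<in> I \<Longrightarrow> total X (pr i)"
    and mono: "\<And>h h'. h \<in> Ar X \<Longrightarrow> h' \<in> Ar X \<Longrightarrow> Dom X h' = Dom X h \<Longrightarrow> Cod X h = dob D \<Longrightarrow>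
      Cod X h' = dob D \<Longrightarrow> total X h \<Longrightarrow> total X h' \<Longrightarrow> (\<And>i. i \<in> I \<Longrightarrow> pr i \<cdot> h = pr i \<cdot> h') \<Longrightarrow> h = h'"
  shows "dob_equations D"
proof -
  note [simp] = D Di do_morphismD(1-3)[OF pr(1)] pr(2)
  let ?A = "dob D"
  have add: "pr i \<cdot> dadd D = dadd (Di i) \<cdot> rpair X (pr i \<cdot> pi1 X ?A ?A) (pr i \<cdot> pi2 X ?A ?A)" if "i \<in> I" for i
    using do_morphismD(6)[OF pr(1)[OF that]] that by (simp add: prod_arr_def)
  have add_x: "pr i \<cdot> dadd D \<cdot> rpair X a b = dadd (Di i) \<cdot> rpair X (pr i \<cdot> a) (pr i \<cdot> b)"
    if "i \<in> I" "a \<in> Ar X" "b \<in> Ar X" "Dom X b = Dom X a" "Cod X a = ?A" "Cod X b = ?A" "total X a" "total X b"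
    for i a b
    using assoc_eq[OF add, of i "rpair X a b"] that by (simp add: rpair_cmp)
  note zero = do_morphismD(5)[OF pr(1)] do_morphism_x(2)[OF pr(1)]
  note proj = do_morphismD(4)[OF pr(1)] do_morphism_x(1)[OF pr(1)]
  note pr_simps = add add_x zero proj
  have Tadd: "Ta X (pr i) \<cdot> Ta X (dadd D) = Ta X (dadd (Di i)) \<cdot>
      pairTprod X (dob (Di i)) (dob (Di i)) (Ta X (pr i) \<cdot> Ta X (pi1 X ?A ?A)) (Ta X (pr i) \<cdot> Ta X (pi2 X ?A ?A))"
    if "i \<in> I" for i
    using T_cmp_cong[OF add] that by (simp add: T_rpair)
  have Tzero: "Ta X (pr i) \<cdot> Ta X (dzero D) = Ta X (dzero (Di i))" if "i \<in> I" for i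
    by (rule T_cmp_cong[OF zero(1)]) (use that in simp_all)
  have Tproj: "Ta X (pr i) \<cdot> Ta X (dproj D) = Ta X (dproj (Di i)) \<cdot> Ta X (Ta X (pr i))" if "i \<in> I" for i
    using T_cmp_cong[OF proj(1)] that by simp
  have Tproj_x: "Ta X (pr i) \<cdot> Ta X (dproj D) \<cdot> x = Ta X (dproj (Di i)) \<cdot> Ta X (Ta X (pr i)) \<cdot> x"
    if "i \<in> I" "x \<in> Ar X" "Cod X x = To X (To X ?A)" for i x
    by (rule assoc_eq[OF Tproj]) (use that in simp_all)
  show ?thesis
    unfolding dob_equations_def Let_def
  proof (intro conjI)
    show "dadd D \<cdot> rpair X (dzero D \<cdot> bang X (One X) ?A) (Ide X ?A) = Ide X ?A"
    proof (rule mono)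
      show "pr i \<cdot> dadd D \<cdot> rpair X (dzero D \<cdot> bang X (One X) ?A) (Ide X ?A) = pr i \<cdot> Ide X ?A" if "i \<in> I" for i
        using that by (simp add: pr_simps zero_add)
    qed simp_all
    show "dadd D \<cdot> rpair X (pi2 X ?A ?A) (pi1 X ?A ?A) = dadd D"
    proof (rule mono)
      show "pr i \<cdot> dadd D \<cdot> rpair X (pi2 X ?A ?A) (pi1 X ?A ?A) = pr i \<cdot> dadd D" if "i \<in> I" for i
        using that add_commute[OF Di[OF that], of "pr i \<cdot> pi1 X ?A ?A" "pr i \<cdot> pi2 X ?A ?A"]
        by (simp add: pr_simps)
    qed simp_all
    let ?p = "pi1 X (Prd X ?A ?A) ?A" and ?r = "pi2 X (Prd X ?A ?A) ?A"
    show "dadd D \<cdot> rpair X (dadd D \<cdot> ?p) ?r =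
        dadd D \<cdot> rpair X (pi1 X ?A ?A \<cdot> ?p) (dadd D \<cdot> rpair X (pi2 X ?A ?A \<cdot> ?p) ?r)"
    proof (rule mono)
      have "pr i \<cdot> dadd D \<cdot> ?p = dadd (Di i) \<cdot> rpair X (pr i \<cdot> pi1 X ?A ?A \<cdot> ?p) (pr i \<cdot> pi2 X ?A ?A \<cdot> ?p)"
        if "i \<in> I" for i
        using assoc_eq[OF add, of i ?p] that by (simp add: rpair_cmp)
      then show "pr i \<cdot> dadd D \<cdot> rpair X (dadd D \<cdot> ?p) ?r =
          pr i \<cdot> dadd D \<cdot> rpair X (pi1 X ?A ?A \<cdot> ?p) (dadd D \<cdot> rpair X (pi2 X ?A ?A \<cdot> ?p) ?r)" if "i \<in> I" for i
        using that by (simp add: pr_simps add_assoc)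
    qed simp_all
    show "dproj D \<cdot> Ta X (dzero D) = dzero D \<cdot> bang X (One X) (To X (One X))"
    proof (rule mono)
      show "pr i \<cdot> dproj D \<cdot> Ta X (dzero D) = pr i \<cdot> dzero D \<cdot> bang X (One X) (To X (One X))" if "i \<in> I" for i
        using that proj_T_zero[OF Di[OF that], of "Ide X (To X (One X))"] by (simp add: pr_simps Tzero)
    qed simp_all
    show "dproj D \<cdot> Ta X (dadd D) =
        dadd D \<cdot> rpair X (dproj D \<cdot> Ta X (pi1 X ?A ?A)) (dproj D \<cdot> Ta X (pi2 X ?A ?A))"
    proof (rule mono)
      show "pr i \<cdot> dproj D \<cdot> Ta X (dadd D) =
          pr i \<cdot> dadd D \<cdot> rpair X (dproj D \<cdot> Ta X (pi1 X ?A ?A)) (dproj D \<cdot> Ta X (pi2 X ?A ?A))" if "i \<in> I" for i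
        using that by (simp add: pr_simps Tadd proj_T_add)
    qed simp_all
    show "dproj D \<cdot> tz X ?A = dzero D \<cdot> bang X (One X) ?A"
    proof (rule mono)
      show "pr i \<cdot> dproj D \<cdot> tz X ?A = pr i \<cdot> dzero D \<cdot> bang X (One X) ?A" if "i \<in> I" for i
        using that proj_z[OF Di[OF that], of "pr i"] tz_natural(1)[of "pr i" "dob (Di i)"] by (simp add: pr_simps)
    qed simp_all
    show "dproj D \<cdot> ts X ?A = dadd D \<cdot> rpair X (dproj D \<cdot> q1 X ?A) (dproj D \<cdot> q2 X ?A)"
    proof (rule mono)
      show "pr i \<cdot> dproj D \<cdot> ts X ?A = pr i \<cdot> dadd D \<cdot> rpair X (dproj D \<cdot> q1 X ?A) (dproj D \<cdot> q2 X ?A)" if "i \<in> I" for i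
        using that proj_s[OF Di[OF that], of "T2a X (pr i)"] ts_natural(1)[of "pr i" "dob (Di i)"]
        by (simp add: pr_simps)
    qed simp_all
    show "dproj D \<cdot> Ta X (dproj D) \<cdot> tl X ?A = dproj D"
    proof (rule mono)
      show "pr i \<cdot> dproj D \<cdot> Ta X (dproj D) \<cdot> tl X ?A = pr i \<cdot> dproj D" if "i \<in> I" for i
        using that proj_l[OF Di[OF that], of "Ta X (pr i)"] tl_natural(1)[of "pr i" "dob (Di i)"]
        by (simp add: pr_simps Tproj_x)
    qed simp_all
  qed
qed

text \<open>Differential objects are closed under wide pullbacks of total linear maps that \<open>T\<close> preserves.
  The product diagram of the limit is assembled from those of the components: a pair of maps into
  \<open>D\<close> gives tangent vectors of all \<open>Di i\<close>, whose images in the base \<open>E\<close> agree because \<open>T E\<close> is itself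
  a product.\<close>

lemma dobj_wide_pullback:
  assumes D: "dob_typed D" and Di: "\<And>i. i \<in> I \<Longrightarrow> dobj (Di i)" and E: "dobj E"
    and pr: "\<And>i. i \<in> I \<Longrightarrow> do_morphism X D (Di i) (pr i)" "\<And>i. i \<in> I \<Longrightarrow> total X (pr i)"
    and b: "\<And>i. i \<in> I \<Longrightarrow> do_morphism X (Di i) E (b i)" "\<And>i. i \<in> I \<Longrightarrow> total X (b i)"
    and cone: "\<And>i j. i \<in> I \<Longrightarrow> j \<in> I \<Longrightarrow> b i \<cdot> pr i = b j \<cdot> pr j"
    and mono: "\<And>h h'. h \<in> Ar X \<Longrightarrow> h' \<in> Ar X \<Longrightarrow> Dom X h' = Dom X h \<Longrightarrow> Cod X h = dob D \<Longrightarrow>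
      Cod X h' = dob D \<Longrightarrow> total X h \<Longrightarrow> total X h' \<Longrightarrow> (\<And>i. i \<in> I \<Longrightarrow> pr i \<cdot> h = pr i \<cdot> h') \<Longrightarrow> h = h'"
    and T_mono: "\<And>h h'. h \<in> Ar X \<Longrightarrow> h' \<in> Ar X \<Longrightarrow> Dom X h' = Dom X h \<Longrightarrow> Cod X h = To X (dob D) \<Longrightarrow>
      Cod X h' = To X (dob D) \<Longrightarrow> total X h \<Longrightarrow> total X h' \<Longrightarrow>
      (\<And>i. i \<in> I \<Longrightarrow> Ta X (pr i) \<cdot> h = Ta X (pr i) \<cdot> h') \<Longrightarrow> h = h'"
    and T_lift: "\<And>Q v. Q \<in> Ob X \<Longrightarrow>
      (\<And>i. i \<in> I \<Longrightarrow> v i \<in> Ar X \<and> Dom X (v i) = Q \<and> Cod X (v i) = To X (dob (Di i)) \<and> total X (v i)) \<Longrightarrow>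
      (\<And>i j. i \<in> I \<Longrightarrow> j \<in> I \<Longrightarrow> Ta X (b i) \<cdot> v i = Ta X (b j) \<cdot> v j) \<Longrightarrow>
      \<exists>h. h \<in> Ar X \<and> Dom X h = Q \<and> Cod X h = To X (dob D) \<and> total X h \<and> (\<forall>i \<in> I. Ta X (pr i) \<cdot> h = v i)"
  shows "dobj D"
proof -
  note [simp] = D Di E do_morphismD(1-3)[OF pr(1)] pr(2) do_morphismD(1-3)[OF b(1)] b(2)
  let ?A = "dob D"
  have nat: "tp X (dob (Di i)) \<cdot> Ta X (pr i) \<cdot> x = pr i \<cdot> tp X ?A \<cdot> x"
    "dproj (Di i) \<cdot> Ta X (pr i) \<cdot> x = pr i \<cdot> dproj D \<cdot> x"
    if "i \<in> I" "x \<in> Ar X" "Cod X x = To X ?A" for i x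
    using that tp_natural(2)[of "pr i" "dob (Di i)" x] do_morphism_x(1)[OF pr(1), of i x] by simp_all
  have b_nat: "tp X (dob E) \<cdot> Ta X (b i) \<cdot> x = b i \<cdot> tp X (dob (Di i)) \<cdot> x"
    "dproj E \<cdot> Ta X (b i) \<cdot> x = b i \<cdot> dproj (Di i) \<cdot> x"
    if "i \<in> I" "x \<in> Ar X" "Cod X x = To X (dob (Di i))" for i x
    using that tp_natural(2)[of "b i" "dob E" x] do_morphism_x(1)[OF b(1), of i x] by simp_all
  have cone_x: "b i \<cdot> pr i \<cdot> x = b j \<cdot> pr j \<cdot> x" if "i \<in> I" "j \<in> I" "x \<in> Ar X" "Cod X x = ?A" for i j x
    by (rule assoc_eq[OF cone]) (use that in simp_all)
  have "\<exists>!h. h \<in> Hom (Tot X) Q (To X ?A) \<and> tp X ?A \<cdot> h = f \<and> dproj D \<cdot> h = g"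
    if "f \<in> Hom (Tot X) Q ?A" "g \<in> Hom (Tot X) Q ?A" for Q f g
  proof -
    have fg [simp]: "f \<in> Ar X" "Dom X f = Q" "Cod X f = ?A" "total X f"
        "g \<in> Ar X" "Dom X g = Q" "Cod X g = ?A" "total X g"
      using that by (simp_all add: in_Hom_Tot)
    have Q [simp]: "Q \<in> Ob X"
      using dom_in_Ob[OF fg(1)] by simp
    have "\<forall>i \<in> I. \<exists>v. v \<in> Ar X \<and> Dom X v = Q \<and> Cod X v = To X (dob (Di i)) \<and> total X v \<and>
        tp X (dob (Di i)) \<cdot> v = pr i \<cdot> f \<and> dproj (Di i) \<cdot> v = pr i \<cdot> g"
    proof
      fix i assume i: "i \<in> I"
      obtain v where "v \<in> Ar X" "Dom X v = Dom X (pr i \<cdot> f)" "Cod X v = To X (dob (Di i))" "total X v"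
          "tp X (dob (Di i)) \<cdot> v = pr i \<cdot> f" "dproj (Di i) \<cdot> v = pr i \<cdot> g"
        by (rule dob_proj_pair[OF Di[OF i], of "pr i \<cdot> f" "pr i \<cdot> g"]) (use i in simp_all)
      then show "\<exists>v. v \<in> Ar X \<and> Dom X v = Q \<and> Cod X v = To X (dob (Di i)) \<and> total X v \<and>
          tp X (dob (Di i)) \<cdot> v = pr i \<cdot> f \<and> dproj (Di i) \<cdot> v = pr i \<cdot> g"
        using i by (intro exI[of _ v]) simp
    qed
    from bchoice[OF this] obtain v where v [simp]: "\<And>i. i \<in> I \<Longrightarrow> v i \<in> Ar X"
        "\<And>i. i \<in> I \<Longrightarrow> Dom X (v i) = Q" "\<And>i. i \<in> I \<Longrightarrow> Cod X (v i) = To X (dob (Di i))"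
        "\<And>i. i \<in> I \<Longrightarrow> total X (v i)"
        "\<And>i. i \<in> I \<Longrightarrow> tp X (dob (Di i)) \<cdot> v i = pr i \<cdot> f" "\<And>i. i \<in> I \<Longrightarrow> dproj (Di i) \<cdot> v i = pr i \<cdot> g"
      by blast
    have T_cone: "Ta X (b i) \<cdot> v i = Ta X (b j) \<cdot> v j" if "i \<in> I" "j \<in> I" for i j
      by (rule dob_proj_ext[OF E]) (use that in \<open>simp_all add: b_nat cone_x[of i j]\<close>)
    have "\<exists>h. h \<in> Ar X \<and> Dom X h = Q \<and> Cod X h = To X ?A \<and> total X h \<and> (\<forall>i \<in> I. Ta X (pr i) \<cdot> h = v i)"
      by (rule T_lift[OF Q _ T_cone]) (use v in blast)+
    then obtain h where h [simp]: "h \<in> Ar X" "Dom X h = Q" "Cod X h = To X ?A" "total X h"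
      and hv: "\<And>i. i \<in> I \<Longrightarrow> Ta X (pr i) \<cdot> h = v i"
      by blast
    show ?thesis
    proof (rule ex1I[where a = h])
      have "tp X ?A \<cdot> h = f"
      proof (rule mono)
        show "pr i \<cdot> tp X ?A \<cdot> h = pr i \<cdot> f" if "i \<in> I" for i
          using that nat(1)[of i h] by (simp add: hv)
      qed simp_all
      moreover have "dproj D \<cdot> h = g"
      proof (rule mono)
        show "pr i \<cdot> dproj D \<cdot> h = pr i \<cdot> g" if "i \<in> I" for i
          using that nat(2)[of i h] by (simp add: hv)
      qed simp_all
      ultimately show "h \<in> Hom (Tot X) Q (To X ?A) \<and> tp X ?A \<cdot> h = f \<and> dproj D \<cdot> h = g"
        by (simp add: in_Hom_Tot)
    next
      fix h' assume "h' \<in> Hom (Tot X) Q (To X ?A) \<and> tp X ?A \<cdot> h' = f \<and> dproj D \<cdot> h' = g"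
      then have h' [simp]: "h' \<in> Ar X" "Dom X h' = Q" "Cod X h' = To X ?A" "total X h'"
        and fg': "tp X ?A \<cdot> h' = f" "dproj D \<cdot> h' = g"
        by (simp_all add: in_Hom_Tot)
      show "h' = h"
      proof (rule T_mono)
        show "Ta X (pr i) \<cdot> h' = Ta X (pr i) \<cdot> h" if "i \<in> I" for i
          by (rule dob_proj_ext[OF Di[OF that]]) (use that in \<open>simp_all add: nat hv fg'\<close>)
      qed simp_all
    qed
  qed
  then have "\<forall>Q. \<forall>f \<in> Hom (Tot X) Q ?A. \<forall>g \<in> Hom (Tot X) Q ?A.
      \<exists>!h. h \<in> Hom (Tot X) Q (To X ?A) \<and> tp X ?A \<cdot> h = f \<and> dproj D \<cdot> h = g"
    by blast
  then have "is_product (Tot X) ?A ?A (To X ?A) (tp X ?A) (dproj D)"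
    unfolding is_product_def Tot_simps by (intro conjI) (simp_all add: in_Hom_Tot)
  moreover have "dob_equations D"
    by (rule dob_equations_reflect[where I = I and Di = Di and pr = pr]) (fact D Di pr mono)+
  ultimately show ?thesis
    by (simp add: dobj_iff_Tot)
qed

text \<open>Naturality of the canonical isomorphism from \<open>T A \<times> T B\<close> to \<open>T (A \<times> B)\<close> in partial maps.\<close>

lemma T_prod_arr:
  assumes [simp]: "f \<in> Ar X" "g \<in> Ar X" "Dom X f = A" "Dom X g = B"
  shows "Ta X (prod_arr X f g) \<cdot> pairTprod X A B (pi1 X (To X A) (To X B)) (pi2 X (To X A) (To X B)) =
    pairTprod X (Cod X f) (Cod X g) (pi1 X (To X (Cod X f)) (To X (Cod X g))) (pi2 X (To X (Cod X f)) (To X (Cod X g)))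
      \<cdot> prod_arr X (Ta X f) (Ta X g)" (is "_ \<cdot> ?\<kappa> = ?\<kappa>' \<cdot> _")
proof -
  have [simp]: "A \<in> Ob X" "B \<in> Ob X"
    using dom_in_Ob[of f] dom_in_Ob[of g] by simp_all
  have "Rst X (Ta X f \<cdot> Ta X (pi1 X A B)) \<cdot> ?\<kappa> = ?\<kappa> \<cdot> Rst X ((Ta X f \<cdot> Ta X (pi1 X A B)) \<cdot> ?\<kappa>)"
    "Rst X (Ta X g \<cdot> Ta X (pi2 X A B)) \<cdot> ?\<kappa> = ?\<kappa> \<cdot> Rst X ((Ta X g \<cdot> Ta X (pi2 X A B)) \<cdot> ?\<kappa>)"
    by (rule rst_slide'; simp)+
  then show ?thesis
    unfolding prod_arr_def[of X f g]
    by - (rule T_prod_ext[where A = "Cod X f" and B = "Cod X g"], simp_all)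
qed

lemma do_morphism_T:
  assumes f: "do_morphism X D E f" and [simp]: "dob_typed D" "dob_typed E"
  shows "do_morphism X (do_T X D) (do_T X E) (Ta X f)"
proof -
  note [simp] = do_morphismD(1-3)[OF f]
  let ?A = "dob D" and ?B = "dob E"
  have 1: "Ta X f \<cdot> Ta X (dproj D) = Ta X (dproj E) \<cdot> Ta X (Ta X f)"
    by (subst T_cmp_cong[OF do_morphismD(4)[OF f]]) simp_all
  have 2: "Ta X f \<cdot> Ta X (dzero D) = Ta X (dzero E)"
    by (subst T_cmp_cong[OF do_morphismD(5)[OF f]]) simp_all
  have 3: "Ta X f \<cdot> Ta X (dadd D) = Ta X (dadd E) \<cdot> Ta X (prod_arr X f f)"
    by (subst T_cmp_cong[OF do_morphismD(6)[OF f]]) simp_all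
  show ?thesis
    unfolding do_morphism_iff
    using assoc_eq[OF 1, of "tc X ?A"] assoc_reduce[OF 2, of "bang X (To X (One X)) (One X)"]
      assoc_eq[OF 3, of "pairTprod X ?A ?A (pi1 X (To X ?A) (To X ?A)) (pi2 X (To X ?A) (To X ?A))"]
    by (simp add: tc_natural T_prod_arr)
qed

text \<open>The structure maps are linear for the flipped structure \<open>T ph \<cdot> c\<close> on tangent bundles because each
  of them interacts with \<open>c\<close> in the way that the tangent axioms prescribe; for \<open>c\<close> itself this is the
  Yang-Baxter equation.\<close>

lemma do_morphism_p:
  assumes D [simp]: "dobj D"
  shows "do_morphism X (do_T X D) D (tp X (dob D))"
  by (rule do_morphism_total_linear) (simp_all add: dobj_do_T tp_natural pT_c)

lemma do_morphism_z:
  assumes D [simp]: "dobj D"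
  shows "do_morphism X D (do_T X D) (tz X (dob D))"
  by (rule do_morphism_total_linear) (simp_all add: dobj_do_T tz_natural c_Tz)

lemma do_morphism_l:
  assumes D [simp]: "dobj D"
  shows "do_morphism X (do_T X D) (do_T X (do_T X D)) (tl X (dob D))"
  by (rule do_morphism_total_linear) (simp_all add: dobj_do_T tl_natural l_c)

lemma do_morphism_c:
  assumes D [simp]: "dobj D"
  shows "do_morphism X (do_T X (do_T X D)) (do_T X (do_T X D)) (tc X (dob D))"
  by (rule do_morphism_total_linear) (simp_all add: dobj_do_T tc_natural yang_baxter)

subsection \<open>Fibre products\<close>

lemma do_T2_simps:
  "dob (do_T2 X D) = T2 X (dob D)"
  "dzero (do_T2 X D) = pairT2 X (dob D) (dzero (do_T X D)) (dzero (do_T X D))"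
  "dadd (do_T2 X D) = pairT2 X (dob D)
    (dadd (do_T X D) \<cdot> prod_arr X (q1 X (dob D)) (q1 X (dob D)))
    (dadd (do_T X D) \<cdot> prod_arr X (q2 X (dob D)) (q2 X (dob D)))"
  "dproj (do_T2 X D) = pairT2 X (dob D)
    (dproj (do_T X D) \<cdot> Ta X (q1 X (dob D))) (dproj (do_T X D) \<cdot> Ta X (q2 X (dob D)))"
  by (simp_all add: do_T2_def Let_def)

text \<open>\<open>T2 A\<close> is the wide pullback of two copies of \<open>p : T A \<rightarrow> A\<close>, whose base is the differential object
  \<open>A\<close> itself.\<close>

lemma dobj_do_T2:
  assumes D [simp]: "dobj D"
  shows "dobj (do_T2 X D)"
    and "do_morphism X (do_T2 X D) (do_T X D) (q1 X (dob D))"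
    and "do_morphism X (do_T2 X D) (do_T X D) (q2 X (dob D))"
proof -
  let ?A = "dob D"
  note [simp] = dobj_do_T do_T2_simps(1)
  note [simp del] = do_T_simps(2-4)
  have add: "tp X ?A \<cdot> dadd (do_T X D) \<cdot> prod_arr X (q1 X ?A) (q1 X ?A) =
      tp X ?A \<cdot> dadd (do_T X D) \<cdot> prod_arr X (q2 X ?A) (q2 X ?A)"
    by (simp add: do_morphism_x(3)[OF do_morphism_p] prod_arr_cmp)
  have proj: "tp X ?A \<cdot> dproj (do_T X D) \<cdot> Ta X (q1 X ?A) = tp X ?A \<cdot> dproj (do_T X D) \<cdot> Ta X (q2 X ?A)"
    by (simp add: do_morphism_x(1)[OF do_morphism_p])
  have typed: "dob_typed (do_T2 X D)"
    unfolding dob_typed_def do_T2_simps by (simp add: add proj)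
  show q: "do_morphism X (do_T2 X D) (do_T X D) (q1 X (dob D))"
    "do_morphism X (do_T2 X D) (do_T X D) (q2 X (dob D))"
    by (simp_all add: do_morphism_iff do_T2_simps add proj)
  show "dobj (do_T2 X D)"
  proof (rule dobj_wide_pullback[where I = UNIV and Di = "\<lambda>_. do_T X D" and E = D
        and pr = "\<lambda>i. if i then q1 X ?A else q2 X ?A" and b = "\<lambda>_. tp X ?A"])
    show "do_morphism X (do_T2 X D) (do_T X D) (if i then q1 X ?A else q2 X ?A)" for i
      using q by simp
    show "do_morphism X (do_T X D) D (tp X ?A)"
      by (rule do_morphism_p) simp
  next
    fix h h' assume "h \<in> Ar X" "h' \<in> Ar X" "Dom X h' = Dom X h" "Cod X h = dob (do_T2 X D)"
      "Cod X h' = dob (do_T2 X D)"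
      and eq: "\<And>i. i \<in> UNIV \<Longrightarrow> (if i then q1 X ?A else q2 X ?A) \<cdot> h = (if i then q1 X ?A else q2 X ?A) \<cdot> h'"
    then show "h = h'"
      using eq[of True] eq[of False] by - (rule T2_ext[where A = ?A], simp_all)
  next
    fix h h' assume "h \<in> Ar X" "h' \<in> Ar X" "Dom X h' = Dom X h" "Cod X h = To X (dob (do_T2 X D))"
      "Cod X h' = To X (dob (do_T2 X D))"
      and eq: "\<And>i. i \<in> UNIV \<Longrightarrow>
        Ta X (if i then q1 X ?A else q2 X ?A) \<cdot> h = Ta X (if i then q1 X ?A else q2 X ?A) \<cdot> h'"
    then show "h = h'"
      using eq[of True] eq[of False] by - (rule TT2_ext[where A = ?A], simp_all)
  next
    fix Q and v :: "bool \<Rightarrow> 'a" assume "Q \<in> Ob X"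
      and "\<And>i. i \<in> UNIV \<Longrightarrow> v i \<in> Ar X \<and> Dom X (v i) = Q \<and> Cod X (v i) = To X (dob (do_T X D)) \<and> total X (v i)"
      and "\<And>i j. i \<in> UNIV \<Longrightarrow> j \<in> UNIV \<Longrightarrow> Ta X (tp X ?A) \<cdot> v i = Ta X (tp X ?A) \<cdot> v j"
    note v = this(2)[OF UNIV_I] this(3)[OF UNIV_I UNIV_I, of True False]
    show "\<exists>h. h \<in> Ar X \<and> Dom X h = Q \<and> Cod X h = To X (dob (do_T2 X D)) \<and> total X h \<and>
        (\<forall>i \<in> UNIV. Ta X (if i then q1 X ?A else q2 X ?A) \<cdot> h = v i)"
      using v by (intro exI[of _ "pairTT2 X ?A (v True) (v False)"]) simp
  qed (simp_all add: typed)
qed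

lemma do_morphism_s:
  assumes D [simp]: "dobj D"
  shows "do_morphism X (do_T2 X D) (do_T X D) (ts X (dob D))"
proof -
  let ?A = "dob D"
  note q = dobj_do_T2(2,3)[OF D]
  have [simp]: "dobj (do_T X D)" "dobj (do_T2 X D)"
    by (simp_all add: dobj_do_T dobj_do_T2)
  let ?u = "pairT2 X (To X ?A) (tc X ?A \<cdot> Ta X (q1 X ?A)) (tc X ?A \<cdot> Ta X (q2 X ?A))"
  have "T2a X (dproj D) \<cdot> ?u = dproj (do_T2 X D)"
  proof (rule T2_ext[where A = ?A])
    show "q1 X ?A \<cdot> T2a X (dproj D) \<cdot> ?u = q1 X ?A \<cdot> dproj (do_T2 X D)"
      using do_morphismD(4)[OF q(1)] by (simp add: do_T2_simps(1))
    show "q2 X ?A \<cdot> T2a X (dproj D) \<cdot> ?u = q2 X ?A \<cdot> dproj (do_T2 X D)"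
      using do_morphismD(4)[OF q(2)] by (simp add: do_T2_simps(1))
  qed (simp_all add: do_T2_simps(1))
  then have "ts X ?A \<cdot> dproj (do_T2 X D) = dproj (do_T X D) \<cdot> Ta X (ts X ?A)"
    using ts_natural(2)[of "dproj D" ?A ?u] by (simp add: c_Ts)
  then show ?thesis
    by - (rule do_morphism_total_linear, simp_all add: do_T2_simps(1))
qed

subsection \<open>Products\<close>

lemma do_one_simps [simp]:
  "dob (do_one X) = One X" "dzero (do_one X) = Ide X (One X)"
  "dadd (do_one X) = bang X (One X) (Prd X (One X) (One X))"
  "dproj (do_one X) = bang X (One X) (To X (One X))"
  by (simp_all add: do_one_def)

text \<open>Every equation between total maps into the terminal object holds.\<close>

lemma dobj_do_one: "dobj (do_one X)"
proof -
  have "\<exists>!h. h \<in> Hom (Tot X) Q (To X (One X)) \<and> tp X (One X) \<cdot> h = f \<and> bang X (One X) (To X (One X)) \<cdot> h = g"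
    if f: "f \<in> Hom (Tot X) Q (One X)" and g: "g \<in> Hom (Tot X) Q (One X)" for Q f g
  proof -
    have [simp]: "f \<in> Ar X" "Dom X f = Q" "Cod X f = One X" "total X f"
      "g \<in> Ar X" "Dom X g = Q" "Cod X g = One X" "total X g"
      using that by (simp_all add: in_Hom_Tot)
    have [simp]: "Q \<in> Ob X"
      using dom_in_Ob[of f] by simp
    show ?thesis
    proof (rule ex1I[where a = "bang X (To X (One X)) Q"])
      have "tp X (One X) \<cdot> bang X (To X (One X)) Q = f"
        "bang X (One X) (To X (One X)) \<cdot> bang X (To X (One X)) Q = g"
        by (rule one_eq; simp)+
      then show "bang X (To X (One X)) Q \<in> Hom (Tot X) Q (To X (One X)) \<and>
          tp X (One X) \<cdot> bang X (To X (One X)) Q = f \<and>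
          bang X (One X) (To X (One X)) \<cdot> bang X (To X (One X)) Q = g"
        by (simp add: in_Hom_Tot)
    next
      fix h assume "h \<in> Hom (Tot X) Q (To X (One X)) \<and>
          tp X (One X) \<cdot> h = f \<and> bang X (One X) (To X (One X)) \<cdot> h = g"
      then show "h = bang X (To X (One X)) Q"
        by - (rule T_one_eq, simp_all add: in_Hom_Tot)
    qed
  qed
  then have "\<forall>Q. \<forall>f \<in> Hom (Tot X) Q (One X). \<forall>g \<in> Hom (Tot X) Q (One X).
      \<exists>!h. h \<in> Hom (Tot X) Q (To X (One X)) \<and> tp X (One X) \<cdot> h = f \<and> bang X (One X) (To X (One X)) \<cdot> h = g"
    by blast
  then have "is_product (Tot X) (One X) (One X) (To X (One X)) (tp X (One X)) (bang X (One X) (To X (One X)))"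
    unfolding is_product_def Tot_simps by (intro conjI) (simp_all add: in_Hom_Tot)
  moreover have "dob_typed (do_one X)"
    by (simp add: dob_typed_def)
  moreover have "dob_equations (do_one X)"
    unfolding dob_equations_def Let_def do_one_simps
    by (intro conjI; rule one_eq; simp)
  ultimately show ?thesis
    by (simp add: dobj_iff_Tot)
qed

lemma do_morphism_bang:
  assumes D [simp]: "dobj D"
  shows "do_morphism X D (do_one X) (bang X (One X) (dob D))"
  by (rule do_morphism_total_linear) (simp_all add: dobj_do_one)

lemma do_prod_simps:
  "dob (do_prod X D E) = Prd X (dob D) (dob E)"
  "dzero (do_prod X D E) = rpair X (dzero D) (dzero E)"
  "dadd (do_prod X D E) = rpair X
    (dadd D \<cdot> prod_arr X (pi1 X (dob D) (dob E)) (pi1 X (dob D) (dob E)))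
    (dadd E \<cdot> prod_arr X (pi2 X (dob D) (dob E)) (pi2 X (dob D) (dob E)))"
  "dproj (do_prod X D E) =
    rpair X (dproj D \<cdot> Ta X (pi1 X (dob D) (dob E))) (dproj E \<cdot> Ta X (pi2 X (dob D) (dob E)))"
  by (simp_all add: do_prod_def Let_def)

text \<open>A product is a wide pullback over the terminal object.\<close>

lemma dobj_do_prod:
  assumes D [simp]: "dobj D" and E [simp]: "dobj E"
  shows "dobj (do_prod X D E)"
    and "do_morphism X (do_prod X D E) D (pi1 X (dob D) (dob E))"
    and "do_morphism X (do_prod X D E) E (pi2 X (dob D) (dob E))"
proof -
  let ?A = "dob D" and ?B = "dob E"
  note [simp] = do_prod_simps(1)
  have typed: "dob_typed (do_prod X D E)"
    unfolding dob_typed_def do_prod_simps by simp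
  show pr: "do_morphism X (do_prod X D E) D (pi1 X ?A ?B)" "do_morphism X (do_prod X D E) E (pi2 X ?A ?B)"
    by (simp_all add: do_morphism_iff do_prod_simps)
  let ?Di = "\<lambda>i. if i then D else E" and ?pr = "\<lambda>i. if i then pi1 X ?A ?B else pi2 X ?A ?B"
  show "dobj (do_prod X D E)"
  proof (rule dobj_wide_pullback[where I = UNIV and Di = ?Di and E = "do_one X" and pr = ?pr
        and b = "\<lambda>i. bang X (One X) (dob (?Di i))"])
    show "do_morphism X (do_prod X D E) (?Di i) (?pr i)" for i
      using pr by simp
    show "do_morphism X (?Di i) (do_one X) (bang X (One X) (dob (?Di i)))" for i
      by (rule do_morphism_bang) simp
  next
    fix h h' assume "h \<in> Ar X" "h' \<in> Ar X" "Dom X h' = Dom X h" "Cod X h = dob (do_prod X D E)"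
      "Cod X h' = dob (do_prod X D E)" and eq: "\<And>i. i \<in> UNIV \<Longrightarrow> ?pr i \<cdot> h = ?pr i \<cdot> h'"
    then show "h = h'"
      using eq[of True] eq[of False] by - (rule prod_ext[where A = ?A and B = ?B], simp_all)
  next
    fix h h' assume "h \<in> Ar X" "h' \<in> Ar X" "Dom X h' = Dom X h" "Cod X h = To X (dob (do_prod X D E))"
      "Cod X h' = To X (dob (do_prod X D E))" and eq: "\<And>i. i \<in> UNIV \<Longrightarrow> Ta X (?pr i) \<cdot> h = Ta X (?pr i) \<cdot> h'"
    then show "h = h'"
      using eq[of True] eq[of False] by - (rule T_prod_ext[where A = ?A and B = ?B], simp_all)
  next
    fix Q and v :: "bool \<Rightarrow> 'a" assume "Q \<in> Ob X"
      and v: "\<And>i. i \<in> UNIV \<Longrightarrow> v i \<in> Ar X \<and> Dom X (v i) = Q \<and> Cod X (v i) = To X (dob (?Di i)) \<and> total X (v i)"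
    show "\<exists>h. h \<in> Ar X \<and> Dom X h = Q \<and> Cod X h = To X (dob (do_prod X D E)) \<and> total X h \<and>
        (\<forall>i \<in> UNIV. Ta X (?pr i) \<cdot> h = v i)"
      using v[of True] v[of False] by (intro exI[of _ "pairTprod X ?A ?B (v True) (v False)"]) simp
  qed (simp_all add: typed dobj_do_one)
qed

subsection \<open>Fibre powers\<close>

lemma fibre_powerD:
  assumes "fibre_power X n b P pr"
  shows "P \<in> Ob X" "i < n \<Longrightarrow> pr i \<in> Ar X" "i < n \<Longrightarrow> Dom X (pr i) = P" "i < n \<Longrightarrow> Cod X (pr i) = Dom X b"
    "i < n \<Longrightarrow> total X (pr i)" "i < n \<Longrightarrow> j < n \<Longrightarrow> b \<cdot> pr i = b \<cdot> pr j"
  using assms unfolding fibre_power_def in_Hom by blast+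

lemma fibre_power_ex1:
  assumes "fibre_power X n b P pr" "Q \<in> Ob X"
    "\<And>i. i < n \<Longrightarrow> u i \<in> Hom X Q (Dom X b)" "\<And>i j. i < n \<Longrightarrow> j < n \<Longrightarrow> b \<cdot> u i = b \<cdot> u j"
  shows "\<exists>!h. h \<in> Hom X Q P \<and> (\<forall>i<n. pr i \<cdot> h = u i)"
proof -
  have "\<forall>Q \<in> Ob X. \<forall>u. (\<forall>i<n. u i \<in> Hom X Q (Dom X b)) \<and> (\<forall>i<n. \<forall>j<n. b \<cdot> u i = b \<cdot> u j) \<longrightarrow>
      (\<exists>!h. h \<in> Hom X Q P \<and> (\<forall>i<n. pr i \<cdot> h = u i))"
    using assms(1) unfolding fibre_power_def by (elim conjE)
  from mp[OF spec[OF bspec[OF this assms(2)], of u]] show ?thesis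
    using assms(3,4) by blast
qed

lemma fibre_power_ext:
  assumes P: "fibre_power X n b P pr" and b: "b \<in> Ar X"
    and h: "h \<in> Ar X" "h' \<in> Ar X" "Dom X h' = Dom X h" "Cod X h = P" "Cod X h' = P"
    and eq: "\<And>i. i < n \<Longrightarrow> pr i \<cdot> h = pr i \<cdot> h'"
  shows "h = h'"
proof -
  note [simp] = fibre_powerD(1-5)[OF P] h b
  have "\<exists>!k. k \<in> Hom X (Dom X h) P \<and> (\<forall>i<n. pr i \<cdot> k = pr i \<cdot> h')"
  proof (rule fibre_power_ex1[OF P])
    show "b \<cdot> pr i \<cdot> h' = b \<cdot> pr j \<cdot> h'" if "i < n" "j < n" for i j
      by (rule assoc_eq[OF fibre_powerD(6)[OF P]]) (use that in simp_all)
  qed (simp_all add: in_Hom)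
  moreover have "h \<in> Hom X (Dom X h) P \<and> (\<forall>i<n. pr i \<cdot> h = pr i \<cdot> h')"
    "h' \<in> Hom X (Dom X h) P \<and> (\<forall>i<n. pr i \<cdot> h' = pr i \<cdot> h')"
    by (simp_all add: in_Hom eq)
  ultimately show ?thesis
    by blast
qed

lemma fibre_power_lift:
  assumes P: "fibre_power X n b P pr" "1 \<le> n" "Q \<in> Ob X"
    and u: "\<And>i. i < n \<Longrightarrow> u i \<in> Ar X \<and> Dom X (u i) = Q \<and> Cod X (u i) = Dom X b \<and> total X (u i)"
      "\<And>i j. i < n \<Longrightarrow> j < n \<Longrightarrow> b \<cdot> u i = b \<cdot> u j"
  obtains h where "h \<in> Ar X" "Dom X h = Q" "Cod X h = P" "total X h" "\<And>i. i < n \<Longrightarrow> pr i \<cdot> h = u i"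
proof -
  have "\<exists>!h. h \<in> Hom X Q P \<and> (\<forall>i<n. pr i \<cdot> h = u i)"
    by (rule fibre_power_ex1[OF P(1,3)]) (use u(1) in \<open>simp add: in_Hom\<close>, fact u(2))
  then obtain h where h: "h \<in> Ar X" "Dom X h = Q" "Cod X h = P" "\<And>i. i < n \<Longrightarrow> pr i \<cdot> h = u i"
    unfolding in_Hom by blast
  have "total X h"
    by (rule total_of_pi1[where u = "pr 0" and f = "u 0"]) (use h u P fibre_powerD[OF P(1)] in simp_all)
  then show ?thesis
    by (rule that[OF h(1-3) _ h(4)])
qed

text \<open>The structure maps of the fibre power are induced by those of the factors: since \<open>p\<close> is a morphism
  of differential objects, these have a common image in the base.\<close>

lemma dobj_fibre_power:
  assumes D [simp]: "dobj D" and n: "1 \<le> n"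
    and P: "fibre_power X n (tp X (dob D)) P pr"
    and TP: "fibre_power X n (Ta X (tp X (dob D))) (To X P) (\<lambda>i. Ta X (pr i))"
  obtains K where "dobj K" "dob K = P" "\<And>i. i < n \<Longrightarrow> do_morphism X K (do_T X D) (pr i)"
proof -
  let ?A = "dob D" and ?TD = "do_T X D"
  note [simp] = dobj_do_T fibre_powerD(1-5)[OF P]
  note [simp del] = do_T_simps(2-4)
  have cone_x: "tp X ?A \<cdot> pr i \<cdot> x = tp X ?A \<cdot> pr j \<cdot> x" if "i < n" "j < n" "x \<in> Ar X" "Cod X x = P" for i j x
    by (rule assoc_eq[OF fibre_powerD(6)[OF P]]) (use that in simp_all)
  obtain \<zeta> where \<zeta>: "\<zeta> \<in> Ar X" "Dom X \<zeta> = One X" "Cod X \<zeta> = P" "total X \<zeta>"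
      "\<And>i. i < n \<Longrightarrow> pr i \<cdot> \<zeta> = dzero ?TD"
    by (rule fibre_power_lift[OF P n, where Q = "One X" and u = "\<lambda>_. dzero ?TD"]) auto
  obtain \<sigma> where \<sigma>: "\<sigma> \<in> Ar X" "Dom X \<sigma> = Prd X P P" "Cod X \<sigma> = P" "total X \<sigma>"
      "\<And>i. i < n \<Longrightarrow> pr i \<cdot> \<sigma> = dadd ?TD \<cdot> prod_arr X (pr i) (pr i)"
  proof (rule fibre_power_lift[OF P n, where Q = "Prd X P P" and u = "\<lambda>i. dadd ?TD \<cdot> prod_arr X (pr i) (pr i)"])
    show "tp X ?A \<cdot> dadd ?TD \<cdot> prod_arr X (pr i) (pr i) = tp X ?A \<cdot> dadd ?TD \<cdot> prod_arr X (pr j) (pr j)"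
      if "i < n" "j < n" for i j
      using that fibre_powerD(6)[OF P, of i j] by (simp add: do_morphism_x(3)[OF do_morphism_p] prod_arr_cmp)
  qed auto
  obtain ph where ph: "ph \<in> Ar X" "Dom X ph = To X P" "Cod X ph = P" "total X ph"
      "\<And>i. i < n \<Longrightarrow> pr i \<cdot> ph = dproj ?TD \<cdot> Ta X (pr i)"
  proof (rule fibre_power_lift[OF P n, where Q = "To X P" and u = "\<lambda>i. dproj ?TD \<cdot> Ta X (pr i)"])
    show "tp X ?A \<cdot> dproj ?TD \<cdot> Ta X (pr i) = tp X ?A \<cdot> dproj ?TD \<cdot> Ta X (pr j)" if "i < n" "j < n" for i j
      using that fibre_powerD(6)[OF TP, of i j] by (simp add: do_morphism_x(1)[OF do_morphism_p])
  qed auto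
  let ?K = "\<lparr>dob = P, dzero = \<zeta>, dadd = \<sigma>, dproj = ph\<rparr>"
  note [simp] = \<zeta>(1-4) \<sigma>(1-4) ph(1-4)
  have pr: "do_morphism X ?K ?TD (pr i)" if "i < n" for i
    using that by (simp add: do_morphism_iff \<zeta>(5) \<sigma>(5) ph(5))
  have "dobj ?K"
  proof (rule dobj_wide_pullback[where I = "{..<n}" and Di = "\<lambda>_. ?TD" and E = D and pr = pr and b = "\<lambda>_. tp X ?A"])
    show "dob_typed ?K"
      by (simp add: dob_typed_def)
    show "do_morphism X ?K ?TD (pr i)" if "i \<in> {..<n}" for i
      using that pr by simp
    show "do_morphism X ?TD D (tp X ?A)"
      by (rule do_morphism_p) simp
    show "tp X ?A \<cdot> pr i = tp X ?A \<cdot> pr j" if "i \<in> {..<n}" "j \<in> {..<n}" for i j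
      using that fibre_powerD(6)[OF P, of i j] by simp
  next
    fix h h' assume "h \<in> Ar X" "h' \<in> Ar X" "Dom X h' = Dom X h" "Cod X h = dob ?K" "Cod X h' = dob ?K"
      "\<And>i. i \<in> {..<n} \<Longrightarrow> pr i \<cdot> h = pr i \<cdot> h'"
    then show "h = h'"
      by - (rule fibre_power_ext[OF P], simp_all)
  next
    fix h h' assume "h \<in> Ar X" "h' \<in> Ar X" "Dom X h' = Dom X h" "Cod X h = To X (dob ?K)" "Cod X h' = To X (dob ?K)"
      "\<And>i. i \<in> {..<n} \<Longrightarrow> Ta X (pr i) \<cdot> h = Ta X (pr i) \<cdot> h'"
    then show "h = h'"
      by - (rule fibre_power_ext[OF TP], simp_all)
  next
    fix Q v assume Q: "Q \<in> Ob X"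
      and v: "\<And>i. i \<in> {..<n} \<Longrightarrow> v i \<in> Ar X \<and> Dom X (v i) = Q \<and> Cod X (v i) = To X (dob ?TD) \<and> total X (v i)"
        "\<And>i j. i \<in> {..<n} \<Longrightarrow> j \<in> {..<n} \<Longrightarrow> Ta X (tp X ?A) \<cdot> v i = Ta X (tp X ?A) \<cdot> v j"
    obtain h where "h \<in> Ar X" "Dom X h = Q" "Cod X h = To X P" "total X h" "\<And>i. i < n \<Longrightarrow> Ta X (pr i) \<cdot> h = v i"
    proof (rule fibre_power_lift[OF TP n Q])
      show "v i \<in> Ar X \<and> Dom X (v i) = Q \<and> Cod X (v i) = Dom X (Ta X (tp X ?A)) \<and> total X (v i)"
        if "i < n" for i
        using v(1)[of i] that by simp
      show "Ta X (tp X ?A) \<cdot> v i = Ta X (tp X ?A) \<cdot> v j" if "i < n" "j < n" for i j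
        by (rule v(2)) (use that in simp_all)
    qed blast
    then show "\<exists>h. h \<in> Ar X \<and> Dom X h = Q \<and> Cod X h = To X (dob ?K) \<and> total X h \<and>
        (\<forall>i \<in> {..<n}. Ta X (pr i) \<cdot> h = v i)"
      by (intro exI[of _ h]) simp
  qed simp_all
  then show ?thesis
    using pr by (intro that[of ?K]) simp_all
qed

subsection \<open>Splittings of restriction idempotents\<close>

text \<open>A splitting \<open>e = s \<cdot> r\<close> of a restriction idempotent makes \<open>E\<close> a retract of \<open>A\<close>, and \<open>E\<close> inherits the
  structure \<open>r \<cdot> \<zeta>\<close>, \<open>r \<cdot> \<sigma> \<cdot> (s \<times> s)\<close>, \<open>r \<cdot> ph \<cdot> T s\<close>.  These maps are total although \<open>r\<close> is partial,
  because \<open>e\<close> is a morphism: after composition with \<open>s\<close> they are \<open>\<zeta>\<close>, \<open>\<sigma> \<cdot> (s \<times> s)\<close> and \<open>ph \<cdot> T s\<close>.  The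
  equations are reflected by the single monic map \<open>s\<close>.\<close>

lemma dobj_split:
  assumes D [simp]: "dobj D" and e: "do_morphism X D D e"
    and r [simp]: "r \<in> Ar X" "Dom X r = dob D" "Cod X r = E"
    and s [simp]: "s \<in> Ar X" "Dom X s = E" "Cod X s = dob D"
    and sr: "s \<cdot> r = e" and rs: "r \<cdot> s = Ide X E"
  obtains K where "dobj K" "dob K = E" "do_morphism X D K r" "do_morphism X K D s"
proof -
  let ?A = "dob D"
  note [simp] = do_morphismD(1-3)[OF e]
  have E [simp]: "E \<in> Ob X"
    using dom_in_Ob[OF s(1)] by simp
  have [simp]: "total X s"
    by (rule total_cancel[where g = r]) (simp_all add: rs)
  have srx: "s \<cdot> r \<cdot> x = e \<cdot> x" if "x \<in> Ar X" "Cod X x = ?A" for x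
    by (rule assoc_reduce[OF sr]) (use that in simp_all)
  have rsx: "r \<cdot> s \<cdot> x = x" if "x \<in> Ar X" "Cod X x = E" for x
    using assoc_reduce[OF rs, of x] that by simp
  have es: "e \<cdot> s = s"
    using assoc_reduce[OF sr, of s] by (simp add: rs)
  have re: "r \<cdot> e = r"
    using assoc_reduce[OF rs, of r] by (simp add: sr)
  have esx: "e \<cdot> s \<cdot> x = s \<cdot> x" if "x \<in> Ar X" "Cod X x = E" for x
    by (rule assoc_reduce[OF es]) (use that in simp_all)
  have rex: "r \<cdot> e \<cdot> x = r \<cdot> x" if "x \<in> Ar X" "Cod X x = ?A" for x
    by (rule assoc_reduce[OF re]) (use that in simp_all)
  have T: "Ta X e \<cdot> Ta X s = Ta X s" "Ta X s \<cdot> Ta X r = Ta X e" "Ta X r \<cdot> Ta X s = Ide X (To X E)"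
    using T_cmp_cong[OF es] T_cmp_cong[OF sr] T_cmp_cong[OF rs] by simp_all
  have Tsrx: "Ta X s \<cdot> Ta X r \<cdot> x = Ta X e \<cdot> x" if "x \<in> Ar X" "Cod X x = To X ?A" for x
    by (rule assoc_reduce[OF T(2)]) (use that in simp_all)
  have Trsx: "Ta X r \<cdot> Ta X s \<cdot> x = x" if "x \<in> Ar X" "Cod X x = To X E" for x
    using assoc_reduce[OF T(3), of x] that by simp
  let ?\<zeta> = "r \<cdot> dzero D" and ?\<sigma> = "r \<cdot> dadd D \<cdot> prod_arr X s s" and ?ph = "r \<cdot> dproj D \<cdot> Ta X s"
  let ?K = "\<lparr>dob = E, dzero = ?\<zeta>, dadd = ?\<sigma>, dproj = ?ph\<rparr>"
  have s\<zeta>: "s \<cdot> ?\<zeta> = dzero D"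
    using do_morphismD(5)[OF e] by (simp add: srx)
  have s\<sigma>: "s \<cdot> ?\<sigma> = dadd D \<cdot> prod_arr X s s"
    using do_morphism_x(3)[OF e, of "prod_arr X s s"] by (simp add: srx prod_arr_cmp es)
  have sph: "s \<cdot> ?ph = dproj D \<cdot> Ta X s"
    using do_morphism_x(1)[OF e, of "Ta X s"] by (simp add: srx T)
  have "total X ?\<zeta>"
    by (rule total_of_pi1[where u = s, OF _ _ _ s\<zeta>]) simp_all
  moreover have "total X ?\<sigma>"
    by (rule total_of_pi1[where u = s, OF _ _ _ s\<sigma>]) simp_all
  moreover have "total X ?ph"
    by (rule total_of_pi1[where u = s, OF _ _ _ sph]) simp_all
  ultimately have typed: "dob_typed ?K"
    unfolding dob_typed_def by simp
  have sK: "do_morphism X ?K D s"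
    by (simp add: do_morphism_iff s\<zeta> s\<sigma> sph)
  have rK: "do_morphism X D ?K r"
    using rex[of "dproj D"] rex[of "dadd D"]
    by (simp add: do_morphism_iff prod_arr_cmp sr T do_morphismD(4,6)[OF e])
  have s_mono: "h = h'" if "h \<in> Ar X" "h' \<in> Ar X" "Cod X h = E" "Cod X h' = E" "s \<cdot> h = s \<cdot> h'" for h h'
    using rsx[of h] rsx[of h'] that by metis
  have "dob_equations ?K"
  proof (rule dob_equations_reflect[where I = "{()}" and Di = "\<lambda>_. D" and pr = "\<lambda>_. s"])
    fix h h' assume "h \<in> Ar X" "h' \<in> Ar X" "Cod X h = dob ?K" "Cod X h' = dob ?K"
      "\<And>i. i \<in> {()} \<Longrightarrow> s \<cdot> h = s \<cdot> h'"
    then show "h = h'"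
      by - (rule s_mono, simp_all)
  qed (simp_all add: typed sK)
  moreover have "\<exists>!h. h \<in> Hom (Tot X) Q (To X E) \<and> tp X E \<cdot> h = f \<and> ?ph \<cdot> h = g"
    if "f \<in> Hom (Tot X) Q E" "g \<in> Hom (Tot X) Q E" for Q f g
  proof -
    have [simp]: "f \<in> Ar X" "Dom X f = Q" "Cod X f = E" "total X f"
        "g \<in> Ar X" "Dom X g = Q" "Cod X g = E" "total X g"
      using that by (simp_all add: in_Hom_Tot)
    obtain v where v [simp]: "v \<in> Ar X" "Dom X v = Q" "Cod X v = To X ?A" "total X v"
      and pv: "tp X ?A \<cdot> v = s \<cdot> f" "dproj D \<cdot> v = s \<cdot> g"
      by (rule dob_proj_pair[OF D, of "s \<cdot> f" "s \<cdot> g"]) simp_all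
    \<comment> \<open>\<open>e\<close> fixes both components of the tangent vector \<open>v\<close>, so \<open>v\<close> is tangent to \<open>E\<close>\<close>
    have Tev: "Ta X e \<cdot> v = v"
      by (rule dob_proj_ext[OF D])
        (simp_all add: tp_natural do_morphism_x(1)[OF e, symmetric] pv esx)
    have ps: "tp X ?A \<cdot> Ta X s \<cdot> x = s \<cdot> tp X E \<cdot> x" if "x \<in> Ar X" "Cod X x = To X E" for x
      using tp_natural(2)[of s ?A x] that by simp
    have phs: "dproj D \<cdot> Ta X s \<cdot> x = s \<cdot> ?ph \<cdot> x" if "x \<in> Ar X" "Cod X x = To X E" for x
      using assoc_eq[OF sph, of x] that by simp
    show ?thesis
    proof (rule ex1I[where a = "Ta X r \<cdot> v"])
      have "tp X E \<cdot> Ta X r \<cdot> v = f"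
        by (rule s_mono) (use ps[of "Ta X r \<cdot> v"] in \<open>simp_all add: Tsrx Tev pv\<close>)
      moreover have "?ph \<cdot> Ta X r \<cdot> v = g"
        by (rule s_mono) (use phs[of "Ta X r \<cdot> v"] in \<open>simp_all add: Tsrx Tev pv\<close>)
      moreover have "total X (Ta X r \<cdot> v)"
        by (rule total_of_pi1[where u = "Ta X s" and f = v]) (simp_all add: Tsrx Tev)
      ultimately show "Ta X r \<cdot> v \<in> Hom (Tot X) Q (To X E) \<and> tp X E \<cdot> Ta X r \<cdot> v = f \<and> ?ph \<cdot> Ta X r \<cdot> v = g"
        by (simp add: in_Hom_Tot)
    next
      fix h assume "h \<in> Hom (Tot X) Q (To X E) \<and> tp X E \<cdot> h = f \<and> ?ph \<cdot> h = g"
      then have h [simp]: "h \<in> Ar X" "Dom X h = Q" "Cod X h = To X E" and eq: "tp X E \<cdot> h = f" "?ph \<cdot> h = g"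
        by (simp_all add: in_Hom_Tot)
      have "Ta X s \<cdot> h = v"
        by (rule dob_proj_ext[OF D]) (use eq in \<open>simp_all add: ps phs pv del: assoc\<close>)
      then show "h = Ta X r \<cdot> v"
        using Trsx[of h] by simp
    qed
  qed
  then have "\<forall>Q. \<forall>f \<in> Hom (Tot X) Q E. \<forall>g \<in> Hom (Tot X) Q E.
      \<exists>!h. h \<in> Hom (Tot X) Q (To X E) \<and> tp X E \<cdot> h = f \<and> ?ph \<cdot> h = g"
    by blast
  then have "is_product (Tot X) E E (To X E) (tp X E) ?ph"
    using dob_typed(10-13)[OF typed] unfolding is_product_def Tot_simps
    by (intro conjI) (simp_all add: in_Hom_Tot)
  ultimately have "dobj ?K"
    using typed by (simp add: dobj_iff_Tot)
  then show ?thesis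
    using rK sK by (intro that[of ?K]) simp_all
qed

end

section \<open>The Cartesian tangent category of differential objects\<close>

context tangent_split_restriction_category
begin

lemmas tangent_axioms [simp] = p_z p_s s_unit s_comm Tp_l l_z pT_c c_Tz Tl_l c_l c_Tc_l c_c

lemma tp_ts_x [simp]:
  "A \<in> Ob X \<Longrightarrow> x \<in> Ar X \<Longrightarrow> Cod X x = T2 X A \<Longrightarrow> tp X A \<cdot> ts X A \<cdot> x = tp X A \<cdot> q1 X A \<cdot> x"
  using assoc_eq[OF p_s, of A x] by simp

lemma tp_tz_x [simp]: "A \<in> Ob X \<Longrightarrow> x \<in> Ar X \<Longrightarrow> Cod X x = A \<Longrightarrow> tp X A \<cdot> tz X A \<cdot> x = x"
  using assoc_reduce[OF p_z, of A x] by simp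

lemma Tp_tl_x [simp]:
  "A \<in> Ob X \<Longrightarrow> x \<in> Ar X \<Longrightarrow> Cod X x = To X A \<Longrightarrow> Ta X (tp X A) \<cdot> tl X A \<cdot> x = tz X A \<cdot> tp X A \<cdot> x"
  by (rule assoc_eq[OF Tp_l]) simp_all

lemma Tp_tz_x [simp]:
  "A \<in> Ob X \<Longrightarrow> x \<in> Ar X \<Longrightarrow> Cod X x = To X A \<Longrightarrow> Ta X (tp X A) \<cdot> tz X (To X A) \<cdot> x = tz X A \<cdot> tp X A \<cdot> x"
  using tz_natural(2)[of "tp X A" A x] by simp

end

locale do_context = cartesian_tangent_split_restriction_category X for X :: "('o, 'a) ctcat" (structure)
begin

lemma DO_simps [simp]:
  "Ob (DO X) = {D. dobj D}"
  "Dom (DO X) (D, E, f) = D" "Cod (DO X) (D, E, f) = E" "Ide (DO X) D = (D, D, Ide X (dob D))"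
  "Cmp (DO X) (D', K, g) (D, E, f) = (D, K, g \<cdot> f)" "Rst (DO X) (D, E, f) = (D, D, Rst X f)"
  "To (DO X) = do_T X" "Ta (DO X) (D, E, f) = (do_T X D, do_T X E, Ta X f)" "T2 (DO X) = do_T2 X"
  "q1 (DO X) D = (do_T2 X D, do_T X D, q1 X (dob D))" "q2 (DO X) D = (do_T2 X D, do_T X D, q2 X (dob D))"
  "tp (DO X) D = (do_T X D, D, tp X (dob D))" "tz (DO X) D = (D, do_T X D, tz X (dob D))"
  "ts (DO X) D = (do_T2 X D, do_T X D, ts X (dob D))"
  "tl (DO X) D = (do_T X D, do_T X (do_T X D), tl X (dob D))"
  "tc (DO X) D = (do_T X (do_T X D), do_T X (do_T X D), tc X (dob D))"
  "One (DO X) = do_one X" "Prd (DO X) = do_prod X"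
  "pi1 (DO X) D E = (do_prod X D E, D, pi1 X (dob D) (dob E))"
  "pi2 (DO X) D E = (do_prod X D E, E, pi2 X (dob D) (dob E))"
  by (simp_all add: DO_def)

lemma Ar_DO: "t \<in> Ar (DO X) \<longleftrightarrow> (\<exists>D E f. t = (D, E, f) \<and> dobj D \<and> dobj E \<and> do_morphism X D E f)"
  using do_morphism_rst by (cases t) (auto simp: DO_def)

lemma Ar_DO_iff [simp]: "(D, E, f) \<in> Ar (DO X) \<longleftrightarrow> dobj D \<and> dobj E \<and> do_morphism X D E f"
  by (simp add: Ar_DO)

lemma Hom_DO: "t \<in> Hom (DO X) D E \<longleftrightarrow> (\<exists>f. t = (D, E, f) \<and> dobj D \<and> dobj E \<and> do_morphism X D E f)"
  by (auto simp: Hom_def Ar_DO)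

lemma Hom_DO_iff [simp]:
  "(D', E', f) \<in> Hom (DO X) D E \<longleftrightarrow> D' = D \<and> E' = E \<and> dobj D \<and> dobj E \<and> do_morphism X D E f"
  by (auto simp: Hom_DO)

lemma total_DO: "do_morphism X D E f \<Longrightarrow> total (DO X) (D, E, f) \<longleftrightarrow> total X f"
  by (auto simp: total_def do_morphismD(2))

lemma DO_restriction: "restriction_category (DO X)"
proof -
  have "do_morphism X D K (g \<cdot> f)"
    if "do_morphism X D E f" "do_morphism X E K g" "dobj D" "dobj E" "dobj K" for D E K f g
    using that by (auto intro: do_morphism_cmp)
  moreover have "Rst X f \<cdot> Rst X g = Rst X g \<cdot> Rst X f"
    if "do_morphism X D E f" "do_morphism X D K g" for D E K f g
    using that by (simp add: rst_comm do_morphismD)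
  moreover have "Rst X g \<cdot> f = f \<cdot> Rst X (g \<cdot> f)"
    if "do_morphism X D E f" "do_morphism X E K g" for D E K f g
    by (rule rst_slide') (use do_morphismD[OF that(1)] do_morphismD[OF that(2)] in simp_all)
  ultimately show ?thesis
    by unfold_locales
      (auto simp: Hom_DO Ar_DO do_morphismD do_morphism_ide do_morphism_rst)
qed

lemma DO_split: "split_restriction_category (DO X)"
proof -
  interpret DO: restriction_category "DO X"
    by (rule DO_restriction)
  show ?thesis
  proof
    fix t D assume t: "t \<in> Hom (DO X) D D" and idem: "t = Rst (DO X) t"
    then obtain e where te: "t = (D, D, e)" and D [simp]: "dobj D" and e: "do_morphism X D D e"
      by (auto simp: Hom_DO)
    have "e \<in> Hom X (dob D) (dob D)" "e = Rst X e"
      using do_morphismD[OF e] idem te by (simp_all add: in_Hom)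
    then obtain E r s where "r \<in> Hom X (dob D) E" "s \<in> Hom X E (dob D)" and rs: "s \<cdot> r = e" "r \<cdot> s = Ide X E"
      using rst_idem_split by blast
    then obtain K where "dobj K" "dob K = E" "do_morphism X D K r" "do_morphism X K D s"
      using dobj_split[OF D e, of r E s] by (auto simp: in_Hom)
    then show "\<exists>E r s. E \<in> Ob (DO X) \<and> r \<in> Hom (DO X) D E \<and> s \<in> Hom (DO X) E D \<and>
        s \<cdot>\<^bsub>DO X\<^esub> r = t \<and> r \<cdot>\<^bsub>DO X\<^esub> s = Ide (DO X) E"
      using rs te by (intro exI[of _ K] exI[of _ "(D, K, r)"] exI[of _ "(K, D, s)"]) simp
  qed
qed

text \<open>Restriction limits of \<open>X\<close> whose projections are morphisms of differential objects are
  restriction limits of \<open>DO X\<close>, since the projections reflect morphisms.\<close>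

lemma DO_pullback:
  assumes P: "restriction_pullback X f g (dob K) u v"
    and dobjs [simp]: "dobj A" "dobj B" "dobj C" "dobj K"
    and f: "do_morphism X A C f" and g: "do_morphism X B C g"
    and u: "do_morphism X K A u" and v: "do_morphism X K B v"
  shows "restriction_pullback (DO X) (A, C, f) (B, C, g) K (K, A, u) (K, B, v)"
proof -
  note [simp] = do_morphismD(1-3)[OF f] do_morphismD(1-3)[OF g] do_morphismD(1-3)[OF u] do_morphismD(1-3)[OF v]
    pullbackD(5,9)[OF P]
  have "\<exists>!h. h \<in> Hom (DO X) Q K \<and> (K, A, u) \<cdot>\<^bsub>DO X\<^esub> h = a \<and> (K, B, v) \<cdot>\<^bsub>DO X\<^esub> h = b"
    if ab: "a \<in> Hom (DO X) Q A" "b \<in> Hom (DO X) Q B"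
      and eq: "(A, C, f) \<cdot>\<^bsub>DO X\<^esub> a = (B, C, g) \<cdot>\<^bsub>DO X\<^esub> b" for Q a b
  proof -
    from ab obtain a' b' where [simp]: "a = (Q, A, a')" "b = (Q, B, b')" "dobj Q"
      and a': "do_morphism X Q A a'" and b': "do_morphism X Q B b'"
      by (auto simp: Hom_DO)
    note [simp] = do_morphismD(1-3)[OF a'] do_morphismD(1-3)[OF b']
    have "\<exists>!h. h \<in> Hom X (Dom X a') (dob K) \<and> u \<cdot> h = a' \<and> v \<cdot> h = b'"
      by (rule pullback_ex1[OF P]) (use eq in simp_all)
    then obtain h where h: "h \<in> Ar X" "Dom X h = dob Q" "Cod X h = dob K" "u \<cdot> h = a'" "v \<cdot> h = b'"
      by (auto simp: in_Hom)
    have hK: "do_morphism X Q K h"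
    proof (rule do_morphism_reflect[where I = UNIV and Di = "\<lambda>i. if i then A else B"
          and pr = "\<lambda>i. if i then u else v"])
      fix k k' assume "k \<in> Ar X" "k' \<in> Ar X" "Dom X k' = Dom X k" "Cod X k = dob K" "Cod X k' = dob K"
        and eq: "\<And>i. i \<in> UNIV \<Longrightarrow> (if i then u else v) \<cdot> k = (if i then u else v) \<cdot> k'"
      then show "k = k'"
        using eq[of True] eq[of False] by - (rule pullback_ext[OF P], simp_all)
    qed (use h a' b' u v in simp_all)
    show ?thesis
    proof (rule ex1I[where a = "(Q, K, h)"])
      fix k assume "k \<in> Hom (DO X) Q K \<and> (K, A, u) \<cdot>\<^bsub>DO X\<^esub> k = a \<and> (K, B, v) \<cdot>\<^bsub>DO X\<^esub> k = b"
      then obtain k' where k: "k = (Q, K, k')" "do_morphism X Q K k'" "u \<cdot> k' = a'" "v \<cdot> k' = b'"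
        by (auto simp: Hom_DO)
      have "k' = h"
        using h k do_morphismD[OF k(2)] by - (rule pullback_ext[OF P], simp_all)
      then show "k = (Q, K, h)"
        using k by simp
    qed (use hK h in simp)
  qed
  then show ?thesis
    unfolding restriction_pullback_def using u v pullbackD(10)[OF P]
    by (intro conjI) (simp_all add: total_DO)
qed

lemma DO_product:
  assumes P: "restriction_product X (dob A) (dob B) (dob K) u v"
    and dobjs [simp]: "dobj A" "dobj B" "dobj K"
    and u: "do_morphism X K A u" and v: "do_morphism X K B v"
  shows "restriction_product (DO X) A B K (K, A, u) (K, B, v)"
proof -
  note [simp] = do_morphismD(1-3)[OF u] do_morphismD(1-3)[OF v] productD(5,9)[OF P]
  have "\<exists>!h. h \<in> Hom (DO X) Q K \<and> (K, A, u) \<cdot>\<^bsub>DO X\<^esub> h = a \<cdot>\<^bsub>DO X\<^esub> Rst (DO X) b \<and>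
      (K, B, v) \<cdot>\<^bsub>DO X\<^esub> h = b \<cdot>\<^bsub>DO X\<^esub> Rst (DO X) a"
    if ab: "a \<in> Hom (DO X) Q A" "b \<in> Hom (DO X) Q B" for Q a b
  proof -
    from ab obtain a' b' where [simp]: "a = (Q, A, a')" "b = (Q, B, b')" "dobj Q"
      and a': "do_morphism X Q A a'" and b': "do_morphism X Q B b'"
      by (auto simp: Hom_DO)
    note [simp] = do_morphismD(1-3)[OF a'] do_morphismD(1-3)[OF b']
    have "\<exists>!h. h \<in> Hom X (Dom X a') (dob K) \<and> u \<cdot> h = a' \<cdot> Rst X b' \<and> v \<cdot> h = b' \<cdot> Rst X a'"
      by (rule product_ex1[OF P]) simp_all
    then obtain h where h: "h \<in> Ar X" "Dom X h = dob Q" "Cod X h = dob K" "u \<cdot> h = a' \<cdot> Rst X b'" "v \<cdot> h = b' \<cdot> Rst X a'"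
      by (auto simp: in_Hom)
    have hK: "do_morphism X Q K h"
    proof (rule do_morphism_reflect[where I = UNIV and Di = "\<lambda>i. if i then A else B"
          and pr = "\<lambda>i. if i then u else v"])
      fix k k' assume "k \<in> Ar X" "k' \<in> Ar X" "Dom X k' = Dom X k" "Cod X k = dob K" "Cod X k' = dob K"
        and eq: "\<And>i. i \<in> UNIV \<Longrightarrow> (if i then u else v) \<cdot> k = (if i then u else v) \<cdot> k'"
      then show "k = k'"
        using eq[of True] eq[of False] by - (rule product_ext[OF P], simp_all)
    next
      have "do_morphism X Q A (a' \<cdot> Rst X b')" "do_morphism X Q B (b' \<cdot> Rst X a')"
        using a' b' by (auto intro!: do_morphism_cmp do_morphism_rst)
      then show "do_morphism X Q (if i then A else B) ((if i then u else v) \<cdot> h)" for i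
        using h by simp
    qed (use h u v in simp_all)
    show ?thesis
    proof (rule ex1I[where a = "(Q, K, h)"])
      fix k assume "k \<in> Hom (DO X) Q K \<and> (K, A, u) \<cdot>\<^bsub>DO X\<^esub> k = a \<cdot>\<^bsub>DO X\<^esub> Rst (DO X) b \<and>
        (K, B, v) \<cdot>\<^bsub>DO X\<^esub> k = b \<cdot>\<^bsub>DO X\<^esub> Rst (DO X) a"
      then obtain k' where k: "k = (Q, K, k')" "do_morphism X Q K k'" "u \<cdot> k' = a' \<cdot> Rst X b'" "v \<cdot> k' = b' \<cdot> Rst X a'"
        by (auto simp: Hom_DO)
      have "k' = h"
        using h k do_morphismD[OF k(2)] by - (rule product_ext[OF P], simp_all)
      then show "k = (Q, K, h)"
        using k by simp
    qed (use hK h in simp)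
  qed
  then show ?thesis
    unfolding restriction_product_def using u v by (intro conjI) (simp_all add: total_DO)
qed

lemma DO_fibre_power:
  assumes P: "fibre_power X n b (dob K) pr"
    and dobjs [simp]: "dobj A" "dobj B" "dobj K"
    and b: "do_morphism X A B b" and pr: "\<And>i. i < n \<Longrightarrow> do_morphism X K A (pr i)"
  shows "fibre_power (DO X) n (A, B, b) K (\<lambda>i. (K, A, pr i))"
proof -
  note [simp] = do_morphismD(1-3)[OF b] do_morphismD(1-3)[OF pr] fibre_powerD(5)[OF P]
  have univ: "\<exists>!h. h \<in> Hom (DO X) Q K \<and> (\<forall>i<n. (K, A, pr i) \<cdot>\<^bsub>DO X\<^esub> h = u i)"
    if Q: "Q \<in> Ob (DO X)" and u: "\<forall>i<n. u i \<in> Hom (DO X) Q (Dom (DO X) (A, B, b))"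
      and eq: "\<forall>i<n. \<forall>j<n. (A, B, b) \<cdot>\<^bsub>DO X\<^esub> u i = (A, B, b) \<cdot>\<^bsub>DO X\<^esub> u j" for Q u
  proof -
    have [simp]: "dobj Q"
      using Q by simp
    from u have "\<forall>i. \<exists>u'. i < n \<longrightarrow> u i = (Q, A, u') \<and> do_morphism X Q A u'"
      by (auto simp: Hom_DO)
    then obtain u' where u': "\<And>i. i < n \<Longrightarrow> u i = (Q, A, u' i)" "\<And>i. i < n \<Longrightarrow> do_morphism X Q A (u' i)"
      by metis
    have "\<exists>!h. h \<in> Hom X (dob Q) (dob K) \<and> (\<forall>i<n. pr i \<cdot> h = u' i)"
    proof (rule fibre_power_ex1[OF P])
      show "u' i \<in> Hom X (dob Q) (Dom X b)" if "i < n" for i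
        using do_morphismD(1-3)[OF u'(2)[OF that]] by (simp add: in_Hom)
      show "b \<cdot> u' i = b \<cdot> u' j" if "i < n" "j < n" for i j
        using eq[rule_format, OF that] that by (simp add: u'(1))
    qed simp
    then obtain h where h: "h \<in> Ar X" "Dom X h = dob Q" "Cod X h = dob K" "\<And>i. i < n \<Longrightarrow> pr i \<cdot> h = u' i"
      unfolding in_Hom by blast
    have hK: "do_morphism X Q K h"
    proof (rule do_morphism_reflect[where I = "{..<n}" and Di = "\<lambda>_. A" and pr = pr])
      fix k k' assume "k \<in> Ar X" "k' \<in> Ar X" "Dom X k' = Dom X k" "Cod X k = dob K" "Cod X k' = dob K"
        and "\<And>i. i \<in> {..<n} \<Longrightarrow> pr i \<cdot> k = pr i \<cdot> k'"
      then show "k = k'"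
        by - (rule fibre_power_ext[OF P], simp_all)
    qed (use h u' pr in simp_all)
    show ?thesis
    proof (rule ex1I[where a = "(Q, K, h)"])
      fix k assume "k \<in> Hom (DO X) Q K \<and> (\<forall>i<n. (K, A, pr i) \<cdot>\<^bsub>DO X\<^esub> k = u i)"
      then obtain k' where k: "k = (Q, K, k')" "do_morphism X Q K k'" "\<And>i. i < n \<Longrightarrow> pr i \<cdot> k' = u' i"
        by (auto simp: Hom_DO u'(1))
      have "k' = h"
        using h k do_morphismD(1-3)[OF k(2)] by - (rule fibre_power_ext[OF P], simp_all)
      then show "k = (Q, K, h)"
        using k by simp
    qed (use hK h u' in simp)
  qed
  show ?thesis
    unfolding fibre_power_def
  proof (intro conjI ballI allI impI)
    show "(A, B, b) \<cdot>\<^bsub>DO X\<^esub> (K, A, pr i) = (A, B, b) \<cdot>\<^bsub>DO X\<^esub> (K, A, pr j)" if "i < n" "j < n" for i j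
      using fibre_powerD(6)[OF P that] by simp
    show "\<exists>!h. h \<in> Hom (DO X) Q K \<and> (\<forall>i<n. (K, A, pr i) \<cdot>\<^bsub>DO X\<^esub> h = u i)"
      if "Q \<in> Ob (DO X)" "(\<forall>i<n. u i \<in> Hom (DO X) Q (Dom (DO X) (A, B, b))) \<and>
        (\<forall>i<n. \<forall>j<n. (A, B, b) \<cdot>\<^bsub>DO X\<^esub> u i = (A, B, b) \<cdot>\<^bsub>DO X\<^esub> u j)" for Q u
      using that by (intro univ) blast+
    show "(K, A, pr i) \<in> Hom (DO X) K (Dom (DO X) (A, B, b))" if "i < n" for i
      using pr[OF that] by simp
    show "total (DO X) (K, A, pr i)" if "i < n" for i
      using pr[OF that] that by (simp add: total_DO)
  qed simp
qed

lemma DO_terminal: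
  assumes U: "restriction_terminal X (dob K)" and K [simp]: "dobj K"
    and bang: "\<And>D. dobj D \<Longrightarrow> do_morphism X D K (bang X (dob K) (dob D))"
  shows "restriction_terminal (DO X) K"
  unfolding restriction_terminal_def
proof (intro conjI ballI allI impI)
  fix D assume "D \<in> Ob (DO X)"
  then have [simp]: "dobj D"
    by simp
  show "\<exists>!t. t \<in> Hom (DO X) D K \<and> total (DO X) t"
  proof (rule ex1I[where a = "(D, K, bang X (dob K) (dob D))"])
    show "(D, K, bang X (dob K) (dob D)) \<in> Hom (DO X) D K \<and> total (DO X) (D, K, bang X (dob K) (dob D))"
      by (simp add: bang total_DO terminal_bang[OF U])
  next
    fix t assume "t \<in> Hom (DO X) D K \<and> total (DO X) t"
    then obtain t' where t': "t = (D, K, t')" "do_morphism X D K t'" "total X t'"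
      by (auto simp: Hom_DO total_DO)
    have "t' = bang X (dob K) (dob D)"
      by (rule terminal_eq[OF U]) (simp_all add: t' do_morphismD[OF t'(2)] terminal_bang[OF U])
    then show "t = (D, K, bang X (dob K) (dob D))"
      by (simp add: t')
  qed
next
  fix D E f t t' assume "f \<in> Hom (DO X) D E" "t \<in> Hom (DO X) D K" "t' \<in> Hom (DO X) E K"
    "total (DO X) t" "total (DO X) t'"
  then obtain f0 t0 t0' where eqs: "f = (D, E, f0)" "t = (D, K, t0)" "t' = (E, K, t0')"
      and f: "do_morphism X D E f0" and t: "do_morphism X D K t0" and t': "do_morphism X E K t0'"
      and "total X t0" "total X t0'"
    by (auto simp: Hom_DO total_DO)
  have "\<forall>A B. \<forall>f \<in> Hom X A B. \<forall>t \<in> Hom X A (dob K). \<forall>t' \<in> Hom X B (dob K).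
      total X t \<longrightarrow> total X t' \<longrightarrow> t' \<cdot> f = t \<cdot> Rst X f"
    using U unfolding restriction_terminal_def by (elim conjE)
  from this[rule_format, of f0 "dob D" "dob E" t0 t0'] have "t0' \<cdot> f0 = t0 \<cdot> Rst X f0"
    using do_morphismD(1-3)[OF f] do_morphismD(1-3)[OF t] do_morphismD(1-3)[OF t'] \<open>total X t0\<close> \<open>total X t0'\<close>
    unfolding in_Hom by blast
  then show "t' \<cdot>\<^bsub>DO X\<^esub> f = t \<cdot>\<^bsub>DO X\<^esub> Rst (DO X) f"
    by (simp add: eqs)
qed simp

text \<open>Consequently pairings in \<open>DO X\<close>, which occur in the tangent axioms, are those of \<open>X\<close>.\<close>

lemma DO_pairing:
  assumes P: "restriction_pullback X f g (dob K) u v"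
    and dobjs: "dobj A" "dobj B" "dobj C" "dobj K" "dobj Q"
    and mor: "do_morphism X A C f" "do_morphism X B C g" "do_morphism X K A u" "do_morphism X K B v"
    and a: "do_morphism X Q A a" and b: "do_morphism X Q B b" and eq: "f \<cdot> a = g \<cdot> b"
  shows "pairing (DO X) K (K, A, u) (K, B, v) (Q, A, a) (Q, B, b) = (Q, K, pairing X (dob K) u v a b)"
    and "do_morphism X Q K (pairing X (dob K) u v a b)"
proof -
  interpret DO: restriction_category "DO X"
    by (rule DO_restriction)
  note P' = DO_pullback[OF P dobjs(1-4) mor]
  let ?h = "pairing (DO X) K (K, A, u) (K, B, v) (Q, A, a) (Q, B, b)"
  have "?h \<in> Ar (DO X)" "Dom (DO X) ?h = Q" "Cod (DO X) ?h = K"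
    and h: "(K, A, u) \<cdot>\<^bsub>DO X\<^esub> ?h = (Q, A, a)" "(K, B, v) \<cdot>\<^bsub>DO X\<^esub> ?h = (Q, B, b)"
    using DO.pairing[OF P', of "(Q, A, a)" "(Q, B, b)"] a b eq dobjs by simp_all
  then obtain k where hk: "?h = (Q, K, k)" and k: "do_morphism X Q K k"
    by (auto simp: Ar_DO)
  have X: "pairing X (dob K) u v a b \<in> Ar X" "Dom X (pairing X (dob K) u v a b) = dob Q"
    "Cod X (pairing X (dob K) u v a b) = dob K" "u \<cdot> pairing X (dob K) u v a b = a" "v \<cdot> pairing X (dob K) u v a b = b"
    using pairing[OF P, of a b] do_morphismD(1-3)[OF a] do_morphismD(1-3)[OF b] do_morphismD(2)[OF mor(1)]
      do_morphismD(2)[OF mor(2)] eq by simp_all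
  have "k = pairing X (dob K) u v a b"
    by (rule pullback_ext[OF P]) (use h hk X do_morphismD(1-3)[OF k] do_morphismD(1)[OF mor(1)]
        do_morphismD(1)[OF mor(2)] in simp_all)
  then show "?h = (Q, K, pairing X (dob K) u v a b)" "do_morphism X Q K (pairing X (dob K) u v a b)"
    using hk k by simp_all
qed

lemmas dobj_closed [simp] = dobj_do_T dobj_do_T2(1) dobj_do_one dobj_do_prod(1)

lemmas do_structure [simp] = do_morphism_p do_morphism_z do_morphism_s do_morphism_l do_morphism_c
  dobj_do_T2(2,3) dobj_do_prod(2,3)

lemma dob_T2 [simp]: "dob (do_T2 X D) = T2 X (dob D)"
  and dob_prod [simp]: "dob (do_prod X D E) = Prd X (dob D) (dob E)"
  by (simp_all add: do_T2_simps(1) do_prod_simps(1))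

lemma do_T_iterate:
  shows "dob ((do_T X ^^ m) D) = (To X ^^ m) (dob D)"
    and "dobj D \<Longrightarrow> dobj ((do_T X ^^ m) D)"
    and "do_morphism X D E f \<Longrightarrow> dobj D \<Longrightarrow> dobj E \<Longrightarrow>
      do_morphism X ((do_T X ^^ m) D) ((do_T X ^^ m) E) ((Ta X ^^ m) f)"
    and "(Ta (DO X) ^^ m) (D, E, f) = ((do_T X ^^ m) D, (do_T X ^^ m) E, (Ta X ^^ m) f)"
proof -
  show 1: "dob ((do_T X ^^ m) D) = (To X ^^ m) (dob D)" for D m
    by (induction m) simp_all
  show 2: "dobj ((do_T X ^^ m) D)" if "dobj D" for D m
    by (induction m) (simp_all add: that)
  show "do_morphism X ((do_T X ^^ m) D) ((do_T X ^^ m) E) ((Ta X ^^ m) f)"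
    if "do_morphism X D E f" "dobj D" "dobj E"
    by (induction m) (simp_all add: that do_morphism_T 2)
  show "(Ta (DO X) ^^ m) (D, E, f) = ((do_T X ^^ m) D, (do_T X ^^ m) E, (Ta X ^^ m) f)"
    by (induction m) simp_all
qed

lemma DO_T2_pullback:
  assumes [simp]: "dobj D"
  shows "restriction_pullback (DO X) ((Ta (DO X) ^^ m) (tp (DO X) D)) ((Ta (DO X) ^^ m) (tp (DO X) D))
    ((To (DO X) ^^ m) (T2 (DO X) D)) ((Ta (DO X) ^^ m) (q1 (DO X) D)) ((Ta (DO X) ^^ m) (q2 (DO X) D))"
  unfolding DO_simps do_T_iterate(4)
  by (rule DO_pullback)
    (use T2_pullback[of "dob D" m] in \<open>simp_all add: do_T_iterate(1-3) del: funpow.simps\<close>)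

lemma DO_pairT2 [simp]:
  assumes "dobj D" "dobj Q" "do_morphism X Q (do_T X D) a" "do_morphism X Q (do_T X D) b"
    "tp X (dob D) \<cdot> a = tp X (dob D) \<cdot> b"
  shows "pairT2 (DO X) D (Q, do_T X D, a) (Q, do_T X D, b) = (Q, do_T2 X D, pairT2 X (dob D) a b)"
    and "do_morphism X Q (do_T2 X D) (pairT2 X (dob D) a b)"
  using DO_pairing[of "tp X (dob D)" "tp X (dob D)" "do_T2 X D" "q1 X (dob D)" "q2 X (dob D)"
      "do_T X D" "do_T X D" D Q a b] T2_pullback0[of "dob D"] assms
  by (simp_all add: pairT2_def)

lemma DO_pairTT2 [simp]:
  assumes "dobj D" "dobj Q" "do_morphism X Q (do_T X (do_T X D)) a" "do_morphism X Q (do_T X (do_T X D)) b"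
    "Ta X (tp X (dob D)) \<cdot> a = Ta X (tp X (dob D)) \<cdot> b"
  shows "pairTT2 (DO X) D (Q, do_T X (do_T X D), a) (Q, do_T X (do_T X D), b) =
      (Q, do_T X (do_T2 X D), pairTT2 X (dob D) a b)"
    and "do_morphism X Q (do_T X (do_T2 X D)) (pairTT2 X (dob D) a b)"
  using DO_pairing[of "Ta X (tp X (dob D))" "Ta X (tp X (dob D))" "do_T X (do_T2 X D)" "Ta X (q1 X (dob D))"
      "Ta X (q2 X (dob D))" "do_T X (do_T X D)" "do_T X (do_T X D)" "do_T X D" Q a b]
    T2_pullback1[of "dob D"] assms
  by (simp_all add: pairTT2_def do_morphism_T)

lemma DO_T2a [simp]:
  assumes "dobj D" "dobj E" and f: "do_morphism X D E f"
  shows "T2a (DO X) (D, E, f) = (do_T2 X D, do_T2 X E, T2a X f)"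
    and "do_morphism X (do_T2 X D) (do_T2 X E) (T2a X f)"
proof -
  have 1: "do_morphism X (do_T2 X D) (do_T X E) (Ta X f \<cdot> q1 X (dob D))"
    "do_morphism X (do_T2 X D) (do_T X E) (Ta X f \<cdot> q2 X (dob D))"
    by (rule do_morphism_cmp[where E = "do_T X D"]; use assms in \<open>simp add: do_morphism_T\<close>)+
  show "T2a (DO X) (D, E, f) = (do_T2 X D, do_T2 X E, T2a X f)"
    "do_morphism X (do_T2 X D) (do_T2 X E) (T2a X f)"
    using assms do_morphismD(1-3)[OF f] DO_pairT2(2)[OF assms(2) dobj_do_T2(1)[OF assms(1)] 1]
    by (simp_all add: T2a_def 1 tp_natural)
qed

text \<open>Every equation required of \<open>DO X\<close> is the corresponding equation of \<open>X\<close>, provided that the arrows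
  which are paired in it are morphisms of differential objects.\<close>

lemma DO_tangent: "tangent_split_restriction_category (DO X)"
proof -
  interpret DO: split_restriction_category "DO X"
    by (rule DO_split)
  show ?thesis
  proof
    show "restriction_functor (DO X) (DO X) (To (DO X)) (Ta (DO X))"
      by (rule DO.restriction_functorI) (auto simp: Ar_DO do_morphism_T do_morphismD)
    show "total_nat_trans (DO X) (DO X) (To (DO X)) (Ta (DO X)) (\<lambda>A. A) (\<lambda>f. f) (tp (DO X))"
      by (rule total_nat_transI) (auto simp: Ar_DO total_DO do_morphismD tp_natural)
    show "total_nat_trans (DO X) (DO X) (\<lambda>A. A) (\<lambda>f. f) (To (DO X)) (Ta (DO X)) (tz (DO X))"
      by (rule total_nat_transI) (auto simp: Ar_DO total_DO do_morphismD tz_natural)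
    show "total_nat_trans (DO X) (DO X) (T2 (DO X)) (T2a (DO X)) (To (DO X)) (Ta (DO X)) (ts (DO X))"
      by (rule total_nat_transI) (auto simp: Ar_DO total_DO do_morphismD ts_natural(1)[symmetric])
    show "total_nat_trans (DO X) (DO X) (To (DO X)) (Ta (DO X)) (\<lambda>A. To (DO X) (To (DO X) A))
        (\<lambda>f. Ta (DO X) (Ta (DO X) f)) (tl (DO X))"
      by (rule total_nat_transI) (auto simp: Ar_DO total_DO do_morphismD tl_natural)
    show "total_nat_trans (DO X) (DO X) (\<lambda>A. To (DO X) (To (DO X) A)) (\<lambda>f. Ta (DO X) (Ta (DO X) f))
        (\<lambda>A. To (DO X) (To (DO X) A)) (\<lambda>f. Ta (DO X) (Ta (DO X) f)) (tc (DO X))"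
      by (rule total_nat_transI) (auto simp: Ar_DO total_DO do_morphismD tc_natural)
    show "restriction_pullback (DO X) ((Ta (DO X) ^^ m) (tp (DO X) D)) ((Ta (DO X) ^^ m) (tp (DO X) D))
        ((To (DO X) ^^ m) (T2 (DO X) D)) ((Ta (DO X) ^^ m) (q1 (DO X) D)) ((Ta (DO X) ^^ m) (q2 (DO X) D))"
      if "D \<in> Ob (DO X)" for D m
      by (rule DO_T2_pullback) (use that in simp)
    show "\<exists>P pr. \<forall>m. fibre_power (DO X) n ((Ta (DO X) ^^ m) (tp (DO X) D)) ((To (DO X) ^^ m) P)
        (\<lambda>i. (Ta (DO X) ^^ m) (pr i))" if D: "D \<in> Ob (DO X)" and n: "1 \<le> n" for D n
    proof -
      have [simp]: "dobj D"
        using D by simp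
      obtain P pr where P: "\<And>m. fibre_power X n ((Ta X ^^ m) (tp X (dob D))) ((To X ^^ m) P) (\<lambda>i. (Ta X ^^ m) (pr i))"
        using Tn_exists[of "dob D" n] n by auto
      obtain K where K: "dobj K" "dob K = P" "\<And>i. i < n \<Longrightarrow> do_morphism X K (do_T X D) (pr i)"
        by (rule dobj_fibre_power[of D n P pr]) (use n P[of 0] P[of 1] in simp_all)
      have "fibre_power (DO X) n ((Ta (DO X) ^^ m) (tp (DO X) D)) ((To (DO X) ^^ m) K)
          (\<lambda>i. (Ta (DO X) ^^ m) (K, do_T X D, pr i))" for m
        unfolding DO_simps do_T_iterate(4)
        by (rule DO_fibre_power) (use P[of m] K in \<open>simp_all add: do_T_iterate(1-3)\<close>)
      then show ?thesis
        by (intro exI[of _ K] exI[of _ "\<lambda>i. (K, do_T X D, pr i)"] allI)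
    qed
    fix D assume "D \<in> Ob (DO X)"
    then have [simp]: "dobj D"
      by simp
    have "do_morphism X (do_T X D) (do_T X D) (tz X (dob D) \<cdot> tp X (dob D))"
      by (rule do_morphism_cmp[where E = D]) simp_all
    then show "ts (DO X) D \<cdot>\<^bsub>DO X\<^esub> pairT2 (DO X) D (tz (DO X) D \<cdot>\<^bsub>DO X\<^esub> tp (DO X) D) (Ide (DO X) (To (DO X) D)) =
        Ide (DO X) (To (DO X) D)"
      using do_morphism_ide[of "do_T X D"] by simp
    show "ts (DO X) D \<cdot>\<^bsub>DO X\<^esub> pairT2 (DO X) D (ts (DO X) D \<cdot>\<^bsub>DO X\<^esub> pairT2 (DO X) D (pr 0) (pr 1)) (pr 2) =
        ts (DO X) D \<cdot>\<^bsub>DO X\<^esub> pairT2 (DO X) D (pr 0) (ts (DO X) D \<cdot>\<^bsub>DO X\<^esub> pairT2 (DO X) D (pr 1) (pr 2))"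
      if P: "fibre_power (DO X) 3 (tp (DO X) D) P pr" for P pr
    proof -
      have "\<exists>u. pr i = (P, do_T X D, u) \<and> dobj P \<and> do_morphism X P (do_T X D) u" if "i < 3" for i
        using P that by (auto simp: fibre_power_def Hom_DO)
      from this[of 0] this[of 1] this[of 2]
      obtain u v w where uvw: "pr 0 = (P, do_T X D, u)" "pr 1 = (P, do_T X D, v)" "pr 2 = (P, do_T X D, w)"
          and [simp]: "dobj P" and u: "do_morphism X P (do_T X D) u" and v: "do_morphism X P (do_T X D) v"
          and w: "do_morphism X P (do_T X D) w"
        by auto
      have *: "\<forall>i<3. \<forall>j<3. tp (DO X) D \<cdot>\<^bsub>DO X\<^esub> pr i = tp (DO X) D \<cdot>\<^bsub>DO X\<^esub> pr j"
        using P unfolding fibre_power_def by (elim conjE)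
      have p [simp]: "tp X (dob D) \<cdot> u = tp X (dob D) \<cdot> w" "tp X (dob D) \<cdot> v = tp X (dob D) \<cdot> w"
        using *[rule_format, of 0 2] *[rule_format, of 1 2] by (simp_all add: uvw del: One_nat_def)
      note [simp] = do_morphismD(1-3)[OF u] do_morphismD(1-3)[OF v] do_morphismD(1-3)[OF w] u v w
      have "do_morphism X P (do_T X D) (ts X (dob D) \<cdot> pairT2 X (dob D) u v)"
        "do_morphism X P (do_T X D) (ts X (dob D) \<cdot> pairT2 X (dob D) v w)"
        by (rule do_morphism_cmp[where E = "do_T2 X D"]; simp)+
      then show ?thesis
        unfolding uvw by (simp add: s_assoc_triple)
    qed
    have "do_morphism X (do_T2 X D) (do_T X (do_T X D)) (tl X (dob D) \<cdot> q1 X (dob D))"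
      "do_morphism X (do_T2 X D) (do_T X (do_T X D)) (tl X (dob D) \<cdot> q2 X (dob D))"
      by (rule do_morphism_cmp[where E = "do_T X D"]; simp)+
    then show "tl (DO X) D \<cdot>\<^bsub>DO X\<^esub> ts (DO X) D = Ta (DO X) (ts (DO X) D) \<cdot>\<^bsub>DO X\<^esub>
        pairTT2 (DO X) D (tl (DO X) D \<cdot>\<^bsub>DO X\<^esub> q1 (DO X) D) (tl (DO X) D \<cdot>\<^bsub>DO X\<^esub> q2 (DO X) D)"
      by (simp add: l_s)
    have "do_morphism X (do_T X (do_T2 X D)) (do_T X (do_T X D)) (tc X (dob D) \<cdot> Ta X (q1 X (dob D)))"
      "do_morphism X (do_T X (do_T2 X D)) (do_T X (do_T X D)) (tc X (dob D) \<cdot> Ta X (q2 X (dob D)))"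
      by (rule do_morphism_cmp[where E = "do_T X (do_T X D)"]; simp add: do_morphism_T)+
    then show "tc (DO X) D \<cdot>\<^bsub>DO X\<^esub> Ta (DO X) (ts (DO X) D) = ts (DO X) (To (DO X) D) \<cdot>\<^bsub>DO X\<^esub>
        pairT2 (DO X) (To (DO X) D) (tc (DO X) D \<cdot>\<^bsub>DO X\<^esub> Ta (DO X) (q1 (DO X) D))
          (tc (DO X) D \<cdot>\<^bsub>DO X\<^esub> Ta (DO X) (q2 (DO X) D))"
      by (simp add: c_Ts)
    have 1: "do_morphism X (do_T2 X D) (do_T X (do_T X D)) (tz X (To X (dob D)) \<cdot> q1 X (dob D))"
      using do_morphism_z[of "do_T X D"] by (auto intro!: do_morphism_cmp[of _ "do_T X D"])
    have 2: "do_morphism X (do_T2 X D) (do_T X (do_T X D)) (tl X (dob D) \<cdot> q2 X (dob D))"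
      by (rule do_morphism_cmp[where E = "do_T X D"]) simp_all
    let ?w = "pairTT2 X (dob D) (tz X (To X (dob D)) \<cdot> q1 X (dob D)) (tl X (dob D) \<cdot> q2 X (dob D))"
    have 3: "do_morphism X (do_T2 X D) (do_T X (do_T2 X D)) ?w"
      by (rule DO_pairTT2(2)) (simp_all add: 1 2)
    have "restriction_pullback (DO X) (D, do_T X D, tz X (dob D)) (do_T X (do_T X D), do_T X D, Ta X (tp X (dob D)))
        (do_T2 X D) (do_T2 X D, D, tp X (dob D) \<cdot> q1 X (dob D)) (do_T2 X D, do_T X (do_T X D), Ta X (ts X (dob D)) \<cdot> ?w)"
    proof (rule DO_pullback)
      show "restriction_pullback X (tz X (dob D)) (Ta X (tp X (dob D))) (dob (do_T2 X D))
          (tp X (dob D) \<cdot> q1 X (dob D)) (Ta X (ts X (dob D)) \<cdot> ?w)"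
        using vertical_lift[of "dob D"] by simp
      show "do_morphism X (do_T2 X D) D (tp X (dob D) \<cdot> q1 X (dob D))"
        by (rule do_morphism_cmp[where E = "do_T X D"]) simp_all
      show "do_morphism X (do_T2 X D) (do_T X (do_T X D)) (Ta X (ts X (dob D)) \<cdot> ?w)"
        by (rule do_morphism_cmp[OF 3]) (simp_all add: do_morphism_T)
    qed (simp_all add: do_morphism_T)
    then show "restriction_pullback (DO X) (tz (DO X) D) (Ta (DO X) (tp (DO X) D)) (T2 (DO X) D)
        (tp (DO X) D \<cdot>\<^bsub>DO X\<^esub> q1 (DO X) D)
        (Ta (DO X) (ts (DO X) D) \<cdot>\<^bsub>DO X\<^esub> pairTT2 (DO X) D (tz (DO X) (To (DO X) D) \<cdot>\<^bsub>DO X\<^esub> q1 (DO X) D)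
          (tl (DO X) D \<cdot>\<^bsub>DO X\<^esub> q2 (DO X) D))"
      using 1 2 by simp
  qed (simp_all add: yang_baxter)
qed

lemma DO_cartesian: "cartesian_tangent_split_restriction_category (DO X)"
proof -
  interpret DO: tangent_split_restriction_category "DO X"
    by (rule DO_tangent)
  show ?thesis
  proof
    show "restriction_terminal (DO X) (One (DO X))"
      unfolding DO_simps by (rule DO_terminal) (simp_all add: one_terminal do_morphism_bang)
    show "restriction_terminal (DO X) (To (DO X) (One (DO X)))"
      unfolding DO_simps
    proof (rule DO_terminal)
      show "do_morphism X D (do_T X (do_one X)) (bang X (dob (do_T X (do_one X))) (dob D))" if [simp]: "dobj D" for D
        by (rule do_morphism_total_linear) (simp_all, rule T_one_eq, simp_all)
    qed (simp_all add: T_one_terminal)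
    show "restriction_product (DO X) D E (Prd (DO X) D E) (pi1 (DO X) D E) (pi2 (DO X) D E)"
      if "D \<in> Ob (DO X)" "E \<in> Ob (DO X)" for D E
      unfolding DO_simps by (rule DO_product) (use that in \<open>simp_all add: product\<close>)
    show "restriction_product (DO X) (To (DO X) D) (To (DO X) E) (To (DO X) (Prd (DO X) D E))
        (Ta (DO X) (pi1 (DO X) D E)) (Ta (DO X) (pi2 (DO X) D E))"
      if "D \<in> Ob (DO X)" "E \<in> Ob (DO X)" for D E
      unfolding DO_simps by (rule DO_product) (use that in \<open>simp_all add: T_product do_morphism_T\<close>)
  qed
qed

end

sublocale do_context \<subseteq> DO: cartesian_tangent_split_restriction_category "DO X"
  by (rule DO_cartesian)

section \<open>The tangent structure of the hom-categories\<close>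

context tangent_split_restriction_category
begin

lemma TTT2_ext:
  assumes "Ta X (Ta X (q1 X A)) \<cdot> h = Ta X (Ta X (q1 X A)) \<cdot> h'"
    "Ta X (Ta X (q2 X A)) \<cdot> h = Ta X (Ta X (q2 X A)) \<cdot> h'"
    and "A \<in> Ob X" "h \<in> Ar X" "h' \<in> Ar X" "Dom X h' = Dom X h"
    "Cod X h = To X (To X (T2 X A))" "Cod X h' = To X (To X (T2 X A))"
  shows "h = h'"
  using T2_pullback[OF assms(3), of 2] assms
  by - (rule pullback_ext, assumption, simp_all add: eval_nat_numeral)

lemma T2a_functor:
  shows T2a_ide: "A \<in> Ob X \<Longrightarrow> T2a X (Ide X A) = Ide X (T2 X A)"
    and T2a_cmp: "f \<in> Ar X \<Longrightarrow> g \<in> Ar X \<Longrightarrow> Cod X f = Dom X g \<Longrightarrow> T2a X (g \<cdot> f) = T2a X g \<cdot> T2a X f"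
    and T2a_rst: "f \<in> Ar X \<Longrightarrow> T2a X (Rst X f) = Rst X (T2a X f)"
proof -
  show "T2a X (Ide X A) = Ide X (T2 X A)" if "A \<in> Ob X"
    using that by - (rule T2_ext[where A = A], simp_all)
  show "T2a X (g \<cdot> f) = T2a X g \<cdot> T2a X f" if "f \<in> Ar X" "g \<in> Ar X" "Cod X f = Dom X g"
    using that by - (rule T2_ext[where A = "Cod X g"], simp_all)
  show "T2a X (Rst X f) = Rst X (T2a X f)" if [simp]: "f \<in> Ar X"
  proof -
    let ?A = "Dom X f" and ?B = "Cod X f"
    have 1: "Rst X (Ta X f) \<cdot> q1 X ?A = q1 X ?A \<cdot> Rst X (Ta X f \<cdot> q1 X ?A)"
      "Rst X (Ta X f) \<cdot> q2 X ?A = q2 X ?A \<cdot> Rst X (Ta X f \<cdot> q2 X ?A)"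
      by (rule rst_slide'; simp)+
    have 2: "Rst X (q1 X ?B \<cdot> T2a X f) = Rst X (T2a X f)" "Rst X (q2 X ?B \<cdot> T2a X f) = Rst X (T2a X f)"
      by (rule rst_total_cmp; simp)+
    show ?thesis
      by (rule T2_ext[where A = ?A]) (use 2 in \<open>simp_all add: 1\<close>)
  qed
qed

lemma q_tp:
  assumes "A \<in> Ob X" "x \<in> Ar X" "Cod X x = To X (T2 X A)"
  shows "q1 X A \<cdot> tp X (T2 X A) \<cdot> x = tp X (To X A) \<cdot> Ta X (q1 X A) \<cdot> x"
    "q2 X A \<cdot> tp X (T2 X A) \<cdot> x = tp X (To X A) \<cdot> Ta X (q2 X A) \<cdot> x"
  using tp_natural(2)[of "q1 X A" "To X A" x] tp_natural(2)[of "q2 X A" "To X A" x] assms by simp_all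

lemma Tq_tz:
  assumes "A \<in> Ob X"
  shows "Ta X (q1 X A) \<cdot> tz X (T2 X A) = tz X (To X A) \<cdot> q1 X A"
    "Ta X (q2 X A) \<cdot> tz X (T2 X A) = tz X (To X A) \<cdot> q2 X A"
  using tz_natural(1)[of "q1 X A" "To X A"] tz_natural(1)[of "q2 X A" "To X A"] assms by simp_all

lemma TTq_tl:
  assumes "A \<in> Ob X" "x \<in> Ar X" "Cod X x = To X (T2 X A)"
  shows "Ta X (Ta X (q1 X A)) \<cdot> tl X (T2 X A) \<cdot> x = tl X (To X A) \<cdot> Ta X (q1 X A) \<cdot> x"
    "Ta X (Ta X (q2 X A)) \<cdot> tl X (T2 X A) \<cdot> x = tl X (To X A) \<cdot> Ta X (q2 X A) \<cdot> x"
  using tl_natural(2)[of "q1 X A" "To X A" x] tl_natural(2)[of "q2 X A" "To X A" x] assms by simp_all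

lemma TTq_tc:
  assumes "A \<in> Ob X" "x \<in> Ar X" "Cod X x = To X (To X (T2 X A))"
  shows "Ta X (Ta X (q1 X A)) \<cdot> tc X (T2 X A) \<cdot> x = tc X (To X A) \<cdot> Ta X (Ta X (q1 X A)) \<cdot> x"
    "Ta X (Ta X (q2 X A)) \<cdot> tc X (T2 X A) \<cdot> x = tc X (To X A) \<cdot> Ta X (Ta X (q2 X A)) \<cdot> x"
  using tc_natural(2)[of "q1 X A" "To X A" x] tc_natural(2)[of "q2 X A" "To X A" x] assms by simp_all

end

locale lax_morphism =
  S: tangent_split_restriction_category S + tangent_split_restriction_category X
  for S :: "('o1, 'a1, 'n) tcat_scheme" and X :: "('o, 'a, 'm) tcat_scheme" (structure) +
  fixes F :: "('o1, 'a1, 'o, 'a) tmor"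
  assumes lax: "lax_tangent_morphism S X F"
begin

lemma ma_functor: "restriction_functor S X (mo F) (ma F)"
  using lax by (simp add: lax_tangent_morphism_def)

lemmas ma_functorD [simp] = S.restriction_functorD[OF ma_functor]
lemmas ma_total [simp] = S.restriction_functor_total[OF ma_functor]

lemma mn_nat: "total_nat_trans S X (\<lambda>A. mo F (To S A)) (\<lambda>f. ma F (Ta S f))
    (\<lambda>A. To X (mo F A)) (\<lambda>f. Ta X (ma F f)) (mn F)"
  using lax by (simp add: lax_tangent_morphism_def)

lemmas mn_typing [simp] = total_nat_transD(1-4)[OF mn_nat]

lemma mn_natural: "f \<in> Ar S \<Longrightarrow> Cod S f = B \<Longrightarrow> mn F B \<cdot> ma F (Ta S f) = Ta X (ma F f) \<cdot> mn F (Dom S f)"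
  using total_nat_transD(5)[OF mn_nat, of f] by simp

lemma mn_natural_x:
  "f \<in> Ar S \<Longrightarrow> Cod S f = B \<Longrightarrow> x \<in> Ar X \<Longrightarrow> Cod X x = mo F (To S (Dom S f)) \<Longrightarrow>
    mn F B \<cdot> ma F (Ta S f) \<cdot> x = Ta X (ma F f) \<cdot> mn F (Dom S f) \<cdot> x"
  by (rule assoc_eq[OF mn_natural]) auto

lemma mn_p [simp]: "A \<in> Ob S \<Longrightarrow> tp X (mo F A) \<cdot> mn F A = ma F (tp S A)"
  and mn_z: "A \<in> Ob S \<Longrightarrow> mn F A \<cdot> ma F (tz S A) = tz X (mo F A)"
  and mn_s: "A \<in> Ob S \<Longrightarrow> mn F A \<cdot> ma F (ts S A) = ts X (mo F A) \<cdot>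
    pairT2 X (mo F A) (mn F A \<cdot> ma F (q1 S A)) (mn F A \<cdot> ma F (q2 S A))"
  and mn_l: "A \<in> Ob S \<Longrightarrow> tl X (mo F A) \<cdot> mn F A = Ta X (mn F A) \<cdot> mn F (To S A) \<cdot> ma F (tl S A)"
  and mn_c: "A \<in> Ob S \<Longrightarrow> tc X (mo F A) \<cdot> Ta X (mn F A) \<cdot> mn F (To S A) =
    Ta X (mn F A) \<cdot> mn F (To S A) \<cdot> ma F (tc S A)"
  using lax by (simp_all add: lax_tangent_morphism_def)

lemma mn_p_x [simp]:
  "A \<in> Ob S \<Longrightarrow> x \<in> Ar X \<Longrightarrow> Cod X x = mo F (To S A) \<Longrightarrow> tp X (mo F A) \<cdot> mn F A \<cdot> x = ma F (tp S A) \<cdot> x"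
  by (rule assoc_reduce[OF mn_p]) simp_all

lemma ma_p_q2 [simp]: "A \<in> Ob S \<Longrightarrow> ma F (tp S A) \<cdot> ma F (q2 S A) = ma F (tp S A) \<cdot> ma F (q1 S A)"
  using ma_functorD(6)[of "q1 S A" "tp S A"] ma_functorD(6)[of "q2 S A" "tp S A"] by simp

lemma hom_T_simps [simp]:
  "A \<in> Ob S \<Longrightarrow> mo (hom_T S X F) A = To X (mo F A)"
  "f \<in> Ar S \<Longrightarrow> ma (hom_T S X F) f = Ta X (ma F f)"
  "A \<in> Ob S \<Longrightarrow> mn (hom_T S X F) A = tc X (mo F A) \<cdot> Ta X (mn F A)"
  by (simp_all add: hom_T_def)

text \<open>The tangent bundle of \<open>(F, \<alpha>)\<close> is \<open>(T F, c \<cdot> T \<alpha>)\<close>.  Each condition on \<open>c \<cdot> T \<alpha>\<close> is the image under \<open>T\<close> of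
  the same condition on \<open>\<alpha>\<close>, combined with the axiom that governs how \<open>c\<close> interacts with the structure
  map in question; for the compatibility with \<open>c\<close> this is the Yang-Baxter equation.\<close>

lemma lax_hom_T: "lax_tangent_morphism S X (hom_T S X F)"
  unfolding lax_tangent_morphism_def
proof (intro conjI ballI)
  show "mo (hom_T S X F) \<in> extensional (Ob S)" "ma (hom_T S X F) \<in> extensional (Ar S)"
    "mn (hom_T S X F) \<in> extensional (Ob S)"
    by (simp_all add: hom_T_def)
  show "restriction_functor S X (mo (hom_T S X F)) (ma (hom_T S X F))"
    by (rule S.restriction_functorI) simp_all
  show "total_nat_trans S X (\<lambda>A. mo (hom_T S X F) (To S A)) (\<lambda>f. ma (hom_T S X F) (Ta S f))
      (\<lambda>A. To X (mo (hom_T S X F) A)) (\<lambda>f. Ta X (ma (hom_T S X F) f)) (mn (hom_T S X F))"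
  proof (rule total_nat_transI)
    fix f assume [simp]: "f \<in> Ar S"
    have "Ta X (Ta X (ma F f)) \<cdot> Ta X (mn F (Dom S f)) = Ta X (mn F (Cod S f)) \<cdot> Ta X (ma F (Ta S f))"
      using T_cmp_cong[OF mn_natural[symmetric], of f] by simp
    then show "Ta X (ma (hom_T S X F) f) \<cdot> mn (hom_T S X F) (Dom S f) =
        mn (hom_T S X F) (Cod S f) \<cdot> ma (hom_T S X F) (Ta S f)"
      using tc_natural(2)[of "ma F f" "mo F (Cod S f)" "Ta X (mn F (Dom S f))"] by simp
  qed simp_all
  fix A assume A [simp]: "A \<in> Ob S"
  let ?\<alpha> = "mn F A" and ?\<alpha>T = "mn F (To S A)" and ?FA = "mo F A"
  show "tp X (mo (hom_T S X F) A) \<cdot> mn (hom_T S X F) A = ma (hom_T S X F) (tp S A)"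
    using T_cmp_cong[OF mn_p, of A] by simp
  show "mn (hom_T S X F) A \<cdot> ma (hom_T S X F) (tz S A) = tz X (mo (hom_T S X F) A)"
    using T_cmp_cong[OF mn_z, of A] by simp
  have Ts: "Ta X ?\<alpha> \<cdot> Ta X (ma F (ts S A)) =
      Ta X (ts X ?FA) \<cdot> Ta X (pairT2 X ?FA (?\<alpha> \<cdot> ma F (q1 S A)) (?\<alpha> \<cdot> ma F (q2 S A)))"
    using T_cmp_cong[OF mn_s, of A] by simp
  have Tpq: "Ta X (ma F (tp S A)) \<cdot> Ta X (ma F (q2 S A)) = Ta X (ma F (tp S A)) \<cdot> Ta X (ma F (q1 S A))"
    using T_cmp_cong[OF ma_p_q2, of A] by simp
  have Tp: "Ta X (tp X ?FA) \<cdot> Ta X ?\<alpha> \<cdot> x = Ta X (ma F (tp S A)) \<cdot> x"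
    if "x \<in> Ar X" "Cod X x = To X (mo F (To S A))" for x
    using assoc_reduce[OF T_cmp_cong[OF mn_p, of A], of x] that by simp
  have pair: "pairT2 X (To X ?FA) (tc X ?FA \<cdot> Ta X (q1 X ?FA)) (tc X ?FA \<cdot> Ta X (q2 X ?FA)) \<cdot>
        Ta X (pairT2 X ?FA (?\<alpha> \<cdot> ma F (q1 S A)) (?\<alpha> \<cdot> ma F (q2 S A))) =
      pairT2 X (To X ?FA) (tc X ?FA \<cdot> Ta X ?\<alpha> \<cdot> Ta X (ma F (q1 S A))) (tc X ?FA \<cdot> Ta X ?\<alpha> \<cdot> Ta X (ma F (q2 S A)))"
    by (rule T2_ext[where A = "To X ?FA"]) (simp_all add: Tp Tpq)
  have "tc X ?FA \<cdot> Ta X ?\<alpha> \<cdot> Ta X (ma F (ts S A)) = (tc X ?FA \<cdot> Ta X (ts X ?FA)) \<cdot>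
      Ta X (pairT2 X ?FA (?\<alpha> \<cdot> ma F (q1 S A)) (?\<alpha> \<cdot> ma F (q2 S A)))"
    by (simp add: Ts)
  also have "\<dots> = ts X (To X ?FA) \<cdot>
      pairT2 X (To X ?FA) (tc X ?FA \<cdot> Ta X ?\<alpha> \<cdot> Ta X (ma F (q1 S A))) (tc X ?FA \<cdot> Ta X ?\<alpha> \<cdot> Ta X (ma F (q2 S A)))"
    unfolding c_Ts[OF ma_functorD(1)[OF A]] pair[symmetric] by simp
  finally show "mn (hom_T S X F) A \<cdot> ma (hom_T S X F) (ts S A) = ts X (mo (hom_T S X F) A) \<cdot>
      pairT2 X (mo (hom_T S X F) A) (mn (hom_T S X F) A \<cdot> ma (hom_T S X F) (q1 S A))
        (mn (hom_T S X F) A \<cdot> ma (hom_T S X F) (q2 S A))"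
    by simp
  have Tl: "Ta X (tl X ?FA) \<cdot> Ta X ?\<alpha> = Ta X (Ta X ?\<alpha>) \<cdot> Ta X ?\<alpha>T \<cdot> Ta X (ma F (tl S A))"
    using T_cmp_cong[OF mn_l, of A] by simp
  have "tl X (To X ?FA) \<cdot> tc X ?FA \<cdot> Ta X ?\<alpha> = (tl X (To X ?FA) \<cdot> tc X ?FA) \<cdot> Ta X ?\<alpha>"
    by simp
  also have "\<dots> = Ta X (tc X ?FA) \<cdot> tc X (To X ?FA) \<cdot> Ta X (tl X ?FA) \<cdot> Ta X ?\<alpha>"
    unfolding l_c[OF ma_functorD(1)[OF A]] by simp
  also have "\<dots> = Ta X (tc X ?FA) \<cdot> Ta X (Ta X ?\<alpha>) \<cdot> tc X (mo F (To S A)) \<cdot> Ta X ?\<alpha>T \<cdot> Ta X (ma F (tl S A))"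
    unfolding Tl by (simp add: tc_natural)
  finally show "tl X (mo (hom_T S X F) A) \<cdot> mn (hom_T S X F) A =
      Ta X (mn (hom_T S X F) A) \<cdot> mn (hom_T S X F) (To S A) \<cdot> ma (hom_T S X F) (tl S A)"
    by simp
  have Tc: "Ta X (tc X ?FA) \<cdot> Ta X (Ta X ?\<alpha>) \<cdot> Ta X ?\<alpha>T = Ta X (Ta X ?\<alpha>) \<cdot> Ta X ?\<alpha>T \<cdot> Ta X (ma F (tc S A))"
    using arg_cong[OF mn_c[OF A], of "Ta X"] by simp
  have YB: "Ta X (tc X ?FA) \<cdot> tc X (To X ?FA) \<cdot> Ta X (tc X ?FA) \<cdot> x =
      tc X (To X ?FA) \<cdot> Ta X (tc X ?FA) \<cdot> tc X (To X ?FA) \<cdot> x"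
    if "x \<in> Ar X" "Cod X x = To X (To X (To X ?FA))" for x
    using assoc_eq[of "Ta X (tc X ?FA)" "tc X (To X ?FA) \<cdot> Ta X (tc X ?FA)" "tc X (To X ?FA)"
        "Ta X (tc X ?FA) \<cdot> tc X (To X ?FA)" x] yang_baxter[of ?FA] that by simp
  have "tc X (To X ?FA) \<cdot> Ta X (tc X ?FA) \<cdot> Ta X (Ta X ?\<alpha>) \<cdot> tc X (mo F (To S A)) \<cdot> Ta X ?\<alpha>T =
      Ta X (tc X ?FA) \<cdot> tc X (To X ?FA) \<cdot> Ta X (tc X ?FA) \<cdot> Ta X (Ta X ?\<alpha>) \<cdot> Ta X ?\<alpha>T"
    using tc_natural(2)[of ?\<alpha> "To X ?FA" "Ta X ?\<alpha>T"] by (simp add: YB)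
  also have "\<dots> = Ta X (tc X ?FA) \<cdot> Ta X (Ta X ?\<alpha>) \<cdot> tc X (mo F (To S A)) \<cdot> Ta X ?\<alpha>T \<cdot> Ta X (ma F (tc S A))"
    unfolding Tc by (simp add: tc_natural)
  finally show "tc X (mo (hom_T S X F) A) \<cdot> Ta X (mn (hom_T S X F) A) \<cdot> mn (hom_T S X F) (To S A) =
      Ta X (mn (hom_T S X F) A) \<cdot> mn (hom_T S X F) (To S A) \<cdot> ma (hom_T S X F) (tc S A)"
    by simp
qed

lemma hom_T2_simps [simp]:
  "A \<in> Ob S \<Longrightarrow> mo (hom_T2 S X F) A = T2 X (mo F A)"
  "f \<in> Ar S \<Longrightarrow> ma (hom_T2 S X F) f = T2a X (ma F f)"
  by (simp_all add: hom_T2_def)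

lemma tp_T_mn:
  assumes [simp]: "A \<in> Ob S" and x: "x \<in> Ar X" "Cod X x = To X (mo F (To S A))"
  shows "tp X (To X (mo F A)) \<cdot> Ta X (mn F A) \<cdot> x = mn F A \<cdot> tp X (mo F (To S A)) \<cdot> x"
  using tp_natural(2)[of "mn F A" "To X (mo F A)" x] x by simp

lemma hom_T2_mn [simp]:
  assumes A [simp]: "A \<in> Ob S"
  shows "mn (hom_T2 S X F) A \<in> Ar X" "Dom X (mn (hom_T2 S X F) A) = T2 X (mo F (To S A))"
    "Cod X (mn (hom_T2 S X F) A) = To X (T2 X (mo F A))" "total X (mn (hom_T2 S X F) A)"
    "Ta X (q1 X (mo F A)) \<cdot> mn (hom_T2 S X F) A = mn (hom_T S X F) A \<cdot> q1 X (mo F (To S A))"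
    "Ta X (q2 X (mo F A)) \<cdot> mn (hom_T2 S X F) A = mn (hom_T S X F) A \<cdot> q2 X (mo F (To S A))"
proof -
  have "mn (hom_T2 S X F) A = pairTT2 X (mo F A) (mn (hom_T S X F) A \<cdot> q1 X (mo F (To S A)))
      (mn (hom_T S X F) A \<cdot> q2 X (mo F (To S A)))"
    by (simp add: hom_T2_def)
  then show "mn (hom_T2 S X F) A \<in> Ar X" "Dom X (mn (hom_T2 S X F) A) = T2 X (mo F (To S A))"
    "Cod X (mn (hom_T2 S X F) A) = To X (T2 X (mo F A))" "total X (mn (hom_T2 S X F) A)"
    "Ta X (q1 X (mo F A)) \<cdot> mn (hom_T2 S X F) A = mn (hom_T S X F) A \<cdot> q1 X (mo F (To S A))"
    "Ta X (q2 X (mo F A)) \<cdot> mn (hom_T2 S X F) A = mn (hom_T S X F) A \<cdot> q2 X (mo F (To S A))"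
    by (simp_all add: tp_T_mn)
qed

text \<open>The component \<open>\<gamma>\<close> of \<open>T2 F\<close> is determined by \<open>T q\<^sub>i \<cdot> \<gamma> = \<beta> \<cdot> q\<^sub>i\<close>, where \<open>\<beta>\<close> is that of \<open>T F\<close>.  Every
  condition on \<open>\<gamma>\<close> follows from the same condition on \<open>\<beta>\<close>, as the maps \<open>T\<^sup>k q\<^sub>1\<close>, \<open>T\<^sup>k q\<^sub>2\<close> are
  jointly monic.\<close>

lemma lax_hom_T2: "lax_tangent_morphism S X (hom_T2 S X F)"
proof -
  define G where "G = hom_T S X F"
  define \<beta> where "\<beta> = mn G"
  interpret G: lax_morphism S X G
    by unfold_locales (simp add: G_def lax_hom_T)
  have G [simp]: "A \<in> Ob S \<Longrightarrow> mo G A = To X (mo F A)" "f \<in> Ar S \<Longrightarrow> ma G f = Ta X (ma F f)" for A f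
    by (simp_all add: G_def)
  note beta_typing [simp] = G.mn_typing[folded \<beta>_def]
  define \<gamma> where "\<gamma> = mn (hom_T2 S X F)"
  have \<gamma> [simp]: "\<gamma> A \<in> Ar X" "Dom X (\<gamma> A) = T2 X (mo F (To S A))" "Cod X (\<gamma> A) = To X (T2 X (mo F A))"
    "total X (\<gamma> A)" "Ta X (q1 X (mo F A)) \<cdot> \<gamma> A = \<beta> A \<cdot> q1 X (mo F (To S A))"
    "Ta X (q2 X (mo F A)) \<cdot> \<gamma> A = \<beta> A \<cdot> q2 X (mo F (To S A))" if "A \<in> Ob S" for A
    using hom_T2_mn[OF that] by (simp_all add: \<gamma>_def \<beta>_def G_def)
  have \<gamma>x [simp]: "Ta X (q1 X (mo F A)) \<cdot> \<gamma> A \<cdot> x = \<beta> A \<cdot> q1 X (mo F (To S A)) \<cdot> x"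
    "Ta X (q2 X (mo F A)) \<cdot> \<gamma> A \<cdot> x = \<beta> A \<cdot> q2 X (mo F (To S A)) \<cdot> x"
    if "A \<in> Ob S" "x \<in> Ar X" "Cod X x = T2 X (mo F (To S A))" for A x
    by (rule assoc_eq[OF \<gamma>(5)] assoc_eq[OF \<gamma>(6)]; use that in simp)+
  have T\<gamma> [simp]: "Ta X (Ta X (q1 X (mo F A))) \<cdot> Ta X (\<gamma> A) \<cdot> x = Ta X (\<beta> A) \<cdot> Ta X (q1 X (mo F (To S A))) \<cdot> x"
    "Ta X (Ta X (q2 X (mo F A))) \<cdot> Ta X (\<gamma> A) \<cdot> x = Ta X (\<beta> A) \<cdot> Ta X (q2 X (mo F (To S A))) \<cdot> x"
    if "A \<in> Ob S" "x \<in> Ar X" "Cod X x = To X (T2 X (mo F (To S A)))" for A x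
    using assoc_eq[of "Ta X (Ta X (q1 X (mo F A)))" "Ta X (\<gamma> A)" "Ta X (\<beta> A)" "Ta X (q1 X (mo F (To S A)))" x]
      assoc_eq[of "Ta X (Ta X (q2 X (mo F A)))" "Ta X (\<gamma> A)" "Ta X (\<beta> A)" "Ta X (q2 X (mo F (To S A)))" x]
      T_cmp_cong[OF \<gamma>(5), of A] T_cmp_cong[OF \<gamma>(6), of A] that by simp_all
  show ?thesis
    unfolding lax_tangent_morphism_def \<gamma>_def[symmetric]
  proof (intro conjI ballI)
    show "mo (hom_T2 S X F) \<in> extensional (Ob S)" "ma (hom_T2 S X F) \<in> extensional (Ar S)"
      "\<gamma> \<in> extensional (Ob S)"
      by (simp_all add: hom_T2_def \<gamma>_def)
    show "restriction_functor S X (mo (hom_T2 S X F)) (ma (hom_T2 S X F))"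
      by (rule S.restriction_functorI) (simp_all add: T2a_functor)
    show "total_nat_trans S X (\<lambda>A. mo (hom_T2 S X F) (To S A)) (\<lambda>f. ma (hom_T2 S X F) (Ta S f))
        (\<lambda>A. To X (mo (hom_T2 S X F) A)) (\<lambda>f. Ta X (ma (hom_T2 S X F) f)) \<gamma>"
    proof (rule total_nat_transI)
      fix f assume [simp]: "f \<in> Ar S"
      have nat: "\<beta> (Cod S f) \<cdot> Ta X (ma F (Ta S f)) \<cdot> x = Ta X (Ta X (ma F f)) \<cdot> \<beta> (Dom S f) \<cdot> x"
        if "x \<in> Ar X" "Cod X x = To X (mo F (To S (Dom S f)))" for x
        using G.mn_natural_x[of f "Cod S f" x] that by (simp add: \<beta>_def)
      show "Ta X (ma (hom_T2 S X F) f) \<cdot> \<gamma> (Dom S f) = \<gamma> (Cod S f) \<cdot> ma (hom_T2 S X F) (Ta S f)"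
        by (rule TT2_ext[where A = "mo F (Cod S f)"]) (simp_all add: nat)
    qed simp_all
    fix A assume A [simp]: "A \<in> Ob S"
    let ?FA = "mo F A" and ?FTA = "mo F (To S A)"
    have \<beta>: "tp X (To X ?FA) \<cdot> \<beta> A = Ta X (ma F (tp S A))" "\<beta> A \<cdot> Ta X (ma F (tz S A)) = tz X (To X ?FA)"
      "\<beta> A \<cdot> Ta X (ma F (ts S A)) = ts X (To X ?FA) \<cdot>
        pairT2 X (To X ?FA) (\<beta> A \<cdot> Ta X (ma F (q1 S A))) (\<beta> A \<cdot> Ta X (ma F (q2 S A)))"
      "tl X (To X ?FA) \<cdot> \<beta> A = Ta X (\<beta> A) \<cdot> \<beta> (To S A) \<cdot> Ta X (ma F (tl S A))"
      "tc X (To X ?FA) \<cdot> Ta X (\<beta> A) \<cdot> \<beta> (To S A) = Ta X (\<beta> A) \<cdot> \<beta> (To S A) \<cdot> Ta X (ma F (tc S A))"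
      using G.mn_p[OF A] G.mn_z[OF A] G.mn_s[OF A] G.mn_l[OF A] G.mn_c[OF A] by (simp_all add: \<beta>_def[symmetric])
    have \<beta>_p: "tp X (To X ?FA) \<cdot> \<beta> A \<cdot> x = Ta X (ma F (tp S A)) \<cdot> x"
      if "x \<in> Ar X" "Cod X x = To X ?FTA" for x
      by (rule assoc_reduce[OF \<beta>(1)]) (use that in simp_all)
    show "tp X (mo (hom_T2 S X F) A) \<cdot> \<gamma> A = ma (hom_T2 S X F) (tp S A)"
      by (rule T2_ext[where A = ?FA]) (simp_all add: q_tp \<beta>_p)
    have \<beta>_z: "\<beta> A \<cdot> Ta X (ma F (tz S A)) \<cdot> x = tz X (To X ?FA) \<cdot> x" if "x \<in> Ar X" "Cod X x = To X ?FA" for x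
      by (rule assoc_reduce[OF \<beta>(2)]) (use that in simp_all)
    show "\<gamma> A \<cdot> ma (hom_T2 S X F) (tz S A) = tz X (mo (hom_T2 S X F) A)"
      by (rule TT2_ext[where A = ?FA]) (simp_all add: \<beta>_z Tq_tz)
    let ?w = "pairT2 X (To X ?FA) (\<beta> A \<cdot> Ta X (ma F (q1 S A))) (\<beta> A \<cdot> Ta X (ma F (q2 S A)))"
    have Tpq [simp]: "Ta X (ma F (tp S A)) \<cdot> Ta X (ma F (q2 S A)) = Ta X (ma F (tp S A)) \<cdot> Ta X (ma F (q1 S A))"
      using T_cmp_cong[OF ma_p_q2, of A] by simp
    have \<beta>_s: "\<beta> A \<cdot> Ta X (ma F (ts S A)) \<cdot> x = ts X (To X ?FA) \<cdot> ?w \<cdot> x"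
      if "x \<in> Ar X" "Cod X x = To X (mo F (T2 S A))" for x
      using assoc_eq[OF \<beta>(3), of x] that by (simp add: \<beta>_p)
    let ?v = "pairT2 X (T2 X ?FA) (\<gamma> A \<cdot> T2a X (ma F (q1 S A))) (\<gamma> A \<cdot> T2a X (ma F (q2 S A)))"
    have eqp: "tp X (T2 X ?FA) \<cdot> \<gamma> A \<cdot> T2a X (ma F (q1 S A)) = tp X (T2 X ?FA) \<cdot> \<gamma> A \<cdot> T2a X (ma F (q2 S A))"
    proof (rule T2_ext[where A = ?FA])
      have "Ta X (ma F (tp S A)) \<cdot> Ta X (ma F (q2 S A)) \<cdot> x = Ta X (ma F (tp S A)) \<cdot> Ta X (ma F (q1 S A)) \<cdot> x"
        if "x \<in> Ar X" "Cod X x = To X (mo F (T2 S A))" for x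
        by (rule assoc_eq[OF Tpq]) (use that in simp_all)
      then show "q1 X ?FA \<cdot> tp X (T2 X ?FA) \<cdot> \<gamma> A \<cdot> T2a X (ma F (q1 S A)) =
          q1 X ?FA \<cdot> tp X (T2 X ?FA) \<cdot> \<gamma> A \<cdot> T2a X (ma F (q2 S A))"
        "q2 X ?FA \<cdot> tp X (T2 X ?FA) \<cdot> \<gamma> A \<cdot> T2a X (ma F (q1 S A)) =
          q2 X ?FA \<cdot> tp X (T2 X ?FA) \<cdot> \<gamma> A \<cdot> T2a X (ma F (q2 S A))"
        by (simp_all add: q_tp \<beta>_p)
    qed simp_all
    have v [simp]: "?v \<in> Ar X" "Dom X ?v = T2 X (mo F (T2 S A))" "Cod X ?v = T2 X (T2 X ?FA)"
      "q1 X (T2 X ?FA) \<cdot> ?v = \<gamma> A \<cdot> T2a X (ma F (q1 S A))" "q2 X (T2 X ?FA) \<cdot> ?v = \<gamma> A \<cdot> T2a X (ma F (q2 S A))"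
      using pairT2(1-5)[of "T2 X ?FA" "\<gamma> A \<cdot> T2a X (ma F (q1 S A))" "\<gamma> A \<cdot> T2a X (ma F (q2 S A))"] eqp
      by simp_all
    have w: "T2a X (q1 X ?FA) \<cdot> ?v = ?w \<cdot> q1 X (mo F (T2 S A))" "T2a X (q2 X ?FA) \<cdot> ?v = ?w \<cdot> q2 X (mo F (T2 S A))"
      by (rule T2_ext[where A = "To X ?FA"]; simp add: \<beta>_p)+
    have "\<gamma> A \<cdot> T2a X (ma F (ts S A)) = ts X (T2 X ?FA) \<cdot> ?v"
      using ts_natural(2)[of "q1 X ?FA" "To X ?FA" ?v] ts_natural(2)[of "q2 X ?FA" "To X ?FA" ?v]
      by - (rule TT2_ext[where A = ?FA], simp_all add: \<beta>_s w)
    then show "\<gamma> A \<cdot> ma (hom_T2 S X F) (ts S A) = ts X (mo (hom_T2 S X F) A) \<cdot>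
        pairT2 X (mo (hom_T2 S X F) A) (\<gamma> A \<cdot> ma (hom_T2 S X F) (q1 S A)) (\<gamma> A \<cdot> ma (hom_T2 S X F) (q2 S A))"
      by simp
    have \<beta>_l: "tl X (To X ?FA) \<cdot> \<beta> A \<cdot> x = Ta X (\<beta> A) \<cdot> \<beta> (To S A) \<cdot> Ta X (ma F (tl S A)) \<cdot> x"
      if "x \<in> Ar X" "Cod X x = To X ?FTA" for x
      using assoc_eq[of "tl X (To X ?FA)" "\<beta> A" "Ta X (\<beta> A)" "\<beta> (To S A) \<cdot> Ta X (ma F (tl S A))" x] \<beta>(4) that by simp
    show "tl X (mo (hom_T2 S X F) A) \<cdot> \<gamma> A = Ta X (\<gamma> A) \<cdot> \<gamma> (To S A) \<cdot> ma (hom_T2 S X F) (tl S A)"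
      by (rule TTT2_ext[where A = ?FA]) (simp_all add: TTq_tl \<beta>_l)
    have \<beta>_c: "tc X (To X ?FA) \<cdot> Ta X (\<beta> A) \<cdot> \<beta> (To S A) \<cdot> x =
        Ta X (\<beta> A) \<cdot> \<beta> (To S A) \<cdot> Ta X (ma F (tc S A)) \<cdot> x"
      if "x \<in> Ar X" "Cod X x = To X (mo F (To S (To S A)))" for x
      using assoc_eq[of "tc X (To X ?FA)" "Ta X (\<beta> A) \<cdot> \<beta> (To S A)" "Ta X (\<beta> A)"
          "\<beta> (To S A) \<cdot> Ta X (ma F (tc S A))" x] \<beta>(5) that by simp
    show "tc X (mo (hom_T2 S X F) A) \<cdot> Ta X (\<gamma> A) \<cdot> \<gamma> (To S A) =
        Ta X (\<gamma> A) \<cdot> \<gamma> (To S A) \<cdot> ma (hom_T2 S X F) (tc S A)"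
      by (rule TTT2_ext[where A = ?FA]) (simp_all add: TTq_tc \<beta>_c)
  qed
qed

lemma tangent_2_morphismI:
  assumes "\<And>A. A \<in> Ob S \<Longrightarrow> \<phi> A \<in> Ar X \<and> Dom X (\<phi> A) = mo G A \<and> Cod X (\<phi> A) = mo H A \<and> total X (\<phi> A)"
    and "\<And>f. f \<in> Ar S \<Longrightarrow> ma H f \<cdot> \<phi> (Dom S f) = \<phi> (Cod S f) \<cdot> ma G f"
    and "\<And>A. A \<in> Ob S \<Longrightarrow> Ta X (\<phi> A) \<cdot> mn G A = mn H A \<cdot> \<phi> (To S A)"
  shows "tangent_2_morphism S X G H (\<lambda>A \<in> Ob S. \<phi> A)"
  using assms unfolding tangent_2_morphism_def by (auto intro!: total_nat_transI)

text \<open>Compatibility of a structural transformation with \<open>c \<cdot> T \<alpha>\<close> is its naturality at \<open>\<alpha>\<close> together with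
  the tangent axiom that relates it to \<open>c\<close>.\<close>

lemma hom_structure:
  shows hom_p: "tangent_2_morphism S X (hom_T S X F) F (\<lambda>A \<in> Ob S. tp X (mo F A))"
    and hom_z: "tangent_2_morphism S X F (hom_T S X F) (\<lambda>A \<in> Ob S. tz X (mo F A))"
    and hom_s: "tangent_2_morphism S X (hom_T2 S X F) (hom_T S X F) (\<lambda>A \<in> Ob S. ts X (mo F A))"
    and hom_l: "tangent_2_morphism S X (hom_T S X F) (hom_T S X (hom_T S X F)) (\<lambda>A \<in> Ob S. tl X (mo F A))"
    and hom_c: "tangent_2_morphism S X (hom_T S X (hom_T S X F)) (hom_T S X (hom_T S X F))
      (\<lambda>A \<in> Ob S. tc X (mo F A))"
    and hom_q1: "tangent_2_morphism S X (hom_T2 S X F) (hom_T S X F) (\<lambda>A \<in> Ob S. q1 X (mo F A))"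
    and hom_q2: "tangent_2_morphism S X (hom_T2 S X F) (hom_T S X F) (\<lambda>A \<in> Ob S. q2 X (mo F A))"
proof -
  interpret G: lax_morphism S X "hom_T S X F"
    by unfold_locales (rule lax_hom_T)
  show "tangent_2_morphism S X (hom_T S X F) F (\<lambda>A \<in> Ob S. tp X (mo F A))"
    by (rule tangent_2_morphismI) (simp_all add: tp_natural)
  show "tangent_2_morphism S X F (hom_T S X F) (\<lambda>A \<in> Ob S. tz X (mo F A))"
  proof (rule tangent_2_morphismI)
    fix A assume [simp]: "A \<in> Ob S"
    show "Ta X (tz X (mo F A)) \<cdot> mn F A = mn (hom_T S X F) A \<cdot> tz X (mo F (To S A))"
      using assoc_reduce[OF c_z, of "mo F A" "mn F A"] tz_natural(1)[of "mn F A" "To X (mo F A)"] by simp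
  qed (simp_all add: tz_natural)
  show "tangent_2_morphism S X (hom_T2 S X F) (hom_T S X F) (\<lambda>A \<in> Ob S. ts X (mo F A))"
  proof (rule tangent_2_morphismI)
    fix A assume [simp]: "A \<in> Ob S"
    let ?FA = "mo F A"
    let ?w = "pairTT2 X ?FA (tc X ?FA \<cdot> q1 X (To X ?FA)) (tc X ?FA \<cdot> q2 X (To X ?FA))"
    have "?w \<cdot> T2a X (mn F A) = mn (hom_T2 S X F) A"
      by (rule TT2_ext[where A = ?FA]) simp_all
    moreover have "tc X ?FA \<cdot> Ta X (mn F A) \<cdot> ts X (mo F (To S A)) = Ta X (ts X ?FA) \<cdot> ?w \<cdot> T2a X (mn F A)"
      using assoc_eq[OF c_s, of ?FA "T2a X (mn F A)"] ts_natural(1)[of "mn F A" "To X ?FA"] by simp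
    ultimately show "Ta X (ts X ?FA) \<cdot> mn (hom_T2 S X F) A = mn (hom_T S X F) A \<cdot> ts X (mo F (To S A))"
      by simp
  next
    show "ma (hom_T S X F) f \<cdot> ts X (mo F (Dom S f)) = ts X (mo F (Cod S f)) \<cdot> ma (hom_T2 S X F) f"
      if "f \<in> Ar S" for f
      using that ts_natural(1)[of "ma F f" "mo F (Cod S f)"] by simp
  qed simp_all
  show "tangent_2_morphism S X (hom_T S X F) (hom_T S X (hom_T S X F)) (\<lambda>A \<in> Ob S. tl X (mo F A))"
  proof (rule tangent_2_morphismI)
    fix A assume [simp]: "A \<in> Ob S"
    let ?FA = "mo F A"
    have "Ta X (tl X ?FA) \<cdot> tc X ?FA \<cdot> Ta X (mn F A) =
        tc X (To X ?FA) \<cdot> Ta X (tc X ?FA) \<cdot> tl X (To X ?FA) \<cdot> Ta X (mn F A)"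
      using assoc_eq[of "tc X (To X ?FA)" "Ta X (tc X ?FA) \<cdot> tl X (To X ?FA)" "Ta X (tl X ?FA)" "tc X ?FA" "Ta X (mn F A)"]
      by simp
    then show "Ta X (tl X ?FA) \<cdot> mn (hom_T S X F) A = mn (hom_T S X (hom_T S X F)) A \<cdot> tl X (mo F (To S A))"
      by (simp add: tl_natural)
  qed (simp_all add: tl_natural)
  show "tangent_2_morphism S X (hom_T S X (hom_T S X F)) (hom_T S X (hom_T S X F)) (\<lambda>A \<in> Ob S. tc X (mo F A))"
  proof (rule tangent_2_morphismI)
    fix A assume [simp]: "A \<in> Ob S"
    let ?FA = "mo F A"
    have "Ta X (tc X ?FA) \<cdot> tc X (To X ?FA) \<cdot> Ta X (tc X ?FA) \<cdot> x =
        tc X (To X ?FA) \<cdot> Ta X (tc X ?FA) \<cdot> tc X (To X ?FA) \<cdot> x"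
      if "x \<in> Ar X" "Cod X x = To X (To X (To X ?FA))" for x
      using assoc_eq[of "Ta X (tc X ?FA)" "tc X (To X ?FA) \<cdot> Ta X (tc X ?FA)" "tc X (To X ?FA)"
          "Ta X (tc X ?FA) \<cdot> tc X (To X ?FA)" x] yang_baxter[of ?FA] that by simp
    then show "Ta X (tc X ?FA) \<cdot> mn (hom_T S X (hom_T S X F)) A = mn (hom_T S X (hom_T S X F)) A \<cdot> tc X (mo F (To S A))"
      by (simp add: tc_natural)
  qed (simp_all add: tc_natural)
  show "tangent_2_morphism S X (hom_T2 S X F) (hom_T S X F) (\<lambda>A \<in> Ob S. q1 X (mo F A))"
    by (rule tangent_2_morphismI) simp_all
  show "tangent_2_morphism S X (hom_T2 S X F) (hom_T S X F) (\<lambda>A \<in> Ob S. q2 X (mo F A))"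
    by (rule tangent_2_morphismI) simp_all
qed

lemma hom_ide: "tangent_2_morphism S X F F (\<lambda>A \<in> Ob S. Ide X (mo F A))"
  by (rule tangent_2_morphismI) simp_all

end

lemma tangent_2_morphismD:
  assumes "tangent_2_morphism S X F G \<phi>"
  shows "\<phi> \<in> extensional (Ob S)"
    and "A \<in> Ob S \<Longrightarrow> \<phi> A \<in> Ar X" "A \<in> Ob S \<Longrightarrow> Dom X (\<phi> A) = mo F A"
    "A \<in> Ob S \<Longrightarrow> Cod X (\<phi> A) = mo G A" "A \<in> Ob S \<Longrightarrow> total X (\<phi> A)"
    and "f \<in> Ar S \<Longrightarrow> ma G f \<cdot>\<^bsub>X\<^esub> \<phi> (Dom S f) = \<phi> (Cod S f) \<cdot>\<^bsub>X\<^esub> ma F f"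
    and "A \<in> Ob S \<Longrightarrow> Ta X (\<phi> A) \<cdot>\<^bsub>X\<^esub> mn F A = mn G A \<cdot>\<^bsub>X\<^esub> \<phi> (To S A)"
proof -
  have ext: "\<phi> \<in> extensional (Ob S)" and nat: "total_nat_trans S X (mo F) (ma F) (mo G) (ma G) \<phi>"
    and tan: "\<forall>A \<in> Ob S. Ta X (\<phi> A) \<cdot>\<^bsub>X\<^esub> mn F A = mn G A \<cdot>\<^bsub>X\<^esub> \<phi> (To S A)"
    using assms unfolding tangent_2_morphism_def by blast+
  show "\<phi> \<in> extensional (Ob S)"
    by (fact ext)
  show "A \<in> Ob S \<Longrightarrow> \<phi> A \<in> Ar X" "A \<in> Ob S \<Longrightarrow> Dom X (\<phi> A) = mo F A"
    "A \<in> Ob S \<Longrightarrow> Cod X (\<phi> A) = mo G A" "A \<in> Ob S \<Longrightarrow> total X (\<phi> A)"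
    "f \<in> Ar S \<Longrightarrow> ma G f \<cdot>\<^bsub>X\<^esub> \<phi> (Dom S f) = \<phi> (Cod S f) \<cdot>\<^bsub>X\<^esub> ma F f"
    by (fact total_nat_transD[OF nat])+
  show "A \<in> Ob S \<Longrightarrow> Ta X (\<phi> A) \<cdot>\<^bsub>X\<^esub> mn F A = mn G A \<cdot>\<^bsub>X\<^esub> \<phi> (To S A)"
    using tan by blast
qed

context lax_morphism
begin

lemma hom_T_2_morphism:
  assumes G: "lax_tangent_morphism S X G" and \<phi>: "tangent_2_morphism S X F G \<phi>"
  shows "tangent_2_morphism S X (hom_T S X F) (hom_T S X G) (\<lambda>A \<in> Ob S. Ta X (\<phi> A))"
proof -
  interpret G: lax_morphism S X G
    by unfold_locales (rule G)
  note [simp] = tangent_2_morphismD(2-5)[OF \<phi>]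
  show ?thesis
  proof (rule tangent_2_morphismI)
    fix f assume "f \<in> Ar S"
    then show "ma (hom_T S X G) f \<cdot> Ta X (\<phi> (Dom S f)) = Ta X (\<phi> (Cod S f)) \<cdot> ma (hom_T S X F) f"
      using T_cmp_cong[OF tangent_2_morphismD(6)[OF \<phi>], of f] by simp
  next
    fix A assume "A \<in> Ob S"
    then show "Ta X (Ta X (\<phi> A)) \<cdot> mn (hom_T S X F) A = mn (hom_T S X G) A \<cdot> Ta X (\<phi> (To S A))"
      using T_cmp_cong[OF tangent_2_morphismD(7)[OF \<phi>], of A] tc_natural(2)[of "\<phi> A" "mo G A" "Ta X (mn F A)"]
      by simp
  qed simp_all
qed

lemma hom_cmp:
  assumes G: "lax_tangent_morphism S X G" and K: "lax_tangent_morphism S X K"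
    and \<phi>: "tangent_2_morphism S X F G \<phi>" and \<psi>: "tangent_2_morphism S X G K \<psi>"
  shows "tangent_2_morphism S X F K (\<lambda>A \<in> Ob S. \<psi> A \<cdot> \<phi> A)"
proof -
  interpret G: lax_morphism S X G
    by unfold_locales (rule G)
  interpret K: lax_morphism S X K
    by unfold_locales (rule K)
  note [simp] = tangent_2_morphismD(2-5)[OF \<phi>] tangent_2_morphismD(2-5)[OF \<psi>]
  show ?thesis
  proof (rule tangent_2_morphismI)
    fix f assume "f \<in> Ar S"
    then show "ma K f \<cdot> \<psi> (Dom S f) \<cdot> \<phi> (Dom S f) = (\<psi> (Cod S f) \<cdot> \<phi> (Cod S f)) \<cdot> ma F f"
      using assoc_eq[OF tangent_2_morphismD(6)[OF \<psi>], of f "\<phi> (Dom S f)"] tangent_2_morphismD(6)[OF \<phi>, of f] by simp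
  next
    fix A assume "A \<in> Ob S"
    then show "Ta X (\<psi> A \<cdot> \<phi> A) \<cdot> mn F A = mn K A \<cdot> \<psi> (To S A) \<cdot> \<phi> (To S A)"
      using assoc_eq[OF tangent_2_morphismD(7)[OF \<psi>], of A "\<phi> (To S A)"] tangent_2_morphismD(7)[OF \<phi>, of A] by simp
  qed simp_all
qed

end

section \<open>Pointwise differential objects as lifts along the forgetful functor\<close>

context do_context
begin

lemma DO_universal_simps [simp]:
  "dobj D \<Longrightarrow> mo (pmor (DO_universal X)) D = dob D"
  "(D, E, f) \<in> Ar (DO X) \<Longrightarrow> ma (pmor (DO_universal X)) (D, E, f) = f"
  "dobj D \<Longrightarrow> mn (pmor (DO_universal X)) D = Ide X (To X (dob D))"
  "dobj D \<Longrightarrow> pzero (DO_universal X) D = dzero D" "dobj D \<Longrightarrow> padd (DO_universal X) D = dadd D"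
  "dobj D \<Longrightarrow> pproj (DO_universal X) D = dproj D"
  by (simp_all add: DO_universal_def)

end

locale comparison = do_context X + S: tangent_split_restriction_category S
  for X :: "('o, 'a) ctcat" (structure) and S :: "('o1, 'a1, 'n) tcat_scheme"
begin

lemma component_simps [simp]:
  "dob (component K A) = mo (pmor K) A" "dzero (component K A) = pzero K A"
  "dadd (component K A) = padd K A" "dproj (component K A) = pproj K A"
  by (simp_all add: component_def)

lemma hom_one_simps [simp]:
  "A \<in> Ob S \<Longrightarrow> mo (hom_one S X) A = One X" "f \<in> Ar S \<Longrightarrow> ma (hom_one S X) f = Ide X (One X)"
  "A \<in> Ob S \<Longrightarrow> mn (hom_one S X) A = bang X (To X (One X)) (One X)"
  by (simp_all add: hom_one_def)

lemma hom_prod_simps [simp]: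
  "A \<in> Ob S \<Longrightarrow> mo (hom_prod S X F G) A = Prd X (mo F A) (mo G A)"
  "f \<in> Ar S \<Longrightarrow> ma (hom_prod S X F G) f = prod_arr X (ma F f) (ma G f)"
  "A \<in> Ob S \<Longrightarrow> mn (hom_prod S X F G) A = pairTprod X (mo F A) (mo G A)
    (mn F A \<cdot> pi1 X (mo F (To S A)) (mo G (To S A))) (mn G A \<cdot> pi2 X (mo F (To S A)) (mo G (To S A)))"
  by (simp_all add: hom_prod_def)

lemma pairTprod_prod_arr:
  assumes "f \<in> Ar X" "Dom X f = A" "Cod X f = To X B" "total X f" "B \<in> Ob X"
  shows "pairTprod X B B (pi1 X (To X B) (To X B)) (pi2 X (To X B) (To X B)) \<cdot> prod_arr X f f =
    pairTprod X B B (f \<cdot> pi1 X A A) (f \<cdot> pi2 X A A)"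
  using assms dom_in_Ob[OF assms(1)] by - (rule T_prod_ext[where A = B and B = B], simp_all)

text \<open>Naturality of the structure maps of a pointwise differential object says that all arrows \<open>F f\<close>
  are morphisms of differential objects, and their compatibility with the tangent structure says the
  same of the components of \<open>\<alpha> : F T \<rightarrow> T F\<close>.\<close>

lemma pointwise_iff:
  "pointwise_differential_object S X K \<longleftrightarrow> lax_tangent_morphism S X (pmor K) \<and>
    pzero K \<in> extensional (Ob S) \<and> padd K \<in> extensional (Ob S) \<and> pproj K \<in> extensional (Ob S) \<and>
    (\<forall>A \<in> Ob S. dobj (component K A)) \<and>
    (\<forall>f \<in> Ar S. do_morphism X (component K (Dom S f)) (component K (Cod S f)) (ma (pmor K) f)) \<and>
    (\<forall>A \<in> Ob S. do_morphism X (component K (To S A)) (do_T X (component K A)) (mn (pmor K) A))"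
  (is "_ \<longleftrightarrow> ?lax \<and> ?ext1 \<and> ?ext2 \<and> ?ext3 \<and> ?dobj \<and> ?mor \<and> ?mn")
proof (cases "?lax \<and> ?dobj")
  case True
  interpret F: lax_morphism S X "pmor K"
    by unfold_locales (use True in blast)
  have comp [simp]: "dobj (component K A)" if "A \<in> Ob S" for A
    using True that by blast
  note typed [simp] = dob_typed[OF dobj_typed[OF comp], unfolded component_simps]
  have "tangent_2_morphism S X (hom_one S X) (pmor K) (pzero K) \<longleftrightarrow> ?ext1 \<and>
      (\<forall>f \<in> Ar S. ma (pmor K) f \<cdot> pzero K (Dom S f) = pzero K (Cod S f)) \<and>
      (\<forall>A \<in> Ob S. mn (pmor K) A \<cdot> pzero K (To S A) = dzero (do_T X (component K A)))"
    unfolding tangent_2_morphism_def total_nat_trans_def Hom_def by auto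
  moreover have "tangent_2_morphism S X (hom_prod S X (pmor K) (pmor K)) (pmor K) (padd K) \<longleftrightarrow> ?ext2 \<and>
      (\<forall>f \<in> Ar S. ma (pmor K) f \<cdot> padd K (Dom S f) = padd K (Cod S f) \<cdot> prod_arr X (ma (pmor K) f) (ma (pmor K) f)) \<and>
      (\<forall>A \<in> Ob S. mn (pmor K) A \<cdot> padd K (To S A) =
        dadd (do_T X (component K A)) \<cdot> prod_arr X (mn (pmor K) A) (mn (pmor K) A))"
    unfolding tangent_2_morphism_def total_nat_trans_def Hom_def by (auto simp: pairTprod_prod_arr)
  moreover have "tangent_2_morphism S X (hom_T S X (pmor K)) (pmor K) (pproj K) \<longleftrightarrow> ?ext3 \<and>
      (\<forall>f \<in> Ar S. ma (pmor K) f \<cdot> pproj K (Dom S f) = pproj K (Cod S f) \<cdot> Ta X (ma (pmor K) f)) \<and>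
      (\<forall>A \<in> Ob S. mn (pmor K) A \<cdot> pproj K (To S A) = dproj (do_T X (component K A)) \<cdot> Ta X (mn (pmor K) A))"
    unfolding tangent_2_morphism_def total_nat_trans_def Hom_def by auto
  moreover have "?mor \<longleftrightarrow>
      (\<forall>f \<in> Ar S. ma (pmor K) f \<cdot> pzero K (Dom S f) = pzero K (Cod S f)) \<and>
      (\<forall>f \<in> Ar S. ma (pmor K) f \<cdot> padd K (Dom S f) = padd K (Cod S f) \<cdot> prod_arr X (ma (pmor K) f) (ma (pmor K) f)) \<and>
      (\<forall>f \<in> Ar S. ma (pmor K) f \<cdot> pproj K (Dom S f) = pproj K (Cod S f) \<cdot> Ta X (ma (pmor K) f))"
    by (auto simp: do_morphism_iff)
  moreover have "?mn \<longleftrightarrow>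
      (\<forall>A \<in> Ob S. mn (pmor K) A \<cdot> pzero K (To S A) = dzero (do_T X (component K A))) \<and>
      (\<forall>A \<in> Ob S. mn (pmor K) A \<cdot> padd K (To S A) =
        dadd (do_T X (component K A)) \<cdot> prod_arr X (mn (pmor K) A) (mn (pmor K) A)) \<and>
      (\<forall>A \<in> Ob S. mn (pmor K) A \<cdot> pproj K (To S A) = dproj (do_T X (component K A)) \<cdot> Ta X (mn (pmor K) A))"
    unfolding do_morphism_iff by (auto simp del: do_T_simps(2-4))
  ultimately show ?thesis
    unfolding pointwise_differential_object_def using True by blast
next
  case False
  then show ?thesis
    unfolding pointwise_differential_object_def by blast
qed

text \<open>\<open>lift d F\<close> is the lax tangent morphism into \<open>DO X\<close> with objects \<open>d A\<close> over \<open>F A\<close>; \<open>forget H\<close> is the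
  composite of \<open>H\<close> with the forgetful functor.\<close>

definition lift :: "('o1 \<Rightarrow> ('o, 'a) dobj) \<Rightarrow> ('o1, 'a1, 'o, 'a) tmor \<Rightarrow>
    ('o1, 'a1, ('o, 'a) dobj, ('o, 'a) do_arr) tmor" where
  "lift d F =
    \<lparr>mo = \<lambda>A \<in> Ob S. d A,
     ma = \<lambda>f \<in> Ar S. (d (Dom S f), d (Cod S f), ma F f),
     mn = \<lambda>A \<in> Ob S. (d (To S A), do_T X (d A), mn F A)\<rparr>"

definition forget :: "('o1, 'a1, ('o, 'a) dobj, ('o, 'a) do_arr) tmor \<Rightarrow> ('o1, 'a1, 'o, 'a) tmor" where
  "forget H =
    \<lparr>mo = \<lambda>A \<in> Ob S. dob (mo H A),
     ma = \<lambda>f \<in> Ar S. snd (snd (ma H f)),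
     mn = \<lambda>A \<in> Ob S. snd (snd (mn H A))\<rparr>"

lemma lift_simps [simp]:
  "A \<in> Ob S \<Longrightarrow> mo (lift d F) A = d A"
  "f \<in> Ar S \<Longrightarrow> ma (lift d F) f = (d (Dom S f), d (Cod S f), ma F f)"
  "A \<in> Ob S \<Longrightarrow> mn (lift d F) A = (d (To S A), do_T X (d A), mn F A)"
  by (simp_all add: lift_def)

lemma forget_simps [simp]:
  "A \<in> Ob S \<Longrightarrow> mo (forget H) A = dob (mo H A)"
  "f \<in> Ar S \<Longrightarrow> ma (forget H) f = snd (snd (ma H f))"
  "A \<in> Ob S \<Longrightarrow> mn (forget H) A = snd (snd (mn H A))"
  by (simp_all add: forget_def)

text \<open>Composition in \<open>DO X\<close> is that of \<open>X\<close> on the third components, so the conditions on \<open>lift d F\<close> and on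
  \<open>F\<close> are the same equations in \<open>X\<close>.\<close>

lemma lax_lift:
  assumes F: "lax_tangent_morphism S X F"
    and d [simp]: "\<And>A. A \<in> Ob S \<Longrightarrow> dobj (d A)" "\<And>A. A \<in> Ob S \<Longrightarrow> dob (d A) = mo F A"
    and mor: "\<And>f. f \<in> Ar S \<Longrightarrow> do_morphism X (d (Dom S f)) (d (Cod S f)) (ma F f)"
    and mn: "\<And>A. A \<in> Ob S \<Longrightarrow> do_morphism X (d (To S A)) (do_T X (d A)) (mn F A)"
  shows "lax_tangent_morphism S (DO X) (lift d F)"
proof -
  interpret F: lax_morphism S X F
    by unfold_locales (rule F)
  note [simp] = mor mn total_DO[OF mn]
  show ?thesis
    unfolding lax_tangent_morphism_def
  proof (intro conjI ballI)
    show "mo (lift d F) \<in> extensional (Ob S)" "ma (lift d F) \<in> extensional (Ar S)"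
      "mn (lift d F) \<in> extensional (Ob S)"
      by (simp_all add: lift_def)
    show "restriction_functor S (DO X) (mo (lift d F)) (ma (lift d F))"
      by (rule S.restriction_functorI) simp_all
    show "total_nat_trans S (DO X) (\<lambda>A. mo (lift d F) (To S A)) (\<lambda>f. ma (lift d F) (Ta S f))
        (\<lambda>A. To (DO X) (mo (lift d F) A)) (\<lambda>f. Ta (DO X) (ma (lift d F) f)) (mn (lift d F))"
      by (rule total_nat_transI) (simp_all add: F.mn_natural)
    fix A assume A [simp]: "A \<in> Ob S"
    have 1: "do_morphism X (d (T2 S A)) (d (To S A)) (ma F (q1 S A))"
      "do_morphism X (d (T2 S A)) (d (To S A)) (ma F (q2 S A))"
      using mor[of "q1 S A"] mor[of "q2 S A"] by simp_all
    have 2: "do_morphism X (d (T2 S A)) (do_T X (d A)) (mn F A \<cdot> ma F (q1 S A))"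
      "do_morphism X (d (T2 S A)) (do_T X (d A)) (mn F A \<cdot> ma F (q2 S A))"
      by (rule do_morphism_cmp[OF 1(1)] do_morphism_cmp[OF 1(2)]; simp)+
    show "tp (DO X) (mo (lift d F) A) \<cdot>\<^bsub>DO X\<^esub> mn (lift d F) A = ma (lift d F) (tp S A)"
      by simp
    show "mn (lift d F) A \<cdot>\<^bsub>DO X\<^esub> ma (lift d F) (tz S A) = tz (DO X) (mo (lift d F) A)"
      by (simp add: F.mn_z)
    show "mn (lift d F) A \<cdot>\<^bsub>DO X\<^esub> ma (lift d F) (ts S A) = ts (DO X) (mo (lift d F) A) \<cdot>\<^bsub>DO X\<^esub>
        pairT2 (DO X) (mo (lift d F) A) (mn (lift d F) A \<cdot>\<^bsub>DO X\<^esub> ma (lift d F) (q1 S A))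
          (mn (lift d F) A \<cdot>\<^bsub>DO X\<^esub> ma (lift d F) (q2 S A))"
      using 2 by (simp add: F.mn_s)
    show "tl (DO X) (mo (lift d F) A) \<cdot>\<^bsub>DO X\<^esub> mn (lift d F) A =
        Ta (DO X) (mn (lift d F) A) \<cdot>\<^bsub>DO X\<^esub> mn (lift d F) (To S A) \<cdot>\<^bsub>DO X\<^esub> ma (lift d F) (tl S A)"
      by (simp add: F.mn_l)
    show "tc (DO X) (mo (lift d F) A) \<cdot>\<^bsub>DO X\<^esub> Ta (DO X) (mn (lift d F) A) \<cdot>\<^bsub>DO X\<^esub> mn (lift d F) (To S A) =
        Ta (DO X) (mn (lift d F) A) \<cdot>\<^bsub>DO X\<^esub> mn (lift d F) (To S A) \<cdot>\<^bsub>DO X\<^esub> ma (lift d F) (tc S A)"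
      by (simp add: F.mn_c)
  qed
qed

context
  fixes H assumes H: "lax_tangent_morphism S (DO X) H"
begin

interpretation H: lax_morphism S "DO X" H
  by unfold_locales (rule H)

lemma lax_DO_ob: "A \<in> Ob S \<Longrightarrow> dobj (mo H A)"
  using H.ma_functorD(1)[of A] by simp

lemma lax_DO_ar:
  assumes "f \<in> Ar S"
  shows "ma H f = (mo H (Dom S f), mo H (Cod S f), ma (forget H) f)"
    and "do_morphism X (mo H (Dom S f)) (mo H (Cod S f)) (ma (forget H) f)"
proof -
  obtain D E g where g: "ma H f = (D, E, g)" "do_morphism X D E g"
    using H.ma_functorD(2)[OF assms] by (auto simp: Ar_DO)
  then have "D = mo H (Dom S f)" "E = mo H (Cod S f)"
    using H.ma_functorD(3,4)[OF assms] by simp_all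
  with g assms show "ma H f = (mo H (Dom S f), mo H (Cod S f), ma (forget H) f)"
    "do_morphism X (mo H (Dom S f)) (mo H (Cod S f)) (ma (forget H) f)"
    by simp_all
qed

lemma lax_DO_mn:
  assumes "A \<in> Ob S"
  shows "mn H A = (mo H (To S A), do_T X (mo H A), mn (forget H) A)"
    and "do_morphism X (mo H (To S A)) (do_T X (mo H A)) (mn (forget H) A)"
    and "total X (mn (forget H) A)"
proof -
  obtain D E g where g: "mn H A = (D, E, g)" "do_morphism X D E g"
    using H.mn_typing(1)[OF assms] by (auto simp: Ar_DO)
  then have "D = mo H (To S A)" "E = do_T X (mo H A)"
    using H.mn_typing(2,3)[OF assms] by simp_all
  moreover have "total X g"
    using H.mn_typing(4)[OF assms] g(1) total_DO[OF g(2)] by simp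
  ultimately show "mn H A = (mo H (To S A), do_T X (mo H A), mn (forget H) A)"
    "do_morphism X (mo H (To S A)) (do_T X (mo H A)) (mn (forget H) A)" "total X (mn (forget H) A)"
    using g assms by simp_all
qed

lemma lift_forget: "lift (mo H) (forget H) = H"
proof -
  have "mo H \<in> extensional (Ob S)" "ma H \<in> extensional (Ar S)" "mn H \<in> extensional (Ob S)"
    using H by (simp_all add: lax_tangent_morphism_def)
  moreover have "mo (lift (mo H) (forget H)) \<in> extensional (Ob S)"
    "ma (lift (mo H) (forget H)) \<in> extensional (Ar S)" "mn (lift (mo H) (forget H)) \<in> extensional (Ob S)"
    by (simp_all add: lift_def)
  ultimately have "mo (lift (mo H) (forget H)) = mo H" "ma (lift (mo H) (forget H)) = ma H"
    "mn (lift (mo H) (forget H)) = mn H"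
    by - (rule extensionalityI, assumption, assumption,
        simp only: lift_simps lax_DO_ar(1)[symmetric] lax_DO_mn(1)[symmetric])+
  then show ?thesis
    by simp
qed

lemma lax_forget: "lax_tangent_morphism S X (forget H)"
proof -
  let ?F = "forget H"
  note [simp] = lax_DO_ob lax_DO_ar(1) lax_DO_mn(1,3)
  note [simp del] = forget_simps(2,3)
  note [simp] = do_morphismD(1-3)[OF lax_DO_ar(2)] do_morphismD(1-3)[OF lax_DO_mn(2)]
  show ?thesis
    unfolding lax_tangent_morphism_def
  proof (intro conjI ballI)
    show "mo ?F \<in> extensional (Ob S)" "ma ?F \<in> extensional (Ar S)" "mn ?F \<in> extensional (Ob S)"
      by (simp_all add: forget_def)
    show "restriction_functor S X (mo ?F) (ma ?F)"
    proof (rule S.restriction_functorI)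
      show "ma ?F (Ide S A) = Ide X (mo ?F A)" if "A \<in> Ob S" for A
        using H.ma_functorD(5)[of A] that by simp
      show "ma ?F (g \<cdot>\<^bsub>S\<^esub> f) = ma ?F g \<cdot> ma ?F f" if "f \<in> Ar S" "g \<in> Ar S" "Cod S f = Dom S g" for f g
        using H.ma_functorD(6)[of f g] that by simp
      show "ma ?F (Rst S f) = Rst X (ma ?F f)" if "f \<in> Ar S" for f
        using H.ma_functorD(7)[of f] that by simp
    qed simp_all
    show "total_nat_trans S X (\<lambda>A. mo ?F (To S A)) (\<lambda>f. ma ?F (Ta S f))
        (\<lambda>A. To X (mo ?F A)) (\<lambda>f. Ta X (ma ?F f)) (mn ?F)"
    proof (rule total_nat_transI)
      show "Ta X (ma ?F f) \<cdot> mn ?F (Dom S f) = mn ?F (Cod S f) \<cdot> ma ?F (Ta S f)" if "f \<in> Ar S" for f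
        using H.mn_natural[of f "Cod S f"] that by simp
    qed simp_all
    fix A assume A [simp]: "A \<in> Ob S"
    show p: "tp X (mo ?F A) \<cdot> mn ?F A = ma ?F (tp S A)"
      using H.mn_p[of A] by simp
    show "mn ?F A \<cdot> ma ?F (tz S A) = tz X (mo ?F A)"
      using H.mn_z[of A] by simp
    have 1: "do_morphism X (mo H (T2 S A)) (mo H (To S A)) (ma ?F (q1 S A))"
      "do_morphism X (mo H (T2 S A)) (mo H (To S A)) (ma ?F (q2 S A))"
      using lax_DO_ar(2)[of "q1 S A"] lax_DO_ar(2)[of "q2 S A"] by simp_all
    have 2: "do_morphism X (mo H (T2 S A)) (do_T X (mo H A)) (mn ?F A \<cdot> ma ?F (q1 S A))"
      "do_morphism X (mo H (T2 S A)) (do_T X (mo H A)) (mn ?F A \<cdot> ma ?F (q2 S A))"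
      by (rule do_morphism_cmp[OF 1(1) lax_DO_mn(2)] do_morphism_cmp[OF 1(2) lax_DO_mn(2)]; simp)+
    have px: "tp X (dob (mo H A)) \<cdot> mn ?F A \<cdot> x = ma ?F (tp S A) \<cdot> x"
      if "x \<in> Ar X" "Cod X x = dob (mo H (To S A))" for x
      using assoc_reduce[OF p, of x] that by simp
    have "ma ?F (tp S A) \<cdot> ma ?F (q1 S A) = ma ?F (tp S A) \<cdot> ma ?F (q2 S A)"
      using H.ma_p_q2[of A] by simp
    then have 3: "tp X (dob (mo H A)) \<cdot> mn ?F A \<cdot> ma ?F (q1 S A) = tp X (dob (mo H A)) \<cdot> mn ?F A \<cdot> ma ?F (q2 S A)"
      by (simp add: px)
    show "mn ?F A \<cdot> ma ?F (ts S A) = ts X (mo ?F A) \<cdot>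
        pairT2 X (mo ?F A) (mn ?F A \<cdot> ma ?F (q1 S A)) (mn ?F A \<cdot> ma ?F (q2 S A))"
      using H.mn_s[of A] 2 3 by simp
    show "tl X (mo ?F A) \<cdot> mn ?F A = Ta X (mn ?F A) \<cdot> mn ?F (To S A) \<cdot> ma ?F (tl S A)"
      using H.mn_l[of A] by simp
    show "tc X (mo ?F A) \<cdot> Ta X (mn ?F A) \<cdot> mn ?F (To S A) = Ta X (mn ?F A) \<cdot> mn ?F (To S A) \<cdot> ma ?F (tc S A)"
      using H.mn_c[of A] by simp
  qed
qed

end

text \<open>The 2-morphisms into \<open>DO X\<close> are the 2-morphisms into \<open>X\<close> with components in \<open>DO X\<close>.\<close>

lemma two_forget:
  assumes H: "lax_tangent_morphism S (DO X) H" and H': "lax_tangent_morphism S (DO X) H'"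
    and \<phi>: "tangent_2_morphism S (DO X) H H' \<phi>"
  shows "A \<in> Ob S \<Longrightarrow> \<phi> A = (mo H A, mo H' A, snd (snd (\<phi> A)))"
    and "A \<in> Ob S \<Longrightarrow> do_morphism X (mo H A) (mo H' A) (snd (snd (\<phi> A)))"
    and "tangent_2_morphism S X (forget H) (forget H') (\<lambda>A \<in> Ob S. snd (snd (\<phi> A)))"
proof -
  have 1: "\<phi> A = (mo H A, mo H' A, snd (snd (\<phi> A)))"
    and 2: "do_morphism X (mo H A) (mo H' A) (snd (snd (\<phi> A)))" if A: "A \<in> Ob S" for A
  proof -
    obtain D E g where g: "\<phi> A = (D, E, g)" "do_morphism X D E g"
      using tangent_2_morphismD(2)[OF \<phi> A] by (auto simp: Ar_DO)
    then have "D = mo H A" "E = mo H' A"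
      using tangent_2_morphismD(3,4)[OF \<phi> A] by simp_all
    with g show "\<phi> A = (mo H A, mo H' A, snd (snd (\<phi> A)))"
      "do_morphism X (mo H A) (mo H' A) (snd (snd (\<phi> A)))"
      by simp_all
  qed
  show "A \<in> Ob S \<Longrightarrow> \<phi> A = (mo H A, mo H' A, snd (snd (\<phi> A)))"
    "A \<in> Ob S \<Longrightarrow> do_morphism X (mo H A) (mo H' A) (snd (snd (\<phi> A)))"
    by (fact 1, fact 2)
  define \<psi> where "\<psi> A = snd (snd (\<phi> A))" for A
  note 1 = 1[folded \<psi>_def] and 2 = 2[folded \<psi>_def]
  have 3: "total X (\<psi> A)" if "A \<in> Ob S" for A
    using tangent_2_morphismD(5)[OF \<phi> that] total_DO[OF 2[OF that]] by (simp add: 1[OF that])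
  interpret F: lax_morphism S X "forget H"
    by unfold_locales (rule lax_forget[OF H])
  note [simp] = lax_DO_ar(1)[OF H] lax_DO_ar(1)[OF H'] lax_DO_mn(1)[OF H] lax_DO_mn(1)[OF H']
  note [simp del] = forget_simps(2,3)
  have "tangent_2_morphism S X (forget H) (forget H') (\<lambda>A \<in> Ob S. \<psi> A)"
  proof (rule F.tangent_2_morphismI)
    show "\<psi> A \<in> Ar X \<and> Dom X (\<psi> A) = mo (forget H) A \<and> Cod X (\<psi> A) = mo (forget H') A \<and> total X (\<psi> A)"
      if "A \<in> Ob S" for A
      using that 3[OF that] do_morphismD(1-3)[OF 2[OF that]] by simp
    show "ma (forget H') f \<cdot> \<psi> (Dom S f) = \<psi> (Cod S f) \<cdot> ma (forget H) f" if "f \<in> Ar S" for f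
      using tangent_2_morphismD(6)[OF \<phi> that] that by (simp add: 1)
    show "Ta X (\<psi> A) \<cdot> mn (forget H) A = mn (forget H') A \<cdot> \<psi> (To S A)" if "A \<in> Ob S" for A
      using tangent_2_morphismD(7)[OF \<phi> that] that by (simp add: 1)
  qed
  then show "tangent_2_morphism S X (forget H) (forget H') (\<lambda>A \<in> Ob S. snd (snd (\<phi> A)))"
    by (simp add: \<psi>_def)
qed

lemma two_lift:
  assumes H: "lax_tangent_morphism S (DO X) H" and H': "lax_tangent_morphism S (DO X) H'"
    and \<psi>: "tangent_2_morphism S X (forget H) (forget H') \<psi>"
    and mor: "\<And>A. A \<in> Ob S \<Longrightarrow> do_morphism X (mo H A) (mo H' A) (\<psi> A)"
  shows "tangent_2_morphism S (DO X) H H' (\<lambda>A \<in> Ob S. (mo H A, mo H' A, \<psi> A))"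
proof -
  interpret H: lax_morphism S "DO X" H
    by unfold_locales (rule H)
  note [simp] = lax_DO_ob[OF H] lax_DO_ob[OF H'] lax_DO_ar(1)[OF H] lax_DO_ar(1)[OF H']
    lax_DO_mn(1)[OF H] lax_DO_mn(1)[OF H']
  note [simp del] = forget_simps(2,3)
  show ?thesis
  proof (rule H.tangent_2_morphismI)
    show "(mo H A, mo H' A, \<psi> A) \<in> Ar (DO X) \<and> Dom (DO X) (mo H A, mo H' A, \<psi> A) = mo H A \<and>
        Cod (DO X) (mo H A, mo H' A, \<psi> A) = mo H' A \<and> total (DO X) (mo H A, mo H' A, \<psi> A)"
      if "A \<in> Ob S" for A
      using that mor[OF that] tangent_2_morphismD(5)[OF \<psi> that] by (simp add: total_DO[OF mor[OF that]])
    show "ma H' f \<cdot>\<^bsub>DO X\<^esub> (mo H (Dom S f), mo H' (Dom S f), \<psi> (Dom S f)) =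
        (mo H (Cod S f), mo H' (Cod S f), \<psi> (Cod S f)) \<cdot>\<^bsub>DO X\<^esub> ma H f" if "f \<in> Ar S" for f
      using tangent_2_morphismD(6)[OF \<psi> that] that by simp
    show "Ta (DO X) (mo H A, mo H' A, \<psi> A) \<cdot>\<^bsub>DO X\<^esub> mn H A =
        mn H' A \<cdot>\<^bsub>DO X\<^esub> (mo H (To S A), mo H' (To S A), \<psi> (To S A))" if "A \<in> Ob S" for A
      using tangent_2_morphismD(7)[OF \<psi> that] that by simp
  qed
qed

section \<open>The comparison functor\<close>

abbreviation \<Phi> :: "('o1, 'a1, ('o, 'a) dobj, ('o, 'a) do_arr) tmor \<Rightarrow> ('o1, 'a1, 'o, 'a) pdobj" where
  "\<Phi> \<equiv> comparison_ob S X (DO_universal X)"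

lemma comparison_ob:
  assumes H: "lax_tangent_morphism S (DO X) H"
  shows "\<Phi> H = \<lparr>pmor = forget H, pzero = \<lambda>A \<in> Ob S. dzero (mo H A),
    padd = \<lambda>A \<in> Ob S. dadd (mo H A), pproj = \<lambda>A \<in> Ob S. dproj (mo H A)\<rparr>"
proof -
  interpret F: lax_morphism S X "forget H"
    by unfold_locales (rule lax_forget[OF H])
  note [simp] = lax_DO_ob[OF H] lax_DO_ar[OF H] lax_DO_mn[OF H]
  note [simp del] = forget_simps(2,3)
  have "mn (forget H) A \<in> Ar X" "Cod X (mn (forget H) A) = To X (dob (mo H A))" if "A \<in> Ob S" for A
    using that F.mn_typing by simp_all
  then have "tmor_comp S X (pmor (DO_universal X)) H = forget H"
    unfolding tmor_comp_def forget_def[of H] by (auto simp: restrict_def fun_eq_iff)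
  then show ?thesis
    unfolding comparison_ob_def by (auto simp: restrict_def fun_eq_iff)
qed

lemma component_comparison [simp]:
  "lax_tangent_morphism S (DO X) H \<Longrightarrow> A \<in> Ob S \<Longrightarrow> component (\<Phi> H) A = mo H A"
  by (simp add: comparison_ob component_def)

lemma pmor_comparison [simp]: "lax_tangent_morphism S (DO X) H \<Longrightarrow> pmor (\<Phi> H) = forget H"
  by (simp add: comparison_ob)

lemma comparison_ob_pointwise:
  assumes H: "lax_tangent_morphism S (DO X) H"
  shows "pointwise_differential_object S X (\<Phi> H)"
  unfolding pointwise_iff
  using H lax_forget[OF H] lax_DO_ob[OF H] lax_DO_ar(2)[OF H] lax_DO_mn(2)[OF H]
  by (simp add: component_comparison[OF H] pmor_comparison[OF H]) (simp add: comparison_ob[OF H])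

text \<open>The inverse of the comparison collects the components of a pointwise differential object into a
  functor to \<open>DO X\<close>.\<close>

lemma comparison_ob_lift:
  assumes K: "pointwise_differential_object S X K"
  shows "lax_tangent_morphism S (DO X) (lift (component K) (pmor K))"
    and "\<Phi> (lift (component K) (pmor K)) = K"
proof -
  note K' = K[unfolded pointwise_iff]
  show lax: "lax_tangent_morphism S (DO X) (lift (component K) (pmor K))"
    by (rule lax_lift) (use K' in auto)
  have ext: "mo (pmor K) \<in> extensional (Ob S)" "ma (pmor K) \<in> extensional (Ar S)" "mn (pmor K) \<in> extensional (Ob S)"
    "pzero K \<in> extensional (Ob S)" "padd K \<in> extensional (Ob S)" "pproj K \<in> extensional (Ob S)"
    using K' by (simp_all add: lax_tangent_morphism_def)
  have "(\<lambda>A \<in> Ob S. mo (pmor K) A) = mo (pmor K)" "(\<lambda>f \<in> Ar S. ma (pmor K) f) = ma (pmor K)"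
    "(\<lambda>A \<in> Ob S. mn (pmor K) A) = mn (pmor K)" "(\<lambda>A \<in> Ob S. pzero K A) = pzero K"
    "(\<lambda>A \<in> Ob S. padd K A) = padd K" "(\<lambda>A \<in> Ob S. pproj K A) = pproj K"
    using ext by (auto intro: extensional_restrict)
  then show "\<Phi> (lift (component K) (pmor K)) = K"
    unfolding comparison_ob[OF lax] forget_def by (simp cong: restrict_cong)
qed

lemma comparison_ob_inj:
  assumes H: "lax_tangent_morphism S (DO X) H" and H': "lax_tangent_morphism S (DO X) H'" and eq: "\<Phi> H = \<Phi> H'"
  shows "H = H'"
proof -
  have "mo H A = mo H' A" if "A \<in> Ob S" for A
    using component_comparison[OF H that] component_comparison[OF H' that] eq by simp
  then have "lift (mo H) (forget H') = lift (mo H') (forget H')"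
    by (simp add: lift_def cong: restrict_cong)
  moreover have "forget H = forget H'"
    using pmor_comparison[OF H] pmor_comparison[OF H'] eq by simp
  ultimately show ?thesis
    using lift_forget[OF H] lift_forget[OF H'] by metis
qed

lemma comparison_ob_bij:
  "bij_betw \<Phi> {H. lax_tangent_morphism S (DO X) H} {K. pointwise_differential_object S X K}"
proof (rule bij_betwI')
  show "\<Phi> H = \<Phi> H' \<longleftrightarrow> H = H'" if "H \<in> {H. lax_tangent_morphism S (DO X) H}"
      "H' \<in> {H. lax_tangent_morphism S (DO X) H}" for H H'
    using that comparison_ob_inj[of H H'] by blast
  show "\<exists>H \<in> {H. lax_tangent_morphism S (DO X) H}. K = \<Phi> H"
    if "K \<in> {K. pointwise_differential_object S X K}" for K
    using that comparison_ob_lift[of K] by (intro bexI[of _ "lift (component K) (pmor K)"]) simp_all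
qed (simp add: comparison_ob_pointwise)

end

lemma hom_tcat_simps:
  "Ob (hom_tcat S Y) = {F. lax_tangent_morphism S Y F}"
  "(F, G, \<phi>) \<in> Ar (hom_tcat S Y) \<longleftrightarrow>
    lax_tangent_morphism S Y F \<and> lax_tangent_morphism S Y G \<and> tangent_2_morphism S Y F G \<phi>"
  "Dom (hom_tcat S Y) (F, G, \<phi>) = F" "Cod (hom_tcat S Y) (F, G, \<phi>) = G"
  "Ide (hom_tcat S Y) F = (F, F, \<lambda>A \<in> Ob S. Ide Y (mo F A))"
  "Cmp (hom_tcat S Y) (G', K, \<psi>) (F, G, \<phi>) = (F, K, \<lambda>A \<in> Ob S. \<psi> A \<cdot>\<^bsub>Y\<^esub> \<phi> A)"
  "Rst (hom_tcat S Y) (F, G, \<phi>) = (F, F, \<lambda>A \<in> Ob S. Ide Y (mo F A))"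
  "To (hom_tcat S Y) F = hom_T S Y F"
  "Ta (hom_tcat S Y) (F, G, \<phi>) = (hom_T S Y F, hom_T S Y G, \<lambda>A \<in> Ob S. Ta Y (\<phi> A))"
  "T2 (hom_tcat S Y) F = hom_T2 S Y F"
  "q1 (hom_tcat S Y) F = (hom_T2 S Y F, hom_T S Y F, \<lambda>A \<in> Ob S. q1 Y (mo F A))"
  "q2 (hom_tcat S Y) F = (hom_T2 S Y F, hom_T S Y F, \<lambda>A \<in> Ob S. q2 Y (mo F A))"
  "tp (hom_tcat S Y) F = (hom_T S Y F, F, \<lambda>A \<in> Ob S. tp Y (mo F A))"
  "tz (hom_tcat S Y) F = (F, hom_T S Y F, \<lambda>A \<in> Ob S. tz Y (mo F A))"
  "ts (hom_tcat S Y) F = (hom_T2 S Y F, hom_T S Y F, \<lambda>A \<in> Ob S. ts Y (mo F A))"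
  "tl (hom_tcat S Y) F = (hom_T S Y F, hom_T S Y (hom_T S Y F), \<lambda>A \<in> Ob S. tl Y (mo F A))"
  "tc (hom_tcat S Y) F =
    (hom_T S Y (hom_T S Y F), hom_T S Y (hom_T S Y F), \<lambda>A \<in> Ob S. tc Y (mo F A))"
  by (simp_all add: hom_tcat_def)

lemma pdo_tcat_simps:
  "Ob (pdo_tcat S X) = {K. pointwise_differential_object S X K}"
  "(K, L, \<phi>) \<in> Ar (pdo_tcat S X) \<longleftrightarrow>
    pointwise_differential_object S X K \<and> pointwise_differential_object S X L \<and>
    tangent_2_morphism S X (pmor K) (pmor L) \<phi> \<and>
    (\<forall>A \<in> Ob S. linear X (component K A) (component L A) (\<phi> A))"
  "Dom (pdo_tcat S X) (K, L, \<phi>) = K" "Cod (pdo_tcat S X) (K, L, \<phi>) = L"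
  "Ide (pdo_tcat S X) K = (K, K, \<lambda>A \<in> Ob S. Ide X (mo (pmor K) A))"
  "Cmp (pdo_tcat S X) (L', M, \<psi>) (K, L, \<phi>) = (K, M, \<lambda>A \<in> Ob S. \<psi> A \<cdot>\<^bsub>X\<^esub> \<phi> A)"
  "Rst (pdo_tcat S X) (K, L, \<phi>) = (K, K, \<lambda>A \<in> Ob S. Ide X (mo (pmor K) A))"
  "To (pdo_tcat S X) K = pdo_T S X K"
  "Ta (pdo_tcat S X) (K, L, \<phi>) = (pdo_T S X K, pdo_T S X L, \<lambda>A \<in> Ob S. Ta X (\<phi> A))"
  "T2 (pdo_tcat S X) K = pdo_T2 S X K"
  "q1 (pdo_tcat S X) K = (pdo_T2 S X K, pdo_T S X K, \<lambda>A \<in> Ob S. q1 X (mo (pmor K) A))"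
  "q2 (pdo_tcat S X) K = (pdo_T2 S X K, pdo_T S X K, \<lambda>A \<in> Ob S. q2 X (mo (pmor K) A))"
  "tp (pdo_tcat S X) K = (pdo_T S X K, K, \<lambda>A \<in> Ob S. tp X (mo (pmor K) A))"
  "tz (pdo_tcat S X) K = (K, pdo_T S X K, \<lambda>A \<in> Ob S. tz X (mo (pmor K) A))"
  "ts (pdo_tcat S X) K = (pdo_T2 S X K, pdo_T S X K, \<lambda>A \<in> Ob S. ts X (mo (pmor K) A))"
  "tl (pdo_tcat S X) K = (pdo_T S X K, pdo_T S X (pdo_T S X K), \<lambda>A \<in> Ob S. tl X (mo (pmor K) A))"
  "tc (pdo_tcat S X) K =
    (pdo_T S X (pdo_T S X K), pdo_T S X (pdo_T S X K), \<lambda>A \<in> Ob S. tc X (mo (pmor K) A))"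
  by (simp_all add: pdo_tcat_def)

context comparison
begin

abbreviation "C \<equiv> hom_tcat S (DO X)"
abbreviation "P \<equiv> pdo_tcat S X"
abbreviation "\<Phi>a \<equiv> comparison_ar S X (DO_universal X)"

text \<open>A linear 2-morphism has total components, which are therefore morphisms of differential
  objects.\<close>

lemma Ar_P:
  "(K, L, \<psi>) \<in> Ar P \<longleftrightarrow> pointwise_differential_object S X K \<and> pointwise_differential_object S X L \<and>
    tangent_2_morphism S X (pmor K) (pmor L) \<psi> \<and>
    (\<forall>A \<in> Ob S. do_morphism X (component K A) (component L A) (\<psi> A))" (is "_ \<longleftrightarrow> ?R")
proof
  assume *: "(K, L, \<psi>) \<in> Ar P"
  then have KL: "pointwise_differential_object S X K" "pointwise_differential_object S X L"
    and \<psi>: "tangent_2_morphism S X (pmor K) (pmor L) \<psi>"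
    and lin: "\<And>A. A \<in> Ob S \<Longrightarrow> linear X (component K A) (component L A) (\<psi> A)"
    by (simp_all add: pdo_tcat_simps)
  have "do_morphism X (component K A) (component L A) (\<psi> A)" if A: "A \<in> Ob S" for A
    by (rule do_morphism_total_linear)
      (use KL lin[OF A] tangent_2_morphismD(2-5)[OF \<psi> A] A in \<open>simp_all add: pointwise_iff linear_def\<close>)
  with KL \<psi> show ?R
    by blast
next
  assume ?R
  then show "(K, L, \<psi>) \<in> Ar P"
    by (simp add: pdo_tcat_simps do_morphism_def)
qed

lemma Ar_C_cases:
  assumes "t \<in> Ar C"
  obtains H H' \<phi> \<psi> where "t = (H, H', \<phi>)" "lax_tangent_morphism S (DO X) H" "lax_tangent_morphism S (DO X) H'"
    "tangent_2_morphism S (DO X) H H' \<phi>"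
    "\<And>A. A \<in> Ob S \<Longrightarrow> \<phi> A = (mo H A, mo H' A, \<psi> A)"
    "\<And>A. A \<in> Ob S \<Longrightarrow> do_morphism X (mo H A) (mo H' A) (\<psi> A)"
    "tangent_2_morphism S X (forget H) (forget H') (\<lambda>A \<in> Ob S. \<psi> A)"
    "\<Phi>a t = (\<Phi> H, \<Phi> H', \<lambda>A \<in> Ob S. \<psi> A)"
proof -
  obtain H H' \<phi> where t: "t = (H, H', \<phi>)"
    by (cases t)
  then have H: "lax_tangent_morphism S (DO X) H" "lax_tangent_morphism S (DO X) H'"
    "tangent_2_morphism S (DO X) H H' \<phi>"
    using assms by (simp_all add: hom_tcat_simps)
  define \<psi> where "\<psi> A = snd (snd (\<phi> A))" for A
  note \<psi> = two_forget[OF H, folded \<psi>_def]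
  have "\<Phi>a t = (\<Phi> H, \<Phi> H', \<lambda>A \<in> Ob S. \<psi> A)"
    by (simp add: t comparison_ar_def \<psi>(1,2) lax_DO_ob[OF H(1)] lax_DO_ob[OF H(2)] cong: restrict_cong)
  with t H \<psi> show ?thesis
    by (rule that)
qed

lemma comparison_ar:
  assumes "(H, H', \<phi>) \<in> Ar C"
    and "\<And>A. A \<in> Ob S \<Longrightarrow> \<phi> A = (mo H A, mo H' A, \<psi> A)"
  shows "\<Phi>a (H, H', \<phi>) = (\<Phi> H, \<Phi> H', \<lambda>A \<in> Ob S. \<psi> A)"
proof (rule Ar_C_cases[OF assms(1)])
  fix G G' \<chi> \<xi> assume *: "(H, H', \<phi>) = (G, G', \<chi>)" "\<And>A. A \<in> Ob S \<Longrightarrow> \<chi> A = (mo G A, mo G' A, \<xi> A)"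
    and "\<Phi>a (H, H', \<phi>) = (\<Phi> G, \<Phi> G', \<lambda>A \<in> Ob S. \<xi> A)"
  moreover have "\<xi> A = \<psi> A" if "A \<in> Ob S" for A
    using *(1) *(2)[OF that] assms(2)[OF that] by simp
  ultimately show ?thesis
    by (simp cong: restrict_cong)
qed

lemma comparison_ar_in_P:
  assumes "t \<in> Ar C"
  shows "\<Phi>a t \<in> Ar P"
  by (rule Ar_C_cases[OF assms]) (simp add: Ar_P comparison_ob_pointwise)

lemma comparison_ar_bij: "bij_betw \<Phi>a (Ar C) (Ar P)"
proof (rule bij_betwI')
  fix t t' assume t: "t \<in> Ar C" and t': "t' \<in> Ar C"
  show "\<Phi>a t = \<Phi>a t' \<longleftrightarrow> t = t'"
  proof
    assume eq: "\<Phi>a t = \<Phi>a t'"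
    obtain H H' \<phi> \<psi> where 1: "t = (H, H', \<phi>)" "lax_tangent_morphism S (DO X) H" "lax_tangent_morphism S (DO X) H'"
      "tangent_2_morphism S (DO X) H H' \<phi>" "\<And>A. A \<in> Ob S \<Longrightarrow> \<phi> A = (mo H A, mo H' A, \<psi> A)"
      "\<Phi>a t = (\<Phi> H, \<Phi> H', \<lambda>A \<in> Ob S. \<psi> A)"
      using t by (rule Ar_C_cases) blast
    obtain G G' \<chi> \<xi> where 2: "t' = (G, G', \<chi>)" "lax_tangent_morphism S (DO X) G" "lax_tangent_morphism S (DO X) G'"
      "tangent_2_morphism S (DO X) G G' \<chi>" "\<And>A. A \<in> Ob S \<Longrightarrow> \<chi> A = (mo G A, mo G' A, \<xi> A)"
      "\<Phi>a t' = (\<Phi> G, \<Phi> G', \<lambda>A \<in> Ob S. \<xi> A)"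
      using t' by (rule Ar_C_cases) blast
    have HG: "H = G" "H' = G'"
      using eq 1(6) 2(6) comparison_ob_inj[OF 1(2) 2(2)] comparison_ob_inj[OF 1(3) 2(3)] by simp_all
    have "\<psi> A = \<xi> A" if "A \<in> Ob S" for A
      using eq 1(6) 2(6) that by (auto dest: fun_cong[of _ _ A])
    then have "\<phi> = \<chi>"
      using 1(5) 2(5) HG
      by - (rule extensionalityI[OF tangent_2_morphismD(1)[OF 1(4)] tangent_2_morphismD(1)[OF 2(4)]], simp)
    then show "t = t'"
      using 1(1) 2(1) HG by simp
  qed simp
next
  fix t assume "t \<in> Ar C"
  then show "\<Phi>a t \<in> Ar P"
    by (rule comparison_ar_in_P)
next
  fix t assume t: "t \<in> Ar P"
  obtain K L \<psi> where t_eq: "t = (K, L, \<psi>)"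
    by (cases t)
  with t have KL: "pointwise_differential_object S X K" "pointwise_differential_object S X L"
    and \<psi>: "tangent_2_morphism S X (pmor K) (pmor L) \<psi>"
    and mor: "\<And>A. A \<in> Ob S \<Longrightarrow> do_morphism X (component K A) (component L A) (\<psi> A)"
    by (simp_all add: Ar_P)
  define H H' where "H = lift (component K) (pmor K)" and "H' = lift (component L) (pmor L)"
  have H: "lax_tangent_morphism S (DO X) H" "lax_tangent_morphism S (DO X) H'" "\<Phi> H = K" "\<Phi> H' = L"
    using comparison_ob_lift KL by (simp_all add: H_def H'_def)
  have F: "forget H = pmor K" "forget H' = pmor L"
    using pmor_comparison[OF H(1)] pmor_comparison[OF H(2)] H(3,4) by simp_all
  let ?\<phi> = "\<lambda>A \<in> Ob S. (mo H A, mo H' A, \<psi> A)"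
  have mo: "mo H A = component K A" "mo H' A = component L A" if "A \<in> Ob S" for A
    using that by (simp_all add: H_def H'_def)
  have "tangent_2_morphism S (DO X) H H' ?\<phi>"
    by (rule two_lift[OF H(1,2)]) (simp_all add: F \<psi> mor mo)
  then have ar: "(H, H', ?\<phi>) \<in> Ar C"
    using H by (simp add: hom_tcat_simps)
  have "(\<lambda>A \<in> Ob S. \<psi> A) = \<psi>"
    using tangent_2_morphismD(1)[OF \<psi>] by (rule extensional_restrict)
  then have "t = \<Phi>a (H, H', ?\<phi>)"
    by (subst comparison_ar[OF ar, of \<psi>]) (simp_all add: H t_eq)
  then show "\<exists>s \<in> Ar C. t = \<Phi>a s"
    using ar by blast
qed

text \<open>The tangent bundle and its fibre products are given by the same formulas in both hom-categories, once
  pairings in \<open>DO X\<close> are identified with pairings in \<open>X\<close>; so they are preserved strictly.\<close>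

context
  fixes H assumes H: "lax_tangent_morphism S (DO X) H"
begin

interpretation H: lax_morphism S "DO X" H
  by unfold_locales (rule H)

interpretation F: lax_morphism S X "forget H"
  by unfold_locales (rule lax_forget[OF H])

lemma lax_T: "lax_tangent_morphism S (DO X) (hom_T S (DO X) H)"
  by (rule H.lax_hom_T)

lemma lax_T2: "lax_tangent_morphism S (DO X) (hom_T2 S (DO X) H)"
  by (rule H.lax_hom_T2)

lemma forget_hom_T: "forget (hom_T S (DO X) H) = hom_T S X (forget H)"
  using lax_DO_ar(1)[OF H] lax_DO_mn(1)[OF H]
  unfolding forget_def[of "hom_T S (DO X) H"] hom_T_def[of S X]
  by (simp del: forget_simps(2,3) cong: restrict_cong)

lemma comparison_T: "\<Phi> (hom_T S (DO X) H) = pdo_T S X (\<Phi> H)"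
  unfolding comparison_ob[OF lax_T] pdo_T_def
  by (simp add: H forget_hom_T del: do_T_simps(2-4) cong: restrict_cong)

lemma forget_hom_T2: "forget (hom_T2 S (DO X) H) = hom_T2 S X (forget H)"
proof -
  note [simp] = lax_DO_ob[OF H] lax_DO_ar[OF H] lax_DO_mn[OF H]
  note [simp del] = forget_simps(2,3)
  have ma: "snd (snd (T2a (DO X) (ma H f))) = T2a X (ma (forget H) f)" if "f \<in> Ar S" for f
    using that by simp
  have mn: "snd (snd (mn (hom_T2 S (DO X) H) A)) = mn (hom_T2 S X (forget H)) A" if A [simp]: "A \<in> Ob S" for A
  proof -
    let ?D = "mo H A" and ?E = "mo H (To S A)" and ?\<beta> = "mn (hom_T S X (forget H)) A"
    have \<beta>: "do_morphism X (do_T X ?E) (do_T X (do_T X ?D)) ?\<beta>"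
      by (simp del: do_T_simps(2-4)) (rule do_morphism_cmp[where E = "do_T X (do_T X ?D)"], simp_all add: do_morphism_T)
    have 1: "do_morphism X (do_T2 X ?E) (do_T X (do_T X ?D)) (?\<beta> \<cdot> q1 X (dob ?E))"
      "do_morphism X (do_T2 X ?E) (do_T X (do_T X ?D)) (?\<beta> \<cdot> q2 X (dob ?E))"
      by (rule do_morphism_cmp[OF _ \<beta>]; simp)+
    have 2: "Ta X (tp X (dob ?D)) \<cdot> ?\<beta> \<cdot> q1 X (dob ?E) = Ta X (tp X (dob ?D)) \<cdot> ?\<beta> \<cdot> q2 X (dob ?E)"
      using F.tp_T_mn[OF A, of "q1 X (dob ?E)"] F.tp_T_mn[OF A, of "q2 X (dob ?E)"]
        F.mn_typing[OF A] by simp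
    have "mn (hom_T2 S (DO X) H) A = pairTT2 (DO X) ?D (do_T2 X ?E, do_T X (do_T X ?D), ?\<beta> \<cdot> q1 X (dob ?E))
        (do_T2 X ?E, do_T X (do_T X ?D), ?\<beta> \<cdot> q2 X (dob ?E))"
      by (simp add: hom_T2_def)
    also have "\<dots> = (do_T2 X ?E, do_T X (do_T2 X ?D), pairTT2 X (dob ?D) (?\<beta> \<cdot> q1 X (dob ?E)) (?\<beta> \<cdot> q2 X (dob ?E)))"
      by (rule DO_pairTT2) (simp_all only: 1 2 dobj_closed lax_DO_ob[OF H] A S.T_functorD)
    finally show ?thesis
      by (simp add: hom_T2_def)
  qed
  have "mn (hom_T2 S X (forget H)) = (\<lambda>A \<in> Ob S. mn (hom_T2 S X (forget H)) A)"
    by (rule extensional_restrict[symmetric]) (simp add: hom_T2_def)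
  then show ?thesis
    unfolding forget_def[of "hom_T2 S (DO X) H"]
    by (simp add: ma mn cong: restrict_cong) (auto simp: hom_T2_def restrict_def fun_eq_iff)
qed

lemma comparison_T2: "\<Phi> (hom_T2 S (DO X) H) = pdo_T2 S X (\<Phi> H)"
  unfolding comparison_ob[OF lax_T2] pdo_T2_def
  by (simp add: H forget_hom_T2 cong: restrict_cong)

end

context
  fixes H assumes H: "lax_tangent_morphism S (DO X) H"
begin

interpretation H: lax_morphism S "DO X" H
  by unfold_locales (rule H)

interpretation TH: lax_morphism S "DO X" "hom_T S (DO X) H"
  by unfold_locales (rule lax_T[OF H])

lemma structure_in_C:
  "Ide C H \<in> Ar C" "q1 C H \<in> Ar C" "q2 C H \<in> Ar C" "tp C H \<in> Ar C" "tz C H \<in> Ar C" "ts C H \<in> Ar C"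
  "tl C H \<in> Ar C" "tc C H \<in> Ar C"
  using H lax_T[OF H] lax_T2[OF H] TH.lax_hom_T H.hom_structure H.hom_ide
  unfolding hom_tcat_simps by blast+

lemma comparison_structure:
  "\<Phi>a (Ide C H) = Ide P (\<Phi> H)" "\<Phi>a (q1 C H) = q1 P (\<Phi> H)" "\<Phi>a (q2 C H) = q2 P (\<Phi> H)"
  "\<Phi>a (tp C H) = tp P (\<Phi> H)" "\<Phi>a (tz C H) = tz P (\<Phi> H)" "\<Phi>a (ts C H) = ts P (\<Phi> H)"
  "\<Phi>a (tl C H) = tl P (\<Phi> H)" "\<Phi>a (tc C H) = tc P (\<Phi> H)"
proof -
  note ar = structure_in_C[unfolded hom_tcat_simps(5-)]
  note [simp] = H comparison_T comparison_T2 lax_T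
  note [cong] = restrict_cong
  let ?D = "\<lambda>A. dob (mo H A)"
  show "\<Phi>a (Ide C H) = Ide P (\<Phi> H)"
    unfolding hom_tcat_simps pdo_tcat_simps
    by (subst comparison_ar[OF ar(1), of "\<lambda>A. Ide X (?D A)"]) simp_all
  show "\<Phi>a (q1 C H) = q1 P (\<Phi> H)"
    unfolding hom_tcat_simps pdo_tcat_simps
    by (subst comparison_ar[OF ar(2), of "\<lambda>A. q1 X (?D A)"]) simp_all
  show "\<Phi>a (q2 C H) = q2 P (\<Phi> H)"
    unfolding hom_tcat_simps pdo_tcat_simps
    by (subst comparison_ar[OF ar(3), of "\<lambda>A. q2 X (?D A)"]) simp_all
  show "\<Phi>a (tp C H) = tp P (\<Phi> H)"
    unfolding hom_tcat_simps pdo_tcat_simps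
    by (subst comparison_ar[OF ar(4), of "\<lambda>A. tp X (?D A)"]) simp_all
  show "\<Phi>a (tz C H) = tz P (\<Phi> H)"
    unfolding hom_tcat_simps pdo_tcat_simps
    by (subst comparison_ar[OF ar(5), of "\<lambda>A. tz X (?D A)"]) simp_all
  show "\<Phi>a (ts C H) = ts P (\<Phi> H)"
    unfolding hom_tcat_simps pdo_tcat_simps
    by (subst comparison_ar[OF ar(6), of "\<lambda>A. ts X (?D A)"]) simp_all
  show "\<Phi>a (tl C H) = tl P (\<Phi> H)"
    unfolding hom_tcat_simps pdo_tcat_simps
    by (subst comparison_ar[OF ar(7), of "\<lambda>A. tl X (?D A)"]) simp_all
  show "\<Phi>a (tc C H) = tc P (\<Phi> H)"
    unfolding hom_tcat_simps pdo_tcat_simps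
    by (subst comparison_ar[OF ar(8), of "\<lambda>A. tc X (?D A)"]) simp_all
qed

end

lemma Hom_C: "t \<in> Hom C F G \<longleftrightarrow> t \<in> Ar C \<and> (\<exists>\<phi>. t = (F, G, \<phi>))"
  by (cases t) (auto simp: Hom_def hom_tcat_simps)

lemma comparison_ar_cmp:
  assumes "(F, G, \<phi>) \<in> Ar C" "(G, K, \<psi>) \<in> Ar C"
  shows "Cmp C (G, K, \<psi>) (F, G, \<phi>) \<in> Ar C"
    and "\<Phi>a (Cmp C (G, K, \<psi>) (F, G, \<phi>)) = Cmp P (\<Phi>a (G, K, \<psi>)) (\<Phi>a (F, G, \<phi>))"
proof -
  have lax: "lax_tangent_morphism S (DO X) F" "lax_tangent_morphism S (DO X) G" "lax_tangent_morphism S (DO X) K"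
    using assms by (simp_all add: hom_tcat_simps)
  interpret F: lax_morphism S "DO X" F
    by unfold_locales (rule lax(1))
  show 1: "Cmp C (G, K, \<psi>) (F, G, \<phi>) \<in> Ar C"
    using F.hom_cmp[OF lax(2,3)] assms unfolding hom_tcat_simps by blast
  obtain \<phi>' where \<phi>': "\<And>A. A \<in> Ob S \<Longrightarrow> \<phi> A = (mo F A, mo G A, \<phi>' A)"
    using assms(1) by (rule Ar_C_cases) blast
  obtain \<psi>' where \<psi>': "\<And>A. A \<in> Ob S \<Longrightarrow> \<psi> A = (mo G A, mo K A, \<psi>' A)"
    using assms(2) by (rule Ar_C_cases) blast
  have 2: "\<Phi>a (F, G, \<phi>) = (\<Phi> F, \<Phi> G, \<lambda>A \<in> Ob S. \<phi>' A)"
    by (rule comparison_ar[OF assms(1)]) (rule \<phi>')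
  have 3: "\<Phi>a (G, K, \<psi>) = (\<Phi> G, \<Phi> K, \<lambda>A \<in> Ob S. \<psi>' A)"
    by (rule comparison_ar[OF assms(2)]) (rule \<psi>')
  show "\<Phi>a (Cmp C (G, K, \<psi>) (F, G, \<phi>)) = Cmp P (\<Phi>a (G, K, \<psi>)) (\<Phi>a (F, G, \<phi>))"
    unfolding 2 3 hom_tcat_simps(6) pdo_tcat_simps(6)
    by (subst comparison_ar[OF 1[unfolded hom_tcat_simps(6)], of "\<lambda>A. \<psi>' A \<cdot> \<phi>' A"])
      (simp_all add: \<phi>' \<psi>' cong: restrict_cong)
qed

lemma comparison_ar_T:
  assumes "(F, G, \<phi>) \<in> Ar C"
  shows "Ta C (F, G, \<phi>) \<in> Ar C"
    and "\<Phi>a (Ta C (F, G, \<phi>)) = Ta P (\<Phi>a (F, G, \<phi>))"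
proof -
  have lax: "lax_tangent_morphism S (DO X) F" "lax_tangent_morphism S (DO X) G"
    using assms by (simp_all add: hom_tcat_simps)
  interpret F: lax_morphism S "DO X" F
    by unfold_locales (rule lax(1))
  interpret G: lax_morphism S "DO X" G
    by unfold_locales (rule lax(2))
  show 1: "Ta C (F, G, \<phi>) \<in> Ar C"
    using F.hom_T_2_morphism[OF lax(2)] lax_T lax assms unfolding hom_tcat_simps by blast
  obtain \<phi>' where \<phi>': "\<And>A. A \<in> Ob S \<Longrightarrow> \<phi> A = (mo F A, mo G A, \<phi>' A)"
    using assms by (rule Ar_C_cases) blast
  have 2: "\<Phi>a (F, G, \<phi>) = (\<Phi> F, \<Phi> G, \<lambda>A \<in> Ob S. \<phi>' A)"
    by (rule comparison_ar[OF assms]) (rule \<phi>')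
  show "\<Phi>a (Ta C (F, G, \<phi>)) = Ta P (\<Phi>a (F, G, \<phi>))"
    unfolding 2 hom_tcat_simps(9) pdo_tcat_simps(9)
    by (subst comparison_ar[OF 1[unfolded hom_tcat_simps(9)], of "\<lambda>A. Ta X (\<phi>' A)"])
      (simp_all add: \<phi>' lax comparison_T cong: restrict_cong)
qed

text \<open>In \<open>P\<close> the pairing of the two projections is an identity, because pairings are computed
  componentwise in \<open>X\<close>.\<close>

lemma pairT2_P:
  assumes K: "pointwise_differential_object S X K" and T2K: "pointwise_differential_object S X (pdo_T2 S X K)"
  shows "pairT2 P K (q1 P K) (q2 P K) = Ide P (T2 P K)"
proof -
  interpret F: lax_morphism S X "pmor K"
    by unfold_locales (use K in \<open>simp add: pointwise_iff\<close>)
  have pm: "pmor (pdo_T2 S X K) = hom_T2 S X (pmor K)"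
    by (simp add: pdo_T2_def)
  have ide: "Ide P (T2 P K) \<in> Ar P"
  proof -
    interpret G: lax_morphism S X "hom_T2 S X (pmor K)"
      by unfold_locales (rule F.lax_hom_T2)
    have "do_morphism X (component (pdo_T2 S X K) A) (component (pdo_T2 S X K) A) (Ide X (T2 X (mo (pmor K) A)))"
      if "A \<in> Ob S" for A
      using do_morphism_ide[of "component (pdo_T2 S X K) A"] T2K that by (simp add: pointwise_iff pm)
    then show ?thesis
      unfolding pdo_tcat_simps(5,10) Ar_P using T2K G.hom_ide by (simp add: pm)
  qed
  show ?thesis
    unfolding pairT2_def pairing_def
  proof (rule the_equality)
    show "Ide P (T2 P K) \<in> Hom P (Dom P (q1 P K)) (T2 P K) \<and>
        q1 P K \<cdot>\<^bsub>P\<^esub> Ide P (T2 P K) = q1 P K \<and> q2 P K \<cdot>\<^bsub>P\<^esub> Ide P (T2 P K) = q2 P K"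
      using ide by (simp add: Hom_def pdo_tcat_simps(3-) pm cong: restrict_cong)
  next
    fix h assume h: "h \<in> Hom P (Dom P (q1 P K)) (T2 P K) \<and> q1 P K \<cdot>\<^bsub>P\<^esub> h = q1 P K \<and> q2 P K \<cdot>\<^bsub>P\<^esub> h = q2 P K"
    obtain \<phi> where \<phi>: "h = (pdo_T2 S X K, pdo_T2 S X K, \<phi>)"
      using h by (cases h) (auto simp: Hom_def pdo_tcat_simps(3-))
    have two: "tangent_2_morphism S X (hom_T2 S X (pmor K)) (hom_T2 S X (pmor K)) \<phi>"
      using h by (simp add: \<phi> Hom_def pdo_tcat_simps(1-3) pm)
    note [simp] = tangent_2_morphismD(2-5)[OF two]
    have "\<phi> A = Ide X (T2 X (mo (pmor K) A))" if A [simp]: "A \<in> Ob S" for A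
    proof (rule T2_ext[where A = "mo (pmor K) A"])
      have "(\<lambda>A \<in> Ob S. q1 X (mo (pmor K) A) \<cdot> \<phi> A) A = (\<lambda>A \<in> Ob S. q1 X (mo (pmor K) A)) A"
        "(\<lambda>A \<in> Ob S. q2 X (mo (pmor K) A) \<cdot> \<phi> A) A = (\<lambda>A \<in> Ob S. q2 X (mo (pmor K) A)) A"
        using h by (auto simp: \<phi> pdo_tcat_simps(3-) fun_eq_iff restrict_def split: if_splits)
      then show "q1 X (mo (pmor K) A) \<cdot> \<phi> A = q1 X (mo (pmor K) A) \<cdot> Ide X (T2 X (mo (pmor K) A))"
        "q2 X (mo (pmor K) A) \<cdot> \<phi> A = q2 X (mo (pmor K) A) \<cdot> Ide X (T2 X (mo (pmor K) A))"
        by simp_all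
    qed simp_all
    then have "\<phi> = (\<lambda>A \<in> Ob S. Ide X (T2 X (mo (pmor K) A)))"
      by - (rule extensionalityI[OF tangent_2_morphismD(1)[OF two]], auto)
    then show "h = Ide P (T2 P K)"
      by (simp add: \<phi> pdo_tcat_simps(5,10) pm cong: restrict_cong)
  qed
qed

text \<open>Identities of \<open>pdo_tcat\<close> are neutral; in this way the conditions for a strict tangent morphism
  reduce to the preservation of the structure maps.\<close>

lemma P_ide:
  assumes "t \<in> Ar P"
  shows "Dom P t = K \<Longrightarrow> t \<cdot>\<^bsub>P\<^esub> Ide P K = t" and "Cod P t = L \<Longrightarrow> Ide P L \<cdot>\<^bsub>P\<^esub> t = t"
proof -
  obtain M N \<phi> where t: "t = (M, N, \<phi>)"
    by (cases t)
  have two: "tangent_2_morphism S X (pmor M) (pmor N) \<phi>"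
    using assms by (simp add: t Ar_P)
  note [simp] = tangent_2_morphismD(2-5)[OF two]
  have "(\<lambda>A \<in> Ob S. \<phi> A) = \<phi>"
    using tangent_2_morphismD(1)[OF two] by (rule extensional_restrict)
  then show "Dom P t = K \<Longrightarrow> t \<cdot>\<^bsub>P\<^esub> Ide P K = t" "Cod P t = L \<Longrightarrow> Ide P L \<cdot>\<^bsub>P\<^esub> t = t"
    by (auto simp: t pdo_tcat_simps(3-6) cong: restrict_cong)
qed

lemma T_ide_P:
  assumes "pointwise_differential_object S X K"
  shows "Ta P (Ide P K) = Ide P (To P K)"
proof -
  interpret F: lax_morphism S X "pmor K"
    by unfold_locales (use assms in \<open>simp add: pointwise_iff\<close>)
  show ?thesis
    by (simp add: pdo_tcat_simps(5,8,9) pdo_T_def cong: restrict_cong)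
qed

lemma comparison_iso: "tangent_iso C P \<Phi> \<Phi>a"
proof -
  let ?W = "\<lparr>mo = restrict \<Phi> (Ob C), ma = restrict \<Phi>a (Ar C), mn = \<lambda>A \<in> Ob C. Ide P (To P (\<Phi> A))\<rparr>"
  have mo: "mo ?W H = \<Phi> H" "mn ?W H = Ide P (To P (\<Phi> H))"
    "mo ?W (To C H) = To P (\<Phi> H)" "mn ?W (To C H) = Ide P (To P (To P (\<Phi> H)))" if "H \<in> Ob C" for H
    using that lax_T[of H] comparison_T[of H] by (simp_all add: hom_tcat_simps(1,8) pdo_tcat_simps(8))
  have ma: "ma ?W t = \<Phi>a t" if "t \<in> Ar C" for t
    using that by simp
  have Hom: "\<Phi>a t \<in> Hom P (\<Phi> F) (\<Phi> G)" if t: "t \<in> Hom C F G" for t F G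
  proof -
    have ar: "t \<in> Ar C"
      using t by (simp add: Hom_C)
    show ?thesis
    proof (rule Ar_C_cases[OF ar])
      fix H H' \<phi> \<psi> assume "t = (H, H', \<phi>)" "\<Phi>a t = (\<Phi> H, \<Phi> H', \<lambda>A \<in> Ob S. \<psi> A)"
      then show ?thesis
        using t comparison_ar_in_P[OF ar] by (simp add: Hom_C) (simp add: Hom_def pdo_tcat_simps(3,4))
    qed
  qed
  have strict: "strict_tangent_morphism C P ?W"
    unfolding strict_tangent_morphism_def lax_tangent_morphism_def
  proof (intro conjI ballI)
    show "mo ?W \<in> extensional (Ob C)" "ma ?W \<in> extensional (Ar C)" "mn ?W \<in> extensional (Ob C)"
      by simp_all
    show "restriction_functor C P (mo ?W) (ma ?W)"
      unfolding restriction_functor_def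
    proof (intro conjI ballI allI)
      show "mo ?W H \<in> Ob P" if "H \<in> Ob C" for H
        using that comparison_ob_pointwise[of H] by (simp add: hom_tcat_simps pdo_tcat_simps)
      show "ma ?W t \<in> Hom P (mo ?W F) (mo ?W G)" if t: "t \<in> Hom C F G" for t F G
      proof -
        have "t \<in> Ar C" "F \<in> Ob C" "G \<in> Ob C"
          using t by (auto simp: Hom_C hom_tcat_simps)
        then show ?thesis
          using Hom[OF t] by simp
      qed
      show "ma ?W (Ide C H) = Ide P (mo ?W H)" if "H \<in> Ob C" for H
        using that structure_in_C(1)[of H] comparison_structure(1)[of H] mo(1)[OF that]
        by (simp add: hom_tcat_simps(1))
      show "ma ?W (u \<cdot>\<^bsub>C\<^esub> t) = ma ?W u \<cdot>\<^bsub>P\<^esub> ma ?W t" if t: "t \<in> Hom C F G" and u: "u \<in> Hom C G K" for t u F G K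
      proof -
        obtain \<phi> \<psi> where tu: "t = (F, G, \<phi>)" "u = (G, K, \<psi>)" "t \<in> Ar C" "u \<in> Ar C"
          using t u unfolding Hom_C by blast
        show ?thesis
          using comparison_ar_cmp[of F G \<phi> K \<psi>] tu by simp
      qed
      show "ma ?W (Rst C t) = Rst P (ma ?W t)" if t: "t \<in> Ar C" for t
      proof (rule Ar_C_cases[OF t])
        fix H H' \<phi> \<psi> assume *: "t = (H, H', \<phi>)" "lax_tangent_morphism S (DO X) H"
          "\<Phi>a t = (\<Phi> H, \<Phi> H', \<lambda>A \<in> Ob S. \<psi> A)"
        then have "Rst C t = Ide C H" "Rst P (\<Phi>a t) = Ide P (\<Phi> H)"
          by (simp_all only: hom_tcat_simps(5,7) pdo_tcat_simps(5,7))
        then show ?thesis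
          using structure_in_C(1)[OF *(2)] comparison_structure(1)[OF *(2)] t by simp
      qed
    qed
    show "total_nat_trans C P (\<lambda>H. mo ?W (To C H)) (\<lambda>t. ma ?W (Ta C t))
        (\<lambda>H. To P (mo ?W H)) (\<lambda>t. Ta P (ma ?W t)) (mn ?W)"
      unfolding total_nat_trans_def
    proof (intro conjI ballI allI)
      fix H assume H: "H \<in> Ob C"
      then have "Ide P (To P (\<Phi> H)) \<in> Ar P"
        using comparison_structure(1)[OF lax_T[of H]] structure_in_C(1)[OF lax_T[of H]] comparison_T[of H]
          comparison_ar_in_P by (metis hom_tcat_simps(1) mem_Collect_eq pdo_tcat_simps(8))
      then show "mn ?W H \<in> Hom P (mo ?W (To C H)) (To P (mo ?W H))"
        unfolding mo[OF H] by (simp add: Hom_def) (simp add: pdo_tcat_simps)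
      show "total P (mn ?W H)"
        unfolding mo[OF H] total_def by (simp add: pdo_tcat_simps)
    next
      fix F G t assume t: "t \<in> Hom C F G"
      then obtain \<phi> where \<phi>: "t = (F, G, \<phi>)" "t \<in> Ar C"
        by (auto simp: Hom_C)
      then have FG: "F \<in> Ob C" "G \<in> Ob C"
        by (auto simp: hom_tcat_simps)
      have Tt: "Ta C t \<in> Ar C" "\<Phi>a (Ta C t) = Ta P (\<Phi>a t)"
        using comparison_ar_T[of F G \<phi>] \<phi> by simp_all
      obtain \<psi> where \<psi>: "\<Phi>a t = (\<Phi> F, \<Phi> G, \<psi>)"
        using Hom[OF t] by (cases "\<Phi>a t") (simp add: Hom_def pdo_tcat_simps)
      have "Ta P (\<Phi>a t) \<in> Ar P"
        using comparison_ar_in_P[OF Tt(1)] Tt(2) by simp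
      moreover have "Dom P (Ta P (\<Phi>a t)) = To P (\<Phi> F)" "Cod P (Ta P (\<Phi>a t)) = To P (\<Phi> G)"
        unfolding \<psi> by (simp_all add: pdo_tcat_simps)
      ultimately show "Ta P (ma ?W t) \<cdot>\<^bsub>P\<^esub> mn ?W F = mn ?W G \<cdot>\<^bsub>P\<^esub> ma ?W (Ta C t)"
        unfolding mo[OF FG(1)] mo[OF FG(2)] ma[OF \<phi>(2)] ma[OF Tt(1)] Tt(2) by (simp add: P_ide)
    qed
    fix H assume HC: "H \<in> Ob C"
    then have H: "lax_tangent_morphism S (DO X) H"
      by (simp add: hom_tcat_simps)
    note in_C = structure_in_C[OF H] and st = comparison_structure[OF H]
    note W = mo[OF HC] ma[OF in_C(2)] ma[OF in_C(3)] ma[OF in_C(4)] ma[OF in_C(5)] ma[OF in_C(6)]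
      ma[OF in_C(7)] ma[OF in_C(8)] st
    have ar: "q1 P (\<Phi> H) \<in> Ar P" "q2 P (\<Phi> H) \<in> Ar P" "tp P (\<Phi> H) \<in> Ar P" "tz P (\<Phi> H) \<in> Ar P"
      "ts P (\<Phi> H) \<in> Ar P" "tl P (\<Phi> H) \<in> Ar P" "tc P (\<Phi> H) \<in> Ar P"
      unfolding st[symmetric] by (intro comparison_ar_in_P in_C)+
    have cod: "Cod P (q1 P (\<Phi> H)) = To P (\<Phi> H)" "Cod P (q2 P (\<Phi> H)) = To P (\<Phi> H)"
      "Dom P (tp P (\<Phi> H)) = To P (\<Phi> H)" "Cod P (tz P (\<Phi> H)) = To P (\<Phi> H)"
      "Dom P (ts P (\<Phi> H)) = T2 P (\<Phi> H)" "Cod P (ts P (\<Phi> H)) = To P (\<Phi> H)"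
      "Dom P (tl P (\<Phi> H)) = To P (\<Phi> H)" "Cod P (tl P (\<Phi> H)) = To P (To P (\<Phi> H))"
      "Dom P (tc P (\<Phi> H)) = To P (To P (\<Phi> H))" "Cod P (tc P (\<Phi> H)) = To P (To P (\<Phi> H))"
      by (simp_all add: pdo_tcat_simps)
    have pdo: "pointwise_differential_object S X (\<Phi> H)" "pointwise_differential_object S X (pdo_T S X (\<Phi> H))"
      "pointwise_differential_object S X (pdo_T2 S X (\<Phi> H))"
      using comparison_ob_pointwise[OF H] comparison_ob_pointwise[OF lax_T[OF H]]
        comparison_ob_pointwise[OF lax_T2[OF H]] comparison_T[OF H] comparison_T2[OF H] by simp_all
    have TI: "Ta P (Ide P (To P (\<Phi> H))) = Ide P (To P (To P (\<Phi> H)))"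
      using T_ide_P[OF pdo(2)] by (simp add: pdo_tcat_simps(8))
    have I2: "Ide P (To P (To P (\<Phi> H))) \<cdot>\<^bsub>P\<^esub> Ide P (To P (To P (\<Phi> H))) = Ide P (To P (To P (\<Phi> H)))"
    proof (rule P_ide(1))
      show "Ide P (To P (To P (\<Phi> H))) \<in> Ar P"
        using comparison_ar_in_P[OF structure_in_C(1)[OF lax_T[OF lax_T[OF H]]]]
          comparison_structure(1)[OF lax_T[OF lax_T[OF H]]] comparison_T[OF lax_T[OF H]] comparison_T[OF H]
        by (simp add: pdo_tcat_simps(8))
      show "Dom P (Ide P (To P (To P (\<Phi> H)))) = To P (To P (\<Phi> H))"
        by (simp add: pdo_tcat_simps)
    qed
    show "tp P (mo ?W H) \<cdot>\<^bsub>P\<^esub> mn ?W H = ma ?W (tp C H)"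
      unfolding W by (simp add: P_ide ar cod)
    show "mn ?W H \<cdot>\<^bsub>P\<^esub> ma ?W (tz C H) = tz P (mo ?W H)"
      unfolding W by (simp add: P_ide ar cod)
    show "mn ?W H \<cdot>\<^bsub>P\<^esub> ma ?W (ts C H) = ts P (mo ?W H) \<cdot>\<^bsub>P\<^esub>
        pairT2 P (mo ?W H) (mn ?W H \<cdot>\<^bsub>P\<^esub> ma ?W (q1 C H)) (mn ?W H \<cdot>\<^bsub>P\<^esub> ma ?W (q2 C H))"
      unfolding W by (simp add: P_ide ar cod pairT2_P[OF pdo(1,3)])
    show "tl P (mo ?W H) \<cdot>\<^bsub>P\<^esub> mn ?W H = Ta P (mn ?W H) \<cdot>\<^bsub>P\<^esub> mn ?W (To C H) \<cdot>\<^bsub>P\<^esub> ma ?W (tl C H)"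
      unfolding W TI by (simp add: P_ide ar cod)
    show "tc P (mo ?W H) \<cdot>\<^bsub>P\<^esub> Ta P (mn ?W H) \<cdot>\<^bsub>P\<^esub> mn ?W (To C H) =
        Ta P (mn ?W H) \<cdot>\<^bsub>P\<^esub> mn ?W (To C H) \<cdot>\<^bsub>P\<^esub> ma ?W (tc C H)"
      unfolding W TI I2 by (simp add: P_ide ar cod)
    show "mo ?W (To C H) = To P (mo ?W H)"
      unfolding W ..
    show "mn ?W H = Ide P (To P (mo ?W H))"
      unfolding W ..
  next
    fix t assume t: "t \<in> Ar C"
    obtain H H' \<phi> where "t = (H, H', \<phi>)"
      by (cases t)
    with t have Tt: "Ta C t \<in> Ar C" "\<Phi>a (Ta C t) = Ta P (\<Phi>a t)"
      using comparison_ar_T[of H H' \<phi>] by simp_all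
    show "ma ?W (Ta C t) = Ta P (ma ?W t)"
      unfolding ma[OF t] ma[OF Tt(1)] Tt(2) ..
  qed
  have "bij_betw \<Phi> (Ob C) (Ob P)"
    using comparison_ob_bij by (simp add: hom_tcat_simps pdo_tcat_simps)
  with strict show ?thesis
    using comparison_ar_bij by (simp add: tangent_iso_def)
qed

end

section \<open>Universality of the category of differential objects\<close>

context do_context
begin

lemma DO_universal_strict: "strict_tangent_morphism (DO X) X (pmor (DO_universal X))"
proof -
  let ?U = "pmor (DO_universal X)"
  note [simp] = do_morphism_ide do_morphism_T
  have pair: "pairT2 X A (q1 X A) (q2 X A) = Ide X (T2 X A)" if "A \<in> Ob X" for A
    using that by - (rule T2_ext[where A = A], simp_all)
  have "lax_tangent_morphism (DO X) X ?U"
    unfolding lax_tangent_morphism_def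
  proof (intro conjI ballI)
    show "mo ?U \<in> extensional (Ob (DO X))" "ma ?U \<in> extensional (Ar (DO X))" "mn ?U \<in> extensional (Ob (DO X))"
      by (simp_all add: DO_universal_def)
    show "restriction_functor (DO X) X (mo ?U) (ma ?U)"
    proof (rule DO.restriction_functorI)
      show "ma ?U (g \<cdot>\<^bsub>DO X\<^esub> f) = ma ?U g \<cdot> ma ?U f"
        if "f \<in> Ar (DO X)" "g \<in> Ar (DO X)" "Cod (DO X) f = Dom (DO X) g" for f g
        using that do_morphism_cmp by (auto simp: Ar_DO)
    qed (auto simp: Ar_DO do_morphismD do_morphism_rst)
    show "total_nat_trans (DO X) X (\<lambda>A. mo ?U (To (DO X) A)) (\<lambda>f. ma ?U (Ta (DO X) f))
        (\<lambda>A. To X (mo ?U A)) (\<lambda>f. Ta X (ma ?U f)) (mn ?U)"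
      by (rule total_nat_transI) (auto simp: Ar_DO do_morphismD)
  qed (auto simp: pair)
  then show ?thesis
    unfolding strict_tangent_morphism_def by (auto simp: Ar_DO)
qed

lemma DO_universal_pointwise: "pointwise_differential_object (DO X) X (DO_universal X)"
proof -
  interpret U: comparison X "DO X"
    by unfold_locales
  have comp: "component (DO_universal X) D = D" if "dobj D" for D
    using that by (simp add: component_def)
  show ?thesis
    unfolding U.pointwise_iff
  proof (intro conjI ballI)
    show "lax_tangent_morphism (DO X) X (pmor (DO_universal X))"
      using DO_universal_strict by (simp add: strict_tangent_morphism_def)
    show "pzero (DO_universal X) \<in> extensional (Ob (DO X))" "padd (DO_universal X) \<in> extensional (Ob (DO X))"
      "pproj (DO_universal X) \<in> extensional (Ob (DO X))"
      by (simp_all add: DO_universal_def)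
    show "dobj (component (DO_universal X) D)" if "D \<in> Ob (DO X)" for D
      using that by (simp add: comp)
    show "do_morphism X (component (DO_universal X) (Dom (DO X) t)) (component (DO_universal X) (Cod (DO X) t))
        (ma (pmor (DO_universal X)) t)" if "t \<in> Ar (DO X)" for t
      using that by (auto simp: Ar_DO comp)
    show "do_morphism X (component (DO_universal X) (To (DO X) D)) (do_T X (component (DO_universal X) D))
        (mn (pmor (DO_universal X)) D)" if "D \<in> Ob (DO X)" for D
      using that do_morphism_ide[of "do_T X D"] by (simp add: comp)
  qed
qed

end

theorem theorem3p22:
  fixes X :: "('o, 'a) ctcat"
  assumes "cartesian_tangent_split_restriction_category X"
  shows "admits_differential_objects TYPE('o1 \<times> 'a1) X
    \<and> tangentad_of_differential_objects TYPE('o1 \<times> 'a1) X (DO X) (DO_universal X)"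
proof -
  interpret do_context X
    by (rule do_context.intro) (rule assms)
  have "tangent_iso (hom_tcat S (DO X)) (pdo_tcat S X)
      (comparison_ob S X (DO_universal X)) (comparison_ar S X (DO_universal X))"
    if "tangent_split_restriction_category S" for S :: "('o1, 'a1) tcat"
  proof -
    interpret S: tangent_split_restriction_category S
      by (rule that)
    interpret comparison X S
      by unfold_locales
    show ?thesis
      by (rule comparison_iso)
  qed
  then have "tangentad_of_differential_objects TYPE('o1 \<times> 'a1) X (DO X) (DO_universal X)"
    unfolding tangentad_of_differential_objects_def
    using DO_cartesian DO_universal_strict DO_universal_pointwise by blast
  then show ?thesis
    unfolding admits_differential_objects_def by blast
qed

end
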